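(* Suppose that $\lambda_k(C)\ge k/c_\lambda$ for all $k=1,\dots,n$, for some constant $c_\lambda>0$. Also suppose $\beta\ge1$. For any $\delta\in(0,1]$, define $c_{T,m,\delta}:=2\left(1+4\log(2Tm/\delta)\right)$, and let $\tau:=\max\left(\mathrm{Tr}[X_0],1\right)$, where $X_0=f_\beta(C-\mu\mathbf I_n)$ is the initial condition. Consider the stochastic mirror descent algorithm described in the context, in its proximal form, with step size $$\eta_t=\eta:=\sqrt{\frac{2D(X_\star\|X_0)}{\tau\,c_{T,m,\delta}^2\,\tilde c_{\mathrm h}^2\,T}},$$ or equivalently in its mirror descent form with $\gamma_t:=\frac{\eta\beta}{\eta+\beta}$, where $$\tilde c_{\mathrm h}:=\max\left(\big\|\,|V|\,\rho(X_\star)\big\|_\infty,\ \max_{t=0,\dots,T-1}\big\|\,|V|\,\rho(X_t)\big\|_\infty\right).$$ Then the inequality $$\frac1T\sum_{t=0}^{T-1}\left(F_\beta(X_t)-\mu\,\mathrm{Tr}[X_t]\right)\le F_\beta(X_\star)-\mu\,\mathrm{Tr}[X_\star]+O\left(\frac{\log(Tm/\delta)\,\left(1+\sqrt{\beta c_{\mathrm h}}\right)\tilde c_{\mathrm h}\,n_{\mathrm{eff}}}{\sqrt T}\right)$$ holds with probability at least $1-\delta$, where $n_{\mathrm{eff}}:=1+c_\lambda[\mu+\beta^{-1}]$.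
   Context: Problem setting. Let $n,m$ be positive integers, $\Psi\in\mathbb R^{m\times n}$ with $\Psi^\top\Psi=\mathbf I_n$, $V\in\mathbb R^{m\times m}$ symmetric positive semidefinite, $C\in\mathbb R^{n\times n}$ symmetric, $\mu\in\mathbb R$, and $\beta\in(0,+\infty)$. $\lambda_k(A)$ denotes the $k$-th eigenvalue of a symmetric matrix $A$ in non-decreasing order. Let $\mathcal X=\{X\in\mathbb R^{n\times n}\text{ symmetric}: 0\preceq X\preceq \mathbf I_n\}$; $\langle\cdot,\cdot\rangle$ is the Frobenius inner product; $|V|$ is the entrywise absolute value of $V$; for a vector, $\|\cdot\|_\infty$ is the max norm; for the matrix $V$, $\|V\|_\infty=\max_i\sum_j|V_{ij}|$. Let $c_\Psi=\max_p\sum_{i=1}^n|\Psi_{pi}|^2$ and $c_{\mathrm h}=c_\Psi\|V\|_\infty$. For $Y\in\mathbb R^{n\times n}$ put $\rho(Y)=\mathrm{diag}[\Psi Y\Psi^\top]\in\mathbb R^m$ (the vector of diagonal entries), $\tilde E(Y)=\frac12\rho(Y)^\top V\rho(Y)$, so that $\nabla\tilde E(Y)=\Psi^\top\mathrm{diag}^*[V\rho(Y)]\Psi$, where $\mathrm{diag}^*[v]$ is the diagonal matrix with diagonal $v$. Standing assumption: $\nabla\tilde E(X)\succeq0$ for all $X\in\mathcal X$. Define $E(X)=\mathrm{Tr}[CX]+\tilde E(X)$, $S_{\mathrm{FD}}(X)=\mathrm{Tr}[X\log X]+\mathrm{Tr}[(\mathbf I_n-X)\log(\mathbf I_n-X)]$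 on $\mathcal X$ (with $0\log0=0$), $F_\beta(X)=E(X)+\beta^{-1}S_{\mathrm{FD}}(X)$, $D(Y\|X)=S_{\mathrm{FD}}(Y)-S_{\mathrm{FD}}(X)-\langle\nabla S_{\mathrm{FD}}(X),Y-X\rangle$, and $f_\beta(x)=\frac1{1+e^{\beta x}}$, applied to symmetric matrices as a matrix function. $X_\star$ denotes the minimizer of $F_\beta(X)-\mu\,\mathrm{Tr}[X]$ over $\mathcal X$. Algorithm. Let $T$ be a positive integer (the number of iterations) and let $z_0,\dots,z_{T-1}$ be i.i.d. standard Gaussian vectors in $\mathbb R^n$. Start from $X_0=f_\beta(C-\mu\mathbf I_n)$. Given $X_t$, set $\hat X_t=X_t^{1/2}z_tz_t^\top X_t^{1/2}$, $\tilde G_t=\nabla\tilde E(\hat X_t)$, $G_t=C+\tilde G_t$. Mirror descent form with step size $\gamma_t$: $X_{t+1}$ is defined by $$\nabla S_{\mathrm{FD}}(X_{t+1})=(1-\beta^{-1}\gamma_t)\nabla S_{\mathrm{FD}}(X_t)-\gamma_t(G_t-\mu\mathbf I_n),$$ where $\nabla S_{\mathrm{FD}}(X)=\log(X(\mathbf I_n-X)^{-1})$ has inverse map $X^*\mapsto(\mathbf I_n+e^{-X^*})^{-1}$ on symmetric matrices. Proximal form with step size $\eta_t>0$ (equivalent when $\gamma_t=\frac{\eta_t\beta}{\eta_t+\beta}$): $X_{t+1}$ is the minimizer over $X\in\mathcal X$ of $E(X_t)+\langle G_t-\mu\mathbf I_n,X-X_t\rangle+\beta^{-1}S_{\mathr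m{FD}}(X)+\eta_t^{-1}D(X\|X_t)$.
   Formalization: Inside the O(...), n_eff is taken with max(μ,0) in place of μ, and log(Tm/δ) is replaced by max(1, log(Tm/δ)); the literal bound fails with a universal constant for some μ<0 (e.g. μ=−1/β) and for T=m=1 as δ→1. *)

theory Defs
  imports
    "HOL-Probability.Probability"
    "Jordan_Normal_Form.Char_Poly"
    "Jordan_Normal_Form.Gauss_Jordan_Elimination"
begin

unbundle no vec_syntax

text \<open>
  Matrices are those of Jordan_Normal_Form, whose dimensions are natural numbers rather than
  types, so that a constant can be chosen uniformly in the dimensions. Indices start at 0.
\<close>

definition mat_trace :: "real mat \<Rightarrow> real" where
  "mat_trace A = (\<Sum>i<dim_row A. A $$ (i, i))"

definition frob_inner :: "real mat \<Rightarrow> real mat \<Rightarrow> real" where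
  "frob_inner A B = (\<Sum>i<dim_row A. \<Sum>j<dim_col A. A $$ (i, j) * B $$ (i, j))"

definition sym_mat :: "nat \<Rightarrow> real mat \<Rightarrow> bool" where
  "sym_mat n A \<longleftrightarrow> A \<in> carrier_mat n n \<and> A\<^sup>T = A"

definition psd_mat :: "nat \<Rightarrow> real mat \<Rightarrow> bool" where
  "psd_mat n A \<longleftrightarrow> sym_mat n A \<and> (\<forall>x \<in> carrier_vec n. 0 \<le> x \<bullet> (A *\<^sub>v x))"

definition mat_inv :: "real mat \<Rightarrow> real mat" where
  "mat_inv A = the (mat_inverse A)"

text \<open>The eigenvalues with multiplicity in non-decreasing order; they are the roots of the
  characteristic polynomial, which splits over the reals when the matrix is symmetric.\<close>

definition sorted_eigvals :: "real mat \<Rightarrow> real list" where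
  "sorted_eigvals A = (THE xs. sorted xs \<and> char_poly A = (\<Prod>x\<leftarrow>xs. [:- x, 1:]))"

definition eigval_nth :: "nat \<Rightarrow> real mat \<Rightarrow> real" where
  "eigval_nth k A = sorted_eigvals A ! (k - 1)"

text \<open>Functional calculus for symmetric matrices. The result does not depend on the
  orthogonal diagonalization, so the description is definite.\<close>

definition mat_fun :: "(real \<Rightarrow> real) \<Rightarrow> real mat \<Rightarrow> real mat" where
  "mat_fun f A = (let n = dim_row A in
     (THE B. \<exists>U d. U \<in> carrier_mat n n \<and> U\<^sup>T * U = 1\<^sub>m n \<and>
        A = U * mat_diag n d * U\<^sup>T \<and> B = U * mat_diag n (\<lambda>i. f (d i)) * U\<^sup>T))"

definition abs_mat :: "real mat \<Rightarrow> real mat" where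
  "abs_mat A = map_mat abs A"

definition vec_max_norm :: "real vec \<Rightarrow> real" where
  "vec_max_norm v = Max ((\<lambda>i. \<bar>v $ i\<bar>) ` {..<dim_vec v})"

definition mat_inf_norm :: "real mat \<Rightarrow> real" where
  "mat_inf_norm A = Max ((\<lambda>i. \<Sum>j<dim_col A. \<bar>A $$ (i, j)\<bar>) ` {..<dim_row A})"

definition c_Psi :: "real mat \<Rightarrow> real" where
  "c_Psi \<Psi> = Max ((\<lambda>p. \<Sum>i<dim_col \<Psi>. \<bar>\<Psi> $$ (p, i)\<bar>\<^sup>2) ` {..<dim_row \<Psi>})"

definition c_h :: "real mat \<Rightarrow> real mat \<Rightarrow> real" where
  "c_h \<Psi> V = c_Psi \<Psi> * mat_inf_norm V"

definition feasible :: "nat \<Rightarrow> real mat set" where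
  "feasible n = {X. psd_mat n X \<and> psd_mat n (1\<^sub>m n - X)}"

definition rho :: "real mat \<Rightarrow> real mat \<Rightarrow> real vec" where
  "rho \<Psi> Y = vec (dim_row \<Psi>) (\<lambda>p. (\<Psi> * Y * \<Psi>\<^sup>T) $$ (p, p))"

definition E_tilde :: "real mat \<Rightarrow> real mat \<Rightarrow> real mat \<Rightarrow> real" where
  "E_tilde \<Psi> V Y = 1 / 2 * (rho \<Psi> Y \<bullet> (V *\<^sub>v rho \<Psi> Y))"

definition grad_E_tilde :: "real mat \<Rightarrow> real mat \<Rightarrow> real mat \<Rightarrow> real mat" where
  "grad_E_tilde \<Psi> V Y =
     \<Psi>\<^sup>T * mat_diag (dim_row \<Psi>) (\<lambda>p. (V *\<^sub>v rho \<Psi> Y) $ p) * \<Psi>"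

definition energy :: "real mat \<Rightarrow> real mat \<Rightarrow> real mat \<Rightarrow> real mat \<Rightarrow> real" where
  "energy \<Psi> V C X = mat_trace (C * X) + E_tilde \<Psi> V X"

text \<open>The value of \<open>ln 0\<close> is immaterial below, as it is multiplied by 0.\<close>

definition S_FD :: "real mat \<Rightarrow> real" where
  "S_FD X = mat_trace (mat_fun (\<lambda>x. x * ln x) X)
          + mat_trace (mat_fun (\<lambda>x. x * ln x) (1\<^sub>m (dim_row X) - X))"

definition grad_S_FD :: "real mat \<Rightarrow> real mat" where
  "grad_S_FD X = mat_fun ln (X * mat_inv (1\<^sub>m (dim_row X) - X))"

definition D_FD :: "real mat \<Rightarrow> real mat \<Rightarrow> real" where
  "D_FD Y X = S_FD Y - S_FD X - frob_inner (grad_S_FD X) (Y - X)"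

definition F_free :: "real mat \<Rightarrow> real mat \<Rightarrow> real mat \<Rightarrow> real \<Rightarrow> real mat \<Rightarrow> real" where
  "F_free \<Psi> V C \<beta> X = energy \<Psi> V C X + (1 / \<beta>) * S_FD X"

definition f_FD :: "real \<Rightarrow> real \<Rightarrow> real" where
  "f_FD \<beta> x = 1 / (1 + exp (\<beta> * x))"

text \<open>The sample \<open>\<hat>X = X\<^sup>\<half> z z\<^sup>T X\<^sup>\<half>\<close> and the gradient estimate \<open>G = C + \<nabla>\<tilde>E(\<hat>X)\<close>.\<close>

definition X_hat :: "real mat \<Rightarrow> real vec \<Rightarrow> real mat" where
  "X_hat X z = mat_fun sqrt X * mat (dim_vec z) (dim_vec z) (\<lambda>(i, j). z $ i * z $ j) * mat_fun sqrt X"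

definition G_est :: "real mat \<Rightarrow> real mat \<Rightarrow> real mat \<Rightarrow> real mat \<Rightarrow> real vec \<Rightarrow> real mat" where
  "G_est \<Psi> V C X z = C + grad_E_tilde \<Psi> V (X_hat X z)"

definition X_init :: "real mat \<Rightarrow> real \<Rightarrow> real \<Rightarrow> real mat" where
  "X_init C \<beta> \<mu> = mat_fun (f_FD \<beta>) (C - \<mu> \<cdot>\<^sub>m 1\<^sub>m (dim_row C))"

text \<open>One step from \<open>X\<close> to \<open>X'\<close> with Gaussian sample \<open>z\<close>, in mirror descent form with step
  size \<open>\<gamma>\<close> and in proximal form with step size \<open>\<eta>\<close>.\<close>

definition mirror_step ::
  "real mat \<Rightarrow> real mat \<Rightarrow> real mat \<Rightarrow> real \<Rightarrow> real \<Rightarrow> real \<Rightarrow> real vec \<Rightarrow> real mat \<Rightarrow> real mat \<Rightarrow> bool"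
  where
  "mirror_step \<Psi> V C \<beta> \<mu> \<gamma> z X X' \<longleftrightarrow>
     (let n = dim_row C;
          L = (1 - (1 / \<beta>) * \<gamma>) \<cdot>\<^sub>m grad_S_FD X - \<gamma> \<cdot>\<^sub>m (G_est \<Psi> V C X z - \<mu> \<cdot>\<^sub>m 1\<^sub>m n)
      in X' = mat_inv (1\<^sub>m n + mat_fun exp (- L)))"

definition prox_step ::
  "real mat \<Rightarrow> real mat \<Rightarrow> real mat \<Rightarrow> real \<Rightarrow> real \<Rightarrow> real \<Rightarrow> real vec \<Rightarrow> real mat \<Rightarrow> real mat \<Rightarrow> bool"
  where
  "prox_step \<Psi> V C \<beta> \<mu> \<eta> z X X' \<longleftrightarrow> 0 < \<eta> \<and>
     is_arg_min
       (\<lambda>Y. energy \<Psi> V C X + frob_inner (G_est \<Psi> V C X z - \<mu> \<cdot>\<^sub>m 1\<^sub>m (dim_row C)) (Y - X)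
            + (1 / \<beta>) * S_FD Y + (1 / \<eta>) * D_FD Y X)
       (\<lambda>Y. Y \<in> feasible (dim_row C)) X'"

text \<open>The first \<open>T\<close> vectors are i.i.d. standard Gaussian: all their entries are independent
  and standard normal.\<close>

definition std_gaussian_vecs :: "'a measure \<Rightarrow> nat \<Rightarrow> nat \<Rightarrow> (nat \<Rightarrow> 'a \<Rightarrow> real vec) \<Rightarrow> bool" where
  "std_gaussian_vecs M n T z \<longleftrightarrow>
     (\<forall>t<T. \<forall>\<omega>\<in>space M. z t \<omega> \<in> carrier_vec n) \<and>
     prob_space.indep_vars M (\<lambda>_. borel) (\<lambda>(t, i) \<omega>. z t \<omega> $ i) ({..<T} \<times> {..<n}) \<and>
     (\<forall>t<T. \<forall>i<n. distributed M lborel (\<lambda>\<omega>. z t \<omega> $ i) std_normal_density)"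

definition c_Tm :: "nat \<Rightarrow> nat \<Rightarrow> real \<Rightarrow> real" where
  "c_Tm T m \<delta> = 2 * (1 + 4 * ln (2 * real T * real m / \<delta>))"

text \<open>Here \<open>X\<close> is one trajectory, given as a sequence of matrices.\<close>

definition c_h_tilde :: "real mat \<Rightarrow> real mat \<Rightarrow> real mat \<Rightarrow> nat \<Rightarrow> (nat \<Rightarrow> real mat) \<Rightarrow> real" where
  "c_h_tilde \<Psi> V Xs T X =
     max (vec_max_norm (abs_mat V *\<^sub>v rho \<Psi> Xs))
         (Max ((\<lambda>t. vec_max_norm (abs_mat V *\<^sub>v rho \<Psi> (X t))) ` {..<T}))"

text \<open>The step size is a functional of the whole trajectory, which in turn is run with that step
  size: the prescription of the step size is a fixed-point equation for each outcome, and its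
  solution is a random variable.\<close>

definition step_size ::
  "real mat \<Rightarrow> real mat \<Rightarrow> real mat \<Rightarrow> nat \<Rightarrow> real \<Rightarrow> (nat \<Rightarrow> real mat) \<Rightarrow> real" where
  "step_size \<Psi> V Xs T \<delta> X =
     sqrt (2 * D_FD Xs (X 0) /
           (max (mat_trace (X 0)) 1 * (c_Tm T (dim_row \<Psi>) \<delta>)\<^sup>2 * (c_h_tilde \<Psi> V Xs T X)\<^sup>2 * real T))"

text \<open>The bound below is meaningful for \<open>\<mu> \<ge> 0\<close>. For arbitrary \<open>\<mu>\<close> it is used with \<open>max \<mu> 0\<close>,
  as the formula itself may vanish or become negative when \<open>\<mu> < 0\<close>.\<close>

definition n_eff :: "real \<Rightarrow> real \<Rightarrow> real \<Rightarrow> real" where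
  "n_eff cl \<mu> \<beta> = 1 + cl * (\<mu> + 1 / \<beta>)"

end

theory Submission
  imports Defs "Jordan_Normal_Form.Spectral_Radius"
begin

text \<open>In the dual variable \<open>log (X (I - X)\<^sup>-\<^sup>1)\<close> both forms of the algorithm are linear: the state is the
sigmoid of \<open>Y\<^sub>0 - \<Psi>\<^sup>T diag(V U) \<Psi>\<close>, where the field \<open>U \<in> \<real>\<^sup>m\<close> is a running average of the sampled
densities, \<open>U\<^sub>t\<^sub>+\<^sub>1 = (1 - \<gamma>/\<beta>) U\<^sub>t + \<gamma> \<rho>\<^sub>t'\<close> with \<open>\<rho>\<^sub>t' = \<rho>(X\<^sub>t\<^sup>\<half> z\<^sub>t z\<^sub>t\<^sup>T X\<^sub>t\<^sup>\<half>)\<close>. So all randomness and all dependence on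
the step size are carried by a recursion in \<open>\<real>\<^sup>m\<close>, which is studied in the locale \<open>sampled_dynamics\<close>.

Mirror descent relative to the entropy telescopes (\<open>regret\<close>): the summed gaps are at most
\<open>D(X\<^sub>*\<parallel>X\<^sub>0) / \<eta>\<close> plus a sum of terms \<open>excess\<close>. Each of them consists of the sampling noise
\<open>\<langle>\<rho> - \<rho>', V (\<rho> - \<rho>\<^sub>*)\<rangle>\<close>, of \<open>- \<parallel>\<rho> - \<rho>\<^sub>*\<parallel>\<^sup>2/2\<close> in the norm of \<open>V\<close>, which the quadratic interaction
provides, and of a second-order term at most \<open>\<kappa> \<parallel>\<rho>'\<parallel>\<^sup>2\<close> with \<open>\<kappa> = \<eta> c\<close>, where \<open>c\<close> is the bound on
\<open>|V| \<rho>\<close> along the run. The second-order term uses \<open>D(A\<parallel>X) \<ge> \<parallel>A\<^sup>\<half> - X\<^sup>\<half>\<parallel>\<^sup>2\<close> (\<open>D_FD_hellinger\<close>) and the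
positivity of the gradient. For one fixed step size the negative quadratic term absorbs the variance
of the noise, so that the exponentials of the excess form a supermartingale (\<open>nn_excess_exp\<close>,
\<open>good_excess_tail\<close>) and the sum is \<open>O(c \<tau> (\<kappa> T + log (1/\<delta>)))\<close>.

The prescribed step size anticipates the whole run, because \<open>c\<close> does. No filtration makes it
predictable, so the estimate is proved for all step sizes at once. What makes this possible is that
the product \<open>\<kappa> = \<eta> c\<close> is deterministic: only those \<open>\<eta>\<close> matter whose own trajectory satisfies
\<open>|V| \<rho> \<le> \<kappa>/\<eta>\<close>. Two trajectories with nearby step sizes stay close in mean square as long as both obey
such a bound, and their distance grows at most by \<open>exp (O(\<kappa> T))\<close> (\<open>nn_pairdist\<close>). Hence a net of step
sizes suffices whose cardinality has a logarithm of order \<open>\<kappa> T + log (T m/\<delta>) + \<surd>(\<beta> c\<^sub>h)\<close>, and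
\<open>\<kappa> T \<le> \<surd>(\<beta> c\<^sub>h T)\<close>. Inside a cell of the net a continuity argument in time transfers the estimate from
the base point (\<open>variation_tail\<close>, \<open>cell_stability\<close>, \<open>cell_excess\<close>); where \<open>\<beta> c\<close> is tiny the bound is
deterministic (\<open>small_scale_excess\<close>). This gives \<open>uniform_excess_bound\<close>.

Finally minimality of \<open>X\<^sub>*\<close> yields \<open>D(X\<^sub>*\<parallel>X\<^sub>0) \<le> \<beta> c \<tau>/2\<close> (\<open>minimizer_distance\<close>), which bounds \<open>D/\<eta>\<close> and
\<open>\<kappa>\<close>, and the growth of the eigenvalues of \<open>C\<close> bounds \<open>\<tau>\<close> by \<open>n\<^sub>e\<^sub>f\<^sub>f\<close> (\<open>tau_le_n_eff\<close>).\<close>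

unbundle no vec_syntax


section \<open>Standard Gaussian vectors\<close>

type_synonym field = "nat \<Rightarrow> real"

abbreviation std_normal :: "real measure" where
  "std_normal \<equiv> density lborel (\<lambda>x. ennreal (std_normal_density x))"

definition gauss_vec :: "nat \<Rightarrow> field measure" where
  "gauss_vec n = Pi\<^sub>M {..<n} (\<lambda>_. std_normal)"

abbreviation sqn :: "nat \<Rightarrow> field \<Rightarrow> real" where
  "sqn n v \<equiv> (\<Sum>i<n. (v i)\<^sup>2)"

definition dotp :: "nat \<Rightarrow> field \<Rightarrow> field \<Rightarrow> real" where
  "dotp n a z = (\<Sum>i<n. a i * z i)"

lemmas numeral_if = simp_thms one_neq_zero if_True if_False

lemma prob_space_std_normal: "prob_space std_normal"
  by (rule prob_space_normal_density) simp

lemma sets_std_normal[measurable_cong, simp]: "sets std_normal = sets borel" by simp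

lemma prob_space_gauss_vec: "prob_space (gauss_vec n)"
  unfolding gauss_vec_def by (intro prob_space_PiM prob_space_std_normal)

lemma sets_gauss_vec[measurable_cong]: "sets (gauss_vec n) = sets (Pi\<^sub>M {..<n} (\<lambda>_. borel))"
  unfolding gauss_vec_def by (intro sets_PiM_cong) auto

lemma gauss_vec_component[measurable]: "i < n \<Longrightarrow> (\<lambda>z. z i) \<in> borel_measurable (gauss_vec n)"
proof -
  assume "i < n"
  then have "(\<lambda>z. z i) \<in> measurable (Pi\<^sub>M {..<n} (\<lambda>_. borel :: real measure)) borel"
    by (intro measurable_component_singleton) auto
  then show ?thesis by (simp cong: measurable_cong_sets add: sets_gauss_vec)
qed

lemma dotp_measurable[measurable]: "dotp n a \<in> borel_measurable (gauss_vec n)"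
  unfolding dotp_def by (intro borel_measurable_sum) (auto intro!: borel_measurable_times)

lemma nn_std_normal_even_moment:
  "(\<integral>\<^sup>+x. ennreal (x ^ (2 * k)) \<partial>std_normal) = ennreal (fact (2 * k) / (2 ^ k * fact k))"
proof -
  have "(\<integral>\<^sup>+x. ennreal (x ^ (2 * k)) \<partial>std_normal)
      = (\<integral>\<^sup>+x. ennreal (std_normal_density x * x ^ (2 * k)) \<partial>lborel)"
    by (subst nn_integral_density) (auto simp: ennreal_mult)
  also have "\<dots> = ennreal (fact (2 * k) / (2 ^ k * fact k))"
    using std_normal_moment_even[of k] by (intro nn_integral_eq_integral[THEN trans])
      (auto simp: has_bochner_integral_iff)
  finally show ?thesis .
qed

lemma nn_std_normal_exp_square:
  assumes "\<theta> < 1 / 2"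
  shows "(\<integral>\<^sup>+x. ennreal (exp (\<theta> * x\<^sup>2)) \<partial>std_normal) = ennreal (1 / sqrt (1 - 2 * \<theta>))"
proof -
  define s where "s = 1 / sqrt (1 - 2 * \<theta>)"
  have s: "s > 0" "s\<^sup>2 = 1 / (1 - 2 * \<theta>)" using assms by (auto simp: s_def power_divide)
  have eq: "std_normal_density x * exp (\<theta> * x\<^sup>2) = s * normal_density 0 s x" for x
  proof -
    have "- (x\<^sup>2) / 2 + \<theta> * x\<^sup>2 = - (x\<^sup>2) / (2 * s\<^sup>2)"
      using assms unfolding s(2) by (simp add: field_simps)
    then have "exp (- (x\<^sup>2) / 2) * exp (\<theta> * x\<^sup>2) = exp (- (x\<^sup>2) / (2 * s\<^sup>2))"
      by (simp flip: exp_add)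
    then show ?thesis using s(1)
      by (simp add: normal_density_def real_sqrt_mult field_simps)
  qed
  have "(\<integral>\<^sup>+x. ennreal (exp (\<theta> * x\<^sup>2)) \<partial>std_normal)
      = (\<integral>\<^sup>+x. ennreal (std_normal_density x * exp (\<theta> * x\<^sup>2)) \<partial>lborel)"
    by (subst nn_integral_density) (auto simp: ennreal_mult)
  also have "\<dots> = (\<integral>\<^sup>+x. ennreal s * ennreal (normal_density 0 s x) \<partial>lborel)"
    unfolding eq using s(1) by (simp add: ennreal_mult)
  also have "\<dots> = ennreal s * (\<integral>\<^sup>+x. ennreal (normal_density 0 s x) \<partial>lborel)"
    by (intro nn_integral_cmult) auto
  also have "(\<integral>\<^sup>+x. ennreal (normal_density 0 s x) \<partial>lborel) = 1"
    using s(1) prob_space.emeasure_space_1[OF prob_space_normal_density[of s 0]]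
    by (simp add: emeasure_density)
  finally show ?thesis by (simp add: s_def)
qed

text \<open>The law of a unit functional of a standard Gaussian vector is standard normal.\<close>

lemma distributed_dotp_unit:
  assumes e: "sqn n e = (1::real)"
  shows "distributed (gauss_vec n) lborel (dotp n e) std_normal_density"
proof -
  interpret prob_space "gauss_vec n" by (rule prob_space_gauss_vec)
  define J where "J = {i. i < n \<and> e i \<noteq> 0}"
  have J: "finite J" "J \<subseteq> {..<n}" by (auto simp: J_def)
  have Jne: "J \<noteq> {}"
  proof
    assume "J = {}"
    then have "sqn n e = 0" by (intro sum.neutral) (auto simp: J_def)
    then show False using e by simp
  qed
  have proj: "distr (gauss_vec n) std_normal (\<lambda>z. z i) = std_normal" if "i < n" for i
    unfolding gauss_vec_def using that
    by (intro distr_PiM_component prob_space_std_normal) auto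
  have dist: "distributed (gauss_vec n) lborel (\<lambda>z. z i) std_normal_density" if "i < n" for i
  proof -
    have "distr (gauss_vec n) std_normal (\<lambda>z. z i) = std_normal" by (rule proj[OF that])
    moreover have "distr (gauss_vec n) lborel (\<lambda>z. z i) = distr (gauss_vec n) std_normal (\<lambda>z. z i)"
      by (intro distr_cong) auto
    ultimately show ?thesis unfolding distributed_def using that by auto
  qed
  have "n > 0" using e by (cases n) auto
  then have ne: "{..<n} \<noteq> {}" by auto
  have "distr (gauss_vec n) (Pi\<^sub>M {..<n} (\<lambda>_. std_normal)) (\<lambda>z. \<lambda>i\<in>{..<n}. z i)
      = distr (gauss_vec n) (gauss_vec n) (\<lambda>z. z)"
    by (intro distr_cong) (auto simp: gauss_vec_def space_PiM PiE_restrict)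
  also have "\<dots> = Pi\<^sub>M {..<n} (\<lambda>i. distr (gauss_vec n) std_normal (\<lambda>z. z i))"
    unfolding distr_id2[OF refl] using proj by (subst gauss_vec_def) (intro PiM_cong, auto)
  finally have "indep_vars (\<lambda>_. std_normal) (\<lambda>i z. z i) {..<n}"
    using gauss_vec_component[of _ n] measurable_cong_sets[OF refl sets_std_normal, of "gauss_vec n"]
    by (subst indep_vars_iff_distr_eq_PiM'[OF ne]) auto
  then have "indep_vars (\<lambda>_. std_normal) (\<lambda>i z. z i) J"
    by (rule indep_vars_subset) (use J in auto)
  then have ind: "indep_vars (\<lambda>_. borel) (\<lambda>i z. e i * z i) J"
    by (rule indep_vars_compose2) auto
  have "distributed (gauss_vec n) lborel (\<lambda>z. \<Sum>i\<in>J. e i * z i)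
      (normal_density (\<Sum>i\<in>J. 0) (sqrt (\<Sum>i\<in>J. \<bar>e i\<bar>\<^sup>2)))"
  proof (rule sum_indep_normal[OF J(1) Jne ind])
    fix i assume i: "i \<in> J"
    show "0 < \<bar>e i\<bar>" using i by (auto simp: J_def)
    have "distributed (gauss_vec n) lborel (\<lambda>z. 0 + e i * z i) (normal_density (0 + e i * 0) (\<bar>e i\<bar> * 1))"
      using i by (intro normal_density_affine dist) (auto simp: J_def)
    then show "distributed (gauss_vec n) lborel (\<lambda>z. e i * z i) (normal_density 0 \<bar>e i\<bar>)" by simp
  qed
  moreover have "(\<Sum>i\<in>J. e i * z i) = dotp n e z" for z
    unfolding dotp_def by (intro sum.mono_neutral_left) (auto simp: J_def)
  moreover have "(\<Sum>i\<in>J. \<bar>e i\<bar>\<^sup>2) = sqn n e"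
    unfolding power2_abs by (intro sum.mono_neutral_left) (auto simp: J_def)
  ultimately show ?thesis using e by simp
qed

lemma nn_integral_dotp_unit:
  assumes e: "sqn n e = (1::real)" and h: "h \<in> borel_measurable borel"
  shows "(\<integral>\<^sup>+z. h (dotp n e z) \<partial>gauss_vec n) = (\<integral>\<^sup>+x. h x \<partial>std_normal)"
proof -
  have "std_normal = distr (gauss_vec n) lborel (dotp n e)"
    using distributed_dotp_unit[OF e] by (simp add: distributed_def)
  then have "(\<integral>\<^sup>+x. h x \<partial>std_normal) = (\<integral>\<^sup>+x. h x \<partial>distr (gauss_vec n) lborel (dotp n e))"
    by simp
  also have "\<dots> = (\<integral>\<^sup>+z. h (dotp n e z) \<partial>gauss_vec n)"
    using h by (intro nn_integral_distr) auto
  finally show ?thesis by simp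
qed

text \<open>A unit vector pointing along \<open>a\<close>; an arbitrary one when \<open>a\<close> vanishes, so that squared
  functionals can be normalised without a case distinction.\<close>

definition unitv :: "nat \<Rightarrow> field \<Rightarrow> nat \<Rightarrow> real" where
  "unitv n a = (if sqn n a = 0 then (\<lambda>i. if i = 0 then 1 else 0)
                else (\<lambda>i. a i / sqrt (sqn n a)))"

lemma unitv_norm: assumes "n > 0" shows "sqn n (unitv n a) = 1"
proof (cases "sqn n a = 0")
  case True
  have "sqn n (unitv n a) = (\<Sum>i<n. if i = 0 then 1 else 0)"
    unfolding unitv_def using True by (intro sum.cong) auto
  then show ?thesis using assms by simp
next
  case False
  have ge: "sqn n a \<ge> 0" by (intro sum_nonneg) auto
  have "sqn n (unitv n a) = (\<Sum>i<n. (a i)\<^sup>2 / sqn n a)"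
    unfolding unitv_def using False ge by (intro sum.cong) (auto simp: power_divide)
  then show ?thesis using False by (simp flip: sum_divide_distrib)
qed

lemma dotp_sq_unitv: "(dotp n a z)\<^sup>2 = sqn n a * (dotp n (unitv n a) z)\<^sup>2"
proof (cases "sqn n a = 0")
  case True
  then have "\<forall>i<n. a i = 0" by (subst (asm) sum_nonneg_eq_0_iff) auto
  then have "dotp n a z = 0" unfolding dotp_def by (intro sum.neutral) auto
  then show ?thesis using True by simp
next
  case False
  have ge: "sqn n a \<ge> 0" by (intro sum_nonneg) auto
  have "dotp n (unitv n a) z = dotp n a z / sqrt (sqn n a)"
    unfolding unitv_def dotp_def using False by (simp add: sum_divide_distrib)
  then show ?thesis using False ge by (simp add: power_divide)
qed

text \<open>Moments of a sample are reduced to moments of single functionals by a pointwise convexity inequality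
  against a weighted sum; this rule integrates such an inequality term by term.\<close>

lemma nn_mean_le:
  assumes "finite I" "\<And>i. i \<in> I \<Longrightarrow> h i \<in> borel_measurable M"
    and "\<And>i. i \<in> I \<Longrightarrow> (\<integral>\<^sup>+x. ennreal (h i x) \<partial>M) \<le> ennreal (B i)"
    and "\<And>i. i \<in> I \<Longrightarrow> 0 \<le> (w i::real)" "\<And>i. i \<in> I \<Longrightarrow> 0 \<le> B i"
    and "\<And>i x. i \<in> I \<Longrightarrow> x \<in> space M \<Longrightarrow> 0 \<le> h i x"
    and "\<And>x. x \<in> space M \<Longrightarrow> f x \<le> (\<Sum>i\<in>I. w i * h i x)"
    and "(\<Sum>i\<in>I. w i * B i) \<le> b"
  shows "(\<integral>\<^sup>+x. ennreal (f x) \<partial>M) \<le> ennreal b"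
proof -
  have "(\<integral>\<^sup>+x. ennreal (f x) \<partial>M) \<le> (\<integral>\<^sup>+x. (\<Sum>i\<in>I. ennreal (w i) * ennreal (h i x)) \<partial>M)"
  proof (rule nn_integral_mono)
    fix x assume x: "x \<in> space M"
    have "ennreal (f x) \<le> ennreal (\<Sum>i\<in>I. w i * h i x)" using assms(7)[OF x] by (rule ennreal_leI)
    also have "\<dots> = (\<Sum>i\<in>I. ennreal (w i * h i x))" using assms x by (intro sum_ennreal[symmetric]) auto
    also have "\<dots> = (\<Sum>i\<in>I. ennreal (w i) * ennreal (h i x))"
      using assms x by (intro sum.cong refl ennreal_mult) auto
    finally show "ennreal (f x) \<le> (\<Sum>i\<in>I. ennreal (w i) * ennreal (h i x))" .
  qed
  also have "\<dots> = (\<Sum>i\<in>I. \<integral>\<^sup>+x. ennreal (w i) * ennreal (h i x) \<partial>M)"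
    using assms(2) by (intro nn_integral_sum) auto
  also have "\<dots> = (\<Sum>i\<in>I. ennreal (w i) * (\<integral>\<^sup>+x. ennreal (h i x) \<partial>M))"
    using assms(2) by (intro sum.cong refl nn_integral_cmult) auto
  also have "\<dots> \<le> (\<Sum>i\<in>I. ennreal (w i) * ennreal (B i))"
    using assms(3) by (intro sum_mono mult_left_mono) auto
  also have "\<dots> = ennreal (\<Sum>i\<in>I. w i * B i)"
    using assms by (subst sum_ennreal[symmetric]) (auto simp: ennreal_mult intro!: sum.cong)
  also have "\<dots> \<le> ennreal b" using assms(8) by (rule ennreal_leI)
  finally show ?thesis .
qed


section \<open>Positive semidefinite forms\<close>

locale psd_form =
  fixes m :: nat and V :: "nat \<Rightarrow> nat \<Rightarrow> real"
  assumes V_sym: "p < m \<Longrightarrow> q < m \<Longrightarrow> V p q = V q p"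
    and V_psd: "0 \<le> (\<Sum>p<m. \<Sum>q<m. V p q * u p * u q)"
begin

definition bil :: "field \<Rightarrow> field \<Rightarrow> real" where
  "bil u v = (\<Sum>p<m. \<Sum>q<m. V p q * u p * v q)"

abbreviation bdist :: "field \<Rightarrow> field \<Rightarrow> real" where
  "bdist u v \<equiv> bil (\<lambda>p. u p - v p) (\<lambda>p. u p - v p)"

definition nrm :: "field \<Rightarrow> real" where
  "nrm u = sqrt (bil u u)"

abbreviation ndist :: "field \<Rightarrow> field \<Rightarrow> real" where
  "ndist u v \<equiv> nrm (\<lambda>p. u p - v p)"

definition act :: "field \<Rightarrow> nat \<Rightarrow> real" where
  "act u p = (\<Sum>q<m. V p q * u q)"

definition absact :: "field \<Rightarrow> nat \<Rightarrow> real" where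
  "absact k p = (\<Sum>q<m. \<bar>V p q\<bar> * k q)"

lemma bil_act: "bil u v = (\<Sum>p<m. u p * act v p)"
  unfolding bil_def act_def by (simp add: sum_distrib_left mult_ac)

lemma bil_commute: "bil u v = bil v u"
proof -
  have "bil u v = (\<Sum>q<m. \<Sum>p<m. V p q * u p * v q)"
    unfolding bil_def by (rule sum.swap)
  also have "\<dots> = bil v u"
    unfolding bil_def using V_sym by (intro sum.cong refl) auto
  finally show ?thesis .
qed

lemma bil_add_right: "bil u (\<lambda>p. v p + w p) = bil u v + bil u w"
  unfolding bil_def by (simp add: distrib_left sum.distrib)
lemma bil_diff_right: "bil u (\<lambda>p. v p - w p) = bil u v - bil u w"
  unfolding bil_def by (simp add: right_diff_distrib sum_subtractf)
lemma bil_scale_right: "bil u (\<lambda>p. c * v p) = c * bil u v"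
  unfolding bil_def by (simp add: sum_distrib_left mult_ac)
lemma bil_add_left: "bil (\<lambda>p. v p + w p) u = bil v u + bil w u"
  unfolding bil_def by (simp add: distrib_left distrib_right sum.distrib)
lemma bil_diff_left: "bil (\<lambda>p. v p - w p) u = bil v u - bil w u"
  unfolding bil_def by (simp add: right_diff_distrib left_diff_distrib sum_subtractf)
lemma bil_scale_left: "bil (\<lambda>p. c * v p) u = c * bil v u"
  unfolding bil_def by (simp add: sum_distrib_left mult_ac)
lemma bil_zero: "bil (\<lambda>_. 0) u = 0" "bil u (\<lambda>_. 0) = 0"
  unfolding bil_def by simp_all

lemmas bil_lin = bil_add_right bil_diff_right bil_scale_right
  bil_add_left bil_diff_left bil_scale_left bil_zero

lemma bil_cong: "(\<And>p. p < m \<Longrightarrow> u p = u' p) \<Longrightarrow> (\<And>p. p < m \<Longrightarrow> v p = v' p) \<Longrightarrow> bil u v = bil u' v'"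
  unfolding bil_def by (intro sum.cong) auto

lemma bil_nonneg: "0 \<le> bil u u"
  unfolding bil_def by (rule V_psd)

lemma nrm_nonneg: "0 \<le> nrm u"
  unfolding nrm_def using bil_nonneg by simp

lemma nrm_sq: "(nrm u)\<^sup>2 = bil u u"
  unfolding nrm_def using bil_nonneg by simp

lemma bil_CS: "\<bar>bil u v\<bar> \<le> nrm u * nrm v"
proof -
  have q: "0 \<le> bil u u * t\<^sup>2 + 2 * bil u v * t + bil v v" for t
  proof -
    have "0 \<le> bil (\<lambda>p. t * u p + v p) (\<lambda>p. t * u p + v p)" by (rule bil_nonneg)
    also have "\<dots> = bil u u * t\<^sup>2 + 2 * bil u v * t + bil v v"
      using bil_commute[of u v] by (simp add: bil_lin power2_eq_square algebra_simps)
    finally show ?thesis .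
  qed
  have "(bil u v)\<^sup>2 \<le> bil u u * bil v v"
  proof (cases "bil u u = 0")
    case True
    have "bil u v = 0"
    proof (rule ccontr)
      assume ne: "bil u v \<noteq> 0"
      have "0 \<le> 2 * bil u v * (- (bil v v + 1) / (2 * bil u v)) + bil v v" using q[of "- (bil v v + 1) / (2 * bil u v)"] True by simp
      then show False using ne by simp
    qed
    then show ?thesis using True by simp
  next
    case False
    then have pos: "bil u u > 0" using bil_nonneg[of u] by simp
    have "0 \<le> bil u u * (- bil u v / bil u u)\<^sup>2 + 2 * bil u v * (- bil u v / bil u u) + bil v v"
      by (rule q)
    also have "\<dots> = bil v v - (bil u v)\<^sup>2 / bil u u"
      using False by (simp add: power2_eq_square field_simps)
    finally show ?thesis using pos by (simp add: field_simps)
  qed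
  then have "sqrt ((bil u v)\<^sup>2) \<le> sqrt (bil u u * bil v v)" by (rule real_sqrt_le_mono)
  then show ?thesis by (simp add: nrm_def real_sqrt_mult)
qed

lemma nrm_triangle: "nrm (\<lambda>p. u p + v p) \<le> nrm u + nrm v"
proof (rule power2_le_imp_le)
  show "(nrm (\<lambda>p. u p + v p))\<^sup>2 \<le> (nrm u + nrm v)\<^sup>2"
    using bil_CS[of u v] bil_commute[of u v]
    by (simp add: nrm_sq power2_sum bil_lin)
qed (simp add: nrm_nonneg)

lemma nrm_scale: "nrm (\<lambda>p. c * u p) = \<bar>c\<bar> * nrm u"
  unfolding nrm_def by (simp add: bil_lin real_sqrt_mult flip: mult.assoc power2_eq_square)

lemma nrm_minus_commute: "ndist u v = ndist v u"
  using nrm_scale[of "-1" "\<lambda>p. u p - v p"] by simp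

lemma nrm_triangle3: "ndist u w \<le> ndist u v + ndist v w"
  using nrm_triangle[of "\<lambda>p. u p - v p" "\<lambda>p. v p - w p"] by simp

lemma nrm_diff_le: "ndist u v \<le> nrm u + nrm v"
  using nrm_triangle[of u "\<lambda>p. - 1 * v p"] nrm_scale[of "-1" v] by simp

text \<open>The row sums of \<open>|V|\<close> against weights \<open>k\<close> dominate the form on vectors
  that are small relative to \<open>k\<close>. This replaces a bound on the spectral radius of
  \<open>diag(k)\<^sup>\<half> |V| diag(k)\<^sup>\<half>\<close>.\<close>

lemma weighted_schur_test:
  assumes k: "\<And>p. p < m \<Longrightarrow> 0 \<le> k p" and e: "\<And>p. p < m \<Longrightarrow> 0 \<le> e p"
    and x: "\<And>p. p < m \<Longrightarrow> (x p)\<^sup>2 \<le> k p * e p"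
    and c: "\<And>p. p < m \<Longrightarrow> absact k p \<le> c"
  shows "(\<Sum>p<m. \<Sum>q<m. \<bar>V p q\<bar> * \<bar>x p\<bar> * \<bar>x q\<bar>) \<le> c * (\<Sum>p<m. e p)"
proof -
  have amgm: "\<bar>x p\<bar> * \<bar>x q\<bar> \<le> (k p * e q + k q * e p) / 2" if "p < m" "q < m" for p q
  proof (rule power2_le_imp_le)
    have "(x p)\<^sup>2 * (x q)\<^sup>2 \<le> (k p * e p) * (k q * e q)"
      using that x k e by (intro mult_mono) (auto intro: mult_nonneg_nonneg)
    also have "\<dots> \<le> ((k p * e q + k q * e p) / 2)\<^sup>2"
      using zero_le_power2[of "k p * e q - k q * e p"]
      by (simp add: power2_eq_square field_simps)
    finally show "(\<bar>x p\<bar> * \<bar>x q\<bar>)\<^sup>2 \<le> ((k p * e q + k q * e p) / 2)\<^sup>2"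
      by (simp add: power_mult_distrib)
    show "0 \<le> (k p * e q + k q * e p) / 2" using that k e by auto
  qed
  have "(\<Sum>p<m. \<Sum>q<m. \<bar>V p q\<bar> * \<bar>x p\<bar> * \<bar>x q\<bar>)
      \<le> (\<Sum>p<m. \<Sum>q<m. \<bar>V p q\<bar> * ((k p * e q + k q * e p) / 2))"
    using amgm by (intro sum_mono) (auto simp: mult.assoc intro!: mult_left_mono)
  also have "\<dots> = ((\<Sum>p<m. \<Sum>q<m. \<bar>V p q\<bar> * k p * e q) + (\<Sum>p<m. \<Sum>q<m. \<bar>V p q\<bar> * k q * e p)) / 2"
    by (simp add: algebra_simps sum.distrib add_divide_distrib sum_divide_distrib)
  also have "(\<Sum>p<m. \<Sum>q<m. \<bar>V p q\<bar> * k p * e q) = (\<Sum>p<m. \<Sum>q<m. \<bar>V p q\<bar> * k q * e p)"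
    by (subst sum.swap) (use V_sym in \<open>auto intro!: sum.cong\<close>)
  also have "(\<Sum>p<m. \<Sum>q<m. \<bar>V p q\<bar> * k q * e p) = (\<Sum>p<m. absact k p * e p)"
    unfolding absact_def by (simp add: sum_distrib_right)
  also have "((\<Sum>p<m. absact k p * e p) + (\<Sum>p<m. absact k p * e p)) / 2 \<le> (\<Sum>p<m. c * e p)"
    using c e by (auto intro!: sum_mono mult_right_mono)
  finally show ?thesis by (simp add: sum_distrib_left)
qed

lemma bil_le_abs: "bil x x \<le> (\<Sum>p<m. \<Sum>q<m. \<bar>V p q\<bar> * \<bar>x p\<bar> * \<bar>x q\<bar>)"
  unfolding bil_def by (intro sum_mono) (metis abs_ge_self abs_mult)

lemma bil_weighted_le:
  assumes "\<And>p. p < m \<Longrightarrow> 0 \<le> k p" "\<And>p. p < m \<Longrightarrow> 0 \<le> e p"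
    "\<And>p. p < m \<Longrightarrow> (x p)\<^sup>2 \<le> k p * e p" "\<And>p. p < m \<Longrightarrow> absact k p \<le> c"
  shows "bil x x \<le> c * (\<Sum>p<m. e p)"
  using bil_le_abs weighted_schur_test[OF assms] by (rule order_trans)

text \<open>By duality: \<open>\<Sum> r (V u)\<^sup>2\<close> is the form at \<open>x = r (V u)\<close> and \<open>u\<close>, and the weighted bound applied to \<open>x\<close>
  itself reproduces the same sum.\<close>

lemma act_weighted_le:
  assumes r: "\<And>p. p < m \<Longrightarrow> 0 \<le> r p" and c: "\<And>p. p < m \<Longrightarrow> absact r p \<le> c"
  shows "(\<Sum>p<m. r p * (act u p)\<^sup>2) \<le> c * bil u u"
proof -
  define W where "W = (\<Sum>p<m. r p * (act u p)\<^sup>2)"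
  define x where "x = (\<lambda>p. r p * act u p)"
  have W0: "0 \<le> W" unfolding W_def using r by (auto intro!: sum_nonneg)
  have "bil x x \<le> c * (\<Sum>p<m. r p * (act u p)\<^sup>2)"
    by (rule bil_weighted_le[of r]) (use r c in \<open>auto simp: x_def power_mult_distrib power2_eq_square\<close>)
  then have x: "bil x x \<le> c * W" by (simp add: W_def)
  have "W = bil x u" unfolding bil_act W_def x_def by (simp add: power2_eq_square mult_ac)
  also have "\<dots> \<le> nrm x * nrm u" using bil_CS[of x u] by linarith
  finally have "W\<^sup>2 \<le> (nrm x * nrm u)\<^sup>2" using W0 by (intro power_mono) auto
  also have "\<dots> = bil x x * bil u u" by (simp add: power_mult_distrib nrm_sq)
  also have "\<dots> \<le> c * W * bil u u" using x bil_nonneg by (intro mult_right_mono) auto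
  finally have *: "W * W \<le> (c * bil u u) * W" by (simp add: power2_eq_square mult_ac)
  show ?thesis
  proof (cases "W = 0")
    case False
    then show ?thesis using * W0 unfolding W_def[symmetric] by (metis mult_right_le_imp_le order_le_less)
  next
    case True
    have "0 \<le> c * bil u u"
    proof (cases "bil u u = 0")
      case False
      have "m > 0" using False unfolding bil_def by (cases m) auto
      then have "0 \<le> c" using c[of 0] r unfolding absact_def
        by (smt (verit) mult_nonneg_nonneg sum_nonneg abs_ge_zero lessThan_iff)
      then show ?thesis using bil_nonneg by simp
    qed simp
    then show ?thesis using True unfolding W_def[symmetric] by simp
  qed
qed

lemma absact_mono: "(\<And>q. q < m \<Longrightarrow> k q \<le> k' q) \<Longrightarrow> absact k p \<le> absact k' p"
  unfolding absact_def by (intro sum_mono mult_left_mono) auto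

lemma absact_add: "absact (\<lambda>q. k q + k' q) p = absact k p + absact k' p"
  unfolding absact_def by (simp add: distrib_left sum.distrib)

lemma absact_scale: "absact (\<lambda>q. c * k q) p = c * absact k p"
  unfolding absact_def by (simp add: sum_distrib_left mult_ac)

lemma abs_act_le: "(\<And>q. q < m \<Longrightarrow> 0 \<le> k q) \<Longrightarrow> \<bar>act k p\<bar> \<le> absact k p"
  unfolding act_def absact_def by (rule order_trans[OF sum_abs]) (auto simp: abs_mult intro!: sum_mono)

lemma act_diff: "act (\<lambda>q. u q - v q) p = act u p - act v p"
  unfolding act_def by (simp add: right_diff_distrib sum_subtractf)

end

lemma exp_convex_comb:
  fixes w y :: "'i \<Rightarrow> real"
  assumes "finite I" "\<And>i. i \<in> I \<Longrightarrow> 0 \<le> w i" "(\<Sum>i\<in>I. w i) = 1"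
  shows "exp (\<Sum>i\<in>I. w i * y i) \<le> (\<Sum>i\<in>I. w i * exp (y i))"
proof -
  have ne: "I \<noteq> {}" using assms(3) by auto
  have "exp (\<Sum>i\<in>I. w i *\<^sub>R y i) \<le> (\<Sum>i\<in>I. w i * exp (y i))"
    by (rule convex_on_sum[OF assms(1) ne exp_convex]) (use assms in auto)
  then show ?thesis by simp
qed


section \<open>One sampling step\<close>

lemma nn_dotp_unit_moment:
  assumes "sqn n e = (1::real)"
  shows "(\<integral>\<^sup>+z. ennreal ((dotp n e z)\<^sup>2) \<partial>gauss_vec n) \<le> ennreal 1"
    "(\<integral>\<^sup>+z. ennreal (((dotp n e z)\<^sup>2)\<^sup>2) \<partial>gauss_vec n) \<le> ennreal 3"
    "(\<integral>\<^sup>+z. ennreal (((dotp n e z)\<^sup>2) ^ 3) \<partial>gauss_vec n) \<le> ennreal 15"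
proof -
  have f: "fact 4 = (24::real)" "fact 6 = (720::real)" "fact 3 = (6::real)" by (simp_all add: fact_numeral)
  have *: "(\<integral>\<^sup>+z. ennreal ((dotp n e z) ^ (2 * k)) \<partial>gauss_vec n) = ennreal (fact (2 * k) / (2 ^ k * fact k))" for k
    by (subst nn_integral_dotp_unit[OF assms, of "\<lambda>x. ennreal (x ^ (2 * k))"])
      (auto simp: nn_std_normal_even_moment)
  show "(\<integral>\<^sup>+z. ennreal ((dotp n e z)\<^sup>2) \<partial>gauss_vec n) \<le> ennreal 1" using *[of 1] by simp
  show "(\<integral>\<^sup>+z. ennreal (((dotp n e z)\<^sup>2)\<^sup>2) \<partial>gauss_vec n) \<le> ennreal 3"
    using *[of 2] f by (simp flip: power_mult)
  show "(\<integral>\<^sup>+z. ennreal (((dotp n e z)\<^sup>2) ^ 3) \<partial>gauss_vec n) \<le> ennreal 15"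
    using *[of 3] f by (simp flip: power_mult)
qed

lemma nn_dotp_unit_exp:
  assumes "sqn n e = (1::real)" "\<theta> < 1 / 2"
  shows "(\<integral>\<^sup>+z. ennreal (exp (\<theta> * (dotp n e z)\<^sup>2)) \<partial>gauss_vec n) = ennreal (1 / sqrt (1 - 2 * \<theta>))"
  by (subst nn_integral_dotp_unit[OF assms(1), of "\<lambda>x. ennreal (exp (\<theta> * x\<^sup>2))"])
    (use assms(2) in \<open>auto simp: nn_std_normal_exp_square\<close>)

text \<open>The cumulant generating function \<open>-\<theta> - log (1 - 2\<theta>)/2\<close> of a centred chi-square variable is quadratic
  near zero.\<close>

lemma nn_dotp_unit_exp_centred:
  assumes e: "sqn n e = (1::real)" and t: "\<bar>\<theta>\<bar> \<le> 1 / 4"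
  shows "(\<integral>\<^sup>+z. ennreal (exp (\<theta> * ((dotp n e z)\<^sup>2 - 1))) \<partial>gauss_vec n) \<le> ennreal (exp (4 * \<theta>\<^sup>2))"
proof -
  have t': "\<theta> < 1 / 2" using t by auto
  have "(\<integral>\<^sup>+z. ennreal (exp (\<theta> * ((dotp n e z)\<^sup>2 - 1))) \<partial>gauss_vec n)
      = (\<integral>\<^sup>+z. ennreal (exp (- \<theta>)) * ennreal (exp (\<theta> * (dotp n e z)\<^sup>2)) \<partial>gauss_vec n)"
    by (intro nn_integral_cong) (simp add: algebra_simps exp_diff exp_minus divide_simps flip: ennreal_mult)
  also have "\<dots> = ennreal (exp (- \<theta>)) * (\<integral>\<^sup>+z. ennreal (exp (\<theta> * (dotp n e z)\<^sup>2)) \<partial>gauss_vec n)"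
    by (intro nn_integral_cmult) measurable
  also have "\<dots> = ennreal (exp (- \<theta>) * (1 / sqrt (1 - 2 * \<theta>)))"
    using t' by (simp add: nn_dotp_unit_exp[OF e t'] flip: ennreal_mult)
  also have "\<dots> \<le> ennreal (exp (4 * \<theta>\<^sup>2))"
  proof (rule ennreal_leI)
    have "\<bar>ln (1 + (- 2 * \<theta>)) - (- 2 * \<theta>)\<bar> \<le> 2 * (- 2 * \<theta>)\<^sup>2"
      using t by (intro abs_ln_one_plus_x_minus_x_bound) auto
    then have l: "- ln (1 - 2 * \<theta>) / 2 \<le> \<theta> + 4 * \<theta>\<^sup>2" by (simp add: power2_eq_square)
    have "1 / sqrt (1 - 2 * \<theta>) = exp (- ln (1 - 2 * \<theta>) / 2)"
    proof -
      have "sqrt (1 - 2 * \<theta>) = exp (ln (1 - 2 * \<theta>) / 2)"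
        using t' by (intro real_sqrt_unique) (auto simp: power2_eq_square simp flip: exp_add)
      then show ?thesis by (simp add: exp_minus inverse_eq_divide)
    qed
    also have "\<dots> \<le> exp (\<theta> + 4 * \<theta>\<^sup>2)" using l by simp
    finally have "exp (- \<theta>) * (1 / sqrt (1 - 2 * \<theta>)) \<le> exp (- \<theta>) * exp (\<theta> + 4 * \<theta>\<^sup>2)"
      by (intro mult_left_mono) auto
    also have "\<dots> = exp (4 * \<theta>\<^sup>2)" by (simp flip: exp_add)
    finally show "exp (- \<theta>) * (1 / sqrt (1 - 2 * \<theta>)) \<le> exp (4 * \<theta>\<^sup>2)" .
  qed
  finally show ?thesis .
qed

lemma nn_dotp_sq_prod:
  assumes n: "n > 0"
  shows "(\<integral>\<^sup>+z. ennreal ((dotp n a z)\<^sup>2 * (dotp n b z)\<^sup>2) \<partial>gauss_vec n)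
    \<le> ennreal (3 * sqn n a * sqn n b)"
proof -
  let ?A = "\<Sum>i<n. (a i)\<^sup>2" and ?B = "\<Sum>i<n. (b i)\<^sup>2"
  have nn: "0 \<le> ?A" "0 \<le> ?B" by (auto intro!: sum_nonneg)
  show ?thesis
  proof (rule nn_mean_le[where I = "{0::nat, 1}" and w = "\<lambda>_. ?A * ?B / 2" and B = "\<lambda>_. 3"
      and h = "\<lambda>i z. ((dotp n (unitv n (if i = 0 then a else b)) z)\<^sup>2)\<^sup>2"])
    fix z :: "nat \<Rightarrow> real"
    let ?x = "(dotp n (unitv n a) z)\<^sup>2" and ?y = "(dotp n (unitv n b) z)\<^sup>2"
    have "2 * (?x * ?y) \<le> ?x\<^sup>2 + ?y\<^sup>2" using sum_squares_bound[of ?x ?y] by simp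
    then have "?A * ?B / 2 * (2 * (?x * ?y)) \<le> ?A * ?B / 2 * (?x\<^sup>2 + ?y\<^sup>2)"
      using nn by (intro mult_left_mono) auto
    then show "(dotp n a z)\<^sup>2 * (dotp n b z)\<^sup>2
      \<le> (\<Sum>i\<in>{0::nat, 1}. ?A * ?B / 2 * ((dotp n (unitv n (if i = 0 then a else b)) z)\<^sup>2)\<^sup>2)"
      unfolding dotp_sq_unitv[of n a] dotp_sq_unitv[of n b] by (simp add: algebra_simps)
  qed (use nn nn_dotp_unit_moment(2)[OF unitv_norm[OF n]] in auto)
qed

text \<open>Jensen's inequality after the missing weight is moved to the index 0, which does not lower the exponent.\<close>

lemma exp_subconvex_comb:
  fixes w y :: "nat \<Rightarrow> real"
  assumes m: "m > 0" and w: "\<And>i. i < m \<Longrightarrow> 0 \<le> w i" and s: "(\<Sum>i<m. w i) \<le> 1"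
    and y: "\<And>i. i < m \<Longrightarrow> 0 \<le> y i"
  shows "exp (\<Sum>i<m. w i * y i) \<le> (\<Sum>i<m. (w i + (if i = 0 then 1 - (\<Sum>i<m. w i) else 0)) * exp (y i))"
proof -
  define w' where "w' = (\<lambda>i. w i + (if i = 0 then 1 - (\<Sum>i<m. w i) else 0))"
  have w'1: "(\<Sum>i<m. w' i) = 1" unfolding w'_def using m by (simp add: sum.distrib)
  have "exp (\<Sum>i<m. w i * y i) \<le> exp (\<Sum>i<m. w' i * y i)"
    unfolding w'_def exp_le_cancel_iff using s y
    by (intro sum_mono mult_right_mono) auto
  also have "\<dots> \<le> (\<Sum>i<m. w' i * exp (y i))"
    by (rule exp_convex_comb) (use w s w'1 in \<open>auto simp: w'_def\<close>)
  finally show ?thesis unfolding w'_def .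
qed

text \<open>The noise is a combination of dependent centred chi-square variables. Convexity of the exponential with
  weights proportional to \<open>|b p| |a p|\<^sup>2\<close> leaves single variables, so \<open>S\<close> acts as a standard deviation.\<close>

lemma nn_sampling_noise_exp:
  fixes m n :: nat
  assumes n: "n > 0" and l: "0 \<le> L"
    and S: "S = (\<Sum>p<m. \<bar>b p\<bar> * sqn n (a p))" and lS: "L * S \<le> 1 / 4"
  shows "(\<integral>\<^sup>+z. ennreal (exp (L * (\<Sum>p<m. b p * (sqn n (a p) - (dotp n (a p) z)\<^sup>2)))) \<partial>gauss_vec n)
    \<le> ennreal (exp (4 * L\<^sup>2 * S\<^sup>2))"
proof -
  define r where "r p = sqn n (a p)" for p
  define chi where "chi p z = (dotp n (unitv n (a p)) z)\<^sup>2" for p z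
  have r0: "0 \<le> r p" for p unfolding r_def by (auto intro!: sum_nonneg)
  have rh: "(dotp n (a p) z)\<^sup>2 = r p * chi p z" for p z
    unfolding r_def chi_def by (rule dotp_sq_unitv)
  have S': "S = (\<Sum>p<m. \<bar>b p\<bar> * r p)" unfolding S r_def ..
  have S0: "0 \<le> S" unfolding S' using r0 by (auto intro!: sum_nonneg)
  show ?thesis
  proof (cases "S = 0")
    case True
    then have "\<bar>b p\<bar> * r p = 0" if "p < m" for p
      using that r0 sum_nonneg_eq_0_iff[of "{..<m}" "\<lambda>p. \<bar>b p\<bar> * r p"] unfolding S' by auto
    then have z: "b p * (r p - r p * chi p z) = 0" if "p < m" for p z using that by fastforce
    have "(\<Sum>p<m. b p * (sqn n (a p) - (dotp n (a p) z)\<^sup>2)) = 0" for z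
      unfolding rh r_def[symmetric] using z by (intro sum.neutral) auto
    then show ?thesis using True prob_space.emeasure_space_1[OF prob_space_gauss_vec[of n]] by simp
  next
    case False
    then have Sp: "S > 0" using S0 by simp
    define \<theta> where "\<theta> p = - (L * S * sgn (b p))" for p
    have th: "\<bar>\<theta> p\<bar> \<le> 1 / 4" for p using lS l Sp by (auto simp: \<theta>_def sgn_if abs_mult)
    have th2: "(\<theta> p)\<^sup>2 \<le> (L * S)\<^sup>2" for p by (auto simp: \<theta>_def sgn_if)
    show ?thesis
    proof (rule nn_mean_le[where I = "{..<m}" and w = "\<lambda>p. \<bar>b p\<bar> * r p / S" and B = "\<lambda>_. exp (4 * L\<^sup>2 * S\<^sup>2)"
        and h = "\<lambda>p z. exp (\<theta> p * (chi p z - 1))"])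
      fix p assume "p \<in> {..<m}"
      have "(\<integral>\<^sup>+z. ennreal (exp (\<theta> p * (chi p z - 1))) \<partial>gauss_vec n) \<le> ennreal (exp (4 * (\<theta> p)\<^sup>2))"
        unfolding chi_def by (rule nn_dotp_unit_exp_centred[OF unitv_norm[OF n] th])
      also have "\<dots> \<le> ennreal (exp (4 * L\<^sup>2 * S\<^sup>2))"
        using th2[of p] by (intro ennreal_leI) (simp add: power_mult_distrib)
      finally show "(\<integral>\<^sup>+z. ennreal (exp (\<theta> p * (chi p z - 1))) \<partial>gauss_vec n) \<le> ennreal (exp (4 * L\<^sup>2 * S\<^sup>2))" .
    next
      fix z
      have w1: "(\<Sum>p<m. \<bar>b p\<bar> * r p / S) = 1" using Sp by (simp add: S' flip: sum_divide_distrib)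
      have "L * (\<Sum>p<m. b p * (r p - r p * chi p z)) = (\<Sum>p<m. \<bar>b p\<bar> * r p / S * (\<theta> p * (chi p z - 1)))"
        unfolding sum_distrib_left \<theta>_def using Sp
        by (intro sum.cong refl) (auto simp: sgn_if field_simps)
      then have "exp (L * (\<Sum>p<m. b p * (r p - r p * chi p z))) = exp (\<Sum>p<m. \<bar>b p\<bar> * r p / S * (\<theta> p * (chi p z - 1)))"
        by simp
      also have "\<dots> \<le> (\<Sum>p<m. \<bar>b p\<bar> * r p / S * exp (\<theta> p * (chi p z - 1)))"
        by (rule exp_convex_comb) (use w1 r0 Sp in auto)
      finally show "exp (L * (\<Sum>p<m. b p * (sqn n (a p) - (dotp n (a p) z)\<^sup>2)))
          \<le> (\<Sum>p<m. \<bar>b p\<bar> * r p / S * exp (\<theta> p * (chi p z - 1)))"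
        unfolding rh r_def[symmetric] .
    next
      have "(\<Sum>p<m. \<bar>b p\<bar> * r p / S * exp (4 * L\<^sup>2 * S\<^sup>2)) = exp (4 * L\<^sup>2 * S\<^sup>2) * (\<Sum>p<m. \<bar>b p\<bar> * r p) / S"
        by (simp add: sum_distrib_left sum_distrib_right sum_divide_distrib mult_ac)
      then show "(\<Sum>p<m. \<bar>b p\<bar> * r p / S * exp (4 * L\<^sup>2 * S\<^sup>2)) \<le> exp (4 * L\<^sup>2 * S\<^sup>2)"
        using Sp by (simp flip: S')
    qed (use r0 Sp in \<open>auto simp: chi_def\<close>)
  qed
qed

lemma three_prod_le_cubes:
  fixes x y z :: real
  assumes "0 \<le> x" "0 \<le> y" "0 \<le> z"
  shows "x * y * z \<le> (x ^ 3 + y ^ 3 + z ^ 3) / 3"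
proof -
  have "x ^ 3 + y ^ 3 + z ^ 3 - 3 * (x * y * z) = (x + y + z) * ((x - y)\<^sup>2 + (y - z)\<^sup>2 + (z - x)\<^sup>2) / 2"
    by (simp add: power2_eq_square power3_eq_cube algebra_simps)
  moreover have "0 \<le> (x + y + z) * ((x - y)\<^sup>2 + (y - z)\<^sup>2 + (z - x)\<^sup>2) / 2" using assms by auto
  ultimately show ?thesis by simp
qed

text \<open>The arithmetic-geometric mean inequality gives sixth moments \<open>15\<close> twice and \<open>\<E> exp (3\<chi>/8) = 2\<close>, and
  \<open>(15 + 15 + 2)/3 \<le> 11\<close>.\<close>

lemma nn_chi_chi_exp:
  assumes "sqn n e1 = (1::real)" "sqn n e2 = (1::real)" "sqn n e3 = (1::real)"
  shows "(\<integral>\<^sup>+z. ennreal ((dotp n e1 z)\<^sup>2 * (dotp n e2 z)\<^sup>2 * exp ((dotp n e3 z)\<^sup>2 / 8)) \<partial>gauss_vec n) \<le> ennreal 11"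
proof (rule nn_mean_le[where I = "{0::nat, 1, 2}" and w = "\<lambda>_. 1 / 3" and B = "\<lambda>i. if i = 2 then 2 else 15"
    and h = "\<lambda>i z. if i = 0 then ((dotp n e1 z)\<^sup>2) ^ 3 else if i = 1 then ((dotp n e2 z)\<^sup>2) ^ 3 else exp (3 / 8 * (dotp n e3 z)\<^sup>2)"])
  fix z
  have "exp ((dotp n e3 z)\<^sup>2 / 8) ^ 3 = exp (3 / 8 * (dotp n e3 z)\<^sup>2)"
    by (simp flip: exp_of_nat_mult)
  then show "(dotp n e1 z)\<^sup>2 * (dotp n e2 z)\<^sup>2 * exp ((dotp n e3 z)\<^sup>2 / 8)
    \<le> (\<Sum>i\<in>{0::nat, 1, 2}. 1 / 3 * (if i = 0 then ((dotp n e1 z)\<^sup>2) ^ 3 else if i = 1 then ((dotp n e2 z)\<^sup>2) ^ 3 else exp (3 / 8 * (dotp n e3 z)\<^sup>2)))"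
    using three_prod_le_cubes[of "(dotp n e1 z)\<^sup>2" "(dotp n e2 z)\<^sup>2" "exp ((dotp n e3 z)\<^sup>2 / 8)"] by simp
next
  fix i :: nat assume i: "i \<in> {0, 1, 2}"
  have "1 / sqrt (1 - 2 * (3 / 8)) = (2::real)" 
    by (simp add: real_sqrt_divide)
  then have e: "(\<integral>\<^sup>+z. ennreal (exp (3 / 8 * (dotp n e3 z)\<^sup>2)) \<partial>gauss_vec n) = ennreal 2"
    using nn_dotp_unit_exp[OF assms(3), of "3/8"] by simp
  show "(\<integral>\<^sup>+z. ennreal (if i = 0 then ((dotp n e1 z)\<^sup>2) ^ 3 else if i = 1 then ((dotp n e2 z)\<^sup>2) ^ 3 else exp (3 / 8 * (dotp n e3 z)\<^sup>2)) \<partial>gauss_vec n)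
      \<le> ennreal (if i = 2 then 2 else 15)"
    using i e nn_dotp_unit_moment(3)[OF assms(1)] nn_dotp_unit_moment(3)[OF assms(2)] by auto
qed auto

context psd_form begin

lemma nn_abs_bil_sample:
  assumes n: "n > 0" and c: "\<And>p. p < m \<Longrightarrow> absact (\<lambda>q. sqn n (a q)) p \<le> c"
  shows "(\<integral>\<^sup>+z. ennreal (\<Sum>p<m. \<Sum>q<m. \<bar>V p q\<bar> * (dotp n (a p) z)\<^sup>2 * (dotp n (a q) z)\<^sup>2) \<partial>gauss_vec n)
    \<le> ennreal (3 * c * (\<Sum>p<m. sqn n (a p)))"
proof -
  define r where "r p = sqn n (a p)" for p
  have r0: "0 \<le> r p" for p unfolding r_def by (auto intro!: sum_nonneg)
  show ?thesis
  proof (rule nn_mean_le[where I = "{..<m} \<times> {..<m}" and w = "\<lambda>(p, q). \<bar>V p q\<bar>" and B = "\<lambda>(p, q). 3 * r p * r q"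
        and h = "\<lambda>(p, q) z. (dotp n (a p) z)\<^sup>2 * (dotp n (a q) z)\<^sup>2"])
    have "(\<Sum>(p, q)\<in>{..<m} \<times> {..<m}. \<bar>V p q\<bar> * (3 * r p * r q)) = (\<Sum>p<m. 3 * r p * absact r p)"
      unfolding absact_def sum.cartesian_product[symmetric] sum_distrib_left
      by (intro sum.cong refl) (simp add: mult_ac)
    also have "\<dots> \<le> (\<Sum>p<m. 3 * r p * c)"
      using c r0 unfolding r_def by (intro sum_mono mult_left_mono) auto
    also have "\<dots> = 3 * c * (\<Sum>p<m. r p)" by (simp add: sum_distrib_left mult_ac)
    finally show "(\<Sum>i\<in>{..<m} \<times> {..<m}. (case i of (p, q) \<Rightarrow> \<bar>V p q\<bar>) * (case i of (p, q) \<Rightarrow> 3 * r p * r q))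
      \<le> 3 * c * (\<Sum>p<m. sqn n (a p))" unfolding r_def by (simp add: split_beta)
  next
    fix i assume "i \<in> {..<m} \<times> {..<m}"
    show "(\<integral>\<^sup>+x. ennreal ((case i of (p, q) \<Rightarrow> \<lambda>z. (dotp n (a p) z)\<^sup>2 * (dotp n (a q) z)\<^sup>2) x) \<partial>gauss_vec n)
         \<le> ennreal (case i of (p, q) \<Rightarrow> 3 * r p * r q)"
      using nn_dotp_sq_prod[OF n, of "a (fst i)" "a (snd i)"] unfolding r_def by (simp add: split_beta)
  qed (auto simp: r0 sum.cartesian_product split_beta mult_ac intro!: sum_mono)
qed

text \<open>A difference of squares factors into a sum and a difference of functionals. The Schur test with the
  squared sums as weights and the squared differences as masses then leaves fourth moments.\<close>

lemma nn_sample_diff: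
  assumes n: "n > 0" and c: "\<And>p. p < m \<Longrightarrow> absact (\<lambda>q. sqn n (a q)) p \<le> c"
    and c': "\<And>p. p < m \<Longrightarrow> absact (\<lambda>q. sqn n (a' q)) p \<le> c"
  shows "(\<integral>\<^sup>+z. ennreal (bil (\<lambda>p. (dotp n (a p) z)\<^sup>2 - (dotp n (a' p) z)\<^sup>2) (\<lambda>p. (dotp n (a p) z)\<^sup>2 - (dotp n (a' p) z)\<^sup>2)) \<partial>gauss_vec n)
    \<le> ennreal (12 * c * (\<Sum>p<m. \<Sum>i<n. (a p i - a' p i)\<^sup>2))"
proof -
  define s where "s p i = a p i + a' p i" for p i
  define d where "d p i = a p i - a' p i" for p i
  define A where "A p = sqn n (s p)" for p
  define D where "D p = sqn n (d p)" for p
  have A0: "0 \<le> A p" "0 \<le> D p" for p unfolding A_def D_def by (auto intro!: sum_nonneg)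
  have fac: "(dotp n (a p) z)\<^sup>2 - (dotp n (a' p) z)\<^sup>2 = dotp n (s p) z * dotp n (d p) z" for p z
  proof -
    have e: "dotp n (s p) z = dotp n (a p) z + dotp n (a' p) z" "dotp n (d p) z = dotp n (a p) z - dotp n (a' p) z"
      unfolding dotp_def s_def d_def by (simp_all add: algebra_simps sum.distrib sum_subtractf)
    show ?thesis unfolding e by (simp add: power2_eq_square algebra_simps)
  qed
  have Ac: "absact A p \<le> 4 * c" if "p < m" for p
  proof -
    have "absact A p \<le> absact (\<lambda>q. 2 * (sqn n (a q) + sqn n (a' q))) p"
    proof (rule absact_mono)
      fix q
      have "A q \<le> (\<Sum>i<n. 2 * ((a q i)\<^sup>2 + (a' q i)\<^sup>2))"
        unfolding A_def s_def
      proof (rule sum_mono)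
        fix i show "(a q i + a' q i)\<^sup>2 \<le> 2 * ((a q i)\<^sup>2 + (a' q i)\<^sup>2)"
          using zero_le_power2[of "a q i - a' q i"] by (simp add: power2_eq_square algebra_simps)
      qed
      then show "A q \<le> 2 * (sqn n (a q) + sqn n (a' q))"
        by (simp add: sum_distrib_left sum.distrib distrib_left)
    qed
    also have "\<dots> \<le> 4 * c" using c[OF that] c'[OF that] by (simp add: absact_scale absact_add)
    finally show ?thesis .
  qed
  show ?thesis
  proof (rule nn_mean_le[where I = "{..<m} \<times> {..<m}" and w = "\<lambda>(p, q). \<bar>V p q\<bar>" and B = "\<lambda>(p, q). 3 * A q * D p"
        and h = "\<lambda>(p, q) z. (dotp n (s q) z)\<^sup>2 * (dotp n (d p) z)\<^sup>2"])
    have "(\<Sum>(p, q)\<in>{..<m} \<times> {..<m}. \<bar>V p q\<bar> * (3 * A q * D p)) = (\<Sum>p<m. 3 * D p * absact A p)"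
      unfolding absact_def sum.cartesian_product[symmetric] sum_distrib_left
      by (intro sum.cong refl) (simp add: mult_ac)
    also have "\<dots> \<le> (\<Sum>p<m. 3 * D p * (4 * c))"
      using Ac A0 by (intro sum_mono mult_left_mono) auto
    also have "\<dots> = 12 * c * (\<Sum>p<m. D p)" by (simp add: sum_distrib_left sum_distrib_right mult_ac)
    finally show "(\<Sum>i\<in>{..<m} \<times> {..<m}. (case i of (p, q) \<Rightarrow> \<bar>V p q\<bar>) * (case i of (p, q) \<Rightarrow> 3 * A q * D p))
      \<le> 12 * c * (\<Sum>p<m. \<Sum>i<n. (a p i - a' p i)\<^sup>2)" unfolding D_def d_def by (simp add: split_beta)
  next
    fix i assume "i \<in> {..<m} \<times> {..<m}"
    show "(\<integral>\<^sup>+x. ennreal ((case i of (p, q) \<Rightarrow> \<lambda>z. (dotp n (s q) z)\<^sup>2 * (dotp n (d p) z)\<^sup>2) x) \<partial>gauss_vec n)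
         \<le> ennreal (case i of (p, q) \<Rightarrow> 3 * A q * D p)"
      using nn_dotp_sq_prod[OF n, of "s (snd i)" "d (fst i)"] unfolding A_def D_def by (simp add: split_beta)
  next
    fix z
    let ?s = "\<lambda>p. dotp n (s p) z" and ?d = "\<lambda>p. dotp n (d p) z"
    have "bil (\<lambda>p. ?s p * ?d p) (\<lambda>p. ?s p * ?d p)
        \<le> (\<Sum>p<m. \<Sum>q<m. \<bar>V p q\<bar> * (((?s q)\<^sup>2 * (?d p)\<^sup>2 + (?s p)\<^sup>2 * (?d q)\<^sup>2) / 2))"
    proof (rule order_trans[OF bil_le_abs], intro sum_mono)
      fix p q
      have "\<bar>?s p * ?d p\<bar> * \<bar>?s q * ?d q\<bar> = \<bar>?s q * ?d p\<bar> * \<bar>?s p * ?d q\<bar>" by (simp add: abs_mult mult_ac)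
      also have "\<dots> \<le> ((?s q)\<^sup>2 * (?d p)\<^sup>2 + (?s p)\<^sup>2 * (?d q)\<^sup>2) / 2"
        using sum_squares_bound[of "\<bar>?s q * ?d p\<bar>" "\<bar>?s p * ?d q\<bar>"] by (simp add: power_mult_distrib)
      finally show "\<bar>V p q\<bar> * \<bar>?s p * ?d p\<bar> * \<bar>?s q * ?d q\<bar> \<le> \<bar>V p q\<bar> * (((?s q)\<^sup>2 * (?d p)\<^sup>2 + (?s p)\<^sup>2 * (?d q)\<^sup>2) / 2)"
        by (simp add: mult.assoc mult_left_mono)
    qed
    also have "\<dots> = ((\<Sum>p<m. \<Sum>q<m. \<bar>V p q\<bar> * ((?s q)\<^sup>2 * (?d p)\<^sup>2)) + (\<Sum>p<m. \<Sum>q<m. \<bar>V p q\<bar> * ((?s p)\<^sup>2 * (?d q)\<^sup>2))) / 2"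
      by (simp add: algebra_simps sum.distrib add_divide_distrib sum_divide_distrib)
    also have "(\<Sum>p<m. \<Sum>q<m. \<bar>V p q\<bar> * ((?s p)\<^sup>2 * (?d q)\<^sup>2)) = (\<Sum>p<m. \<Sum>q<m. \<bar>V p q\<bar> * ((?s q)\<^sup>2 * (?d p)\<^sup>2))"
      by (subst sum.swap) (use V_sym in \<open>auto intro!: sum.cong\<close>)
    finally show "bil (\<lambda>p. (dotp n (a p) z)\<^sup>2 - (dotp n (a' p) z)\<^sup>2) (\<lambda>p. (dotp n (a p) z)\<^sup>2 - (dotp n (a' p) z)\<^sup>2)
      \<le> (\<Sum>i\<in>{..<m} \<times> {..<m}. (case i of (p, q) \<Rightarrow> \<bar>V p q\<bar>) * (case i of (p, q) \<Rightarrow> \<lambda>z. (dotp n (s q) z)\<^sup>2 * (dotp n (d p) z)\<^sup>2) z)"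
      unfolding fac by (simp add: sum.cartesian_product split_beta)
  qed (auto simp: A0)
qed

text \<open>The first argument of the minimum is linear in chi-square variables and guarantees exponential
  integrability, the second one carries the small factor \<open>\<kappa>\<close>: with \<open>y\<close> the minimum,
  \<open>exp (L y) \<le> 1 + L y exp (L y)\<close>, the factor \<open>y\<close> is estimated by the second argument and the exponent by the first.\<close>

lemma nn_second_order_exp:
  assumes n: "n > 0" and m: "m > 0" and c: "\<And>p. p < m \<Longrightarrow> absact (\<lambda>q. sqn n (a q)) p \<le> c"
    and tau: "(\<Sum>p<m. sqn n (a p)) \<le> \<tau>" and L: "0 \<le> L" "8 * L * (c * \<tau>) \<le> 1" and \<kappa>: "0 \<le> \<kappa>" and c0: "0 \<le> c"
  shows "(\<integral>\<^sup>+z. ennreal (exp (L * min (bil (\<lambda>p. (dotp n (a p) z)\<^sup>2) (\<lambda>p. sqn n (a p)))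
            (\<kappa> * bil (\<lambda>p. (dotp n (a p) z)\<^sup>2) (\<lambda>p. (dotp n (a p) z)\<^sup>2)))) \<partial>gauss_vec n)
    \<le> ennreal (exp (11 * L * \<kappa> * (c * \<tau>)))"
proof -
  define r where "r p = sqn n (a p)" for p
  define chi where "chi p z = (dotp n (unitv n (a p)) z)\<^sup>2" for p z
  define w where "w p = 8 * L * (r p * \<bar>act r p\<bar>)" for p
  define w' where "w' p = w p + (if p = 0 then 1 - (\<Sum>p<m. w p) else 0)" for p
  have r0: "0 \<le> r p" for p unfolding r_def by (auto intro!: sum_nonneg)
  have chi0: "0 \<le> chi p z" for p z unfolding chi_def by simp
  have rh: "(dotp n (a p) z)\<^sup>2 = r p * chi p z" for p z
    unfolding r_def chi_def by (rule dotp_sq_unitv)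
  have tau': "(\<Sum>p<m. r p) \<le> \<tau>" using tau unfolding r_def .
  have actle: "\<bar>act r p\<bar> \<le> c" if "p < m" for p
    using abs_act_le[of r p] r0 c[OF that] unfolding r_def by auto
  have w0: "0 \<le> w p" for p unfolding w_def using r0 L by simp
  have "(\<Sum>p<m. w p) = 8 * L * (\<Sum>p<m. r p * \<bar>act r p\<bar>)" unfolding w_def by (simp add: sum_distrib_left)
  also have "\<dots> \<le> 8 * L * (\<Sum>p<m. r p * c)"
    using actle r0 L by (intro mult_left_mono sum_mono) auto
  also have "\<dots> \<le> 8 * L * (c * \<tau>)"
    using tau' L c0 by (intro mult_left_mono) (auto simp: mult_left_mono mult.commute[of _ c] simp flip: sum_distrib_left)
  finally have w1: "(\<Sum>p<m. w p) \<le> 1" using L by simp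
  have w'0: "0 \<le> w' p" for p unfolding w'_def using w0 w1 by simp
  have w'1: "(\<Sum>p<m. w' p) = 1" unfolding w'_def using m by (simp add: sum.distrib)
  have main: "(\<integral>\<^sup>+z. ennreal (exp (L * min (bil (\<lambda>p. (dotp n (a p) z)\<^sup>2) r)
            (\<kappa> * bil (\<lambda>p. (dotp n (a p) z)\<^sup>2) (\<lambda>p. (dotp n (a p) z)\<^sup>2)))) \<partial>gauss_vec n)
    \<le> ennreal (1 + 11 * L * \<kappa> * (c * \<tau>))"
  proof (rule nn_mean_le[where I = "insert None (Some ` ({..<m} \<times> {..<m} \<times> {..<m}))"
        and w = "\<lambda>x. case x of None \<Rightarrow> 1 | Some (p, q, k) \<Rightarrow> L * \<kappa> * \<bar>V p q\<bar> * r p * r q * w' k"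
        and B = "\<lambda>x. case x of None \<Rightarrow> 1 | Some (p, q, k) \<Rightarrow> 11"
        and h = "\<lambda>x z. case x of None \<Rightarrow> 1 | Some (p, q, k) \<Rightarrow> chi p z * chi q z * exp (chi k z / 8)"])
    fix x assume "x \<in> insert None (Some ` ({..<m} \<times> {..<m} \<times> {..<m}))"
    show "(\<lambda>z. case x of None \<Rightarrow> 1 | Some (p, q, k) \<Rightarrow> chi p z * chi q z * exp (chi k z / 8)) \<in> borel_measurable (gauss_vec n)"
      unfolding chi_def by (cases x) (auto split: prod.split)
    show "(\<integral>\<^sup>+z. ennreal (case x of None \<Rightarrow> 1 | Some (p, q, k) \<Rightarrow> chi p z * chi q z * exp (chi k z / 8)) \<partial>gauss_vec n)
       \<le> ennreal (case x of None \<Rightarrow> 1 | Some (p, q, k) \<Rightarrow> 11)"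
      using nn_chi_chi_exp[OF unitv_norm[OF n] unitv_norm[OF n] unitv_norm[OF n]]
        prob_space.emeasure_space_1[OF prob_space_gauss_vec[of n]]
      unfolding chi_def by (cases x) (auto split: prod.split)
  next
    fix z
    let ?rh = "\<lambda>p. (dotp n (a p) z)\<^sup>2"
    define Q where "Q = (\<Sum>p<m. \<Sum>q<m. \<bar>V p q\<bar> * r p * r q * (chi p z * chi q z))"
    define l where "l = (\<Sum>p<m. r p * \<bar>act r p\<bar> * chi p z)"
    define y where "y = min (bil ?rh r) (\<kappa> * bil ?rh ?rh)"
    have Q0: "0 \<le> Q" unfolding Q_def using r0 chi0 by (auto intro!: sum_nonneg)
    have yQ: "y \<le> \<kappa> * Q"
    proof -
      have "bil ?rh ?rh \<le> Q" unfolding Q_def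
        by (rule order_trans[OF bil_le_abs]) (auto simp: rh abs_mult r0 chi0 mult_ac intro!: sum_mono)
      then show ?thesis unfolding y_def using \<kappa> by (auto intro: order_trans[OF min.cobounded2] mult_left_mono)
    qed
    have yl: "y \<le> l"
    proof -
      have "bil ?rh r \<le> l" unfolding bil_act l_def rh
        by (intro sum_mono) (auto simp: mult.assoc mult.commute[of "chi _ _"] intro!: mult_left_mono mult_right_mono r0 chi0)
      then show ?thesis unfolding y_def by auto
    qed
    have el: "exp (L * l) \<le> (\<Sum>k<m. w' k * exp (chi k z / 8))"
    proof -
      have "L * l = (\<Sum>k<m. w k * (chi k z / 8))" unfolding l_def w_def by (simp add: sum_distrib_left mult_ac)
      then show ?thesis using exp_subconvex_comb[OF m w0 w1, of "\<lambda>k. chi k z / 8"] chi0 unfolding w'_def by simp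
    qed
    have "exp (L * y) \<le> 1 + (L * \<kappa> * Q) * exp (L * l)"
    proof (cases "y \<le> 0")
      case True
      then have "L * y \<le> 0" using L by (simp add: mult_nonneg_nonpos)
      then show ?thesis using Q0 \<kappa> L by (smt (verit) exp_le_one_iff mult_nonneg_nonneg exp_ge_zero)
    next
      case False
      have "exp (L * y) * (1 - L * y) \<le> exp (L * y) * exp (- (L * y))"
        using exp_ge_add_one_self[of "- (L * y)"] by (intro mult_left_mono) auto
      then have "exp (L * y) \<le> 1 + (L * y) * exp (L * y)" by (simp add: exp_minus algebra_simps)
      also have "(L * y) * exp (L * y) \<le> (L * (\<kappa> * Q)) * exp (L * l)"
        using L yQ yl False Q0 \<kappa> by (intro mult_mono mult_left_mono) (auto intro: mult_left_mono)
      finally show ?thesis by (simp add: mult.assoc)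
    qed
    also have "\<dots> \<le> 1 + (L * \<kappa> * Q) * (\<Sum>k<m. w' k * exp (chi k z / 8))"
      using el Q0 \<kappa> L by (intro add_left_mono mult_left_mono) auto
    also have "(L * \<kappa> * Q) * (\<Sum>k<m. w' k * exp (chi k z / 8))
       = (\<Sum>p<m. \<Sum>q<m. \<Sum>k<m. L * \<kappa> * \<bar>V p q\<bar> * r p * r q * w' k * (chi p z * chi q z * exp (chi k z / 8)))"
      unfolding Q_def by (simp add: sum_distrib_left sum_distrib_right mult_ac)
    finally show "exp (L * min (bil ?rh r) (\<kappa> * bil ?rh ?rh))
      \<le> (\<Sum>x\<in>insert None (Some ` ({..<m} \<times> {..<m} \<times> {..<m})).
            (case x of None \<Rightarrow> 1 | Some (p, q, k) \<Rightarrow> L * \<kappa> * \<bar>V p q\<bar> * r p * r q * w' k) *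
            (case x of None \<Rightarrow> 1 | Some (p, q, k) \<Rightarrow> chi p z * chi q z * exp (chi k z / 8)))"
      unfolding y_def by (subst sum.insert) (auto simp: sum.reindex sum.cartesian_product split_beta)
  next
    have "(\<Sum>p<m. \<Sum>q<m. \<Sum>k<m. L * \<kappa> * \<bar>V p q\<bar> * r p * r q * w' k * 11) = 11 * L * \<kappa> * (\<Sum>p<m. \<Sum>q<m. \<bar>V p q\<bar> * r p * r q) * (\<Sum>k<m. w' k)"
      by (simp add: sum_distrib_left sum_distrib_right mult_ac)
    also have "\<dots> = 11 * L * \<kappa> * (\<Sum>p<m. r p * absact r p)"
      unfolding w'1 absact_def by (simp add: sum_distrib_left mult_ac)
    also have "\<dots> \<le> 11 * L * \<kappa> * (\<Sum>p<m. r p * c)"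
      using c r0 L \<kappa> unfolding r_def by (intro mult_left_mono sum_mono) auto
    also have "\<dots> \<le> 11 * L * \<kappa> * (c * \<tau>)"
      using tau' L c0 \<kappa> by (intro mult_left_mono) (auto simp: mult_left_mono mult.commute[of _ c] simp flip: sum_distrib_left)
    finally show "(\<Sum>x\<in>insert None (Some ` ({..<m} \<times> {..<m} \<times> {..<m})).
            (case x of None \<Rightarrow> 1 | Some (p, q, k) \<Rightarrow> L * \<kappa> * \<bar>V p q\<bar> * r p * r q * w' k) *
            (case x of None \<Rightarrow> 1 | Some (p, q, k) \<Rightarrow> 11)) \<le> 1 + 11 * L * \<kappa> * (c * \<tau>)"
      by (subst sum.insert) (auto simp: sum.reindex sum.cartesian_product split_beta)
  qed (use L \<kappa> r0 w'0 chi0 in \<open>auto split: option.splits\<close>)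
  also have "\<dots> \<le> ennreal (exp (11 * L * \<kappa> * (c * \<tau>)))"
    by (intro ennreal_leI) (rule exp_ge_add_one_self)
  finally show ?thesis unfolding r_def .
qed

text \<open>What one step contributes to the regret, with \<open>r\<close> the density of the current state, \<open>rh\<close> its sample and
  \<open>r0\<close> the density of the comparator.\<close>

definition excess :: "real \<Rightarrow> field \<Rightarrow> field \<Rightarrow> field \<Rightarrow> real" where
  "excess \<kappa> r0 r rh = bil (\<lambda>p. r p - rh p) (\<lambda>p. r p - r0 p)
     - bdist r r0 / 2 + min (bil rh r) (\<kappa> * bil rh rh)"

text \<open>With \<open>d = r - rs\<close>, the noise has variance of order \<open>c \<tau> \<parallel>d\<parallel>\<^sup>2\<close>, hence an exponential moment that the
  term \<open>- \<parallel>d\<parallel>\<^sup>2/2\<close> compensates once \<open>L c \<tau>\<close> is small. The two random parts are separated by the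
  arithmetic-geometric mean, which doubles \<open>L\<close>.\<close>

lemma nn_excess_exp:
  assumes n: "n > 0" and m: "m > 0" and c: "\<And>p. p < m \<Longrightarrow> absact (\<lambda>q. sqn n (a q)) p \<le> c"
    and cs: "\<And>p. p < m \<Longrightarrow> absact rs p \<le> c" and rs: "\<And>p. p < m \<Longrightarrow> 0 \<le> rs p"
    and tau: "(\<Sum>p<m. sqn n (a p)) \<le> \<tau>" and L: "0 \<le> L" "16 * L * (c * \<tau>) \<le> 1" and \<kappa>: "0 \<le> \<kappa>" and c0: "0 \<le> c"
  shows "(\<integral>\<^sup>+z. ennreal (exp (L * excess \<kappa> rs (\<lambda>p. sqn n (a p)) (\<lambda>p. (dotp n (a p) z)\<^sup>2))) \<partial>gauss_vec n)
    \<le> ennreal (exp (22 * L * \<kappa> * (c * \<tau>)))"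
proof -
  define r where "r p = sqn n (a p)" for p
  define d where "d p = r p - rs p" for p
  have r0: "0 \<le> r p" for p unfolding r_def by (auto intro!: sum_nonneg)
  have tau': "(\<Sum>p<m. r p) \<le> \<tau>" using tau unfolding r_def .
  have tau0: "0 \<le> \<tau>" using tau' r0 by (meson order_trans sum_nonneg)
  have rc: "absact r p \<le> c" if "p < m" for p using c[OF that] unfolding r_def .
  have dc: "\<bar>act d p\<bar> \<le> 2 * c" if "p < m" for p
    using abs_act_le[of r p] abs_act_le[of rs p] r0 rs rc[OF that] cs[OF that]
    unfolding d_def act_diff by fastforce
  define S where "S = (\<Sum>p<m. \<bar>act d p\<bar> * r p)"
  have S0: "0 \<le> S" unfolding S_def using r0 by (auto intro!: sum_nonneg)
  have "S \<le> (\<Sum>p<m. 2 * c * r p)" unfolding S_def using dc r0 by (intro sum_mono mult_right_mono) auto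
  also have "\<dots> \<le> 2 * (c * \<tau>)" using tau' c0 by (simp add: mult_left_mono flip: sum_distrib_left)
  finally have Sc: "S \<le> 2 * (c * \<tau>)" .
  have LS: "2 * L * S \<le> 1 / 4"
  proof -
    have "2 * L * S \<le> 2 * L * (2 * (c * \<tau>))" using Sc L by (intro mult_left_mono) auto
    then show ?thesis using L by (simp add: mult_ac)
  qed
  have S2: "S\<^sup>2 \<le> \<tau> * c * bil d d"
  proof -
    have "S = (\<Sum>p<m. sqrt (r p) * (sqrt (r p) * \<bar>act d p\<bar>))" unfolding S_def
      by (intro sum.cong refl) (use r0 in \<open>simp add: mult.assoc[symmetric] mult.commute\<close>)
    then have "S\<^sup>2 \<le> (\<Sum>p<m. (sqrt (r p))\<^sup>2) * (\<Sum>p<m. (sqrt (r p) * \<bar>act d p\<bar>)\<^sup>2)"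
      using Cauchy_Schwarz_ineq_sum[of "\<lambda>p. sqrt (r p)" "\<lambda>p. sqrt (r p) * \<bar>act d p\<bar>" "{..<m}"] by simp
    also have "\<dots> = (\<Sum>p<m. r p) * (\<Sum>p<m. r p * (act d p)\<^sup>2)" using r0 by (simp add: power_mult_distrib)
    also have "\<dots> \<le> \<tau> * (c * bil d d)"
      using tau' tau0 r0 by (intro mult_mono act_weighted_le rc sum_nonneg) auto
    finally show ?thesis by (simp add: mult.assoc)
  qed
  let ?N = "\<lambda>z. (\<Sum>p<m. act d p * (sqn n (a p) - (dotp n (a p) z)\<^sup>2))"
  let ?X = "\<lambda>z. min (bil (\<lambda>p. (dotp n (a p) z)\<^sup>2) (\<lambda>p. sqn n (a p)))
            (\<kappa> * bil (\<lambda>p. (dotp n (a p) z)\<^sup>2) (\<lambda>p. (dotp n (a p) z)\<^sup>2))"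
  have e1: "(\<integral>\<^sup>+z. ennreal (exp (2 * L * ?N z)) \<partial>gauss_vec n) \<le> ennreal (exp (L * bil d d))"
  proof -
    have "(\<integral>\<^sup>+z. ennreal (exp (2 * L * ?N z)) \<partial>gauss_vec n) \<le> ennreal (exp (4 * (2 * L)\<^sup>2 * S\<^sup>2))"
      by (rule nn_sampling_noise_exp) (use n L LS in \<open>auto simp: S_def r_def\<close>)
    also have "\<dots> \<le> ennreal (exp (L * bil d d))"
    proof (intro ennreal_leI, unfold exp_le_cancel_iff)
      have "4 * (2 * L)\<^sup>2 * S\<^sup>2 \<le> 16 * L\<^sup>2 * (\<tau> * c * bil d d)" using S2 by (simp add: power_mult_distrib mult_left_mono)
      also have "\<dots> = (16 * L * (c * \<tau>)) * (L * bil d d)" by (simp add: power2_eq_square mult_ac)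
      also have "\<dots> \<le> 1 * (L * bil d d)" using L bil_nonneg[of d] by (intro mult_right_mono) auto
      finally show "4 * (2 * L)\<^sup>2 * S\<^sup>2 \<le> L * bil d d" by simp
    qed
    finally show ?thesis .
  qed
  have e2: "(\<integral>\<^sup>+z. ennreal (exp (2 * L * ?X z)) \<partial>gauss_vec n) \<le> ennreal (exp (11 * (2 * L) * \<kappa> * (c * \<tau>)))"
    by (rule nn_second_order_exp[OF n m c tau]) (use L \<kappa> c0 in auto)
  show ?thesis
  proof (rule nn_mean_le[where I = "{0::nat, 1}" and w = "\<lambda>i. if i = 0 then exp (- (L * bil d d)) / 2 else 1 / 2"
      and B = "\<lambda>i. if i = 0 then exp (L * bil d d) else exp (11 * (2 * L) * \<kappa> * (c * \<tau>))"
      and h = "\<lambda>i z. if i = 0 then exp (2 * L * ?N z) else exp (2 * L * ?X z)"])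
    fix i assume "i \<in> {0::nat, 1}"
    show "(\<lambda>z. if i = 0 then exp (2 * L * ?N z) else exp (2 * L * ?X z)) \<in> borel_measurable (gauss_vec n)"
      unfolding bil_def by simp
    show "(\<integral>\<^sup>+z. ennreal (if i = 0 then exp (2 * L * ?N z) else exp (2 * L * ?X z)) \<partial>gauss_vec n)
      \<le> ennreal (if i = 0 then exp (L * bil d d) else exp (11 * (2 * L) * \<kappa> * (c * \<tau>)))"
      using e1 e2 by simp
  next
    fix z
    define N where "N = ?N z"
    define X where "X = ?X z"
    have "excess \<kappa> rs (\<lambda>p. sqn n (a p)) (\<lambda>p. (dotp n (a p) z)\<^sup>2) = N - bil d d / 2 + X"
      unfolding excess_def N_def X_def d_def[symmetric] r_def[symmetric]
      by (simp add: bil_act[of _ d] mult.commute)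
    then have e: "L * excess \<kappa> rs (\<lambda>p. sqn n (a p)) (\<lambda>p. (dotp n (a p) z)\<^sup>2)
       = (L * N - L * bil d d / 2) + L * X"
      by (simp only:) (simp add: algebra_simps)
    have "exp (L * excess \<kappa> rs (\<lambda>p. sqn n (a p)) (\<lambda>p. (dotp n (a p) z)\<^sup>2))
       = exp (L * N - L * bil d d / 2) * exp (L * X)"
      unfolding e by (rule exp_add)
    also have "\<dots> \<le> ((exp (L * N - L * bil d d / 2))\<^sup>2 + (exp (L * X))\<^sup>2) / 2"
      using sum_squares_bound[of "exp (L * N - L * bil d d / 2)" "exp (L * X)"] by simp
    also have "\<dots> = exp (- (L * bil d d)) / 2 * exp (2 * L * N) + 1 / 2 * exp (2 * L * X)"
      by (simp add: power2_eq_square algebra_simps add_divide_distrib flip: exp_add)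
    finally show "exp (L * excess \<kappa> rs (\<lambda>p. sqn n (a p)) (\<lambda>p. (dotp n (a p) z)\<^sup>2))
      \<le> (\<Sum>i\<in>{0::nat, 1}. (if i = 0 then exp (- (L * bil d d)) / 2 else 1 / 2) * (if i = 0 then exp (2 * L * ?N z) else exp (2 * L * ?X z)))"
      by (simp add: N_def X_def)
  next
    have "1 \<le> exp (22 * L * \<kappa> * (c * \<tau>))" using L \<kappa> c0 tau0 by simp
    moreover have "(\<Sum>i\<in>{0::nat, 1}. (if i = 0 then exp (- (L * bil d d)) / 2 else 1 / 2) * (if i = 0 then exp (L * bil d d) else exp (11 * (2 * L) * \<kappa> * (c * \<tau>))))
      = 1 / 2 + exp (22 * L * \<kappa> * (c * \<tau>)) / 2"
      by (simp add: mult.assoc flip: exp_add)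
    ultimately show "(\<Sum>i\<in>{0::nat, 1}. (if i = 0 then exp (- (L * bil d d)) / 2 else 1 / 2) * (if i = 0 then exp (L * bil d d) else exp (11 * (2 * L) * \<kappa> * (c * \<tau>))))
      \<le> exp (22 * L * \<kappa> * (c * \<tau>))" by linarith
  qed auto
qed

end


section \<open>The sampled dynamics\<close>

text \<open>The row \<open>a U p\<close> stands for \<open>X\<^sup>\<half> \<psi>\<^sub>p\<close> in the state with field \<open>U\<close>, where \<open>\<psi>\<^sub>p\<close> is the \<open>p\<close>-th row of \<open>\<Psi>\<close>; its
  squared length is the density at \<open>p\<close>. \<open>K\<close> is the convex cone of fields whose potential is positive
  semidefinite: there the number of particles is at most its initial value, up to \<open>\<tau>\<close>.\<close>

locale sampled_dynamics = psd_form +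
  fixes n T :: nat and a :: "field \<Rightarrow> nat \<Rightarrow> field"
    and \<beta> \<tau> cpsi vinf :: real and K :: "(nat \<Rightarrow> real) set"
  assumes n0: "n > 0" and nm: "n \<le> m" and m0: "m > 0" and T0: "T > 0" and \<beta>0: "\<beta> > 0"
    and a_diff: "(\<Sum>p<m. \<Sum>i<n. (a U p i - a U' p i)\<^sup>2)
       \<le> (\<Sum>p<m. (sqn n (a U p) + sqn n (a U' p)) * (act (\<lambda>q. U q - U' q) p)\<^sup>2) / 4"
    and rho_le: "p < m \<Longrightarrow> (sqn n (a U p)) \<le> cpsi"
    and vinf: "p < m \<Longrightarrow> absact (\<lambda>_. 1) p \<le> vinf"
    and cpsi: "1 \<le> real m * cpsi" and \<tau>1: "1 \<le> \<tau>" and \<tau>m: "\<tau> \<le> real m"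
    and K_zero: "(\<lambda>_. 0) \<in> K"
    and K_add: "U \<in> K \<Longrightarrow> U' \<in> K \<Longrightarrow> 0 \<le> s \<Longrightarrow> 0 \<le> s' \<Longrightarrow> (\<lambda>p. s * U p + s' * U' p) \<in> K"
    and K_samp: "U \<in> K \<Longrightarrow> (\<lambda>p. (dotp n (a U p) z)\<^sup>2) \<in> K"
    and K_trace: "U \<in> K \<Longrightarrow> (\<Sum>p<m. sqn n (a U p)) \<le> \<tau>"
begin

definition rho :: "field \<Rightarrow> nat \<Rightarrow> real" where
  "rho U p = sqn n (a U p)"

definition samp :: "field \<Rightarrow> field \<Rightarrow> nat \<Rightarrow> real" where
  "samp U z p = (dotp n (a U p) z)\<^sup>2"

fun traj :: "real \<Rightarrow> (nat \<Rightarrow> field) \<Rightarrow> nat \<Rightarrow> nat \<Rightarrow> real" where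
  "traj \<gamma> x 0 = (\<lambda>_. 0)"
| "traj \<gamma> x (Suc t) = (\<lambda>p. (1 - \<gamma> / \<beta>) * traj \<gamma> x t p + \<gamma> * samp (traj \<gamma> x t) (x t) p)"

definition \<Omega> :: "(nat \<Rightarrow> field) measure" where
  "\<Omega> = Pi\<^sub>M {..<T} (\<lambda>_. gauss_vec n)"

definition ch :: real where "ch = cpsi * vinf"

lemma rho_nonneg: "0 \<le> rho U p" unfolding rho_def by (auto intro!: sum_nonneg)

lemma samp_nonneg: "0 \<le> samp U z p" unfolding samp_def by simp

lemma cpsi_pos: "0 < cpsi"
proof -
  have "0 < real m * cpsi" using cpsi by simp
  then show ?thesis using m0 by (simp add: zero_less_mult_iff)
qed

lemma vinf_nonneg: "0 \<le> vinf"
proof -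
  have "0 \<le> absact (\<lambda>_. 1) 0" unfolding absact_def by (auto intro: sum_nonneg)
  then show ?thesis using vinf[OF m0] by simp
qed

lemma ch_nonneg: "0 \<le> ch" unfolding ch_def using cpsi_pos vinf_nonneg by simp

lemma vinf_le: "vinf \<le> real m * ch"
proof -
  have "1 * vinf \<le> (real m * cpsi) * vinf" using cpsi vinf_nonneg by (intro mult_right_mono)
  then show ?thesis by (simp add: ch_def)
qed

lemma absact_const: "p < m \<Longrightarrow> 0 \<le> k \<Longrightarrow> absact (\<lambda>_. k) p \<le> k * vinf"
  using vinf[of p] absact_scale[of k "\<lambda>_. 1" p] by (simp add: mult_left_mono)

lemma act_sq_sum_le: "(\<Sum>p<m. (act u p)\<^sup>2) \<le> vinf * bil u u"
  using act_weighted_le[of "\<lambda>_. 1" vinf u] vinf by simp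

lemma a_diff_crude: "(\<Sum>p<m. \<Sum>i<n. (a U p i - a U' p i)\<^sup>2) \<le> ch / 2 * bdist U U'"
proof -
  let ?u = "\<lambda>q. U q - U' q"
  have r2: "rho U p + rho U' p \<le> 2 * cpsi" if "p \<in> {..<m}" for p
    using rho_le[of p U] rho_le[of p U'] that unfolding rho_def by simp
  have "(\<Sum>p<m. (rho U p + rho U' p) * (act ?u p)\<^sup>2) / 4 \<le> (\<Sum>p<m. (2 * cpsi) * (act ?u p)\<^sup>2) / 4"
    by (intro divide_right_mono sum_mono mult_right_mono r2) auto
  also have "\<dots> = cpsi / 2 * (\<Sum>p<m. (act ?u p)\<^sup>2)" by (simp flip: sum_distrib_left)
  also have "\<dots> \<le> cpsi / 2 * (vinf * bil ?u ?u)" using cpsi_pos by (intro mult_left_mono act_sq_sum_le) auto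
  finally show ?thesis using a_diff[of U U'] unfolding rho_def ch_def by (simp add: mult_ac)
qed

text \<open>Lipschitz dependence of the amplitudes on the field, at the actual scale of the two states and not at \<open>ch\<close>.\<close>

lemma a_diff_good:
  assumes "\<And>p. p < m \<Longrightarrow> absact (rho U) p \<le> c" "\<And>p. p < m \<Longrightarrow> absact (rho U') p \<le> c"
  shows "(\<Sum>p<m. \<Sum>i<n. (a U p i - a U' p i)\<^sup>2) \<le> c / 2 * bdist U U'"
proof -
  let ?u = "\<lambda>q. U q - U' q"
  have "(\<Sum>p<m. (rho U p + rho U' p) * (act ?u p)\<^sup>2) \<le> (2 * c) * bil ?u ?u"
  proof (rule act_weighted_le)
    fix p assume "p < m"
    then show "absact (\<lambda>p. rho U p + rho U' p) p \<le> 2 * c" using assms[of p] by (simp add: absact_add)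
  qed (auto simp: rho_nonneg)
  then show ?thesis using a_diff[of U U'] unfolding rho_def by simp
qed

lemma a_cong: "(\<And>p. p < m \<Longrightarrow> U p = U' p) \<Longrightarrow> p < m \<Longrightarrow> i < n \<Longrightarrow> a U p i = a U' p i"
proof -
  assume e: "\<And>p. p < m \<Longrightarrow> U p = U' p" and p: "p < m" and i: "i < n"
  have "bdist U U' = bil (\<lambda>_. 0) (\<lambda>_. 0)"
    by (rule bil_cong) (auto simp: e)
  then have "(\<Sum>p<m. \<Sum>i<n. (a U p i - a U' p i)\<^sup>2) \<le> 0"
    using a_diff_crude[of U U'] by (simp add: bil_zero)
  moreover have "(a U p i - a U' p i)\<^sup>2 \<le> (\<Sum>i<n. (a U p i - a U' p i)\<^sup>2)"
    using i by (intro member_le_sum) auto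
  moreover have "(\<Sum>i<n. (a U p i - a U' p i)\<^sup>2) \<le> (\<Sum>p<m. \<Sum>i<n. (a U p i - a U' p i)\<^sup>2)"
    using p by (intro member_le_sum) (auto intro!: sum_nonneg)
  ultimately have "(a U p i - a U' p i)\<^sup>2 \<le> 0" by linarith
  then show ?thesis by simp
qed

lemma a_component_le:
  assumes "p < m" "i < n"
  shows "\<bar>a U p i - a U' p i\<bar> \<le> sqrt (ch / 2 * bdist U U')"
proof -
  have "(a U p i - a U' p i)\<^sup>2 \<le> (\<Sum>i<n. (a U p i - a U' p i)\<^sup>2)"
    using assms by (intro member_le_sum) auto
  also have "\<dots> \<le> (\<Sum>p<m. \<Sum>i<n. (a U p i - a U' p i)\<^sup>2)"
    using assms by (intro member_le_sum[of p]) (auto intro!: sum_nonneg)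
  also note a_diff_crude
  finally have "sqrt ((a U p i - a U' p i)\<^sup>2) \<le> sqrt (ch / 2 * bdist U U')"
    by (rule real_sqrt_le_mono)
  then show ?thesis by simp
qed

lemma a_continuous:
  assumes "p < m" "i < n"
  shows "continuous_on UNIV (\<lambda>U. a U p i)"
proof (subst continuous_on_eq_continuous_at[OF open_UNIV], intro ballI)
  fix U :: "nat \<Rightarrow> real"
  have c: "continuous_on UNIV (\<lambda>U'. sqrt (ch / 2 * bdist U' U))"
    unfolding bil_def by (intro continuous_intros continuous_on_product_coordinates)
  then have "isCont (\<lambda>U'. sqrt (ch / 2 * bdist U' U)) U"
    by (simp add: continuous_on_eq_continuous_at)
  then have "((\<lambda>U'. sqrt (ch / 2 * bdist U' U)) \<longlongrightarrow> 0) (at U)"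
    unfolding isCont_def by (simp add: bil_zero)
  then have "((\<lambda>U'. a U' p i - a U p i) \<longlongrightarrow> 0) (at U)"
    by (rule Lim_null_comparison[rotated]) (use a_component_le[OF assms] in \<open>auto intro!: always_eventually\<close>)
  then show "isCont (\<lambda>U. a U p i) U" unfolding isCont_def by (subst (asm) LIM_zero_iff)
qed

lemma a_measurable:
  assumes f: "\<And>p. p < m \<Longrightarrow> (\<lambda>x. f x p) \<in> borel_measurable M" and "p < m" "i < n"
  shows "(\<lambda>x. a (f x) p i) \<in> borel_measurable M"
proof -
  define h where "h x p = (if p < m then f x p else 0)" for x p
  have "(\<lambda>x. h x p) \<in> borel_measurable M" for p unfolding h_def using f by (cases "p < m") auto
  then have "h \<in> borel_measurable M" by (rule measurable_coordinatewise_then_product)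
  moreover have "(\<lambda>U. a U p i) \<in> borel_measurable borel"
    by (intro borel_measurable_continuous_onI a_continuous assms)
  ultimately have "(\<lambda>x. a (h x) p i) \<in> borel_measurable M" by (rule measurable_compose)
  moreover have "a (h x) p i = a (f x) p i" for x by (rule a_cong) (use assms in \<open>auto simp: h_def\<close>)
  ultimately show ?thesis by simp
qed

lemma rho_measurable:
  assumes f: "\<And>p. p < m \<Longrightarrow> (\<lambda>x. f x p) \<in> borel_measurable M" and "p < m"
  shows "(\<lambda>x. rho (f x) p) \<in> borel_measurable M"
  unfolding rho_def using a_measurable[OF f assms(2)] by (intro borel_measurable_sum borel_measurable_power) auto

lemma samp_measurable:
  assumes f: "\<And>p. p < m \<Longrightarrow> (\<lambda>x. f x p) \<in> borel_measurable M" and "p < m"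
    and z: "\<And>i. i < n \<Longrightarrow> (\<lambda>x. z x i) \<in> borel_measurable M"
  shows "(\<lambda>x. samp (f x) (z x) p) \<in> borel_measurable M"
  unfolding samp_def dotp_def using a_measurable[OF f assms(2)] z
  by (intro borel_measurable_sum borel_measurable_power borel_measurable_times) auto

lemma bil_measurable:
  assumes f: "\<And>p. p < m \<Longrightarrow> (\<lambda>x. f x p) \<in> borel_measurable M"
    and g: "\<And>p. p < m \<Longrightarrow> (\<lambda>x. g x p) \<in> borel_measurable M"
  shows "(\<lambda>x. bil (f x) (g x)) \<in> borel_measurable M"
  unfolding bil_def using f g by (intro borel_measurable_sum borel_measurable_times) auto

lemma absact_measurable:
  assumes f: "\<And>p. p < m \<Longrightarrow> (\<lambda>x. f x p) \<in> borel_measurable M"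
  shows "(\<lambda>x. absact (f x) p) \<in> borel_measurable M"
  unfolding absact_def using f by (intro borel_measurable_sum borel_measurable_times) auto

lemma prob_space_\<Omega>: "prob_space \<Omega>"
  unfolding \<Omega>_def by (intro prob_space_PiM prob_space_gauss_vec)

lemma \<Omega>_component: "t < T \<Longrightarrow> (\<lambda>x. x t) \<in> measurable \<Omega> (gauss_vec n)"
  unfolding \<Omega>_def by (intro measurable_component_singleton) auto

lemma \<Omega>_entry: "t < T \<Longrightarrow> i < n \<Longrightarrow> (\<lambda>x. x t i) \<in> borel_measurable \<Omega>"
  using measurable_compose[OF \<Omega>_component gauss_vec_component] .

lemma traj_measurable: "t \<le> T \<Longrightarrow> p < m \<Longrightarrow> (\<lambda>x. traj \<gamma> x t p) \<in> borel_measurable \<Omega>"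
proof (induction t arbitrary: p)
  case (Suc t)
  have "(\<lambda>x. samp (traj \<gamma> x t) (x t) p) \<in> borel_measurable \<Omega>"
    by (rule samp_measurable) (use Suc \<Omega>_entry[of t] in auto)
  then show ?case using Suc by (auto intro!: borel_measurable_add borel_measurable_times)
qed simp

lemma traj_upd: "t \<le> s \<Longrightarrow> traj \<gamma> (x(s := y)) t = traj \<gamma> x t"
  by (induction t) auto

lemma traj_in_K:
  assumes "0 \<le> \<gamma>" "\<gamma> \<le> \<beta>"
  shows "traj \<gamma> x t \<in> K"
proof (induction t)
  case (Suc t)
  show ?case unfolding traj.simps
    by (rule K_add[OF Suc]) (use K_samp[OF Suc] assms \<beta>0 in \<open>auto simp: samp_def[abs_def]\<close>)
qed (simp add: K_zero)

lemma rho_sum_le: "U \<in> K \<Longrightarrow> (\<Sum>p<m. rho U p) \<le> \<tau>"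
  unfolding rho_def by (rule K_trace)

text \<open>Redrawing one coordinate leaves the product measure invariant. This replaces conditioning on the
  samples drawn before time \<open>t\<close>.\<close>

lemma resample:
  assumes F: "F \<in> borel_measurable \<Omega>" and t: "t < T"
  shows "(\<integral>\<^sup>+x. F x \<partial>\<Omega>) = (\<integral>\<^sup>+x. (\<integral>\<^sup>+y. F (x(t := y)) \<partial>gauss_vec n) \<partial>\<Omega>)"
proof -
  interpret G: prob_space "gauss_vec n" by (rule prob_space_gauss_vec)
  interpret P: product_sigma_finite "\<lambda>_::nat. gauss_vec n" ..
  define I where "I = {..<T} - {t}"
  have I: "finite I" "t \<notin> I" "{..<T} = insert t I" using t by (auto simp: I_def)
  have ins: "(\<integral>\<^sup>+x. H x \<partial>\<Omega>) = (\<integral>\<^sup>+x. (\<integral>\<^sup>+y. H (x(t := y)) \<partial>gauss_vec n) \<partial>Pi\<^sub>M I (\<lambda>_. gauss_vec n))"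
    if "H \<in> borel_measurable \<Omega>" for H
    using P.product_nn_integral_insert[OF I(1,2), of H] that unfolding \<Omega>_def I(3) by simp
  have upd: "(\<lambda>(x, y). x(t := y)) \<in> measurable (\<Omega> \<Otimes>\<^sub>M gauss_vec n) \<Omega>"
    using measurable_add_dim[of t "{..<T}" "\<lambda>_. gauss_vec n"] t unfolding \<Omega>_def by (simp add: insert_absorb)
  have m: "(\<lambda>x. \<integral>\<^sup>+y. F (x(t := y)) \<partial>gauss_vec n) \<in> borel_measurable \<Omega>"
    by (rule G.borel_measurable_nn_integral) (use measurable_compose[OF upd F] in \<open>simp add: split_beta'\<close>)
  have "(\<integral>\<^sup>+x. (\<integral>\<^sup>+y. F (x(t := y)) \<partial>gauss_vec n) \<partial>\<Omega>)
      = (\<integral>\<^sup>+x. (\<integral>\<^sup>+y'. (\<integral>\<^sup>+y. F ((x(t := y'))(t := y)) \<partial>gauss_vec n) \<partial>gauss_vec n) \<partial>Pi\<^sub>M I (\<lambda>_. gauss_vec n))"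
    by (rule ins[OF m])
  also have "\<dots> = (\<integral>\<^sup>+x. (\<integral>\<^sup>+y. F (x(t := y)) \<partial>gauss_vec n) \<partial>Pi\<^sub>M I (\<lambda>_. gauss_vec n))"
    by (simp add: G.emeasure_space_1)
  also have "\<dots> = (\<integral>\<^sup>+x. F x \<partial>\<Omega>)" by (rule ins[OF F, symmetric])
  finally show ?thesis by simp
qed

lemma resample_le:
  assumes F: "F \<in> borel_measurable \<Omega>" and t: "t < T"
    and le: "\<And>x. x \<in> space \<Omega> \<Longrightarrow> (\<integral>\<^sup>+y. F (x(t := y)) \<partial>gauss_vec n) \<le> A x"
  shows "(\<integral>\<^sup>+x. F x \<partial>\<Omega>) \<le> (\<integral>\<^sup>+x. A x \<partial>\<Omega>)"
  unfolding resample[OF F t] by (intro nn_integral_mono le)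

end


section \<open>Moment bounds along trajectories\<close>

lemma weighted_square_sum3:
  fixes A B C :: real
  assumes "\<theta> > 0" "\<iota> > 0"
  shows "(A + B + C)\<^sup>2 \<le> (1 + \<theta> + \<iota>) * (A\<^sup>2 + B\<^sup>2 / \<theta> + C\<^sup>2 / \<iota>)"
proof -
  have "(1 + \<theta> + \<iota>) * (A\<^sup>2 + B\<^sup>2 / \<theta> + C\<^sup>2 / \<iota>) - (A + B + C)\<^sup>2
      = (\<theta> * A - B)\<^sup>2 / \<theta> + (\<iota> * A - C)\<^sup>2 / \<iota> + (\<iota> * B - \<theta> * C)\<^sup>2 / (\<theta> * \<iota>)"
    using assms by (simp add: power2_eq_square field_simps)
  moreover have "0 \<le> (\<theta> * A - B)\<^sup>2 / \<theta> + (\<iota> * A - C)\<^sup>2 / \<iota> + (\<iota> * B - \<theta> * C)\<^sup>2 / (\<theta> * \<iota>)"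
    using assms by auto
  ultimately show ?thesis by linarith
qed

context sampled_dynamics begin

text \<open>A trajectory is good at time \<open>t\<close> when its density obeys the scale \<open>c\<close>. This event depends only on samples
  drawn before \<open>t\<close>, so the sample at \<open>t\<close> can be redrawn on it.\<close>

definition good :: "real \<Rightarrow> real \<Rightarrow> (nat \<Rightarrow> field) \<Rightarrow> nat \<Rightarrow> bool" where
  "good \<gamma> c x t \<longleftrightarrow> (\<forall>p<m. absact (rho (traj \<gamma> x t)) p \<le> c)"

definition good_before :: "real \<Rightarrow> real \<Rightarrow> (nat \<Rightarrow> field) \<Rightarrow> nat \<Rightarrow> bool" where
  "good_before \<gamma> c x t \<longleftrightarrow> (\<forall>s<t. good \<gamma> c x s)"

lemma good_upd: "t \<le> s \<Longrightarrow> good \<gamma> c (x(s := y)) t = good \<gamma> c x t"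
  unfolding good_def by (simp add: traj_upd)

lemma good_before_upd: "t \<le> Suc s \<Longrightarrow> good_before \<gamma> c (x(s := y)) t = good_before \<gamma> c x t"
  unfolding good_before_def using good_upd[of _ s] by (auto simp: less_Suc_eq_le)

lemma good_sets: "t \<le> T \<Longrightarrow> {x \<in> space \<Omega>. good \<gamma> c x t} \<in> sets \<Omega>"
proof -
  assume t: "t \<le> T"
  have "(\<lambda>x. absact (rho (traj \<gamma> x t)) p) \<in> borel_measurable \<Omega>" for p
    by (intro absact_measurable rho_measurable traj_measurable t)
  then have "{x \<in> space \<Omega>. \<forall>p\<in>{..<m}. absact (rho (traj \<gamma> x t)) p \<le> c} \<in> sets \<Omega>"
    by (intro sets.sets_Collect_finite_All borel_measurable_le) auto
  moreover have "{x \<in> space \<Omega>. \<forall>p\<in>{..<m}. absact (rho (traj \<gamma> x t)) p \<le> c} = {x \<in> space \<Omega>. good \<gamma> c x t}"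
    by (auto simp: good_def)
  ultimately show ?thesis by simp
qed

lemma good_before_sets: "t \<le> T \<Longrightarrow> {x \<in> space \<Omega>. good_before \<gamma> c x t} \<in> sets \<Omega>"
proof -
  assume t: "t \<le> T"
  have "{x \<in> space \<Omega>. \<forall>s\<in>{..<t}. good \<gamma> c x s} \<in> sets \<Omega>"
    using t by (intro sets.sets_Collect_finite_All good_sets) auto
  moreover have "{x \<in> space \<Omega>. \<forall>s\<in>{..<t}. good \<gamma> c x s} = {x \<in> space \<Omega>. good_before \<gamma> c x t}"
    by (auto simp: good_before_def)
  ultimately show ?thesis by simp
qed

lemma nn_samp_bil:
  assumes "U \<in> K" "\<And>p. p < m \<Longrightarrow> absact (rho U) p \<le> c" "0 \<le> c"
  shows "(\<integral>\<^sup>+z. ennreal (bil (samp U z) (samp U z)) \<partial>gauss_vec n) \<le> ennreal (3 * c * \<tau>)"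
proof -
  have "(\<integral>\<^sup>+z. ennreal (bil (samp U z) (samp U z)) \<partial>gauss_vec n)
     \<le> (\<integral>\<^sup>+z. ennreal (\<Sum>p<m. \<Sum>q<m. \<bar>V p q\<bar> * (dotp n (a U p) z)\<^sup>2 * (dotp n (a U q) z)\<^sup>2) \<partial>gauss_vec n)"
    using bil_le_abs[of "samp U _"] by (intro nn_integral_mono ennreal_leI) (simp add: samp_def)
  also have "\<dots> \<le> ennreal (3 * c * (\<Sum>p<m. sqn n (a U p)))"
    by (rule nn_abs_bil_sample[OF n0]) (use assms(2) in \<open>simp add: rho_def[abs_def]\<close>)
  also have "\<dots> \<le> ennreal (3 * c * \<tau>)"
    using K_trace[OF assms(1)] assms(3) by (intro ennreal_leI mult_left_mono) auto
  finally show ?thesis .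
qed

lemma nn_samp_diff_bil:
  assumes "\<And>p. p < m \<Longrightarrow> absact (rho U) p \<le> c" "\<And>p. p < m \<Longrightarrow> absact (rho U') p \<le> c" "0 \<le> c"
  shows "(\<integral>\<^sup>+z. ennreal (bdist (samp U z) (samp U' z)) \<partial>gauss_vec n)
    \<le> ennreal (6 * c\<^sup>2 * bdist U U')"
proof -
  have "(\<integral>\<^sup>+z. ennreal (bdist (samp U z) (samp U' z)) \<partial>gauss_vec n)
    \<le> ennreal (12 * c * (\<Sum>p<m. \<Sum>i<n. (a U p i - a U' p i)\<^sup>2))"
    unfolding samp_def by (rule nn_sample_diff[OF n0]) (use assms in \<open>simp_all add: rho_def[abs_def]\<close>)
  also have "\<dots> \<le> ennreal (12 * c * (c / 2 * bdist U U'))"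
    by (intro ennreal_leI mult_left_mono a_diff_good assms) (use assms in auto)
  finally show ?thesis by (simp add: power2_eq_square mult_ac)
qed

text \<open>The update is a convex combination of the old field and \<open>\<beta>\<close> times the sampled density, with weight
  \<open>\<gamma>/\<beta>\<close>. Convexity keeps second moments of trajectories bounded independently of \<open>t\<close>.\<close>

lemma bil_convex:
  assumes "0 \<le> s" "s \<le> 1"
  shows "bil (\<lambda>p. (1 - s) * u p + s * v p) (\<lambda>p. (1 - s) * u p + s * v p) \<le> (1 - s) * bil u u + s * bil v v"
proof -
  have "(1 - s) * bil u u + s * bil v v - bil (\<lambda>p. (1 - s) * u p + s * v p) (\<lambda>p. (1 - s) * u p + s * v p)
      = s * (1 - s) * bdist u v"
    using bil_commute[of u v] by (simp add: bil_lin algebra_simps)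
  moreover have "0 \<le> s * (1 - s) * bdist u v" using assms bil_nonneg by simp
  ultimately show ?thesis by linarith
qed

lemma samp_entry_measurable: "p < m \<Longrightarrow> (\<lambda>z. samp U z p) \<in> borel_measurable (gauss_vec n)"
  unfolding samp_def by simp

lemma samp_bil_measurable: "(\<lambda>z. bil (samp U z) (samp U z)) \<in> borel_measurable (gauss_vec n)"
  by (intro bil_measurable samp_entry_measurable)

lemma samp_diff_bil_measurable:
  "(\<lambda>z. bdist (samp U z) (samp U' z)) \<in> borel_measurable (gauss_vec n)"
  by (intro bil_measurable borel_measurable_diff samp_entry_measurable)

lemma nn_one_gauss: "(\<integral>\<^sup>+y. ennreal 1 \<partial>gauss_vec n) \<le> ennreal 1"
  using prob_space.emeasure_space_1[OF prob_space_gauss_vec[of n]] by simp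

lemma nn_one_\<Omega>: "(\<integral>\<^sup>+x. ennreal 1 \<partial>\<Omega>) \<le> ennreal 1"
  using prob_space.emeasure_space_1[OF prob_space_\<Omega>] by simp

lemma traj_second_moment:
  assumes g: "0 \<le> \<gamma>" "\<gamma> \<le> \<beta>" and c: "0 \<le> c"
  shows "t \<le> T \<Longrightarrow> (\<integral>\<^sup>+x. ennreal (if good_before \<gamma> c x t then bil (traj \<gamma> x t) (traj \<gamma> x t) else 0) \<partial>\<Omega>)
     \<le> ennreal (3 * c * \<tau> * \<beta>\<^sup>2)"
proof (induction t)
  case 0
  then show ?case by (simp add: bil_zero cong: if_cong)
next
  case (Suc t)
  define s where "s = \<gamma> / \<beta>"
  have s: "0 \<le> s" "s \<le> 1" "\<gamma> = s * \<beta>" using g \<beta>0 by (auto simp: s_def)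
  let ?D = "\<lambda>x t. (if good_before \<gamma> c x t then bil (traj \<gamma> x t) (traj \<gamma> x t) else 0)"
  let ?B = "3 * c * \<tau> * \<beta>\<^sup>2"
  have B0: "0 \<le> ?B" using c \<tau>1 by auto
  have meas: "(\<lambda>x. ?D x t') \<in> borel_measurable \<Omega>" if "t' \<le> T" for t'
    by (intro measurable_If bil_measurable traj_measurable good_before_sets that) auto
  have "(\<integral>\<^sup>+x. ennreal (?D x (Suc t)) \<partial>\<Omega>) \<le> (\<integral>\<^sup>+x. ennreal ((1 - s) * ?D x t + s * ?B) \<partial>\<Omega>)"
  proof (rule resample_le[where t = t])
    show "(\<lambda>x. ennreal (?D x (Suc t))) \<in> borel_measurable \<Omega>" using meas[OF Suc.prems] by measurable
    show "t < T" using Suc.prems by simp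
    fix x assume "x \<in> space \<Omega>"
    show "(\<integral>\<^sup>+y. ennreal (?D (x(t := y)) (Suc t)) \<partial>gauss_vec n) \<le> ennreal ((1 - s) * ?D x t + s * ?B)"
    proof (cases "good_before \<gamma> c x (Suc t)")
      case False
      then show ?thesis by (simp add: good_before_upd)
    next
      case True
      then have gt: "good_before \<gamma> c x t" "\<And>p. p < m \<Longrightarrow> absact (rho (traj \<gamma> x t)) p \<le> c"
        unfolding good_before_def good_def by auto
      let ?U = "traj \<gamma> x t"
      show ?thesis
      proof (rule nn_mean_le[where I = "{0::nat, 1}" and w = "\<lambda>i. if i = 0 then (1 - s) * bil ?U ?U else s * \<beta>\<^sup>2"
            and B = "\<lambda>i. if i = 0 then 1 else 3 * c * \<tau>" and h = "\<lambda>i y. if i = 0 then 1 else bil (samp ?U y) (samp ?U y)"])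
        fix i assume "i \<in> {0::nat, 1}"
        show "(\<lambda>y. if i = 0 then 1 else bil (samp ?U y) (samp ?U y)) \<in> borel_measurable (gauss_vec n)"
          using samp_bil_measurable[of ?U] by (cases "i = 0") (simp_all only: numeral_if borel_measurable_const)
        show "(\<integral>\<^sup>+y. ennreal (if i = 0 then 1 else bil (samp ?U y) (samp ?U y)) \<partial>gauss_vec n)
           \<le> ennreal (if i = 0 then 1 else 3 * c * \<tau>)"
        proof (cases "i = 0")
          case True
          then show ?thesis using nn_one_gauss by (simp only: numeral_if)
        next
          case False
          then show ?thesis using nn_samp_bil[OF traj_in_K[OF g] gt(2) c] by (simp only: numeral_if)
        qed
      next
        fix y
        have "bil (traj \<gamma> (x(t := y)) (Suc t)) (traj \<gamma> (x(t := y)) (Suc t))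
           = bil (\<lambda>p. (1 - s) * ?U p + s * (\<beta> * samp ?U y p)) (\<lambda>p. (1 - s) * ?U p + s * (\<beta> * samp ?U y p))"
          using \<beta>0 by (simp add: traj_upd s_def mult_ac)
        also have "\<dots> \<le> (1 - s) * bil ?U ?U + s * bil (\<lambda>p. \<beta> * samp ?U y p) (\<lambda>p. \<beta> * samp ?U y p)"
          by (rule bil_convex[OF s(1,2)])
        also have "bil (\<lambda>p. \<beta> * samp ?U y p) (\<lambda>p. \<beta> * samp ?U y p) = \<beta>\<^sup>2 * bil (samp ?U y) (samp ?U y)"
          by (simp add: bil_scale_left bil_scale_right power2_eq_square)
        finally have le: "bil (traj \<gamma> (x(t := y)) (Suc t)) (traj \<gamma> (x(t := y)) (Suc t))
          \<le> (1 - s) * bil ?U ?U + s * (\<beta>\<^sup>2 * bil (samp ?U y) (samp ?U y))" .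
        have "?D (x(t := y)) (Suc t) = bil (traj \<gamma> (x(t := y)) (Suc t)) (traj \<gamma> (x(t := y)) (Suc t))"
          unfolding good_before_upd[OF order_refl] by (rule if_P[OF True])
        also note le
        also have "(1 - s) * bil ?U ?U + s * (\<beta>\<^sup>2 * bil (samp ?U y) (samp ?U y))
          = (\<Sum>i\<in>{0::nat, 1}. (if i = 0 then (1 - s) * bil ?U ?U else s * \<beta>\<^sup>2) * (if i = 0 then 1 else bil (samp ?U y) (samp ?U y)))"
          by (simp add: mult.assoc)
        finally show "?D (x(t := y)) (Suc t) \<le> (\<Sum>i\<in>{0::nat, 1}. (if i = 0 then (1 - s) * bil ?U ?U else s * \<beta>\<^sup>2) * (if i = 0 then 1 else bil (samp ?U y) (samp ?U y)))" .
      qed (use gt s c \<tau>1 in \<open>auto simp: bil_nonneg mult_ac\<close>)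
    qed
  qed
  also have "\<dots> \<le> ennreal ?B"
  proof (rule nn_mean_le[where I = "{0::nat, 1}" and w = "\<lambda>i. if i = 0 then 1 - s else s * ?B"
       and B = "\<lambda>i. if i = 0 then ?B else 1" and h = "\<lambda>i x. if i = 0 then ?D x t else 1"])
    fix i assume "i \<in> {0::nat, 1}"
    show "(\<integral>\<^sup>+x. ennreal (if i = 0 then ?D x t else 1) \<partial>\<Omega>) \<le> ennreal (if i = 0 then ?B else 1)"
    proof (cases "i = 0")
      case True
      then show ?thesis using Suc by simp
    next
      case False
      then show ?thesis using nn_one_\<Omega> by (simp only: numeral_if)
    qed
    have "(\<lambda>x. ?D x t) \<in> borel_measurable \<Omega>" using Suc.prems by (intro meas) simp
    then show "(\<lambda>x. if i = 0 then ?D x t else 1) \<in> borel_measurable \<Omega>"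
      by (cases "i = 0") (simp_all only: numeral_if borel_measurable_const)
  qed (use s B0 mult_nonneg_nonneg[OF s(1) B0] in \<open>auto simp: bil_nonneg algebra_simps\<close>)
  finally show ?case .
qed

text \<open>The distance of two trajectories driven by the same samples, cut off as soon as one of them is not good.\<close>

definition pairdist :: "real \<Rightarrow> real \<Rightarrow> real \<Rightarrow> (nat \<Rightarrow> field) \<Rightarrow> nat \<Rightarrow> real" where
  "pairdist \<gamma> \<gamma>' c x t = (if good_before \<gamma> c x t \<and> good_before \<gamma>' c x t
     then bdist (traj \<gamma> x t) (traj \<gamma>' x t) else 0)"

lemma pairdist_nonneg: "0 \<le> pairdist \<gamma> \<gamma>' c x t"
  unfolding pairdist_def by (simp add: bil_nonneg)

lemma pairdist_measurable: "t \<le> T \<Longrightarrow> (\<lambda>x. pairdist \<gamma> \<gamma>' c x t) \<in> borel_measurable \<Omega>"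
proof -
  assume t: "t \<le> T"
  have "{x \<in> space \<Omega>. good_before \<gamma> c x t \<and> good_before \<gamma>' c x t} \<in> sets \<Omega>"
    by (intro sets.sets_Collect_conj good_before_sets t)
  then show ?thesis unfolding pairdist_def
    by (intro measurable_If bil_measurable borel_measurable_diff traj_measurable t) auto
qed

text \<open>Young's inequality with free parameters \<open>\<theta>\<close> and \<open>\<iota>\<close> separates the inherited distance, the difference of
  the samples and the effect of the different step sizes. The factors \<open>1 - \<gamma>/\<beta>\<close> are at most 1.\<close>

lemma traj_diff_step:
  assumes g: "0 \<le> \<gamma>" "\<gamma> \<le> \<beta>" and \<theta>: "\<theta> > 0" and \<iota>: "\<iota> > 0"
  shows "bil (\<lambda>p. ((1 - \<gamma> / \<beta>) * U p + \<gamma> * s p) - ((1 - \<gamma>' / \<beta>) * U' p + \<gamma>' * s' p))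
        (\<lambda>p. ((1 - \<gamma> / \<beta>) * U p + \<gamma> * s p) - ((1 - \<gamma>' / \<beta>) * U' p + \<gamma>' * s' p))
    \<le> (1 + \<theta> + \<iota>) * (bdist U U'
        + \<gamma>\<^sup>2 / \<theta> * bdist s s'
        + (\<gamma> - \<gamma>')\<^sup>2 / \<iota> * (2 * bil s' s' + 2 * bil U' U' / \<beta>\<^sup>2))"
proof -
  let ?d = "\<lambda>p. U p - U' p" and ?e = "\<lambda>p. s p - s' p"
  define w where "w p = s' p - (1 / \<beta>) * U' p" for p
  let ?f = "\<lambda>p. ((1 - \<gamma> / \<beta>) * U p + \<gamma> * s p) - ((1 - \<gamma>' / \<beta>) * U' p + \<gamma>' * s' p)"
  have f: "?f = (\<lambda>p. ((1 - \<gamma> / \<beta>) * ?d p + \<gamma> * ?e p) + (\<gamma> - \<gamma>') * w p)"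
    using \<beta>0 by (auto simp: w_def field_simps)
  have "nrm ?f \<le> nrm (\<lambda>p. (1 - \<gamma> / \<beta>) * ?d p + \<gamma> * ?e p) + nrm (\<lambda>p. (\<gamma> - \<gamma>') * w p)"
    unfolding f by (rule nrm_triangle)
  also have "nrm (\<lambda>p. (1 - \<gamma> / \<beta>) * ?d p + \<gamma> * ?e p) \<le> nrm (\<lambda>p. (1 - \<gamma> / \<beta>) * ?d p) + nrm (\<lambda>p. \<gamma> * ?e p)"
    by (rule nrm_triangle)
  also have "nrm (\<lambda>p. (1 - \<gamma> / \<beta>) * ?d p) = (1 - \<gamma> / \<beta>) * nrm ?d" unfolding nrm_scale using g \<beta>0 by simp
  also have "nrm (\<lambda>p. \<gamma> * ?e p) = \<gamma> * nrm ?e" unfolding nrm_scale using g by simp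
  also have "nrm (\<lambda>p. (\<gamma> - \<gamma>') * w p) = \<bar>\<gamma> - \<gamma>'\<bar> * nrm w" unfolding nrm_scale ..
  also have "(1 - \<gamma> / \<beta>) * nrm ?d \<le> 1 * nrm ?d" using g \<beta>0 nrm_nonneg by (intro mult_right_mono) auto
  finally have "nrm ?f \<le> nrm ?d + \<gamma> * nrm ?e + \<bar>\<gamma> - \<gamma>'\<bar> * nrm w" by simp
  then have "(nrm ?f)\<^sup>2 \<le> (nrm ?d + \<gamma> * nrm ?e + \<bar>\<gamma> - \<gamma>'\<bar> * nrm w)\<^sup>2" using nrm_nonneg by (intro power_mono) auto
  also have "\<dots> \<le> (1 + \<theta> + \<iota>) * ((nrm ?d)\<^sup>2 + (\<gamma> * nrm ?e)\<^sup>2 / \<theta> + (\<bar>\<gamma> - \<gamma>'\<bar> * nrm w)\<^sup>2 / \<iota>)"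
    by (rule weighted_square_sum3[OF \<theta> \<iota>])
  also have "\<dots> = (1 + \<theta> + \<iota>) * (bil ?d ?d + \<gamma>\<^sup>2 / \<theta> * bil ?e ?e + (\<gamma> - \<gamma>')\<^sup>2 / \<iota> * bil w w)"
    by (simp add: power_mult_distrib nrm_sq)
  also have "\<dots> \<le> (1 + \<theta> + \<iota>) * (bil ?d ?d + \<gamma>\<^sup>2 / \<theta> * bil ?e ?e + (\<gamma> - \<gamma>')\<^sup>2 / \<iota> * (2 * bil s' s' + 2 * bil U' U' / \<beta>\<^sup>2))"
  proof -
    have "0 \<le> bil (\<lambda>p. s' p + (1 / \<beta>) * U' p) (\<lambda>p. s' p + (1 / \<beta>) * U' p)" by (rule bil_nonneg)
    then have "bil w w \<le> 2 * bil s' s' + 2 * bil U' U' / \<beta>\<^sup>2"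
      unfolding w_def by (simp only: bil_lin) (simp add: power2_eq_square algebra_simps)
    then show ?thesis using \<theta> \<iota> by (intro mult_left_mono add_left_mono) auto
  qed
  finally show ?thesis by (simp add: nrm_sq)
qed

text \<open>On good steps the samples differ by \<open>6 c\<^sup>2\<close> times the distance of the fields in mean square, so one step
  multiplies the distance by \<open>1 + O(\<gamma> c)\<close>, that is \<open>1 + O(\<kappa>)\<close>. The choice \<open>\<theta> = 20 \<kappa>\<close>, \<open>\<iota> = 1/T\<close> in
  the previous lemma keeps the total growth at \<open>exp (O(\<kappa> T))\<close>.\<close>

lemma nn_pairdist:
  assumes g: "0 \<le> \<gamma>" "\<gamma> \<le> \<beta>" and g': "0 \<le> \<gamma>'" "\<gamma>' \<le> \<beta>" and c: "0 \<le> c" and \<kappa>: "0 < \<kappa>" and gc: "\<gamma> * c \<le> 8 * \<kappa>"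
  shows "t \<le> T \<Longrightarrow> (\<integral>\<^sup>+x. ennreal (pairdist \<gamma> \<gamma>' c x t) \<partial>\<Omega>)
    \<le> ennreal (real t * (12 * c * \<tau> * real T * (\<gamma> - \<gamma>')\<^sup>2) * ((1 + 20 * \<kappa> + 1 / real T) * (1 + 20 * \<kappa>)) ^ t)"
proof (induction t)
  case 0
  then show ?case by (simp add: pairdist_def bil_zero cong: if_cong)
next
  case (Suc t)
  define \<theta> where "\<theta> = 20 * \<kappa>"
  define \<iota> where "\<iota> = 1 / real T"
  have \<theta>: "\<theta> > 0" and \<iota>: "\<iota> > 0" using \<kappa> T0 by (auto simp: \<theta>_def \<iota>_def)
  define J where "J = 1 + \<theta> + \<iota>"
  define q where "q = J * (1 + \<theta>)"
  define e where "e = (\<gamma> - \<gamma>')\<^sup>2 / \<iota>"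
  have J1: "J \<ge> 1" unfolding J_def using \<theta> \<iota> by simp
  have q1: "q \<ge> 1" and qJ: "J \<le> q" unfolding q_def using J1 \<theta> mult_mono[of 1 J 1 "1 + \<theta>"] by (auto simp: distrib_left)
  have e0: "e \<ge> 0" unfolding e_def using \<iota> by simp
  define B where "B = real t * (12 * c * \<tau> * e) * q ^ t"
  have IH: "(\<integral>\<^sup>+x. ennreal (pairdist \<gamma> \<gamma>' c x t) \<partial>\<Omega>) \<le> ennreal B"
    using Suc unfolding B_def e_def q_def J_def \<theta>_def \<iota>_def by (simp add: mult_ac)
  have B0: "0 \<le> B" unfolding B_def using c \<tau>1 e0 q1 by auto
  let ?N = "\<lambda>x. (if good_before \<gamma>' c x t then bil (traj \<gamma>' x t) (traj \<gamma>' x t) else 0)"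
  have gcq: "\<gamma>\<^sup>2 / \<theta> * (6 * c\<^sup>2) \<le> \<theta>"
  proof -
    have "(\<gamma> * c)\<^sup>2 \<le> (8 * \<kappa>)\<^sup>2" using gc g c by (intro power_mono) auto
    moreover have "6 * (8 * \<kappa>)\<^sup>2 = 384 * \<kappa>\<^sup>2" "\<theta> * \<theta> = 400 * \<kappa>\<^sup>2"
      unfolding \<theta>_def by (simp_all add: power2_eq_square)
    ultimately have "6 * (\<gamma> * c)\<^sup>2 \<le> \<theta> * \<theta>" using zero_le_power2[of \<kappa>] by linarith
    then show ?thesis using \<theta> by (simp add: power_mult_distrib field_simps)
  qed
  have "(\<integral>\<^sup>+x. ennreal (pairdist \<gamma> \<gamma>' c x (Suc t)) \<partial>\<Omega>)
     \<le> (\<integral>\<^sup>+x. ennreal (J * ((1 + \<theta>) * pairdist \<gamma> \<gamma>' c x t + e * (2 * (3 * c * \<tau>) + 2 * ?N x / \<beta>\<^sup>2))) \<partial>\<Omega>)"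
  proof (rule resample_le[where t = t])
    show "(\<lambda>x. ennreal (pairdist \<gamma> \<gamma>' c x (Suc t))) \<in> borel_measurable \<Omega>"
      using pairdist_measurable[OF Suc.prems] by measurable
    show "t < T" using Suc.prems by simp
    fix x assume "x \<in> space \<Omega>"
    show "(\<integral>\<^sup>+y. ennreal (pairdist \<gamma> \<gamma>' c (x(t := y)) (Suc t)) \<partial>gauss_vec n)
      \<le> ennreal (J * ((1 + \<theta>) * pairdist \<gamma> \<gamma>' c x t + e * (2 * (3 * c * \<tau>) + 2 * ?N x / \<beta>\<^sup>2)))"
    proof (cases "good_before \<gamma> c x (Suc t) \<and> good_before \<gamma>' c x (Suc t)")
      case False
      then have "pairdist \<gamma> \<gamma>' c (x(t := y)) (Suc t) = 0" for y
        unfolding pairdist_def good_before_upd[OF order_refl] by (rule if_not_P)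
      then show ?thesis by simp
    next
      case True
      then have gt: "good_before \<gamma> c x t" "\<And>p. p < m \<Longrightarrow> absact (rho (traj \<gamma> x t)) p \<le> c"
        "good_before \<gamma>' c x t" "\<And>p. p < m \<Longrightarrow> absact (rho (traj \<gamma>' x t)) p \<le> c"
        unfolding good_before_def good_def by auto
      let ?U = "traj \<gamma> x t" and ?U' = "traj \<gamma>' x t"
      define D where "D = bdist ?U ?U'"
      define N where "N = bil ?U' ?U'"
      have D0: "0 \<le> D" "0 \<le> N" unfolding D_def N_def by (rule bil_nonneg)+
      have D: "pairdist \<gamma> \<gamma>' c x t = D" unfolding pairdist_def D_def using gt by simp
      have N: "?N x = N" unfolding N_def using gt by simp
      let ?h1 = "\<lambda>y. bdist (samp ?U y) (samp ?U' y)"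
      let ?h2 = "\<lambda>y. bil (samp ?U' y) (samp ?U' y)"
      show ?thesis unfolding D N
      proof (rule nn_mean_le[where I = "{0::nat, 1, 2}" and w = "\<lambda>i. if i = 0 then J * (D + e * (2 * N / \<beta>\<^sup>2)) else if i = 1 then J * (\<gamma>\<^sup>2 / \<theta>) else J * (e * 2)"
            and B = "\<lambda>i. if i = 0 then 1 else if i = 1 then 6 * c\<^sup>2 * D else 3 * c * \<tau>"
            and h = "\<lambda>i y. if i = 0 then 1 else if i = 1 then ?h1 y else ?h2 y"])
        fix i assume "i \<in> {0::nat, 1, 2}"
        show "(\<lambda>y. if i = 0 then 1 else if i = 1 then ?h1 y else ?h2 y) \<in> borel_measurable (gauss_vec n)"
          using samp_bil_measurable[of ?U'] samp_diff_bil_measurable[of ?U ?U']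
          by (cases "i = 0"; cases "i = 1") (simp_all only: numeral_if borel_measurable_const)
        show "(\<integral>\<^sup>+y. ennreal (if i = 0 then 1 else if i = 1 then ?h1 y else ?h2 y) \<partial>gauss_vec n)
           \<le> ennreal (if i = 0 then 1 else if i = 1 then 6 * c\<^sup>2 * D else 3 * c * \<tau>)"
        proof -
          consider "i = 0" | "i \<noteq> 0" "i = 1" | "i \<noteq> 0" "i \<noteq> 1" by blast
          then show ?thesis
          proof cases
            case 1
            then show ?thesis using nn_one_gauss by (simp only: numeral_if)
          next
            case 2
            then show ?thesis using nn_samp_diff_bil[OF gt(2) gt(4) c] unfolding D_def
              by (simp only: numeral_if)
          next
            case 3
            then show ?thesis using nn_samp_bil[OF traj_in_K[OF g'] gt(4) c] by (simp only: numeral_if)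
          qed
        qed
      next
        fix y
        have "pairdist \<gamma> \<gamma>' c (x(t := y)) (Suc t)
          = bil (\<lambda>p. ((1 - \<gamma> / \<beta>) * ?U p + \<gamma> * samp ?U y p) - ((1 - \<gamma>' / \<beta>) * ?U' p + \<gamma>' * samp ?U' y p))
            (\<lambda>p. ((1 - \<gamma> / \<beta>) * ?U p + \<gamma> * samp ?U y p) - ((1 - \<gamma>' / \<beta>) * ?U' p + \<gamma>' * samp ?U' y p))"
          unfolding pairdist_def good_before_upd[OF order_refl] if_P[OF True] traj.simps traj_upd[OF order_refl] fun_upd_same ..
        also have "\<dots> \<le> J * (D + \<gamma>\<^sup>2 / \<theta> * ?h1 y + e * (2 * ?h2 y + 2 * N / \<beta>\<^sup>2))"
          unfolding D_def N_def e_def J_def by (rule traj_diff_step[OF g \<theta> \<iota>])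
        also have "\<dots> = (\<Sum>i\<in>{0::nat, 1, 2}. (if i = 0 then J * (D + e * (2 * N / \<beta>\<^sup>2)) else if i = 1 then J * (\<gamma>\<^sup>2 / \<theta>) else J * (e * 2)) * (if i = 0 then 1 else if i = 1 then ?h1 y else ?h2 y))"
          by (simp add: algebra_simps)
        finally show "pairdist \<gamma> \<gamma>' c (x(t := y)) (Suc t) \<le> (\<Sum>i\<in>{0::nat, 1, 2}. (if i = 0 then J * (D + e * (2 * N / \<beta>\<^sup>2)) else if i = 1 then J * (\<gamma>\<^sup>2 / \<theta>) else J * (e * 2)) * (if i = 0 then 1 else if i = 1 then ?h1 y else ?h2 y))" .
      next
        have "(\<Sum>i\<in>{0::nat, 1, 2}. (if i = 0 then J * (D + e * (2 * N / \<beta>\<^sup>2)) else if i = 1 then J * (\<gamma>\<^sup>2 / \<theta>) else J * (e * 2)) * (if i = 0 then 1 else if i = 1 then 6 * c\<^sup>2 * D else 3 * c * \<tau>))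
          = J * (D + (\<gamma>\<^sup>2 / \<theta> * (6 * c\<^sup>2)) * D + e * (2 * (3 * c * \<tau>) + 2 * N / \<beta>\<^sup>2))"
          by (simp add: algebra_simps)
        also have "\<dots> \<le> J * (D + \<theta> * D + e * (2 * (3 * c * \<tau>) + 2 * N / \<beta>\<^sup>2))"
          using gcq D0 J1 by (intro mult_left_mono add_mono mult_right_mono order_refl) auto
        finally show "(\<Sum>i\<in>{0::nat, 1, 2}. (if i = 0 then J * (D + e * (2 * N / \<beta>\<^sup>2)) else if i = 1 then J * (\<gamma>\<^sup>2 / \<theta>) else J * (e * 2)) * (if i = 0 then 1 else if i = 1 then 6 * c\<^sup>2 * D else 3 * c * \<tau>))
          \<le> J * ((1 + \<theta>) * D + e * (2 * (3 * c * \<tau>) + 2 * N / \<beta>\<^sup>2))" by (simp add: distrib_right)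
      qed (use D0 J1 e0 c \<tau>1 \<theta> in \<open>auto simp: bil_nonneg\<close>)
    qed
  qed
  also have "\<dots> \<le> ennreal (J * ((1 + \<theta>) * B + e * (12 * c * \<tau>)))"
  proof (rule nn_mean_le[where I = "{0::nat, 1, 2}" and w = "\<lambda>i. if i = 0 then J * (1 + \<theta>) else if i = 1 then J * e * (2 * (3 * c * \<tau>)) else J * e * 2 / \<beta>\<^sup>2"
       and B = "\<lambda>i. if i = 0 then B else if i = 1 then 1 else 3 * c * \<tau> * \<beta>\<^sup>2" and h = "\<lambda>i x. if i = 0 then pairdist \<gamma> \<gamma>' c x t else if i = 1 then 1 else ?N x"])
    fix i assume "i \<in> {0::nat, 1, 2}"
    show "(\<integral>\<^sup>+x. ennreal (if i = 0 then pairdist \<gamma> \<gamma>' c x t else if i = 1 then 1 else ?N x) \<partial>\<Omega>) \<le> ennreal (if i = 0 then B else if i = 1 then 1 else 3 * c * \<tau> * \<beta>\<^sup>2)"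
    proof -
      consider "i = 0" | "i \<noteq> 0" "i = 1" | "i \<noteq> 0" "i \<noteq> 1" by blast
      then show ?thesis
      proof cases
        case 1
        then show ?thesis using IH by (simp only: numeral_if)
      next
        case 2
        then show ?thesis using nn_one_\<Omega> by (simp only: numeral_if)
      next
        case 3
        have "t \<le> T" using Suc.prems by simp
        then show ?thesis using 3 traj_second_moment[OF g' c, of t] by (simp only: numeral_if)
      qed
    qed
    have "?N \<in> borel_measurable \<Omega>" using Suc.prems
      by (intro measurable_If bil_measurable traj_measurable good_before_sets) auto
    then show "(\<lambda>x. if i = 0 then pairdist \<gamma> \<gamma>' c x t else if i = 1 then 1 else ?N x) \<in> borel_measurable \<Omega>"
      using pairdist_measurable[of t \<gamma> \<gamma>' c] Suc.prems
      by (cases "i = 0"; cases "i = 1") (simp_all only: numeral_if borel_measurable_const)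
  qed (use J1 e0 \<theta> c \<tau>1 B0 \<beta>0 in \<open>auto simp: bil_nonneg pairdist_nonneg algebra_simps\<close>)
  also have "\<dots> \<le> ennreal (real (Suc t) * (12 * c * \<tau> * e) * q ^ Suc t)"
  proof (rule ennreal_leI)
    have "J * (e * (12 * c * \<tau>)) \<le> q ^ Suc t * (e * (12 * c * \<tau>))"
      using qJ q1 e0 c \<tau>1 by (intro mult_right_mono order_trans[OF qJ] self_le_power) auto
    moreover have "J * ((1 + \<theta>) * B) = real t * (12 * c * \<tau> * e) * q ^ Suc t" by (simp add: B_def q_def mult_ac)
    ultimately show "J * ((1 + \<theta>) * B + e * (12 * c * \<tau>)) \<le> real (Suc t) * (12 * c * \<tau> * e) * q ^ Suc t"
      by (simp add: algebra_simps)
  qed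
  finally show ?case unfolding e_def q_def J_def \<theta>_def \<iota>_def by (simp add: mult_ac)
qed

end


lemma nn_markov:
  assumes f: "f \<in> borel_measurable M" and B: "(\<integral>\<^sup>+x. ennreal (f x) \<partial>M) \<le> ennreal B" and b: "0 < b"
    and S: "\<And>x. x \<in> S \<Longrightarrow> x \<in> space M \<and> b \<le> f x"
  shows "emeasure M S \<le> ennreal (B / b)"
proof -
  have "(\<lambda>x. ennreal (f x) * indicator (space M) x) \<in> borel_measurable M" using f by measurable
  then have "emeasure M {x \<in> space M. 1 \<le> ennreal (1 / b) * ennreal (f x)}
      \<le> ennreal (1 / b) * (\<integral>\<^sup>+x. ennreal (f x) * indicator (space M) x \<partial>M)"
    by (rule nn_integral_Markov_inequality) simp
  also have "(\<integral>\<^sup>+x. ennreal (f x) * indicator (space M) x \<partial>M) = (\<integral>\<^sup>+x. ennreal (f x) \<partial>M)"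
    by (intro nn_integral_cong) simp
  also have "ennreal (1 / b) * \<dots> \<le> ennreal (1 / b) * ennreal B" using B by (rule mult_left_mono) simp
  also have "\<dots> = ennreal (B / b)" using b by (simp flip: ennreal_mult')
  finally have "emeasure M {x \<in> space M. 1 \<le> ennreal (1 / b) * ennreal (f x)} \<le> ennreal (B / b)" .
  moreover have "emeasure M S \<le> emeasure M {x \<in> space M. 1 \<le> ennreal (1 / b) * ennreal (f x)}"
  proof (rule emeasure_mono)
    show "S \<subseteq> {x \<in> space M. 1 \<le> ennreal (1 / b) * ennreal (f x)}"
    proof
      fix x assume "x \<in> S"
      then have x: "x \<in> space M" "b \<le> f x" using S by auto
      then have "1 \<le> (1 / b) * f x" using b by (simp add: field_simps)
      then have "1 \<le> ennreal (1 / b) * ennreal (f x)" using b by (simp flip: ennreal_mult')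
      then show "x \<in> {x \<in> space M. 1 \<le> ennreal (1 / b) * ennreal (f x)}" using x by simp
    qed
    show "{x \<in> space M. 1 \<le> ennreal (1 / b) * ennreal (f x)} \<in> sets M" using f by measurable
  qed
  ultimately show ?thesis by (rule order_trans[rotated])
qed

context sampled_dynamics begin

definition step_excess :: "real \<Rightarrow> field \<Rightarrow> real \<Rightarrow> (nat \<Rightarrow> field) \<Rightarrow> nat \<Rightarrow> real" where
  "step_excess \<kappa> rs \<gamma> x t = excess \<kappa> rs (rho (traj \<gamma> x t)) (samp (traj \<gamma> x t) (x t))"

text \<open>Dropping the steps that are not good gives a process to which the one-step exponential bound applies
  unconditionally.\<close>

definition good_excess :: "real \<Rightarrow> field \<Rightarrow> real \<Rightarrow> real \<Rightarrow> (nat \<Rightarrow> field) \<Rightarrow> nat \<Rightarrow> real" where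
  "good_excess \<kappa> rs \<gamma> c x t = (if good \<gamma> c x t then step_excess \<kappa> rs \<gamma> x t else 0)"

lemma step_excess_measurable: "t < T \<Longrightarrow> (\<lambda>x. step_excess \<kappa> rs \<gamma> x t) \<in> borel_measurable \<Omega>"
proof -
  assume t: "t < T"
  have r: "(\<lambda>x. rho (traj \<gamma> x t) p) \<in> borel_measurable \<Omega>" if "p < m" for p
    using t that by (intro rho_measurable traj_measurable) auto
  have s: "(\<lambda>x. samp (traj \<gamma> x t) (x t) p) \<in> borel_measurable \<Omega>" if "p < m" for p
    using t that by (intro samp_measurable traj_measurable \<Omega>_entry) auto
  show ?thesis unfolding step_excess_def excess_def
    by (intro borel_measurable_add borel_measurable_diff borel_measurable_divide borel_measurable_min
        borel_measurable_times borel_measurable_const bil_measurable r s)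
qed

lemma good_excess_measurable: "t < T \<Longrightarrow> (\<lambda>x. good_excess \<kappa> rs \<gamma> c x t) \<in> borel_measurable \<Omega>"
  unfolding good_excess_def by (intro measurable_If step_excess_measurable good_sets) auto

lemma good_excess_upd: "t < s \<Longrightarrow> good_excess \<kappa> rs \<gamma> c (x(s := y)) t = good_excess \<kappa> rs \<gamma> c x t"
  unfolding good_excess_def step_excess_def by (simp add: good_upd traj_upd)

lemma nn_exp_good_excess:
  assumes g: "0 \<le> \<gamma>" "\<gamma> \<le> \<beta>" and c: "0 \<le> c" and \<kappa>: "0 \<le> \<kappa>" and L: "0 \<le> L" "16 * L * (c * \<tau>) \<le> 1"
    and rs: "\<And>p. p < m \<Longrightarrow> 0 \<le> rs p" "\<And>p. p < m \<Longrightarrow> absact rs p \<le> c"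
  shows "t \<le> T \<Longrightarrow> (\<integral>\<^sup>+x. ennreal (exp (\<Sum>s<t. L * good_excess \<kappa> rs \<gamma> c x s - 22 * L * \<kappa> * (c * \<tau>))) \<partial>\<Omega>) \<le> 1"
proof (induction t)
  case 0
  then show ?case using prob_space.emeasure_space_1[OF prob_space_\<Omega>] by simp
next
  case (Suc t)
  let ?f = "\<lambda>x s. L * good_excess \<kappa> rs \<gamma> c x s - 22 * L * \<kappa> * (c * \<tau>)"
  let ?W = "\<lambda>x t. (\<Sum>s<t. ?f x s)"
  have meas: "(\<lambda>x. ?W x t') \<in> borel_measurable \<Omega>" if "t' \<le> T" for t'
    using that by (intro borel_measurable_sum borel_measurable_diff borel_measurable_times good_excess_measurable) auto
  have "(\<integral>\<^sup>+x. ennreal (exp (?W x (Suc t))) \<partial>\<Omega>) \<le> (\<integral>\<^sup>+x. ennreal (exp (?W x t)) \<partial>\<Omega>)"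
  proof (rule resample_le[where t = t])
    show "(\<lambda>x. ennreal (exp (?W x (Suc t)))) \<in> borel_measurable \<Omega>" using meas[OF Suc.prems] by measurable
    show "t < T" using Suc.prems by simp
    fix x assume "x \<in> space \<Omega>"
    let ?U = "traj \<gamma> x t"
    have W: "?W (x(t := y)) (Suc t) = ?W x t + ?f (x(t := y)) t" for y
      by (simp add: good_excess_upd)
    have pos: "1 \<le> exp (22 * L * \<kappa> * (c * \<tau>))" using L \<kappa> c \<tau>1 by simp
    have one: "(\<integral>\<^sup>+y. ennreal (exp (L * good_excess \<kappa> rs \<gamma> c (x(t := y)) t)) \<partial>gauss_vec n) \<le> ennreal (exp (22 * L * \<kappa> * (c * \<tau>)))"
    proof (cases "good \<gamma> c x t")
      case False
      then show ?thesis using pos prob_space.emeasure_space_1[OF prob_space_gauss_vec[of n]]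
        by (simp add: good_excess_def good_upd)
    next
      case True
      then have gt: "\<And>p. p < m \<Longrightarrow> absact (rho ?U) p \<le> c" unfolding good_def by auto
      have "(\<integral>\<^sup>+z. ennreal (exp (L * excess \<kappa> rs (\<lambda>p. sqn n (a ?U p)) (\<lambda>p. (dotp n (a ?U p) z)\<^sup>2))) \<partial>gauss_vec n)
        \<le> ennreal (exp (22 * L * \<kappa> * (c * \<tau>)))"
        by (rule nn_excess_exp[OF n0 m0]) (use gt rs K_trace[OF traj_in_K[OF g]] L \<kappa> c in \<open>auto simp: rho_def[abs_def]\<close>)
      then show ?thesis using True
        by (simp add: good_excess_def good_upd step_excess_def traj_upd rho_def[abs_def] samp_def[abs_def])
    qed
    have gm: "(\<lambda>y. good_excess \<kappa> rs \<gamma> c (x(t := y)) t) \<in> borel_measurable (gauss_vec n)"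
    proof (cases "good \<gamma> c x t")
      case True
      have "(\<lambda>y. excess \<kappa> rs (rho ?U) (samp ?U y)) \<in> borel_measurable (gauss_vec n)"
        unfolding excess_def
        by (intro borel_measurable_add borel_measurable_diff borel_measurable_divide borel_measurable_min
            borel_measurable_times borel_measurable_const bil_measurable samp_entry_measurable)
      moreover have "(\<lambda>y. good_excess \<kappa> rs \<gamma> c (x(t := y)) t) = (\<lambda>y. excess \<kappa> rs (rho ?U) (samp ?U y))"
        using True by (simp add: good_excess_def good_upd step_excess_def traj_upd)
      ultimately show ?thesis by (simp only:)
    next
      case False
      then have "(\<lambda>y. good_excess \<kappa> rs \<gamma> c (x(t := y)) t) = (\<lambda>y. 0)"
        by (simp add: good_excess_def good_upd)
      then show ?thesis by (simp only: borel_measurable_const)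
    qed
    have "(\<integral>\<^sup>+y. ennreal (exp (?W (x(t := y)) (Suc t))) \<partial>gauss_vec n)
      = (\<integral>\<^sup>+y. ennreal (exp (?W x t - 22 * L * \<kappa> * (c * \<tau>))) * ennreal (exp (L * good_excess \<kappa> rs \<gamma> c (x(t := y)) t)) \<partial>gauss_vec n)"
    proof (intro nn_integral_cong)
      fix y
      have "exp (?W (x(t := y)) (Suc t)) = exp (?W x t - 22 * L * \<kappa> * (c * \<tau>)) * exp (L * good_excess \<kappa> rs \<gamma> c (x(t := y)) t)"
        unfolding W by (simp flip: exp_add)
      then show "ennreal (exp (?W (x(t := y)) (Suc t))) = ennreal (exp (?W x t - 22 * L * \<kappa> * (c * \<tau>))) * ennreal (exp (L * good_excess \<kappa> rs \<gamma> c (x(t := y)) t))"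
        by (simp add: ennreal_mult)
    qed
    also have "\<dots> = ennreal (exp (?W x t - 22 * L * \<kappa> * (c * \<tau>))) * (\<integral>\<^sup>+y. ennreal (exp (L * good_excess \<kappa> rs \<gamma> c (x(t := y)) t)) \<partial>gauss_vec n)"
    proof (rule nn_integral_cmult)
      have "(\<lambda>r. ennreal (exp (L * r))) \<in> borel_measurable borel" by measurable
      from measurable_compose[OF gm this]
      show "(\<lambda>y. ennreal (exp (L * good_excess \<kappa> rs \<gamma> c (x(t := y)) t))) \<in> borel_measurable (gauss_vec n)" .
    qed
    also have "\<dots> \<le> ennreal (exp (?W x t - 22 * L * \<kappa> * (c * \<tau>))) * ennreal (exp (22 * L * \<kappa> * (c * \<tau>)))"
      using one by (rule mult_left_mono) simp
    also have "\<dots> = ennreal (exp (?W x t))" by (simp add: exp_diff flip: ennreal_mult)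
    finally show "(\<integral>\<^sup>+y. ennreal (exp (?W (x(t := y)) (Suc t))) \<partial>gauss_vec n) \<le> ennreal (exp (?W x t))" .
  qed
  also have "\<dots> \<le> 1" using Suc by simp
  finally show ?case .
qed

text \<open>Markov's inequality for the supermartingale at \<open>L = 1/(16 c \<tau>)\<close>.\<close>

lemma good_excess_tail:
  assumes g: "0 \<le> \<gamma>" "\<gamma> \<le> \<beta>" and c: "0 < c" and \<kappa>: "0 \<le> \<kappa>" and p: "0 < p"
    and rs: "\<And>p. p < m \<Longrightarrow> 0 \<le> rs p" "\<And>p. p < m \<Longrightarrow> absact rs p \<le> c"
  shows "emeasure \<Omega> {x \<in> space \<Omega>. 22 * \<kappa> * (c * \<tau>) * real T + 16 * (c * \<tau>) * ln (1 / p) \<le> (\<Sum>s<T. good_excess \<kappa> rs \<gamma> c x s)} \<le> ennreal p"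
proof -
  define L where "L = 1 / (16 * (c * \<tau>))"
  have ct: "0 < c * \<tau>" using c \<tau>1 by simp
  have L: "0 < L" "16 * L * (c * \<tau>) = 1" using ct by (auto simp: L_def)
  let ?W = "\<lambda>x. \<Sum>s<T. L * good_excess \<kappa> rs \<gamma> c x s - 22 * L * \<kappa> * (c * \<tau>)"
  have meas: "?W \<in> borel_measurable \<Omega>"
    by (intro borel_measurable_sum borel_measurable_diff borel_measurable_times good_excess_measurable) auto
  have i1: "(\<integral>\<^sup>+x. ennreal (exp (?W x)) \<partial>\<Omega>) \<le> ennreal 1"
    using nn_exp_good_excess[OF g _ \<kappa> _ _ rs, of L T] c L by simp
  have i2: "(\<lambda>x. exp (?W x)) \<in> borel_measurable \<Omega>" by (rule measurable_compose[OF meas borel_measurable_exp]) 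
  have i3: "x \<in> space \<Omega> \<and> 1 / p \<le> exp (?W x)"
    if "x \<in> {x \<in> space \<Omega>. 22 * \<kappa> * (c * \<tau>) * real T + 16 * (c * \<tau>) * ln (1 / p) \<le> (\<Sum>s<T. good_excess \<kappa> rs \<gamma> c x s)}" for x
  proof -
    have x: "x \<in> space \<Omega>" and le: "22 * \<kappa> * (c * \<tau>) * real T + 16 * (c * \<tau>) * ln (1 / p) \<le> (\<Sum>s<T. good_excess \<kappa> rs \<gamma> c x s)"
      using that by auto
    have "L * (22 * \<kappa> * (c * \<tau>) * real T + 16 * (c * \<tau>) * ln (1 / p)) \<le> L * (\<Sum>s<T. good_excess \<kappa> rs \<gamma> c x s)"
      using le L by (intro mult_left_mono) auto
    moreover have "L * (22 * \<kappa> * (c * \<tau>) * real T + 16 * (c * \<tau>) * ln (1 / p)) = 22 * L * \<kappa> * (c * \<tau>) * real T + (16 * L * (c * \<tau>)) * ln (1 / p)"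
      by (simp add: algebra_simps)
    ultimately have "ln (1 / p) \<le> ?W x" unfolding L(2) by (simp add: sum_subtractf sum_distrib_left mult_ac)
    then have "exp (ln (1 / p)) \<le> exp (?W x)" by simp
    then show ?thesis using p x by simp
  qed
  have "emeasure \<Omega> {x \<in> space \<Omega>. 22 * \<kappa> * (c * \<tau>) * real T + 16 * (c * \<tau>) * ln (1 / p) \<le> (\<Sum>s<T. good_excess \<kappa> rs \<gamma> c x s)} \<le> ennreal (1 / (1 / p))"
    by (rule nn_markov[OF i2 i1 _ i3]) (use p in auto)
  then show ?thesis by simp
qed

lemma sum_sq_norm_tail:
  assumes "0 < p"
  shows "emeasure \<Omega> {x \<in> space \<Omega>. real n * real T / p \<le> (\<Sum>t<T. sqn n (x t))} \<le> ennreal p"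
proof -
  have one: "(\<integral>\<^sup>+x. ennreal ((x t i)\<^sup>2) \<partial>\<Omega>) \<le> ennreal 1" if "t < T" "i < n" for t i
  proof -
    have "(\<integral>\<^sup>+x. ennreal ((x t i)\<^sup>2) \<partial>\<Omega>) \<le> (\<integral>\<^sup>+x. ennreal 1 \<partial>\<Omega>)"
    proof (rule resample_le[OF _ that(1)])
      show "(\<lambda>x. ennreal ((x t i)\<^sup>2)) \<in> borel_measurable \<Omega>" using \<Omega>_entry[OF that] by measurable
      fix x :: "nat \<Rightarrow> nat \<Rightarrow> real"
      define e where "e j = (if j = i then 1 else 0 :: real)" for j
      have "(\<Sum>j<n. (e j)\<^sup>2) = (\<Sum>j<n. if j = i then 1 else 0)" unfolding e_def by (intro sum.cong) auto
      then have e1: "(\<Sum>j<n. (e j)\<^sup>2) = 1" using that by simp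
      have "dotp n e y = (\<Sum>j<n. if j = i then y j else 0)" for y unfolding dotp_def e_def by (intro sum.cong) auto
      then have "dotp n e y = y i" for y using that by simp
      then show "(\<integral>\<^sup>+y. ennreal (((x(t := y)) t i)\<^sup>2) \<partial>gauss_vec n) \<le> ennreal 1"
        using nn_dotp_unit_moment(1)[OF e1] by simp
    qed
    then show ?thesis using prob_space.emeasure_space_1[OF prob_space_\<Omega>] by simp
  qed
  let ?S = "\<lambda>x. \<Sum>t<T. \<Sum>i<n. (x t i)\<^sup>2"
  have meas: "?S \<in> borel_measurable \<Omega>" using \<Omega>_entry by (intro borel_measurable_sum borel_measurable_power) auto
  have nT: "0 < real n * real T" using n0 T0 by simp
  have S: "(\<integral>\<^sup>+x. ennreal (?S x) \<partial>\<Omega>) \<le> ennreal (real n * real T)"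
    by (rule nn_mean_le[where I = "{..<T} \<times> {..<n}" and w = "\<lambda>_. 1" and B = "\<lambda>_. 1" and h = "\<lambda>(t, i) x. (x t i)\<^sup>2"])
      (use one \<Omega>_entry in \<open>auto simp: sum.cartesian_product split_beta\<close>)
  have "emeasure \<Omega> {x \<in> space \<Omega>. real n * real T / p \<le> ?S x} \<le> ennreal (real n * real T / (real n * real T / p))"
    by (rule nn_markov[OF meas S]) (use nT assms in auto)
  then show ?thesis using n0 T0 by simp
qed

end


section \<open>Stability of single trajectories\<close>

lemma dotp_sq_le: "(dotp n u z)\<^sup>2 \<le> sqn n u * sqn n z"
  unfolding dotp_def by (rule Cauchy_Schwarz_ineq_sum)

lemma dotp_add: "dotp n (\<lambda>i. u i + v i) z = dotp n u z + dotp n v z"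
  and dotp_diff: "dotp n (\<lambda>i. u i - v i) z = dotp n u z - dotp n v z"
  unfolding dotp_def by (simp_all add: algebra_simps sum.distrib sum_subtractf)

context psd_form begin

lemma excess_lipschitz:
  assumes A: "nrm r \<le> A" "nrm r' \<le> A" "nrm rs \<le> A" and Z: "1 \<le> Z" "nrm rh \<le> Z * A" "nrm rh' \<le> Z * A"
    and e: "ndist r r' \<le> \<epsilon>" "ndist rh rh' \<le> \<epsilon>" and \<kappa>: "0 \<le> \<kappa>"
  shows "excess \<kappa> rs r rh - excess \<kappa> rs r' rh' \<le> 10 * (1 + \<kappa>) * Z * A * \<epsilon>"
proof -
  have A0: "0 \<le> A" using A(1) nrm_nonneg[of r] by linarith
  have e0: "0 \<le> \<epsilon>" using e(1) nrm_nonneg by (rule order_trans[rotated])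
  have ZA: "A \<le> Z * A" using mult_right_mono[OF Z(1) A0] by simp
  have ZA0: "0 \<le> Z * A" using Z A0 by simp
  have cs: "\<bar>bil u v\<bar> \<le> a * b" if "nrm u \<le> a" "nrm v \<le> b" "0 \<le> a" for u v a b
    using bil_CS[of u v] mult_mono[OF that(1,2)] that(3) nrm_nonneg[of v] by linarith
  let ?dr = "\<lambda>p. r p - r' p" and ?dh = "\<lambda>p. rh p - rh' p"
  have r1: "ndist r rs \<le> 2 * A" "ndist r' rs \<le> 2 * A"
    using nrm_diff_le[of r rs] nrm_diff_le[of r' rs] A by linarith+
  have r2: "ndist r' rh' \<le> 2 * (Z * A)" using nrm_diff_le[of r' rh'] A Z ZA by linarith
  have r3: "ndist ?dr ?dh \<le> 2 * \<epsilon>" using nrm_diff_le[of ?dr ?dh] e by linarith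
  have "bil (\<lambda>p. r p - rh p) (\<lambda>p. r p - rs p) - bil (\<lambda>p. r' p - rh' p) (\<lambda>p. r' p - rs p)
    = bil (\<lambda>p. ?dr p - ?dh p) (\<lambda>p. r p - rs p) + bil (\<lambda>p. r' p - rh' p) ?dr"
    by (simp add: bil_lin)
  moreover have "\<bar>bil (\<lambda>p. ?dr p - ?dh p) (\<lambda>p. r p - rs p)\<bar> \<le> 2 * \<epsilon> * (2 * A)" by (rule cs[OF r3 r1(1)]) (use e0 in simp)
  moreover have "\<bar>bil (\<lambda>p. r' p - rh' p) ?dr\<bar> \<le> 2 * (Z * A) * \<epsilon>" by (rule cs[OF r2 e(1)]) (use ZA0 in simp)
  ultimately have t1: "bil (\<lambda>p. r p - rh p) (\<lambda>p. r p - rs p) - bil (\<lambda>p. r' p - rh' p) (\<lambda>p. r' p - rs p)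
    \<le> 4 * (A * \<epsilon>) + 2 * (Z * A * \<epsilon>)" by (simp add: mult_ac)
  have "bdist r' rs - bdist r rs
    = - bil ?dr (\<lambda>p. r p - rs p) - bil (\<lambda>p. r' p - rs p) ?dr"
    by (simp add: bil_lin)
  moreover have "\<bar>bil ?dr (\<lambda>p. r p - rs p)\<bar> \<le> \<epsilon> * (2 * A)" by (rule cs[OF e(1) r1(1) e0])
  moreover have "\<bar>bil (\<lambda>p. r' p - rs p) ?dr\<bar> \<le> 2 * A * \<epsilon>" by (rule cs[OF r1(2) e(1)]) (use A0 in simp)
  ultimately have t2: "bdist r' rs - bdist r rs \<le> 4 * (A * \<epsilon>)"
    by (simp add: mult_ac)
  have "bil rh r - bil rh' r' = bil ?dh r + bil rh' ?dr" by (simp add: bil_lin)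
  moreover have "\<bar>bil ?dh r\<bar> \<le> \<epsilon> * A" by (rule cs[OF e(2) A(1) e0])
  moreover have "\<bar>bil rh' ?dr\<bar> \<le> Z * A * \<epsilon>" by (rule cs[OF Z(3) e(1) ZA0])
  ultimately have t3: "bil rh r - bil rh' r' \<le> A * \<epsilon> + Z * A * \<epsilon>" by (simp add: mult_ac)
  have "bil rh rh - bil rh' rh' = bil ?dh rh + bil rh' ?dh" by (simp add: bil_lin)
  moreover have "\<bar>bil ?dh rh\<bar> \<le> \<epsilon> * (Z * A)" by (rule cs[OF e(2) Z(2) e0])
  moreover have "\<bar>bil rh' ?dh\<bar> \<le> Z * A * \<epsilon>" by (rule cs[OF Z(3) e(2) ZA0])
  ultimately have "bil rh rh - bil rh' rh' \<le> 2 * (Z * A * \<epsilon>)" by (simp add: mult_ac)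
  then have "\<kappa> * (bil rh rh - bil rh' rh') \<le> \<kappa> * (2 * (Z * A * \<epsilon>))" using \<kappa> by (rule mult_left_mono)
  then have t4: "\<kappa> * bil rh rh - \<kappa> * bil rh' rh' \<le> 2 * \<kappa> * (Z * A * \<epsilon>)" by (simp add: algebra_simps)
  have Ae: "A * \<epsilon> \<le> Z * A * \<epsilon>" using ZA e0 by (rule mult_right_mono)
  have ZAe: "0 \<le> Z * A * \<epsilon>" "0 \<le> \<kappa> * (Z * A * \<epsilon>)" using ZA0 e0 \<kappa> by simp_all
  have t5: "min (bil rh r) (\<kappa> * bil rh rh) - min (bil rh' r') (\<kappa> * bil rh' rh') \<le> 2 * (Z * A * \<epsilon>) + 2 * \<kappa> * (Z * A * \<epsilon>)"
    using t3 t4 Ae ZAe by linarith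
  have "excess \<kappa> rs r rh - excess \<kappa> rs r' rh' \<le> 4 * (A * \<epsilon>) + 2 * (Z * A * \<epsilon>) + 2 * (A * \<epsilon>) + (2 * (Z * A * \<epsilon>) + 2 * \<kappa> * (Z * A * \<epsilon>))"
    using t1 t2 t5 unfolding excess_def by linarith
  also have "\<dots> \<le> 10 * (Z * A * \<epsilon>) + 10 * (\<kappa> * (Z * A * \<epsilon>))" using Ae ZAe by linarith
  finally show ?thesis by (simp add: algebra_simps)
qed

end

context sampled_dynamics begin

lemma rho_diff_factor:
  "rho U p - rho U' p = dotp n (\<lambda>i. a U p i + a U' p i) (\<lambda>i. a U p i - a U' p i)"
  unfolding rho_def dotp_def by (simp add: power2_eq_square algebra_simps flip: sum_subtractf)

lemma samp_diff_factor:
  "samp U z p - samp U' z p = dotp n (\<lambda>i. a U p i + a U' p i) z * dotp n (\<lambda>i. a U p i - a U' p i) z"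
  unfolding samp_def dotp_add dotp_diff by (simp add: power2_eq_square algebra_simps)

lemma sum_rows_le: "(\<Sum>i<n. (a U p i + a U' p i)\<^sup>2) \<le> 2 * (rho U p + rho U' p)"
proof -
  have "(\<Sum>i<n. (a U p i + a U' p i)\<^sup>2) \<le> (\<Sum>i<n. 2 * ((a U p i)\<^sup>2 + (a U' p i)\<^sup>2))"
  proof (rule sum_mono)
    fix i show "(a U p i + a U' p i)\<^sup>2 \<le> 2 * ((a U p i)\<^sup>2 + (a U' p i)\<^sup>2)"
      using zero_le_power2[of "a U p i - a U' p i"] by (simp add: power2_eq_square algebra_simps)
  qed
  then show ?thesis unfolding rho_def by (simp add: sum_distrib_left sum.distrib distrib_left)
qed

text \<open>Squares differ by a product of sum and difference; the weighted bound takes the squared sums as weights,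
  whose row sums against \<open>|V|\<close> are at most \<open>4 c\<close>, and the squared differences as masses.\<close>

lemma rho_samp_diff:
  assumes c: "\<And>p. p < m \<Longrightarrow> absact (rho U) p \<le> c" "\<And>p. p < m \<Longrightarrow> absact (rho U') p \<le> c"
    and D: "(\<Sum>p<m. \<Sum>i<n. (a U p i - a U' p i)\<^sup>2) \<le> D" and c0: "0 \<le> c"
  shows "bdist (rho U) (rho U') \<le> 4 * c * D"
    and "sqn n z \<le> Z \<Longrightarrow> bdist (samp U z) (samp U' z) \<le> 4 * c * D * Z\<^sup>2"
proof -
  define d where "d p = (\<Sum>i<n. (a U p i - a U' p i)\<^sup>2)" for p
  have d0: "0 \<le> d p" for p unfolding d_def by (auto intro!: sum_nonneg)
  let ?k = "\<lambda>p. 2 * (rho U p + rho U' p)"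
  have k: "absact ?k p \<le> 4 * c" if "p < m" for p
    using c[OF that] by (simp add: absact_scale absact_add)
  have "bdist (rho U) (rho U') \<le> 4 * c * (\<Sum>p<m. d p)"
  proof (rule bil_weighted_le[of ?k])
    fix p
    have "(rho U p - rho U' p)\<^sup>2 \<le> (\<Sum>i<n. (a U p i + a U' p i)\<^sup>2) * d p"
      unfolding rho_diff_factor d_def by (rule dotp_sq_le)
    also have "\<dots> \<le> ?k p * d p" using sum_rows_le d0 by (rule mult_right_mono)
    finally show "(rho U p - rho U' p)\<^sup>2 \<le> ?k p * d p" .
  qed (use k d0 rho_nonneg in \<open>auto intro: add_nonneg_nonneg\<close>)
  also have "\<dots> \<le> 4 * c * D" using D c0 unfolding d_def by (intro mult_left_mono) auto
  finally show "bdist (rho U) (rho U') \<le> 4 * c * D" .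
  assume Z: "sqn n z \<le> Z"
  have Z0: "0 \<le> Z" using Z by (rule order_trans[rotated]) (auto intro!: sum_nonneg)
  have "bdist (samp U z) (samp U' z) \<le> 4 * c * Z * (\<Sum>p<m. d p * Z)"
  proof (rule bil_weighted_le[of "\<lambda>p. Z * ?k p"])
    fix p
    have "(samp U z p - samp U' z p)\<^sup>2 \<le> ((\<Sum>i<n. (a U p i + a U' p i)\<^sup>2) * sqn n z) * (d p * sqn n z)"
      unfolding samp_diff_factor power_mult_distrib d_def
      by (intro mult_mono dotp_sq_le) (auto intro!: sum_nonneg mult_nonneg_nonneg)
    also have "\<dots> \<le> (?k p * Z) * (d p * Z)"
      using sum_rows_le[of U p U'] d0[of p] Z Z0
      by (intro mult_mono) (auto intro!: sum_nonneg mult_nonneg_nonneg add_nonneg_nonneg rho_nonneg)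
    finally show "(samp U z p - samp U' z p)\<^sup>2 \<le> Z * ?k p * (d p * Z)" by (simp add: mult_ac)
  next
    fix p assume "p < m"
    then have "Z * absact ?k p \<le> Z * (4 * c)" using k Z0 by (intro mult_left_mono) auto
    then show "absact (\<lambda>p. Z * ?k p) p \<le> 4 * c * Z" by (simp only: absact_scale) (simp add: mult_ac)
  qed (use d0 Z0 rho_nonneg in \<open>auto intro: add_nonneg_nonneg\<close>)
  also have "(\<Sum>p<m. d p * Z) = (\<Sum>p<m. d p) * Z" by (rule sum_distrib_right[symmetric])
  also have "4 * c * Z * ((\<Sum>p<m. d p) * Z) = 4 * c * (\<Sum>p<m. d p) * Z\<^sup>2" by (simp add: power2_eq_square mult_ac)
  also have "\<dots> \<le> 4 * c * D * Z\<^sup>2" using D c0 unfolding d_def by (intro mult_right_mono mult_left_mono) auto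
  finally show "bdist (samp U z) (samp U' z) \<le> 4 * c * D * Z\<^sup>2" .
qed

lemma rho_bil_le:
  assumes "\<And>p. p < m \<Longrightarrow> absact (rho U) p \<le> c" "(\<Sum>p<m. rho U p) \<le> t" "0 \<le> c"
  shows "bil (rho U) (rho U) \<le> c * t"
proof -
  have "bil (rho U) (rho U) \<le> c * (\<Sum>p<m. rho U p)"
    by (rule bil_weighted_le[of "rho U"]) (use assms rho_nonneg in \<open>auto simp: power2_eq_square\<close>)
  also have "\<dots> \<le> c * t" using assms by (intro mult_left_mono) auto
  finally show ?thesis .
qed

lemma samp_bil_le:
  assumes c: "\<And>p. p < m \<Longrightarrow> absact (rho U) p \<le> c" and t: "(\<Sum>p<m. rho U p) \<le> t" and c0: "0 \<le> c"
    and Z: "sqn n z \<le> Z"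
  shows "bil (samp U z) (samp U z) \<le> Z\<^sup>2 * (c * t)"
proof -
  have Z0: "0 \<le> Z" using Z by (rule order_trans[rotated]) (auto intro!: sum_nonneg)
  have s: "samp U z p \<le> Z * rho U p" for p
  proof -
    have "samp U z p \<le> rho U p * sqn n z" unfolding samp_def rho_def by (rule dotp_sq_le)
    also have "\<dots> \<le> rho U p * Z" using Z rho_nonneg by (rule mult_left_mono)
    finally show ?thesis by (simp add: mult.commute)
  qed
  have "bil (samp U z) (samp U z) \<le> (Z * c) * (\<Sum>p<m. Z * rho U p)"
  proof (rule bil_weighted_le[of "\<lambda>p. Z * rho U p"])
    fix p
    show "(samp U z p)\<^sup>2 \<le> Z * rho U p * (Z * rho U p)"
      using s[of p] samp_nonneg[of U z p] by (simp add: power2_eq_square mult_mono)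
  next
    fix p assume "p < m"
    then show "absact (\<lambda>p. Z * rho U p) p \<le> Z * c" unfolding absact_scale using c Z0 by (intro mult_left_mono) auto
  qed (use Z0 rho_nonneg in auto)
  also have "\<dots> = Z\<^sup>2 * (c * (\<Sum>p<m. rho U p))" by (simp add: power2_eq_square mult_ac flip: sum_distrib_left)
  also have "\<dots> \<le> Z\<^sup>2 * (c * t)" using t c0 by (intro mult_left_mono) auto
  finally show ?thesis .
qed

lemma absact_rho_crude: "p < m \<Longrightarrow> absact (rho U) p \<le> ch"
proof -
  assume p: "p < m"
  have "absact (rho U) p \<le> absact (\<lambda>_. cpsi) p"
    by (rule absact_mono) (use rho_le in \<open>auto simp: rho_def\<close>)
  also have "\<dots> \<le> cpsi * vinf" using p cpsi_pos by (intro absact_const) auto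
  finally show ?thesis by (simp add: ch_def)
qed

lemma nrm_traj_step_diff:
  assumes g: "0 \<le> \<gamma>" "\<gamma> \<le> \<beta>"
  shows "ndist (traj \<gamma> x (Suc t)) (traj \<gamma>' x (Suc t))
    \<le> ndist (traj \<gamma> x t) (traj \<gamma>' x t)
      + \<gamma> * nrm (\<lambda>p. samp (traj \<gamma> x t) (x t) p - samp (traj \<gamma>' x t) (x t) p)
      + \<bar>\<gamma> - \<gamma>'\<bar> * (nrm (samp (traj \<gamma>' x t) (x t)) + nrm (traj \<gamma>' x t) / \<beta>)"
proof -
  let ?U = "traj \<gamma> x t" and ?U' = "traj \<gamma>' x t"
  let ?s = "samp ?U (x t)" and ?s' = "samp ?U' (x t)"
  let ?d = "\<lambda>p. ?U p - ?U' p" and ?e = "\<lambda>p. ?s p - ?s' p"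
  let ?w = "\<lambda>p. ?s' p - (1 / \<beta>) * ?U' p"
  have f: "(\<lambda>p. traj \<gamma> x (Suc t) p - traj \<gamma>' x (Suc t) p) = (\<lambda>p. ((1 - \<gamma> / \<beta>) * ?d p + \<gamma> * ?e p) + (\<gamma> - \<gamma>') * ?w p)"
    using \<beta>0 by (auto simp: field_simps)
  have "ndist (traj \<gamma> x (Suc t)) (traj \<gamma>' x (Suc t)) \<le> nrm (\<lambda>p. (1 - \<gamma> / \<beta>) * ?d p + \<gamma> * ?e p) + nrm (\<lambda>p. (\<gamma> - \<gamma>') * ?w p)"
    unfolding f by (rule nrm_triangle)
  also have "nrm (\<lambda>p. (1 - \<gamma> / \<beta>) * ?d p + \<gamma> * ?e p) \<le> nrm (\<lambda>p. (1 - \<gamma> / \<beta>) * ?d p) + nrm (\<lambda>p. \<gamma> * ?e p)"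
    by (rule nrm_triangle)
  also have "nrm (\<lambda>p. (1 - \<gamma> / \<beta>) * ?d p) = (1 - \<gamma> / \<beta>) * nrm ?d" unfolding nrm_scale using g \<beta>0 by simp
  also have "nrm (\<lambda>p. \<gamma> * ?e p) = \<gamma> * nrm ?e" unfolding nrm_scale using g by simp
  also have "nrm (\<lambda>p. (\<gamma> - \<gamma>') * ?w p) = \<bar>\<gamma> - \<gamma>'\<bar> * nrm ?w" unfolding nrm_scale ..
  also have "(1 - \<gamma> / \<beta>) * nrm ?d \<le> 1 * nrm ?d" using g \<beta>0 nrm_nonneg by (intro mult_right_mono) auto
  also have "nrm ?w \<le> nrm ?s' + nrm ?U' / \<beta>"
    using nrm_diff_le[of ?s' "\<lambda>p. (1 / \<beta>) * ?U' p"] nrm_scale[of "1 / \<beta>" ?U'] \<beta>0 by simp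
  finally show ?thesis by (simp add: mult_left_mono)
qed

lemma nrm_traj_le:
  assumes g: "0 \<le> \<gamma>" "\<gamma> \<le> \<beta>" and B: "\<And>s. s < t \<Longrightarrow> nrm (samp (traj \<gamma> x s) (x s)) \<le> B"
  shows "nrm (traj \<gamma> x t) \<le> \<gamma> * real t * B"
  using B
proof (induction t)
  case 0
  then show ?case by (simp add: nrm_def bil_zero)
next
  case (Suc t)
  have "nrm (traj \<gamma> x (Suc t)) \<le> nrm (\<lambda>p. (1 - \<gamma> / \<beta>) * traj \<gamma> x t p) + nrm (\<lambda>p. \<gamma> * samp (traj \<gamma> x t) (x t) p)"
    unfolding traj.simps by (rule nrm_triangle)
  also have "\<dots> = (1 - \<gamma> / \<beta>) * nrm (traj \<gamma> x t) + \<gamma> * nrm (samp (traj \<gamma> x t) (x t))"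
    unfolding nrm_scale using g \<beta>0 by simp
  also have "\<dots> \<le> 1 * nrm (traj \<gamma> x t) + \<gamma> * B"
    using g \<beta>0 nrm_nonneg Suc.prems by (intro add_mono mult_right_mono mult_left_mono) auto
  also have "\<dots> \<le> \<gamma> * real (Suc t) * B" using Suc.IH Suc.prems by (simp add: algebra_simps)
  finally show ?case .
qed

abbreviation lip :: "real \<Rightarrow> nat \<Rightarrow> real \<Rightarrow> bool" where
  "lip Z t L \<equiv> \<forall>x \<gamma> \<gamma>'. (\<forall>s<T. sqn n (x s) \<le> Z) \<longrightarrow> 0 \<le> \<gamma> \<longrightarrow> \<gamma> \<le> \<beta> \<longrightarrow> 0 \<le> \<gamma>' \<longrightarrow> \<gamma>' \<le> \<beta>
    \<longrightarrow> ndist (traj \<gamma> x t) (traj \<gamma>' x t) \<le> L * \<bar>\<gamma> - \<gamma>'\<bar>"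

text \<open>For a fixed sample the trajectories depend on the step size in a Lipschitz way. The constant
  is far too large for a union bound, but finite.\<close>

lemma traj_lipschitz_crude:
  assumes Z: "0 \<le> Z"
  shows "\<exists>L\<ge>0. \<forall>t\<le>T. lip Z t L"
proof -
  define S where "S = sqrt (Z\<^sup>2 * (ch * \<tau>))"
  define H where "H = sqrt 2 * ch * Z"
  define M where "M = S + real T * S"
  have S0: "0 \<le> S" and H0: "0 \<le> H" unfolding S_def H_def using ch_nonneg Z \<tau>1 by auto
  have M0: "0 \<le> M" unfolding M_def using S0 by simp
  have "\<exists>L\<ge>0. lip Z t L" if "t \<le> T" for t
    using that
  proof (induction t)
    case 0
    have "nrm (\<lambda>p. traj \<gamma> x 0 p - traj \<gamma>' x 0 p) = 0" for x \<gamma> \<gamma>' by (simp add: nrm_def bil_zero)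
    then show ?case by (intro exI[of _ 0]) (simp del: traj.simps)
  next
    case (Suc t)
    then obtain L where L: "0 \<le> L" "\<And>x \<gamma> \<gamma>'. (\<forall>s<T. sqn n (x s) \<le> Z) \<Longrightarrow> 0 \<le> \<gamma> \<Longrightarrow> \<gamma> \<le> \<beta> \<Longrightarrow> 0 \<le> \<gamma>' \<Longrightarrow> \<gamma>' \<le> \<beta>
      \<Longrightarrow> ndist (traj \<gamma> x t) (traj \<gamma>' x t) \<le> L * \<bar>\<gamma> - \<gamma>'\<bar>" by auto
    show ?case
    proof (intro exI[of _ "L + \<beta> * (H * L) + M"] conjI allI impI)
      show "0 \<le> L + \<beta> * (H * L) + M" using L H0 M0 \<beta>0 by simp
      fix x \<gamma> \<gamma>'
      assume x: "\<forall>s<T. sqn n (x s) \<le> Z" and g: "0 \<le> \<gamma>" "\<gamma> \<le> \<beta>" and g': "0 \<le> \<gamma>'" "\<gamma>' \<le> \<beta>"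
      let ?U = "traj \<gamma> x t" and ?U' = "traj \<gamma>' x t"
      have tT: "t < T" using Suc.prems by simp
      have sle: "nrm (samp (traj \<gamma>' x s) (x s)) \<le> S" if "s < T" for s
        unfolding nrm_def S_def
        by (intro real_sqrt_le_mono samp_bil_le absact_rho_crude rho_sum_le traj_in_K g' ch_nonneg) (use x that in auto)
      have "nrm ?U' / \<beta> \<le> (\<gamma>' * real t * S) / \<beta>"
        using nrm_traj_le[OF g', of t x S] sle tT \<beta>0 by (intro divide_right_mono) auto
      also have "\<dots> = (\<gamma>' / \<beta>) * (real t * S)" by simp
      also have "\<dots> \<le> 1 * (real T * S)" using g' \<beta>0 S0 tT by (intro mult_mono mult_right_mono) auto
      finally have U': "nrm (samp ?U' (x t)) + nrm ?U' / \<beta> \<le> M" unfolding M_def using sle[OF tT] by simp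
      have "bdist (samp ?U (x t)) (samp ?U' (x t))
        \<le> 4 * ch * (ch / 2 * bdist ?U ?U') * Z\<^sup>2"
        by (rule rho_samp_diff(2)[OF absact_rho_crude absact_rho_crude a_diff_crude ch_nonneg]) (use x tT in auto)
      also have "\<dots> = H\<^sup>2 * bdist ?U ?U'"
        unfolding H_def by (simp add: power_mult_distrib power2_eq_square mult_ac)
      finally have "ndist (samp ?U (x t)) (samp ?U' (x t)) \<le> sqrt (H\<^sup>2 * bdist ?U ?U')"
        unfolding nrm_def by (rule real_sqrt_le_mono)
      also have "\<dots> = H * ndist ?U ?U'" unfolding nrm_def using H0 by (simp add: real_sqrt_mult)
      also have "\<dots> \<le> H * (L * \<bar>\<gamma> - \<gamma>'\<bar>)" using L(2)[OF x g g'] H0 by (rule mult_left_mono)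
      finally have s: "\<gamma> * ndist (samp ?U (x t)) (samp ?U' (x t)) \<le> \<beta> * (H * (L * \<bar>\<gamma> - \<gamma>'\<bar>))"
        using g nrm_nonneg \<beta>0 by (intro mult_mono) auto
      have "\<bar>\<gamma> - \<gamma>'\<bar> * (nrm (samp ?U' (x t)) + nrm ?U' / \<beta>) \<le> \<bar>\<gamma> - \<gamma>'\<bar> * M"
        using U' by (rule mult_left_mono) simp
      then show "ndist (traj \<gamma> x (Suc t)) (traj \<gamma>' x (Suc t)) \<le> (L + \<beta> * (H * L) + M) * \<bar>\<gamma> - \<gamma>'\<bar>"
        using nrm_traj_step_diff[OF g, of x t \<gamma>'] s L(2)[OF x g g'] by (simp add: algebra_simps del: traj.simps)
    qed
  qed
  then have "\<forall>t\<in>{..T}. \<exists>L. 0 \<le> L \<and> lip Z t L" by blast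
  from bchoice[OF this] obtain L where L': "\<forall>t\<in>{..T}. 0 \<le> L t \<and> lip Z t (L t)" ..
  note L = bspec[OF L', unfolded atMost_iff]
  show ?thesis
  proof (intro exI[of _ "\<Sum>t\<le>T. L t"] conjI allI impI)
    show "0 \<le> (\<Sum>t\<le>T. L t)" using L by (intro sum_nonneg) auto
    fix t x \<gamma> \<gamma>'
    assume t: "t \<le> T" and A: "\<forall>s<T. sqn n (x s) \<le> Z" "0 \<le> \<gamma>" "\<gamma> \<le> \<beta>" "0 \<le> \<gamma>'" "\<gamma>' \<le> \<beta>"
    have "ndist (traj \<gamma> x t) (traj \<gamma>' x t) \<le> L t * \<bar>\<gamma> - \<gamma>'\<bar>" using L[OF t] A by blast
    also have "\<dots> \<le> (\<Sum>t\<le>T. L t) * \<bar>\<gamma> - \<gamma>'\<bar>" using t L by (intro mult_right_mono member_le_sum) auto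
    finally show "ndist (traj \<gamma> x t) (traj \<gamma>' x t) \<le> (\<Sum>t\<le>T. L t) * \<bar>\<gamma> - \<gamma>'\<bar>" .
  qed
qed

text \<open>When the scale \<open>c\<close> is tiny the iterates barely move and the excess is negligible for every
  sample of moderate size.\<close>

lemma small_scale_excess:
  assumes g: "0 \<le> \<gamma>" "\<gamma> \<le> \<beta>" and gc: "\<gamma> * c \<le> \<kappa>" and \<kappa>: "0 \<le> \<kappa>" "\<kappa>\<^sup>2 * real T \<le> \<beta> * c" and c: "0 < c" and t: "t < T"
    and Z: "1 \<le> Z" "real T \<le> Z" "\<And>s. s < T \<Longrightarrow> (sqn n (x s)) \<le> Z" and sm: "\<beta> * c \<le> 1 / Z ^ 8"
    and good: "\<And>s. s < T \<Longrightarrow> good \<gamma> c x s"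
    and rs: "bil rs rs \<le> c * \<tau>" "bdist rs (rho (\<lambda>_. 0)) \<le> 16 * (\<beta> * c)\<^sup>2 * (c * \<tau>)"
  shows "step_excess \<kappa> rs \<gamma> x t \<le> 13 * (c * \<tau>) / real T"
proof -
  let ?U = "traj \<gamma> x t"
  let ?r = "rho ?U" and ?h = "samp ?U (x t)" and ?rz = "rho (\<lambda>_. 0)"
  define A where "A = sqrt (c * \<tau>)"
  have A0: "0 \<le> A" and A2: "A * A = c * \<tau>" unfolding A_def using c \<tau>1 by auto
  have gd: "\<And>s p. s < T \<Longrightarrow> p < m \<Longrightarrow> absact (rho (traj \<gamma> x s)) p \<le> c" using good unfolding good_def by auto
  have T1: "1 \<le> real T" using T0 by simp
  define q where "q = sqrt (\<beta> * c)"
  have q0: "0 \<le> q" and q2: "q * q = \<beta> * c" unfolding q_def using \<beta>0 c by auto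
  have q4: "q * Z ^ 4 \<le> 1"
  proof (rule power2_le_imp_le)
    have "(q * Z ^ 4)\<^sup>2 = (q * q) * Z ^ 8" by (simp add: power_mult_distrib power2_eq_square flip: power_add)
    also have "\<dots> \<le> (1 / Z ^ 8) * Z ^ 8" unfolding q2 using sm Z by (intro mult_right_mono) auto
    also have "\<dots> = 1" using Z by simp
    finally show "(q * Z ^ 4)\<^sup>2 \<le> 1\<^sup>2" by simp
  qed simp
  have q1: "q \<le> 1"
  proof -
    have "q * 1 \<le> q * Z ^ 4" using q0 Z by (intro mult_left_mono one_le_power) auto
    then show ?thesis using q4 by simp
  qed
  have q3: "q * Z ^ 3 * real T \<le> 1"
  proof -
    have "q * Z ^ 3 * real T \<le> q * Z ^ 3 * Z" using q0 Z by (intro mult_left_mono) auto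
    then show ?thesis using q4 by (simp add: eval_nat_numeral mult_ac)
  qed
  have \<kappa>q: "\<kappa> \<le> q"
  proof (rule power2_le_imp_le)
    have "\<kappa>\<^sup>2 * 1 \<le> \<kappa>\<^sup>2 * real T" using T1 by (intro mult_left_mono) auto
    then show "\<kappa>\<^sup>2 \<le> q\<^sup>2" using \<kappa>(2) q2 by (simp add: power2_eq_square)
  qed (rule q0)
  have h: "nrm (samp (traj \<gamma> x s) (x s)) \<le> Z * A" if "s < T" for s
  proof -
    have "bil (samp (traj \<gamma> x s) (x s)) (samp (traj \<gamma> x s) (x s)) \<le> Z\<^sup>2 * (c * \<tau>)"
      by (intro samp_bil_le gd rho_sum_le traj_in_K g) (use that Z c in auto)
    then have "nrm (samp (traj \<gamma> x s) (x s)) \<le> sqrt (Z\<^sup>2 * (c * \<tau>))" unfolding nrm_def by (rule real_sqrt_le_mono)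
    then show ?thesis unfolding A_def using Z by (simp add: real_sqrt_mult)
  qed
  have r: "nrm ?r \<le> A"
  proof -
    have "bil ?r ?r \<le> c * \<tau>"
      by (rule rho_bil_le[OF gd[OF t] rho_sum_le[OF traj_in_K[OF g]]]) (use c in auto)
    then show ?thesis unfolding nrm_def A_def by (rule real_sqrt_le_mono)
  qed
  have U: "c * nrm ?U \<le> q * (Z\<^sup>2 * A)"
  proof -
    have "nrm ?U \<le> \<gamma> * real t * (Z * A)" by (rule nrm_traj_le[OF g]) (use h t in auto)
    then have "c * nrm ?U \<le> (\<gamma> * c) * (real t * (Z * A))" using c by (simp add: mult_left_mono mult_ac)
    also have "\<dots> \<le> q * (Z * (Z * A))"
    proof (rule mult_mono)
      show "\<gamma> * c \<le> q" using gc \<kappa>q by linarith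
      have "real t \<le> Z" using t Z(2) by linarith
      then show "real t * (Z * A) \<le> Z * (Z * A)" using Z(1) A0 by (intro mult_right_mono) auto
      show "0 \<le> q" by (rule q0)
      show "0 \<le> real t * (Z * A)" using Z(1) A0 by simp
    qed
    finally show ?thesis by (simp add: power2_eq_square mult_ac)
  qed
  have d1: "ndist ?r ?rz \<le> 2 * (q * (Z\<^sup>2 * A))"
  proof -
    have good0: "\<And>p. p < m \<Longrightarrow> absact ?rz p \<le> c" using gd[of 0] T0 by simp
    have "bdist ?r ?rz \<le> 4 * c * (c / 2 * bil (\<lambda>q. ?U q - 0) (\<lambda>q. ?U q - 0))"
      by (rule rho_samp_diff(1)[OF _ good0 a_diff_good[OF _ good0]]) (use gd t c in auto)
    also have "\<dots> = 2 * (c * nrm ?U)\<^sup>2" unfolding power_mult_distrib nrm_sq by (simp add: power2_eq_square)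
    also have "\<dots> \<le> 2 * (q * (Z\<^sup>2 * A))\<^sup>2" using U c nrm_nonneg by (intro mult_left_mono power_mono) auto
    also have "\<dots> \<le> (2 * (q * (Z\<^sup>2 * A)))\<^sup>2" by (simp add: power_mult_distrib)
    finally have le: "bdist ?r ?rz \<le> (2 * (q * (Z\<^sup>2 * A)))\<^sup>2" .
    have "0 \<le> 2 * (q * (Z\<^sup>2 * A))" using q0 A0 by simp
    from real_le_lsqrt[OF this le] show ?thesis unfolding nrm_def .
  qed
  have d2: "ndist rs ?rz \<le> 4 * (q * (Z\<^sup>2 * A))"
  proof -
    have "ndist rs ?rz \<le> sqrt (16 * (\<beta> * c)\<^sup>2 * (c * \<tau>))"
      unfolding nrm_def by (rule real_sqrt_le_mono[OF rs(2)])
    also have "\<dots> = 4 * (\<beta> * c) * A" unfolding A_def using \<beta>0 c by (simp add: real_sqrt_mult)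
    also have "\<dots> = 4 * (q * (q * A))" by (simp flip: q2)
    also have "\<dots> \<le> 4 * (q * (Z\<^sup>2 * A))"
    proof -
      have "q \<le> Z\<^sup>2" using q1 one_le_power[OF Z(1), of 2] by linarith
      then show ?thesis using q0 A0 by (intro mult_left_mono mult_right_mono) auto
    qed
    finally show ?thesis .
  qed
  have d: "ndist ?r rs \<le> 6 * (q * (Z\<^sup>2 * A))"
    using nrm_triangle3[of ?r rs ?rz] nrm_minus_commute[of ?rz rs] d1 d2 by linarith
  have rh: "ndist ?r ?h \<le> 2 * (Z * A)"
  proof -
    have "A \<le> Z * A" using mult_right_mono[OF Z(1) A0] by simp
    then show ?thesis using nrm_diff_le[of ?r ?h] r h[OF t] by linarith
  qed
  have "bil (\<lambda>p. ?r p - ?h p) (\<lambda>p. ?r p - rs p) \<le> ndist ?r ?h * ndist ?r rs"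
    using bil_CS abs_le_D1 by blast
  also have "\<dots> \<le> (2 * (Z * A)) * (6 * (q * (Z\<^sup>2 * A)))"
    using rh d nrm_nonneg Z A0 by (intro mult_mono) auto
  also have "\<dots> = 12 * ((q * Z ^ 3) * (c * \<tau>))"
    unfolding A2[symmetric] by (simp add: power2_eq_square power3_eq_cube mult_ac)
  finally have e1: "bil (\<lambda>p. ?r p - ?h p) (\<lambda>p. ?r p - rs p) \<le> 12 * ((q * Z ^ 3) * (c * \<tau>))" .
  have "\<kappa> * bil ?h ?h = \<kappa> * (nrm ?h)\<^sup>2" by (simp add: nrm_sq)
  also have "\<dots> \<le> q * (Z * A)\<^sup>2" using \<kappa>q \<kappa>(1) h[OF t] nrm_nonneg q0 by (intro mult_mono power_mono) auto
  also have "\<dots> = q * Z\<^sup>2 * (c * \<tau>)" unfolding A2[symmetric] by (simp add: power2_eq_square mult_ac)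
  also have "\<dots> \<le> (q * Z ^ 3) * (c * \<tau>)"
    using q0 c \<tau>1 Z(1) by (intro mult_right_mono mult_left_mono power_increasing) auto
  finally have e2: "\<kappa> * bil ?h ?h \<le> (q * Z ^ 3) * (c * \<tau>)" .
  have e3: "step_excess \<kappa> rs \<gamma> x t \<le> 13 * ((q * Z ^ 3) * (c * \<tau>))"
    unfolding step_excess_def excess_def using e1 e2 bil_nonneg[of "\<lambda>p. ?r p - rs p"] by linarith
  show ?thesis
  proof -
    have "(q * Z ^ 3 * real T) * (c * \<tau>) \<le> 1 * (c * \<tau>)" using q3 c \<tau>1 by (intro mult_right_mono) auto
    then have "13 * ((q * Z ^ 3) * (c * \<tau>)) * real T \<le> 13 * (c * \<tau>)" by (simp add: mult_ac)
    then have "13 * ((q * Z ^ 3) * (c * \<tau>)) \<le> 13 * (c * \<tau>) / real T" using T1 by (simp add: field_simps)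
    then show ?thesis using e3 by linarith
  qed
qed

end


section \<open>Uniformity in the step size\<close>

context sampled_dynamics begin

definition gam :: "real \<Rightarrow> real" where "gam \<eta> = \<eta> * \<beta> / (\<eta> + \<beta>)"

lemma gam_bounds:
  assumes "0 \<le> \<eta>" shows "0 \<le> gam \<eta>" "gam \<eta> \<le> \<beta>" "gam \<eta> \<le> \<eta>"
  using assms \<beta>0 by (auto simp: gam_def field_simps)

lemma gam_lipschitz:
  assumes "0 \<le> \<eta>" "0 \<le> \<eta>'" shows "\<bar>gam \<eta> - gam \<eta>'\<bar> \<le> \<bar>\<eta> - \<eta>'\<bar>"
proof -
  have pos: "0 < \<eta> + \<beta>" "0 < \<eta>' + \<beta>" using assms \<beta>0 by auto
  have "gam \<eta> - gam \<eta>' = (\<beta> / (\<eta> + \<beta>)) * (\<beta> / (\<eta>' + \<beta>)) * (\<eta> - \<eta>')"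
    using pos by (simp add: gam_def field_simps)
  then have "\<bar>gam \<eta> - gam \<eta>'\<bar> = (\<beta> / (\<eta> + \<beta>)) * (\<beta> / (\<eta>' + \<beta>)) * \<bar>\<eta> - \<eta>'\<bar>"
    using pos \<beta>0 by (simp add: abs_mult)
  also have "(\<beta> / (\<eta> + \<beta>)) * (\<beta> / (\<eta>' + \<beta>)) \<le> 1 * 1"
    using assms \<beta>0 pos by (intro mult_mono) auto
  then have "(\<beta> / (\<eta> + \<beta>)) * (\<beta> / (\<eta>' + \<beta>)) * \<bar>\<eta> - \<eta>'\<bar> \<le> 1 * \<bar>\<eta> - \<eta>'\<bar>"
    by (intro mult_right_mono) auto
  finally show ?thesis by simp
qed

lemma growth_factor_le:
  assumes "0 \<le> \<kappa>"
  shows "((1 + 20 * \<kappa> + 1 / real T) * (1 + 20 * \<kappa>)) ^ T \<le> 3 * exp (40 * \<kappa> * real T)"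
proof -
  have T1: "real T > 0" using T0 by simp
  have "(1 + (20 * \<kappa> + 1 / real T)) * (1 + 20 * \<kappa>) \<le> exp (20 * \<kappa> + 1 / real T) * exp (20 * \<kappa>)"
    using assms by (intro mult_mono exp_ge_add_one_self) auto
  also have "\<dots> = exp (40 * \<kappa> + 1 / real T)" by (simp flip: exp_add)
  finally have "((1 + 20 * \<kappa> + 1 / real T) * (1 + 20 * \<kappa>)) ^ T \<le> exp (40 * \<kappa> + 1 / real T) ^ T"
    using assms by (intro power_mono) (auto simp: add.assoc)
  also have "\<dots> = exp (real T * (40 * \<kappa> + 1 / real T))" by (simp add: exp_of_nat_mult)
  also have "\<dots> = exp (40 * \<kappa> * real T) * exp 1" using T1 by (simp add: distrib_left flip: exp_add)
  also have "\<dots> \<le> exp (40 * \<kappa> * real T) * 3" using exp_le by (intro mult_left_mono) auto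
  finally show ?thesis by simp
qed

text \<open>Length of the path of trajectories over a grid of \<open>R\<close> equal pieces of the cell \<open>[y, y + w]\<close>.\<close>

definition variation :: "real \<Rightarrow> real \<Rightarrow> nat \<Rightarrow> real \<Rightarrow> (nat \<Rightarrow> field) \<Rightarrow> nat \<Rightarrow> real" where
  "variation y w R c x t = (\<Sum>i<R. sqrt (pairdist (gam (y + w * real i / real R)) (gam (y + w * real (Suc i) / real R)) c x t))"

lemma variation_measurable: "t \<le> T \<Longrightarrow> (\<lambda>x. variation y w R c x t) \<in> borel_measurable \<Omega>"
  unfolding variation_def
  by (intro borel_measurable_sum measurable_compose[OF pairdist_measurable borel_measurable_sqrt])

text \<open>By Cauchy-Schwarz the squared length is at most \<open>R\<close> times the sum of \<open>R\<close> squared pieces, each of mean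
  \<open>O((w/R)\<^sup>2)\<close>. The bound is therefore independent of \<open>R\<close>, and the grid can be refined until even the
  crude deterministic Lipschitz constant is harmless between grid points.\<close>

lemma variation_tail:
  assumes w: "0 < w" and k: "1 \<le> (k::nat)" and R: "0 < R" and \<kappa>: "0 < \<kappa>" and r: "0 < r" and t: "t \<le> T"
    and c: "c = 4 * (\<kappa> / (real k * w))"
  shows "emeasure \<Omega> {x \<in> space \<Omega>. r \<le> variation (real k * w) w R c x t}
    \<le> ennreal (36 * c * \<tau> * (real T)\<^sup>2 * w\<^sup>2 * exp (40 * \<kappa> * real T) / r\<^sup>2)"
proof -
  define h where "h i x = pairdist (gam (real k * w + w * real i / real R)) (gam (real k * w + w * real (Suc i) / real R)) c x t" for i x
  define q where "q = (1 + 20 * \<kappa> + 1 / real T) * (1 + 20 * \<kappa>)"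
  define B where "B = real T * (12 * c * \<tau> * real T * (w / real R)\<^sup>2) * q ^ T"
  have c0: "0 \<le> c" unfolding c using \<kappa> w by simp
  have T1: "1 \<le> real T" using T0 by simp
  have q1: "1 \<le> q" unfolding q_def using \<kappa> mult_mono[of 1 "1 + 20 * \<kappa> + 1 / real T" 1 "1 + 20 * \<kappa>"] by simp
  have B0: "0 \<le> B" unfolding B_def using c0 \<tau>1 q1 by simp
  have h0: "0 \<le> h i x" for i x unfolding h_def by (rule pairdist_nonneg)
  have hm: "h i \<in> borel_measurable \<Omega>" for i unfolding h_def using t by (intro pairdist_measurable)
  have hB: "(\<integral>\<^sup>+x. ennreal (h i x) \<partial>\<Omega>) \<le> ennreal B" if i: "i < R" for i
  proof -
    let ?y = "real k * w + w * real i / real R" and ?y' = "real k * w + w * real (Suc i) / real R"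
    have y0: "0 \<le> ?y" "0 \<le> ?y'" using w by auto
    have "w * real i / real R \<le> w * 1"
      using w i R by (simp add: field_simps)
    then have "?y \<le> (real k + 1) * w" by (simp add: algebra_simps)
    also have "\<dots> \<le> (2 * real k) * w" using k w by (intro mult_right_mono) auto
    finally have "?y \<le> 2 * (real k * w)" by (simp only: mult.assoc)
    then have "gam ?y \<le> 2 * (real k * w)" using gam_bounds(3)[OF y0(1)] by linarith
    then have "gam ?y * c \<le> 2 * (real k * w) * c" using c0 by (rule mult_right_mono)
    also have "\<dots> = 8 * \<kappa>" unfolding c using w k by simp
    finally have gc: "gam ?y * c \<le> 8 * \<kappa>" .
    have "(\<integral>\<^sup>+x. ennreal (h i x) \<partial>\<Omega>) \<le> ennreal (real t * (12 * c * \<tau> * real T * (gam ?y - gam ?y')\<^sup>2) * q ^ t)"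
      unfolding h_def q_def using nn_pairdist[OF gam_bounds(1,2)[OF y0(1)] gam_bounds(1,2)[OF y0(2)] c0 \<kappa> gc t] .
    also have "\<dots> \<le> ennreal B"
    proof (rule ennreal_leI)
      have d: "?y - ?y' = - (w / real R)" by (simp add: algebra_simps add_divide_distrib)
      have "\<bar>gam ?y - gam ?y'\<bar> \<le> \<bar>w / real R\<bar>" using gam_lipschitz[OF y0] unfolding d by simp
      then have "(gam ?y - gam ?y')\<^sup>2 \<le> (w / real R)\<^sup>2" by (rule abs_le_square_iff[THEN iffD1])
      then have h1: "12 * c * \<tau> * real T * (gam ?y - gam ?y')\<^sup>2 \<le> 12 * c * \<tau> * real T * (w / real R)\<^sup>2"
        using c0 \<tau>1 by (intro mult_left_mono) auto
      have h2: "q ^ t \<le> q ^ T" using q1 t by (intro power_increasing) auto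
      have h3: "real t \<le> real T" using t by simp
      show "real t * (12 * c * \<tau> * real T * (gam ?y - gam ?y')\<^sup>2) * q ^ t \<le> B"
        unfolding B_def by (rule mult_mono[OF mult_mono[OF h3 h1] h2]) (use c0 \<tau>1 q1 in auto)
    qed
    finally show ?thesis .
  qed
  have int: "(\<integral>\<^sup>+x. ennreal (real R * (\<Sum>i<R. h i x)) \<partial>\<Omega>) \<le> ennreal (real R * (real R * B))"
    by (rule nn_mean_le[where I = "{..<R}" and w = "\<lambda>_. real R" and B = "\<lambda>_. B" and h = h])
      (use hm hB h0 B0 in \<open>auto simp: sum_distrib_left\<close>)
  have meas: "(\<lambda>x. real R * (\<Sum>i<R. h i x)) \<in> borel_measurable \<Omega>"
    using hm by (intro borel_measurable_times borel_measurable_const borel_measurable_sum)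
  have "emeasure \<Omega> {x \<in> space \<Omega>. r \<le> variation (real k * w) w R c x t} \<le> ennreal (real R * (real R * B) / r\<^sup>2)"
  proof (rule nn_markov[OF meas int])
    show "0 < r\<^sup>2" using r by simp
    fix x assume "x \<in> {x \<in> space \<Omega>. r \<le> variation (real k * w) w R c x t}"
    then have x: "x \<in> space \<Omega>" and v: "r \<le> (\<Sum>i<R. sqrt (h i x))" by (auto simp: variation_def h_def)
    have "r\<^sup>2 \<le> (\<Sum>i<R. 1 * sqrt (h i x))\<^sup>2" using v r by (intro power_mono) auto
    also have "\<dots> \<le> (\<Sum>i<R. 1\<^sup>2) * (\<Sum>i<R. (sqrt (h i x))\<^sup>2)" by (rule Cauchy_Schwarz_ineq_sum)
    also have "\<dots> = real R * (\<Sum>i<R. h i x)" using h0 by simp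
    finally show "x \<in> space \<Omega> \<and> r\<^sup>2 \<le> real R * (\<Sum>i<R. h i x)" using x by simp
  qed
  also have "\<dots> \<le> ennreal (36 * c * \<tau> * (real T)\<^sup>2 * w\<^sup>2 * exp (40 * \<kappa> * real T) / r\<^sup>2)"
  proof (intro ennreal_leI divide_right_mono)
    have "real R * (real R * B) = 12 * c * \<tau> * (real T)\<^sup>2 * w\<^sup>2 * q ^ T"
      unfolding B_def using R by (simp add: power2_eq_square field_simps)
    also have "\<dots> \<le> 12 * c * \<tau> * (real T)\<^sup>2 * w\<^sup>2 * (3 * exp (40 * \<kappa> * real T))"
      using growth_factor_le[of \<kappa>] \<kappa> c0 \<tau>1 unfolding q_def by (intro mult_left_mono) auto
    finally show "real R * (real R * B) \<le> 36 * c * \<tau> * (real T)\<^sup>2 * w\<^sup>2 * exp (40 * \<kappa> * real T)" by simp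
  qed simp
  finally show ?thesis .
qed

text \<open>The factor 2 comes from comparing squares of the amplitudes, the remainder from their distance.\<close>

lemma good_transfer:
  assumes "ndist U' U \<le> 2 * r" "\<And>p. p < m \<Longrightarrow> absact (rho U) p \<le> c" "p < m"
  shows "absact (rho U') p \<le> 2 * c + 4 * ch * r\<^sup>2 * vinf"
proof -
  define d where "d q = (\<Sum>i<n. (a U' q i - a U q i)\<^sup>2)" for q
  have "bdist U' U = (ndist U' U)\<^sup>2" by (simp add: nrm_sq)
  also have "\<dots> \<le> (2 * r)\<^sup>2" using assms(1) nrm_nonneg by (intro power_mono) auto
  finally have "(\<Sum>p<m. d p) \<le> ch / 2 * (2 * r)\<^sup>2"
    using a_diff_crude[of U' U] ch_nonneg mult_left_mono[of "bdist U' U" "(2 * r)\<^sup>2" "ch / 2"]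
    unfolding d_def by simp
  then have D: "(\<Sum>p<m. d p) \<le> 2 * ch * r\<^sup>2" by (simp add: power2_eq_square mult_ac)
  have dq: "d q \<le> 2 * ch * r\<^sup>2" if "q < m" for q
  proof -
    have "d q \<le> (\<Sum>p<m. d p)" using that by (intro member_le_sum) (auto simp: d_def intro!: sum_nonneg)
    then show ?thesis using D by simp
  qed
  have "absact (rho U') p \<le> absact (\<lambda>q. 2 * rho U q + 4 * ch * r\<^sup>2) p"
  proof (rule absact_mono)
    fix q assume q: "q < m"
    have "rho U' q \<le> (\<Sum>i<n. 2 * ((a U q i)\<^sup>2 + (a U' q i - a U q i)\<^sup>2))"
      unfolding rho_def
    proof (rule sum_mono)
      fix i show "(a U' q i)\<^sup>2 \<le> 2 * ((a U q i)\<^sup>2 + (a U' q i - a U q i)\<^sup>2)"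
        using zero_le_power2[of "a U' q i - 2 * a U q i"] by (simp add: power2_eq_square algebra_simps)
    qed
    also have "\<dots> = 2 * rho U q + 2 * d q" unfolding rho_def d_def by (simp add: sum_distrib_left sum.distrib distrib_left)
    also have "\<dots> \<le> 2 * rho U q + 4 * ch * r\<^sup>2" using dq[OF q] by simp
    finally show "rho U' q \<le> 2 * rho U q + 4 * ch * r\<^sup>2" .
  qed
  also have "\<dots> = 2 * absact (rho U) p + absact (\<lambda>_. 4 * ch * r\<^sup>2) p" by (simp add: absact_add absact_scale)
  also have "\<dots> \<le> 2 * c + 4 * ch * r\<^sup>2 * vinf"
    using assms(2)[OF assms(3)] absact_const[OF assms(3), of "4 * ch * r\<^sup>2"] ch_nonneg by simp
  finally show ?thesis .
qed

lemma nrm_chain: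
  assumes "i \<le> j" "j \<le> R"
  shows "ndist (u i) (u j) \<le> (\<Sum>l<R. ndist (u l) (u (Suc l)))"
proof -
  have "ndist (u i) (u j) \<le> (\<Sum>l=i..<j. ndist (u l) (u (Suc l)))"
    using assms(1)
  proof (induction j rule: dec_induct)
    case base
    then show ?case by (simp add: nrm_def bil_zero)
  next
    case (step j)
    then show ?case using nrm_triangle3[of "u i" "u (Suc j)" "u j"] by simp
  qed
  also have "\<dots> \<le> (\<Sum>l<R. ndist (u l) (u (Suc l)))"
    using assms by (intro sum_mono2) (auto simp: nrm_nonneg)
  finally show ?thesis .
qed

text \<open>If the trajectory of some step size in the cell stays good, then so do those of all grid
  points of the cell, and they stay close to it. The variation along the grid is known to be
  small only as long as all grid points are good, so both claims advance together in time.\<close>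

lemma cell_stability:
  assumes w: "0 < w" and y: "0 \<le> y" and \<eta>: "y \<le> \<eta>" "\<eta> \<le> y + w" and R: "0 < R"
    and L: "\<And>\<gamma> \<gamma>' t. 0 \<le> \<gamma> \<Longrightarrow> \<gamma> \<le> \<beta> \<Longrightarrow> 0 \<le> \<gamma>' \<Longrightarrow> \<gamma>' \<le> \<beta> \<Longrightarrow> t \<le> T \<Longrightarrow> ndist (traj \<gamma> x t) (traj \<gamma>' x t) \<le> L * \<bar>\<gamma> - \<gamma>'\<bar>"
    and LR: "L * (w / real R) \<le> r" and L0: "0 \<le> L"
    and var: "\<And>t. t < T \<Longrightarrow> variation y w R c' x t \<le> r"
    and good: "\<And>t. t < T \<Longrightarrow> good (gam \<eta>) c x t" and c': "2 * c + 4 * ch * r\<^sup>2 * vinf \<le> c'"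
    and t: "t < T"
  shows "good (gam y) c' x t" "ndist (traj (gam \<eta>) x t) (traj (gam y) x t) \<le> 2 * r"
proof -
  define g where "g i = y + w * real i / real R" for i :: nat
  define u where "u t i = traj (gam (g i)) x t" for t i
  have g0: "0 \<le> g i" for i unfolding g_def using y w by simp
  have \<eta>0: "0 \<le> \<eta>" using y \<eta> by simp
  define i0 where "i0 = nat \<lfloor>(\<eta> - y) * real R / w\<rfloor>"
  have s0: "0 \<le> (\<eta> - y) * real R / w" using w \<eta> by simp
  have i0: "real i0 \<le> (\<eta> - y) * real R / w" "(\<eta> - y) * real R / w < real i0 + 1"
    unfolding i0_def using s0 by linarith+
  have "(\<eta> - y) * real R / w \<le> w * real R / w" using w \<eta> by (intro divide_right_mono mult_right_mono) auto
  then have "real i0 \<le> real R" using i0(1) w by simp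
  then have i0R: "i0 \<le> R" by simp
  have near: "\<bar>\<eta> - g i0\<bar> \<le> w / real R"
  proof -
    have "w * real i0 \<le> (\<eta> - y) * real R" "(\<eta> - y) * real R \<le> w * real i0 + w"
      using i0 w by (auto simp: field_simps)
    then have "w * real i0 / real R \<le> \<eta> - y" "\<eta> - y \<le> w * real i0 / real R + w / real R"
      using R by (auto simp: field_simps)
    then show ?thesis unfolding g_def by simp
  qed
  have close: "ndist (u s i) (traj (gam \<eta>) x s) \<le> 2 * r"
    if s: "s < T" and gb: "\<And>i. i \<le> R \<Longrightarrow> good_before (gam (g i)) c' x s" and i: "i \<le> R" for s i
  proof -
    have "(\<Sum>l<R. ndist (u s l) (u s (Suc l))) = variation y w R c' x s"
      unfolding variation_def
    proof (rule sum.cong[OF refl])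
      fix l assume l: "l \<in> {..<R}"
      have "pairdist (gam (g l)) (gam (g (Suc l))) c' x s = bdist (u s l) (u s (Suc l))"
        unfolding pairdist_def u_def using gb[of l] gb[of "Suc l"] l by simp
      then show "ndist (u s l) (u s (Suc l)) = sqrt (pairdist (gam (y + w * real l / real R)) (gam (y + w * real (Suc l) / real R)) c' x s)"
        unfolding nrm_def g_def by simp
    qed
    then have sum_le: "(\<Sum>l<R. ndist (u s l) (u s (Suc l))) \<le> r" using var[OF s] by simp
    have d1: "ndist (u s i) (u s i0) \<le> r"
    proof (cases "i \<le> i0")
      case True
      then show ?thesis using nrm_chain[of i i0 R "u s"] i0R sum_le by linarith
    next
      case False
      then show ?thesis using nrm_chain[of i0 i R "u s"] i sum_le nrm_minus_commute[of "u s i" "u s i0"] by linarith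
    qed
    have "ndist (u s i0) (traj (gam \<eta>) x s) \<le> L * \<bar>gam (g i0) - gam \<eta>\<bar>"
      unfolding u_def using s by (intro L gam_bounds g0 \<eta>0) auto
    also have "\<dots> \<le> L * (w / real R)"
    proof (rule mult_left_mono[OF _ L0])
      show "\<bar>gam (g i0) - gam \<eta>\<bar> \<le> w / real R"
        using gam_lipschitz[OF g0[of i0] \<eta>0] near by (simp add: abs_minus_commute)
    qed
    finally have d2: "ndist (u s i0) (traj (gam \<eta>) x s) \<le> r" using LR by simp
    show ?thesis using nrm_triangle3[of "u s i" "traj (gam \<eta>) x s" "u s i0"] d1 d2 by linarith
  qed
  have gb: "\<forall>i\<le>R. good_before (gam (g i)) c' x s" if "s \<le> T" for s
    using that
  proof (induction s)
    case 0
    then show ?case by (simp add: good_before_def)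
  next
    case (Suc s)
    then have s: "s < T" and IH: "\<And>i. i \<le> R \<Longrightarrow> good_before (gam (g i)) c' x s" by auto
    show ?case
    proof (intro allI impI)
      fix i assume i: "i \<le> R"
      have "good (gam (g i)) c' x s"
        unfolding good_def
      proof (intro allI impI)
        fix p assume p: "p < m"
        have "absact (rho (u s i)) p \<le> 2 * c + 4 * ch * r\<^sup>2 * vinf"
          by (rule good_transfer[OF close[OF s IH i] _ p]) (use good[OF s] in \<open>auto simp: good_def\<close>)
        then show "absact (rho (traj (gam (g i)) x s)) p \<le> c'" using c' unfolding u_def by simp
      qed
      then show "good_before (gam (g i)) c' x (Suc s)" using IH[OF i] unfolding good_before_def by (auto simp: less_Suc_eq)
    qed
  qed
  have y0: "g 0 = y" unfolding g_def by simp
  have "good_before (gam y) c' x (Suc t)" using gb[of "Suc t"] t y0 by (metis Suc_leI le0)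
  then show "good (gam y) c' x t" unfolding good_before_def by simp
  have "nrm (\<lambda>p. u t 0 p - traj (gam \<eta>) x t p) \<le> 2 * r"
    by (rule close[OF t]) (use gb[of t] t in auto)
  then show "ndist (traj (gam \<eta>) x t) (traj (gam y) x t) \<le> 2 * r"
    unfolding u_def y0 by (subst nrm_minus_commute)
qed

lemma excess_transfer:
  assumes g: "0 \<le> \<gamma>" "\<gamma> \<le> \<beta>" "0 \<le> \<gamma>'" "\<gamma>' \<le> \<beta>" and t: "t < T"
    and good: "good \<gamma> c x t" "good \<gamma>' c x t" and c: "0 < c"
    and d: "ndist (traj \<gamma> x t) (traj \<gamma>' x t) \<le> 2 * r" and r: "0 \<le> r"
    and rs: "bil rs rs \<le> c * \<tau>" and Z: "1 \<le> Z" "sqn n (x t) \<le> Z" and \<kappa>: "0 \<le> \<kappa>"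
  shows "step_excess \<kappa> rs \<gamma> x t - step_excess \<kappa> rs \<gamma>' x t \<le> 10 * (1 + \<kappa>) * Z * sqrt (c * \<tau>) * (3 * c * Z * r)"
proof -
  let ?U = "traj \<gamma> x t" and ?V = "traj \<gamma>' x t"
  have gd: "\<And>p. p < m \<Longrightarrow> absact (rho ?U) p \<le> c" "\<And>p. p < m \<Longrightarrow> absact (rho ?V) p \<le> c"
    using good unfolding good_def by auto
  have c0: "0 \<le> c" using c by simp
  have "bdist ?U ?V = (ndist ?U ?V)\<^sup>2" by (simp add: nrm_sq)
  also have "\<dots> \<le> (2 * r)\<^sup>2" using d nrm_nonneg by (intro power_mono) auto
  finally have "c / 2 * bdist ?U ?V \<le> c / 2 * (2 * r)\<^sup>2" using c by (intro mult_left_mono) auto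
  then have D: "(\<Sum>p<m. \<Sum>i<n. (a ?U p i - a ?V p i)\<^sup>2) \<le> 2 * c * r\<^sup>2"
    using a_diff_good[OF gd] by (simp add: power2_eq_square)
  have e1: "ndist (rho ?U) (rho ?V) \<le> 3 * c * Z * r"
  proof -
    have "bdist (rho ?U) (rho ?V) \<le> 4 * c * (2 * c * r\<^sup>2)"
      by (rule rho_samp_diff(1)[OF gd D c0])
    also have "\<dots> \<le> (3 * c * r)\<^sup>2" using zero_le_power2[of "c * r"] by (simp add: power2_eq_square mult_ac)
    finally have "ndist (rho ?U) (rho ?V) \<le> sqrt ((3 * c * r)\<^sup>2)" unfolding nrm_def by (rule real_sqrt_le_mono)
    also have "\<dots> = 3 * c * r * 1" using c r by simp
    also have "\<dots> \<le> 3 * c * r * Z" using c r Z by (intro mult_left_mono) auto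
    finally show ?thesis by (simp add: mult_ac)
  qed
  have e2: "ndist (samp ?U (x t)) (samp ?V (x t)) \<le> 3 * c * Z * r"
  proof -
    have "bdist (samp ?U (x t)) (samp ?V (x t)) \<le> 4 * c * (2 * c * r\<^sup>2) * Z\<^sup>2"
      by (rule rho_samp_diff(2)[OF gd D c0 Z(2)])
    also have "\<dots> \<le> (3 * c * Z * r)\<^sup>2" using zero_le_power2[of "c * Z * r"]
      by (simp add: power_mult_distrib power2_eq_square mult_ac)
    finally have "ndist (samp ?U (x t)) (samp ?V (x t)) \<le> sqrt ((3 * c * Z * r)\<^sup>2)" unfolding nrm_def by (rule real_sqrt_le_mono)
    then show ?thesis using c r Z by simp
  qed
  have r': "nrm (rho (traj \<delta> x t)) \<le> sqrt (c * \<tau>)" if "\<And>p. p < m \<Longrightarrow> absact (rho (traj \<delta> x t)) p \<le> c" "0 \<le> \<delta>" "\<delta> \<le> \<beta>" for \<delta>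
    unfolding nrm_def by (rule real_sqrt_le_mono, rule rho_bil_le[OF that(1) rho_sum_le[OF traj_in_K[OF that(2,3)]] c0])
  have h': "nrm (samp (traj \<delta> x t) (x t)) \<le> Z * sqrt (c * \<tau>)" if "\<And>p. p < m \<Longrightarrow> absact (rho (traj \<delta> x t)) p \<le> c" "0 \<le> \<delta>" "\<delta> \<le> \<beta>" for \<delta>
  proof -
    have "nrm (samp (traj \<delta> x t) (x t)) \<le> sqrt (Z\<^sup>2 * (c * \<tau>))"
      unfolding nrm_def by (rule real_sqrt_le_mono, rule samp_bil_le[OF that(1) rho_sum_le[OF traj_in_K[OF that(2,3)]] c0 Z(2)])
    then show ?thesis using Z by (simp add: real_sqrt_mult)
  qed
  have rs': "nrm rs \<le> sqrt (c * \<tau>)" unfolding nrm_def by (rule real_sqrt_le_mono[OF rs])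
  show ?thesis
    unfolding step_excess_def
    by (rule excess_lipschitz[OF r'[OF gd(1) g(1,2)] r'[OF gd(2) g(3,4)] rs' Z(1) h'[OF gd(1) g(1,2)] h'[OF gd(2) g(3,4)] e1 e2 \<kappa>])
qed

end


lemma ln_one_plus_le: "0 \<le> b \<Longrightarrow> ln (1 + b) \<le> 2 * sqrt (b::real)"
proof -
  assume b: "0 \<le> b"
  have "1 + b \<le> (1 + sqrt b)\<^sup>2" using b by (simp add: power2_sum)
  moreover have "0 < 1 + b" "0 < (1 + sqrt b)\<^sup>2"
    using b zero_less_power[of "1 + sqrt b" 2] by (auto simp: add_pos_nonneg)
  ultimately have "ln (1 + b) \<le> ln ((1 + sqrt b)\<^sup>2)" by (subst ln_le_cancel_iff)
  also have "\<dots> = 2 * ln (1 + sqrt b)" using b by (simp add: ln_realpow add_pos_nonneg)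
  also have "\<dots> \<le> 2 * sqrt b" using b ln_add_one_self_le_self[of "sqrt b"] by simp
  finally show ?thesis .
qed

context sampled_dynamics begin

text \<open>All constants below are polynomial in \<open>Z = 4 T m / \<delta>\<close> and \<open>1 + \<beta> c\<^sub>h\<close> apart from one factor
  \<open>exp (40 \<kappa> T)\<close>. Hence the logarithm of the number of cells is of the order that the final
  bound can afford.\<close>

lemma log_net_size:
  assumes d: "0 < \<delta>" "\<delta> \<le> 1" and b: "0 \<le> b" and \<kappa>: "0 \<le> \<kappa>"
    and Z: "Z = 4 * real T * real m / \<delta>"
    and W: "W = 132710400 * (1 + b)\<^sup>2 * (1 + \<kappa>) ^ 4 * Z ^ 28 * exp (40 * \<kappa> * real T)"
    and N: "N = (1 + b) * W * Z ^ 8"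
  shows "ln (4 * N / \<delta>) \<le> 6 * sqrt b + 44 * (\<kappa> * real T) + 101 + 37 * ln (real T * real m / \<delta>)"
proof -
  have T1: "1 \<le> real T" "1 \<le> real m" using T0 m0 by simp_all
  then have Tm: "1 \<le> real T * real m" using mult_mono[of 1 "real T" 1 "real m"] by simp
  then have X1: "1 \<le> real T * real m / \<delta>" using d by (simp add: field_simps)
  have Z4: "Z = 4 * (real T * real m / \<delta>)" unfolding Z by simp
  have Zpos: "0 < Z" and dZ: "4 / \<delta> \<le> Z" using X1 Tm d unfolding Z by (auto simp: divide_right_mono)
  define P where "P = 132710400 * (1 + b) ^ 3 * (1 + \<kappa>) ^ 4 * Z ^ 37 * exp (40 * \<kappa> * real T)"
  have Npos: "0 < N" unfolding N W using b \<kappa> Zpos by (simp add: add_pos_nonneg)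
  have "4 * N / \<delta> = N * (4 / \<delta>)" by simp
  also have "\<dots> \<le> N * Z" using dZ Npos by (intro mult_left_mono) auto
  also have "\<dots> = P" unfolding P_def N W by (simp add: power_add[symmetric] eval_nat_numeral mult_ac)
  finally have "4 * N / \<delta> \<le> P" .
  moreover have "0 < 4 * N / \<delta>" using Npos d by simp
  ultimately have "ln (4 * N / \<delta>) \<le> ln P" by (subst ln_le_cancel_iff) auto
  also have "ln P = ln 132710400 + 3 * ln (1 + b) + 4 * ln (1 + \<kappa>) + 37 * ln Z + 40 * \<kappa> * real T"
    unfolding P_def using b \<kappa> Zpos by (simp add: ln_mult ln_realpow add_pos_nonneg)
  also have "ln (132710400::real) \<le> 27"
  proof -
    have "ln (132710400::real) \<le> ln (2 ^ 27)" by simp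
    also have "\<dots> = 27 * ln (2::real)" using ln_realpow[of "2::real" 27] by (simp only: of_nat_numeral zero_less_numeral simp_thms)
    also have "\<dots> \<le> 27" using ln_2_less_1 by simp
    finally show ?thesis .
  qed
  also have "ln (1 + b) \<le> 2 * sqrt b" by (rule ln_one_plus_le[OF b])
  also have "ln (1 + \<kappa>) \<le> \<kappa> * real T"
  proof -
    have "ln (1 + \<kappa>) \<le> \<kappa> * 1" using ln_add_one_self_le_self[OF \<kappa>] by simp
    also have "\<dots> \<le> \<kappa> * real T" using T1 \<kappa> by (intro mult_left_mono) auto
    finally show ?thesis .
  qed
  also have "ln Z \<le> 2 + ln (real T * real m / \<delta>)"
  proof -
    have "ln Z = ln 4 + ln (real T * real m / \<delta>)" unfolding Z4 using X1 by (intro ln_mult_pos) auto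
    moreover have "ln (4::real) = 2 * ln 2" using ln_realpow[of 2 2] by simp
    ultimately show ?thesis using ln_2_less_1 by simp
  qed
  finally show ?thesis by (simp add: algebra_simps)
qed

text \<open>Goodness and the excess are transferred from a step size to the base point of its cell, where the tail bound
  is available. The distance \<open>r\<close> of the trajectories is so small that the excesses differ by \<open>c \<tau>\<close> in total.\<close>

lemma cell_excess:
  assumes d: "0 < \<delta>" "\<delta> \<le> 1" and ch: "0 < ch" and \<kappa>: "0 < \<kappa>"
    and Z: "Z = 4 * real T * real m / \<delta>"
    and r: "r\<^sup>2 = 1 / (460800 * Z ^ 15 * (1 + \<kappa>)\<^sup>2 * ch * (1 + \<beta> * ch))" "0 < r"
    and w: "0 < w" and k: "1 \<le> (k::nat)" and \<eta>: "real k * w \<le> \<eta>" "\<eta> \<le> real k * w + w" and R: "0 < R"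
    and c: "c = \<kappa> / \<eta>" "c \<le> ch" "1 / Z ^ 8 \<le> \<beta> * c" and c': "c' = 4 * (\<kappa> / (real k * w))"
    and L: "\<And>\<gamma> \<gamma>' t. 0 \<le> \<gamma> \<Longrightarrow> \<gamma> \<le> \<beta> \<Longrightarrow> 0 \<le> \<gamma>' \<Longrightarrow> \<gamma>' \<le> \<beta> \<Longrightarrow> t \<le> T \<Longrightarrow> ndist (traj \<gamma> x t) (traj \<gamma>' x t) \<le> L * \<bar>\<gamma> - \<gamma>'\<bar>"
    and LR: "L * (w / real R) \<le> r" and L0: "0 \<le> L"
    and x: "\<And>t. t < T \<Longrightarrow> (sqn n (x t)) \<le> Z"
    and var: "\<And>t. t < T \<Longrightarrow> variation (real k * w) w R c' x t \<le> r"
    and good: "\<And>t. t < T \<Longrightarrow> good (gam \<eta>) c x t"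
    and rs: "bil rs rs \<le> c * \<tau>"
    and tail: "(\<Sum>s<T. good_excess \<kappa> rs (gam (real k * w)) c' x s) \<le> 22 * \<kappa> * (c' * \<tau>) * real T + 16 * (c' * \<tau>) * l"
    and l: "0 \<le> l"
  shows "(\<Sum>t<T. step_excess \<kappa> rs (gam \<eta>) x t) \<le> c * \<tau> * (1 + 176 * (\<kappa> * real T) + 128 * l)"
proof -
  have T1: "1 \<le> real T" "1 \<le> real m" using T0 m0 by simp_all
  have Zge: "real T \<le> Z" "real m \<le> Z" "1 \<le> Z"
  proof -
    have a: "real T * real m \<le> real T * real m / \<delta>" using d T1 by (simp add: field_simps)
    have b: "real T * 1 \<le> real T * real m" "1 * real m \<le> real T * real m" using T1 by (auto intro: mult_mono)
    have c: "Z = 4 * (real T * real m / \<delta>)" unfolding Z by simp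
    have "0 \<le> real T * real m / \<delta>" using d by simp
    then show "real T \<le> Z" "real m \<le> Z" "1 \<le> Z" using a b T1 unfolding c by linarith+
  qed
  have kw: "0 < real k * w" using k w by simp
  have \<eta>0: "0 < \<eta>" by (rule less_le_trans[OF kw \<eta>(1)])
  have c0: "0 < c" unfolding c using \<kappa> \<eta>0 by simp
  have cle: "4 * c \<le> c'" unfolding c c' using \<eta> kw \<kappa> \<eta>0 by (simp add: frac_le)
  have c8: "c' \<le> 8 * c"
  proof -
    have "real k * w + w \<le> 2 * (real k * w)" using k w mult_right_mono[of 1 "real k" w] by simp
    then have "\<eta> \<le> 2 * (real k * w)" using \<eta> by linarith
    then have "\<kappa> / (2 * (real k * w)) \<le> \<kappa> / \<eta>" using \<kappa> \<eta>0 by (intro frac_le) auto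
    then have "8 * (\<kappa> / (2 * (real k * w))) \<le> 8 * (\<kappa> / \<eta>)" by (rule mult_left_mono) simp
    moreover have "c' = 8 * (\<kappa> / (2 * (real k * w)))" unfolding c' by simp
    ultimately show ?thesis unfolding c by (simp only:)
  qed
  have b0: "0 \<le> \<beta> * ch" using \<beta>0 ch by simp
  have ZP: "1 \<le> Z ^ j" for j using Zge(3) by (rule one_le_power)
  have r2ch: "r\<^sup>2 * ch * (460800 * Z ^ 15 * (1 + \<kappa>)\<^sup>2 * (1 + \<beta> * ch)) = 1"
  proof -
    define D where "D = 460800 * Z ^ 15 * (1 + \<kappa>)\<^sup>2 * (1 + \<beta> * ch)"
    have "0 < D" unfolding D_def using Zge(3) \<kappa> b0 by (intro mult_pos_pos) auto
    moreover have "r\<^sup>2 = 1 / (ch * D)" unfolding r(1) D_def by (simp add: mult_ac)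
    ultimately show ?thesis unfolding D_def[symmetric] using ch by simp
  qed
  have k1: "1 \<le> (1 + \<kappa>)\<^sup>2" using \<kappa> by (intro one_le_power) auto
  have vr: "4 * ch * r\<^sup>2 * vinf \<le> c"
  proof -
    have "4 * ch * r\<^sup>2 * vinf \<le> 4 * ch * r\<^sup>2 * (real m * ch)"
      using vinf_le ch by (intro mult_left_mono) auto
    also have "\<dots> \<le> 4 * ch * r\<^sup>2 * (Z * ch)"
      using Zge ch by (intro mult_left_mono mult_right_mono) auto
    finally have "4 * ch * r\<^sup>2 * vinf * (\<beta> * Z ^ 8) \<le> 4 * ch * r\<^sup>2 * (Z * ch) * (\<beta> * Z ^ 8)"
      using \<beta>0 Zge(3) by (intro mult_right_mono) auto
    also have "\<dots> = r\<^sup>2 * ch * (4 * Z ^ 9 * 1 * (\<beta> * ch))" by (simp add: eval_nat_numeral mult_ac)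
    also have "\<dots> \<le> r\<^sup>2 * ch * (460800 * Z ^ 15 * (1 + \<kappa>)\<^sup>2 * (1 + \<beta> * ch))"
      using ch b0 k1 ZP Zge(3) by (intro mult_left_mono mult_mono power_increasing) auto
    also have "\<dots> = 1" by (rule r2ch)
    also have "1 \<le> c * (\<beta> * Z ^ 8)" using c(3) ZP[of 8] Zge(3) by (simp add: field_simps)
    finally show ?thesis using \<beta>0 Zge(3) by (simp add: mult_le_cancel_right)
  qed
  have y0: "0 \<le> real k * w" using kw by simp
  have st: "good (gam (real k * w)) c' x t" "nrm (\<lambda>p. traj (gam \<eta>) x t p - traj (gam (real k * w)) x t p) \<le> 2 * r"
    if t: "t < T" for t
    using cell_stability[OF w y0 \<eta> R L LR L0 var good _ t] vr cle c0 by linarith+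
  have good': "good (gam \<eta>) c' x t" if "t < T" for t
  proof -
    have "c \<le> c'" using cle c0 by linarith
    then show ?thesis using good[OF that] unfolding good_def by (auto intro: order_trans)
  qed
  have ge: "good_excess \<kappa> rs (gam (real k * w)) c' x t = step_excess \<kappa> rs (gam (real k * w)) x t" if "t < T" for t
    unfolding good_excess_def using st(1)[OF that] by simp
  define E where "E = 10 * (1 + \<kappa>) * Z * sqrt (c' * \<tau>) * (3 * c' * Z * r)"
  have c'0: "0 < c'" using cle c0 by linarith
  have rs': "bil rs rs \<le> c' * \<tau>"
  proof -
    have "c * \<tau> \<le> c' * \<tau>" using cle c0 \<tau>1 by (intro mult_right_mono) auto
    then show ?thesis using rs by linarith
  qed
  have tr: "step_excess \<kappa> rs (gam \<eta>) x t \<le> good_excess \<kappa> rs (gam (real k * w)) c' x t + E" if t: "t < T" for t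
  proof -
    have "step_excess \<kappa> rs (gam \<eta>) x t - step_excess \<kappa> rs (gam (real k * w)) x t \<le> E"
      unfolding E_def
      by (rule excess_transfer[OF gam_bounds(1,2) gam_bounds(1,2) t good'[OF t] st(1)[OF t] c'0 st(2)[OF t] _ rs' Zge(3) x[OF t]])
        (use \<eta>0 y0 r \<kappa> in auto)
    then show ?thesis using ge[OF t] by linarith
  qed
  have TE: "real T * E \<le> c * \<tau>"
  proof (rule power2_le_imp_le)
    have "(real T * E)\<^sup>2 = (real T)\<^sup>2 * (900 * (1 + \<kappa>)\<^sup>2 * Z ^ 4 * (sqrt (c' * \<tau>))\<^sup>2 * c'\<^sup>2 * r\<^sup>2)"
    proof -
      define K1 A where "K1 = 1 + \<kappa>" and "A = sqrt (c' * \<tau>)"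
      show ?thesis unfolding E_def K1_def[symmetric] A_def[symmetric]
        by (simp add: power_mult_distrib power2_eq_square eval_nat_numeral mult_ac)
    qed
    also have "(sqrt (c' * \<tau>))\<^sup>2 = c' * \<tau>" using c'0 \<tau>1 by simp
    also have "(real T)\<^sup>2 * (900 * (1 + \<kappa>)\<^sup>2 * Z ^ 4 * (c' * \<tau>) * c'\<^sup>2 * r\<^sup>2)
      \<le> Z\<^sup>2 * (900 * (1 + \<kappa>)\<^sup>2 * Z ^ 4 * ((8 * c) * \<tau>) * (8 * c)\<^sup>2 * r\<^sup>2)"
      using Zge c8 c'0 \<tau>1 c0 \<kappa> r(2) by (intro mult_mono power_mono) auto
    also have "\<dots> = (r\<^sup>2 * c * (460800 * Z ^ 6 * (1 + \<kappa>)\<^sup>2)) * (c\<^sup>2 * \<tau>)"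
      by (simp add: power2_eq_square eval_nat_numeral mult_ac)
    also have "\<dots> \<le> 1 * (c\<^sup>2 * \<tau>)"
    proof (rule mult_right_mono)
      have "r\<^sup>2 * c * (460800 * Z ^ 6 * (1 + \<kappa>)\<^sup>2 * 1) \<le> r\<^sup>2 * ch * (460800 * Z ^ 15 * (1 + \<kappa>)\<^sup>2 * (1 + \<beta> * ch))"
      proof (rule mult_mono)
        show "r\<^sup>2 * c \<le> r\<^sup>2 * ch" using c(2) by (intro mult_left_mono) auto
        have "Z ^ 6 \<le> Z ^ 15" using Zge(3) by (intro power_increasing) auto
        then have h: "460800 * Z ^ 6 * (1 + \<kappa>)\<^sup>2 \<le> 460800 * Z ^ 15 * (1 + \<kappa>)\<^sup>2"
          by (intro mult_right_mono mult_left_mono) auto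
        show "460800 * Z ^ 6 * (1 + \<kappa>)\<^sup>2 * 1 \<le> 460800 * Z ^ 15 * (1 + \<kappa>)\<^sup>2 * (1 + \<beta> * ch)"
          by (rule mult_mono[OF h]) (use b0 Zge(3) in auto)
      qed (use ch Zge(3) in auto)
      then show "r\<^sup>2 * c * (460800 * Z ^ 6 * (1 + \<kappa>)\<^sup>2) \<le> 1" using r2ch by simp
      show "0 \<le> c\<^sup>2 * \<tau>" using \<tau>1 by simp
    qed
    also have "\<dots> \<le> c\<^sup>2 * \<tau>\<^sup>2" using \<tau>1 by (simp add: mult_left_mono power2_eq_square)
    finally show "(real T * E)\<^sup>2 \<le> (c * \<tau>)\<^sup>2" by (simp add: power_mult_distrib)
    show "0 \<le> c * \<tau>" using c0 \<tau>1 by simp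
  qed
  have "(\<Sum>t<T. step_excess \<kappa> rs (gam \<eta>) x t) \<le> (\<Sum>t<T. good_excess \<kappa> rs (gam (real k * w)) c' x t + E)"
    using tr by (intro sum_mono) auto
  also have "\<dots> = (\<Sum>t<T. good_excess \<kappa> rs (gam (real k * w)) c' x t) + real T * E" by (simp add: sum.distrib)
  also have "\<dots> \<le> (22 * \<kappa> * (c' * \<tau>) * real T + 16 * (c' * \<tau>) * l) + c * \<tau>" using tail TE by linarith
  also have "22 * \<kappa> * (c' * \<tau>) * real T + 16 * (c' * \<tau>) * l = c' * (\<tau> * (22 * \<kappa> * real T + 16 * l))" by (simp add: algebra_simps)
  also have "\<dots> \<le> (8 * c) * (\<tau> * (22 * \<kappa> * real T + 16 * l))"
    using c8 \<tau>1 \<kappa> l by (intro mult_right_mono) auto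
  finally show ?thesis by (simp add: algebra_simps)
qed

text \<open>A union bound over the net. The step size enters only through the requirement that its own trajectory
  is good at the scale \<open>\<kappa>/\<eta>\<close>, so the conclusion may be applied to a step size that depends on \<open>x\<close>.\<close>

theorem uniform_excess_bound:
  assumes d: "0 < \<delta>" "\<delta> \<le> 1" and \<kappa>: "0 < \<kappa>" and rs: "\<And>p. p < m \<Longrightarrow> 0 \<le> rs p"
  shows "\<exists>A\<in>sets \<Omega>. 1 - \<delta> \<le> measure \<Omega> A \<and> (\<forall>x\<in>A. \<forall>\<eta>>0. \<forall>c. c = \<kappa> / \<eta> \<longrightarrow> c \<le> ch \<longrightarrow>
      (\<forall>t<T. good (gam \<eta>) c x t) \<longrightarrow> (\<forall>p<m. absact rs p \<le> c) \<longrightarrow> bil rs rs \<le> c * \<tau> \<longrightarrow>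
      4 * \<kappa>\<^sup>2 * real T \<le> \<beta> * c \<longrightarrow>
      bdist rs (rho (\<lambda>_. 0)) \<le> 16 * (\<beta> * c)\<^sup>2 * (c * \<tau>) \<longrightarrow>
      (\<Sum>t<T. step_excess \<kappa> rs (gam \<eta>) x t)
        \<le> 25000 * (c * \<tau>) * sqrt (real T) * (1 + sqrt (\<beta> * ch)) * max 1 (ln (real T * real m / \<delta>)))"
proof (cases "ch = 0")
  case True
  show ?thesis
  proof (intro bexI[of _ "space \<Omega>"] conjI ballI allI impI)
    show "1 - \<delta> \<le> measure \<Omega> (space \<Omega>)" using d prob_space.prob_space[OF prob_space_\<Omega>] by simp
    fix x \<eta> c assume "0 < \<eta>" and c: "c = \<kappa> / \<eta>" "c \<le> ch"
    then have "0 < c" using \<kappa> by simp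
    then have "False" using c True by simp
    then show "(\<Sum>t<T. step_excess \<kappa> rs (gam \<eta>) x t)
        \<le> 25000 * (c * \<tau>) * sqrt (real T) * (1 + sqrt (\<beta> * ch)) * max 1 (ln (real T * real m / \<delta>))" ..
  qed simp
next
  case False
  then have ch: "0 < ch" using ch_nonneg by simp
  define b where "b = \<beta> * ch"
  have b0: "0 < b" unfolding b_def using \<beta>0 ch by simp
  define Z where "Z = 4 * real T * real m / \<delta>"
  define e where "e = exp (40 * \<kappa> * real T)"
  define r where "r = sqrt (1 / (460800 * Z ^ 15 * (1 + \<kappa>)\<^sup>2 * ch * (1 + \<beta> * ch)))"
  define W where "W = 132710400 * (1 + b)\<^sup>2 * (1 + \<kappa>) ^ 4 * Z ^ 28 * exp (40 * \<kappa> * real T)"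
  \<comment> \<open>Cells have width \<open>w\<close> and the net points are \<open>k w\<close>. As \<open>c \<le> ch\<close> forces \<open>\<eta> \<ge> \<kappa>/ch = W w\<close>, every relevant cell is
    short compared to its distance from 0; \<open>\<beta> c \<ge> Z\<^sup>-\<^sup>8\<close> forces \<open>\<eta> \<le> \<beta> \<kappa> Z\<^sup>8\<close>, so finitely many cells remain.
    \<open>W\<close> is chosen so that the bounds of all \<open>variation_tail\<close> events add up to at most \<open>1/Z\<close>.\<close>
  define w where "w = \<kappa> / (ch * W)"
  define N where "N = (1 + b) * W * Z ^ 8"
  have T1: "1 \<le> real T" "1 \<le> real m" using T0 m0 by simp_all
  have Zge: "real T \<le> Z" "real m \<le> Z" "4 \<le> Z" and dZ: "1 / Z \<le> \<delta> / 4"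
  proof -
    have a: "real T * real m \<le> real T * real m / \<delta>" using d T1 by (simp add: field_simps)
    have b: "real T * 1 \<le> real T * real m" "1 * real m \<le> real T * real m" using T1 by (auto intro: mult_mono)
    have c: "Z = 4 * (real T * real m / \<delta>)" unfolding Z_def by simp
    have "0 \<le> real T * real m / \<delta>" using d by simp
    then show "real T \<le> Z" "real m \<le> Z" "4 \<le> Z" using a b T1 unfolding c by linarith+
    have "1 \<le> real T * real m" using b T1 by linarith
    then show "1 / Z \<le> \<delta> / 4" unfolding Z_def using d by (simp add: field_simps)
  qed
  have Z1: "1 \<le> Z" using Zge by simp
  have e1: "1 \<le> e" unfolding e_def using \<kappa> by simp
  have ZP: "1 \<le> Z ^ j" for j using Z1 by (rule one_le_power)
  have W4: "4 \<le> W"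
  proof -
    have "4 * 1 * 1 * 1 * 1 \<le> 132710400 * (1 + b)\<^sup>2 * (1 + \<kappa>) ^ 4 * Z ^ 28 * e"
      using b0 \<kappa> Z1 e1 by (intro mult_mono one_le_power mult_nonneg_nonneg) auto
    then show ?thesis unfolding W_def e_def by simp
  qed
  have w0: "0 < w" unfolding w_def using \<kappa> ch W4 by simp
  have N0: "0 < N" unfolding N_def using b0 W4 Z1 by (intro mult_pos_pos) auto
  have r2: "r\<^sup>2 = 1 / (460800 * Z ^ 15 * (1 + \<kappa>)\<^sup>2 * ch * (1 + \<beta> * ch))" and r0: "0 < r"
  proof -
    have "0 < 460800 * Z ^ 15 * (1 + \<kappa>)\<^sup>2 * ch * (1 + \<beta> * ch)"
      using Z1 \<kappa> ch b0 unfolding b_def by (intro mult_pos_pos) auto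
    then show "r\<^sup>2 = 1 / (460800 * Z ^ 15 * (1 + \<kappa>)\<^sup>2 * ch * (1 + \<beta> * ch))" "0 < r"
      unfolding r_def by auto
  qed
  obtain L where L0: "0 \<le> L" and L: "\<forall>t\<le>T. lip Z t L"
    using traj_lipschitz_crude[of Z] Z1 by auto
  define R where "R = Suc (nat \<lceil>L * w / r\<rceil>)"
  have R0: "0 < R" unfolding R_def by simp
  have LR: "L * (w / real R) \<le> r"
  proof -
    have "L * w / r \<le> real R" unfolding R_def by linarith
    then show ?thesis using r0 R0 by (simp add: field_simps)
  qed
  \<comment> \<open>Since \<open>k w \<le> \<eta>\<close>, this is at least \<open>4 c\<close>: a factor 2 is lost in \<open>good_transfer\<close>, another one makes room for its
    remainder.\<close>
  define C where "C k = 4 * (\<kappa> / (real k * w))" for k :: nat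
  define KK where "KK = {k::nat. 1 \<le> k \<and> W / 2 \<le> real k \<and> real k \<le> b * W * Z ^ 8 \<and> (\<forall>p<m. absact rs p \<le> C k)}"
  have KKfin: "finite KK"
  proof (rule finite_subset)
    show "KK \<subseteq> {..nat \<lfloor>b * W * Z ^ 8\<rfloor>}" unfolding KK_def by (auto simp: le_nat_floor)
  qed simp
  have cardKK: "real (card KK) \<le> b * W * Z ^ 8"
  proof -
    have nn: "0 \<le> b * W * Z ^ 8" using b0 W4 Z1 by simp
    have "KK \<subseteq> {1..nat \<lfloor>b * W * Z ^ 8\<rfloor>}" unfolding KK_def by (auto simp: le_nat_floor)
    then have "card KK \<le> card {1..nat \<lfloor>b * W * Z ^ 8\<rfloor>}" by (intro card_mono) auto
    then show ?thesis using nn by (simp add: le_nat_iff) linarith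
  qed
  have C8: "C k \<le> 8 * ch" if "k \<in> KK" for k
  proof -
    have k: "W / 2 \<le> real k" using that unfolding KK_def by simp
    have "\<kappa> / (real k * w) \<le> \<kappa> / (W / 2 * w)" using k w0 W4 \<kappa> by (intro divide_left_mono mult_right_mono mult_pos_pos) auto
    also have "\<dots> = 2 * ch" unfolding w_def using \<kappa> ch W4 by simp
    finally show ?thesis unfolding C_def by simp
  qed
  have C0: "0 < C k" if "k \<in> KK" for k using that \<kappa> w0 unfolding C_def KK_def by simp
  \<comment> \<open>The exceptional events: a large sample, a large variation in some cell, a large excess at some net point.\<close>
  define B1 where "B1 = {x \<in> space \<Omega>. real n * real T / (\<delta> / 4) \<le> (\<Sum>t<T. sqn n (x t))}"
  define B2 where "B2 = (\<lambda>(k, t). {x \<in> space \<Omega>. r \<le> variation (real k * w) w R (C k) x t})"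
  define p where "p = \<delta> / (4 * N)"
  have p0: "0 < p" unfolding p_def using d N0 by simp
  define B3 where "B3 k = {x \<in> space \<Omega>. 22 * \<kappa> * (C k * \<tau>) * real T + 16 * (C k * \<tau>) * ln (1 / p) \<le> (\<Sum>s<T. good_excess \<kappa> rs (gam (real k * w)) (C k) x s)}" for k
  have m1: "B1 \<in> sets \<Omega>"
  proof -
    have "(\<lambda>x. \<Sum>t<T. sqn n (x t)) \<in> borel_measurable \<Omega>"
      using \<Omega>_entry by (intro borel_measurable_sum borel_measurable_power) auto
    then show ?thesis unfolding B1_def by (intro borel_measurable_le) auto
  qed
  have m2: "B2 kt \<in> sets \<Omega>" if "kt \<in> KK \<times> {..<T}" for kt
    using that variation_measurable[of "snd kt"] unfolding B2_def by (auto simp: split_beta intro!: borel_measurable_le)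
  have m3: "B3 k \<in> sets \<Omega>" for k
  proof -
    have "(\<lambda>x. \<Sum>s<T. good_excess \<kappa> rs (gam (real k * w)) (C k) x s) \<in> borel_measurable \<Omega>"
      by (intro borel_measurable_sum good_excess_measurable) auto
    then show ?thesis unfolding B3_def by (intro borel_measurable_le) auto
  qed
  have e1': "emeasure \<Omega> B1 \<le> ennreal (\<delta> / 4)" unfolding B1_def using sum_sq_norm_tail[of "\<delta> / 4"] d by simp
  define v where "v = 288 * ch * \<tau> * (real T)\<^sup>2 * w\<^sup>2 * e / r\<^sup>2"
  have v0: "0 \<le> v" unfolding v_def using ch \<tau>1 e1 by simp
  have e2: "emeasure \<Omega> (\<Union>kt\<in>KK \<times> {..<T}. B2 kt) \<le> ennreal (\<delta> / 4)"
  proof -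
    have "emeasure \<Omega> (\<Union>kt\<in>KK \<times> {..<T}. B2 kt) \<le> (\<Sum>kt\<in>KK \<times> {..<T}. emeasure \<Omega> (B2 kt))"
      using KKfin m2 by (intro emeasure_subadditive_finite) auto
    also have "\<dots> \<le> (\<Sum>kt\<in>KK \<times> {..<T}. ennreal v)"
    proof (rule sum_mono)
      fix kt assume kt: "kt \<in> KK \<times> {..<T}"
      obtain k t where kt': "kt = (k, t)" "k \<in> KK" "t < T" using kt by auto
      have k1: "1 \<le> k" using kt'(2) unfolding KK_def by simp
      have "emeasure \<Omega> (B2 kt) \<le> ennreal (36 * C k * \<tau> * (real T)\<^sup>2 * w\<^sup>2 * exp (40 * \<kappa> * real T) / r\<^sup>2)"
        unfolding B2_def kt'(1) prod.case by (rule variation_tail[OF w0 k1 R0 \<kappa> r0]) (use kt' in \<open>auto simp: C_def\<close>)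
      also have "\<dots> \<le> ennreal v"
      proof (rule ennreal_leI)
        have "36 * C k * \<tau> * (real T)\<^sup>2 * w\<^sup>2 * e / r\<^sup>2 \<le> 36 * (8 * ch) * \<tau> * (real T)\<^sup>2 * w\<^sup>2 * e / r\<^sup>2"
          using C8[OF kt'(2)] \<tau>1 e1 by (intro divide_right_mono mult_right_mono mult_left_mono) auto
        then show "36 * C k * \<tau> * (real T)\<^sup>2 * w\<^sup>2 * exp (40 * \<kappa> * real T) / r\<^sup>2 \<le> v" unfolding v_def e_def by simp
      qed
      finally show "emeasure \<Omega> (B2 kt) \<le> ennreal v" .
    qed
    also have "\<dots> = ennreal (real (card KK * T) * v)"
      by (simp add: ennreal_mult' ennreal_of_nat_eq_real_of_nat card_cartesian_product)
    also have "\<dots> \<le> ennreal (\<delta> / 4)"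
    proof (rule ennreal_leI)
      have r2i: "1 / r\<^sup>2 = 460800 * Z ^ 15 * (1 + \<kappa>)\<^sup>2 * ch * (1 + b)" unfolding r2 b_def by simp
      have "real (card KK * T) * v = (real (card KK) * real T) * v" by simp
      also have "\<dots> \<le> (b * W * Z ^ 8 * real T) * v" using cardKK v0 by (intro mult_right_mono) auto
      also have "\<dots> = b * W * Z ^ 8 * real T * (288 * ch * \<tau> * (real T)\<^sup>2 * (\<kappa> / (ch * W))\<^sup>2 * e * (1 / r\<^sup>2))"
        unfolding v_def w_def by simp
      also have "\<dots> = (132710400 * e * b * (1 + b) * \<kappa>\<^sup>2 * (1 + \<kappa>)\<^sup>2 * (real T ^ 3 * \<tau>) * Z ^ 23) / W"
        unfolding r2i using ch W4 by (simp add: power_divide power_mult_distrib power2_eq_square eval_nat_numeral field_simps)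
      also have "\<dots> \<le> (132710400 * e * (1 + b) * (1 + b) * (1 + \<kappa>)\<^sup>2 * (1 + \<kappa>)\<^sup>2 * (Z ^ 3 * Z) * Z ^ 23) / W"
        using Zge \<tau>m \<tau>1 b0 \<kappa> e1 W4 Z1 by (intro divide_right_mono mult_mono power_mono mult_nonneg_nonneg) auto
      also have "\<dots> = (132710400 * (1 + b)\<^sup>2 * (1 + \<kappa>) ^ 4 * Z ^ 28 * e) / (W * Z)"
        using Z1 W4 by (simp add: power2_eq_square eval_nat_numeral field_simps)
      also have "\<dots> = 1 / Z" 
      proof -
        have "1 + \<kappa> \<noteq> 0" "1 + b \<noteq> 0" using \<kappa> b0 by auto
        then show ?thesis using Z1 unfolding W_def e_def by simp
      qed
      also have "\<dots> \<le> \<delta> / 4" by (rule dZ)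
      finally show "real (card KK * T) * v \<le> \<delta> / 4" .
    qed
    finally show ?thesis .
  qed
  have e3: "emeasure \<Omega> (\<Union>k\<in>KK. B3 k) \<le> ennreal (\<delta> / 4)"
  proof -
    have "emeasure \<Omega> (\<Union>k\<in>KK. B3 k) \<le> (\<Sum>k\<in>KK. emeasure \<Omega> (B3 k))"
      using KKfin m3 by (intro emeasure_subadditive_finite) auto
    also have "\<dots> \<le> (\<Sum>k\<in>KK. ennreal p)"
    proof (rule sum_mono)
      fix k assume k: "k \<in> KK"
      have y: "0 \<le> real k * w" using w0 by simp
      have rsk: "\<And>p. p < m \<Longrightarrow> absact rs p \<le> C k" using k unfolding KK_def by simp
      show "emeasure \<Omega> (B3 k) \<le> ennreal p" unfolding B3_def
        by (rule good_excess_tail[OF gam_bounds(1)[OF y] gam_bounds(2)[OF y] C0[OF k] _ p0 rs rsk]) (use \<kappa> in auto)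
    qed
    also have "\<dots> = ennreal (real (card KK) * p)" using p0 by (simp add: ennreal_mult' ennreal_of_nat_eq_real_of_nat)
    also have "\<dots> \<le> ennreal (\<delta> / 4)"
    proof (rule ennreal_leI)
      have "b * W * Z ^ 8 \<le> N" unfolding N_def using W4 Z1 by (intro mult_right_mono) auto
      then have "real (card KK) * p \<le> N * p" using cardKK p0 by (intro mult_right_mono) auto
      then show "real (card KK) * p \<le> \<delta> / 4" unfolding p_def using N0 by simp
    qed
    finally show ?thesis .
  qed
  define Bad where "Bad = B1 \<union> (\<Union>kt\<in>KK \<times> {..<T}. B2 kt) \<union> (\<Union>k\<in>KK. B3 k)"
  have u2: "(\<Union>kt\<in>KK \<times> {..<T}. B2 kt) \<in> sets \<Omega>" using KKfin m2 by (intro sets.finite_UN) auto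
  have u3: "(\<Union>k\<in>KK. B3 k) \<in> sets \<Omega>" using KKfin m3 by (intro sets.finite_UN) auto
  have BadS: "Bad \<in> sets \<Omega>" unfolding Bad_def using m1 u2 u3 by auto
  interpret P: prob_space \<Omega> by (rule prob_space_\<Omega>)
  have mb: "measure \<Omega> Bad \<le> \<delta>"
  proof -
    have me: "measure \<Omega> S \<le> q" if "emeasure \<Omega> S \<le> ennreal q" "0 \<le> q" for S q
      using that by (simp add: P.emeasure_eq_measure)
    have "measure \<Omega> Bad \<le> measure \<Omega> (B1 \<union> (\<Union>kt\<in>KK \<times> {..<T}. B2 kt)) + measure \<Omega> (\<Union>k\<in>KK. B3 k)"
      unfolding Bad_def using m1 u2 u3 by (intro measure_Un_le) auto
    also have "measure \<Omega> (B1 \<union> (\<Union>kt\<in>KK \<times> {..<T}. B2 kt)) \<le> measure \<Omega> B1 + measure \<Omega> (\<Union>kt\<in>KK \<times> {..<T}. B2 kt)"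
      using m1 u2 by (intro measure_Un_le) auto
    finally show ?thesis using me[OF e1'] me[OF e2] me[OF e3] d by linarith
  qed
  show ?thesis
  proof (intro bexI[of _ "space \<Omega> - Bad"] conjI ballI allI impI)
    show "space \<Omega> - Bad \<in> sets \<Omega>" using BadS by auto
    show "1 - \<delta> \<le> measure \<Omega> (space \<Omega> - Bad)" using mb P.prob_compl[OF BadS] by simp
    fix x \<eta> c
    assume x: "x \<in> space \<Omega> - Bad" and \<eta>0: "0 < \<eta>" and c: "c = \<kappa> / \<eta>" "c \<le> ch" and good: "\<forall>t<T. good (gam \<eta>) c x t"
      and rsc: "\<forall>p<m. absact rs p \<le> c" and rsb: "bil rs rs \<le> c * \<tau>" and \<kappa>c: "4 * \<kappa>\<^sup>2 * real T \<le> \<beta> * c"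
      and rs0: "bdist rs (rho (\<lambda>_. 0)) \<le> 16 * (\<beta> * c)\<^sup>2 * (c * \<tau>)"
    have c0: "0 < c" unfolding c using \<kappa> \<eta>0 by simp
    have xZ: "sqn n (x t) \<le> Z" if t: "t < T" for t
    proof -
      have "sqn n (x t) \<le> (\<Sum>t<T. sqn n (x t))" using t by (intro member_le_sum) (auto intro!: sum_nonneg)
      also have "\<dots> \<le> real n * real T / (\<delta> / 4)" using x unfolding Bad_def B1_def by auto
      also have "\<dots> \<le> real m * real T / (\<delta> / 4)" using nm d by (intro divide_right_mono mult_right_mono) auto
      also have "\<dots> = Z" unfolding Z_def by simp
      finally show ?thesis .
    qed
    define M where "M = max 1 (ln (real T * real m / \<delta>))"
    have M1: "1 \<le> M" "ln (real T * real m / \<delta>) \<le> M" unfolding M_def by auto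
    have sT: "1 \<le> sqrt (real T)" using T1 by simp
    have F: "c * \<tau> * (A * (sqrt (real T) * (1 + sqrt b) * M)) = A * (c * \<tau>) * sqrt (real T) * (1 + sqrt (\<beta> * ch)) * max 1 (ln (real T * real m / \<delta>))" for A
      unfolding M_def b_def by simp
    have one: "1 \<le> sqrt (real T) * (1 + sqrt b) * M"
      using mult_mono[of 1 "sqrt (real T) * (1 + sqrt b)" 1 M] mult_mono[of 1 "sqrt (real T)" 1 "1 + sqrt b"] sT b0 M1 by auto
    have "(\<Sum>t<T. step_excess \<kappa> rs (gam \<eta>) x t) \<le> c * \<tau> * (25000 * (sqrt (real T) * (1 + sqrt b) * M))"
    proof (cases "1 / Z ^ 8 \<le> \<beta> * c")
      case False
      have gc: "gam \<eta> * c \<le> \<kappa>"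
      proof -
        have "gam \<eta> * c \<le> \<eta> * c" using gam_bounds(3)[of \<eta>] \<eta>0 c0 by (intro mult_right_mono) auto
        then show ?thesis unfolding c using \<eta>0 by simp
      qed
      have \<kappa>c': "\<kappa>\<^sup>2 * real T \<le> \<beta> * c"
      proof -
        have "0 \<le> \<kappa>\<^sup>2 * real T" by simp
        then show ?thesis using \<kappa>c by linarith
      qed
      have "step_excess \<kappa> rs (gam \<eta>) x t \<le> 13 * (c * \<tau>) / real T" if t: "t < T" for t
        by (rule small_scale_excess[OF gam_bounds(1,2) gc _ \<kappa>c' c0 t Z1 Zge(1) xZ _ _ rsb rs0])
          (use False \<kappa> \<eta>0 good in auto)
      then have "(\<Sum>t<T. step_excess \<kappa> rs (gam \<eta>) x t) \<le> (\<Sum>t<T. 13 * (c * \<tau>) / real T)" by (intro sum_mono) auto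
      also have "\<dots> = c * \<tau> * 13" using T1 by simp
      also have "\<dots> \<le> c * \<tau> * (25000 * (sqrt (real T) * (1 + sqrt b) * M))"
        using one c0 \<tau>1 by (intro mult_left_mono) auto
      finally show ?thesis .
    next
      case True
      \<comment> \<open>the cell that contains \<open>\<eta>\<close>\<close>
      define k where "k = nat \<lfloor>\<eta> / w\<rfloor>"
      have ew: "0 \<le> \<eta> / w" using \<eta>0 w0 by simp
      have k: "real k \<le> \<eta> / w" "\<eta> / w < real k + 1" unfolding k_def using ew by linarith+
      have eW: "W \<le> \<eta> / w"
      proof -
        have "\<eta> / w = \<eta> * ch * W / \<kappa>" unfolding w_def by simp
        moreover have "\<kappa> \<le> \<eta> * ch"
        proof -
          have "\<eta> * c = \<kappa>" unfolding c using \<eta>0 by simp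
          then show ?thesis using mult_left_mono[OF c(2), of \<eta>] \<eta>0 by simp
        qed
        moreover have "\<kappa> * W / \<kappa> \<le> \<eta> * ch * W / \<kappa>"
          using calculation(2) \<kappa> W4 by (intro divide_right_mono mult_right_mono) auto
        ultimately show ?thesis using \<kappa> by simp
      qed
      have k1: "1 \<le> k" and kW: "W / 2 \<le> real k"
      proof -
        show "W / 2 \<le> real k" using k eW W4 by linarith
        have "1 \<le> real k" using k eW W4 by linarith
        then show "1 \<le> k" by simp
      qed
      have kN: "real k \<le> b * W * Z ^ 8"
      proof -
        have "\<eta> * (1 / Z ^ 8) \<le> \<eta> * (\<beta> * c)" using True \<eta>0 by (intro mult_left_mono) auto
        also have "\<dots> = \<beta> * \<kappa>" unfolding c using \<eta>0 by simp
        finally have "\<eta> \<le> \<beta> * \<kappa> * Z ^ 8" using Z1 by (simp add: field_simps)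
        then have "\<eta> / w \<le> \<beta> * \<kappa> * Z ^ 8 / w" using w0 by (intro divide_right_mono) auto
        also have "\<dots> = b * W * Z ^ 8" unfolding w_def b_def using \<kappa> by simp
        finally show ?thesis using k by simp
      qed
      have \<eta>k: "real k * w \<le> \<eta>" "\<eta> \<le> real k * w + w" using k w0 by (auto simp: field_simps)
      have cC: "4 * c \<le> C k"
        unfolding c C_def using \<eta>k(1) \<kappa> k1 w0 \<eta>0 by (simp add: frac_le)
      have kK: "k \<in> KK" unfolding KK_def using k1 kW kN rsc cC c0 by (auto intro: order_trans[of _ c])
      have l: "ln (1 / p) = ln (4 * N / \<delta>)" unfolding p_def by simp
      have l1: "ln (4 * N / \<delta>) \<le> 6 * sqrt b + 44 * (\<kappa> * real T) + 101 + 37 * ln (real T * real m / \<delta>)"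
        by (rule log_net_size[OF d _ _ Z_def W_def N_def]) (use b0 \<kappa> in auto)
      have l0: "0 \<le> ln (1 / p)"
      proof -
        have "1 * 1 * 1 \<le> (1 + b) * W * Z ^ 8" using b0 W4 ZP[of 8] by (intro mult_mono mult_nonneg_nonneg) auto
        then have "1 \<le> N" unfolding N_def by simp
        then have "1 \<le> 4 * N / \<delta>" using d by (simp add: field_simps)
        then show ?thesis unfolding l by (rule ln_ge_zero)
      qed
      have \<kappa>T: "\<kappa> * real T \<le> sqrt b * sqrt (real T)"
      proof (rule power2_le_imp_le)
        have "4 * \<kappa>\<^sup>2 * real T \<le> b" using \<kappa>c mult_left_mono[OF c(2), of \<beta>] \<beta>0 unfolding b_def by linarith
        moreover have "0 \<le> \<kappa>\<^sup>2 * real T" by simp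
        ultimately have "\<kappa>\<^sup>2 * real T \<le> b" by linarith
        then have "\<kappa>\<^sup>2 * real T * real T \<le> b * real T" using T1 by (intro mult_right_mono) auto
        then show "(\<kappa> * real T)\<^sup>2 \<le> (sqrt b * sqrt (real T))\<^sup>2"
          using b0 by (simp add: power_mult_distrib power2_eq_square[of "real T"] mult.assoc)
      qed (use b0 in simp)
      have "(\<Sum>t<T. step_excess \<kappa> rs (gam \<eta>) x t) \<le> c * \<tau> * (1 + 176 * (\<kappa> * real T) + 128 * ln (1 / p))"
      proof (rule cell_excess[OF d ch \<kappa> Z_def r2 r0 w0 k1 \<eta>k R0 c True C_def _ LR L0 xZ _ _ rsb _ l0])
        show "ndist (traj \<gamma> x t) (traj \<gamma>' x t) \<le> L * \<bar>\<gamma> - \<gamma>'\<bar>"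
          if "0 \<le> \<gamma>" "\<gamma> \<le> \<beta>" "0 \<le> \<gamma>'" "\<gamma>' \<le> \<beta>" "t \<le> T" for \<gamma> \<gamma>' t
          using L xZ that by blast
        show "variation (real k * w) w R (C k) x t \<le> r" if "t < T" for t
          using x kK that unfolding Bad_def B2_def by force
        show "good (gam \<eta>) c x t" if "t < T" for t using good that by simp
        show "(\<Sum>s<T. good_excess \<kappa> rs (gam (real k * w)) (C k) x s) \<le> 22 * \<kappa> * (C k * \<tau>) * real T + 16 * (C k * \<tau>) * ln (1 / p)"
          using x kK unfolding Bad_def B3_def by force
      qed
      also have "\<dots> \<le> c * \<tau> * (25000 * (sqrt (real T) * (1 + sqrt b) * M))"
      proof (rule mult_left_mono)
        define Q where "Q = sqrt (real T) * (1 + sqrt b) * M"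
        have q1: "1 \<le> Q" unfolding Q_def by (rule one)
        have a: "sqrt (real T) * (1 + sqrt b) * 1 \<le> Q" unfolding Q_def using M1 sT b0 by (intro mult_left_mono) auto
        have "1 * 1 * M \<le> Q" unfolding Q_def using M1 sT b0 by (intro mult_right_mono mult_mono) auto
        then have q2: "ln (real T * real m / \<delta>) \<le> Q" using M1 by linarith
        have "sqrt b * sqrt (real T) \<le> sqrt (real T) * (1 + sqrt b) * 1" by (simp add: algebra_simps)
        then have q3: "\<kappa> * real T \<le> Q" using \<kappa>T a by linarith
        have "1 * (1 + sqrt b) * 1 \<le> sqrt (real T) * (1 + sqrt b) * 1" using sT b0 by (intro mult_right_mono) auto
        then have "1 * (1 + sqrt b) * 1 \<le> Q" using a by (rule order_trans)
        then have q4: "sqrt b \<le> Q" by simp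
        have "1 + 176 * (\<kappa> * real T) + 128 * ln (1 / p) \<le> 25000 * Q"
          using l1 q1 q2 q3 q4 unfolding l by linarith
        then show "1 + 176 * (\<kappa> * real T) + 128 * ln (1 / p) \<le> 25000 * (sqrt (real T) * (1 + sqrt b) * M)" unfolding Q_def .
        show "0 \<le> c * \<tau>" using c0 \<tau>1 by simp
      qed
      finally show ?thesis .
    qed
    then show "(\<Sum>t<T. step_excess \<kappa> rs (gam \<eta>) x t)
        \<le> 25000 * (c * \<tau>) * sqrt (real T) * (1 + sqrt (\<beta> * ch)) * max 1 (ln (real T * real m / \<delta>))"
      unfolding F .
  qed
qed

end



section \<open>Spectral theorem and functional calculus\<close>

lemma square_mult_closed: "A \<in> carrier_mat n n \<Longrightarrow> B \<in> carrier_mat n n \<Longrightarrow> A * B \<in> carrier_mat n n"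
  by simp

lemma mult_entry:
  assumes "A \<in> carrier_mat r k" "B \<in> carrier_mat k c" "i < r" "j < c"
  shows "(A * B) $$ (i, j) = (\<Sum>l<k. A $$ (i, l) * B $$ (l, j))"
  using assms by (auto simp: scalar_prod_def atLeast0LessThan)

lemma mult_vec_entry:
  assumes "A \<in> carrier_mat r k" "v \<in> carrier_vec k" "i < r"
  shows "(A *\<^sub>v v) $ i = (\<Sum>l<k. A $$ (i, l) * v $ l)"
  using assms by (auto simp: scalar_prod_def atLeast0LessThan)

lemma scalar_prod_sum:
  assumes "w \<in> carrier_vec n" shows "v \<bullet> w = (\<Sum>i<n. v $ i * w $ i)"
  using assms by (auto simp: scalar_prod_def atLeast0LessThan)

lemma sym_mat_entry: "sym_mat n A \<Longrightarrow> i < n \<Longrightarrow> j < n \<Longrightarrow> A $$ (i, j) = A $$ (j, i)"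
  unfolding sym_mat_def by (metis carrier_matD index_transpose_mat(1))

lemma sym_matI:
  assumes "A \<in> carrier_mat n n" "\<And>i j. i < n \<Longrightarrow> j < n \<Longrightarrow> A $$ (i, j) = A $$ (j, i)"
  shows "sym_mat n A"
  unfolding sym_mat_def using assms by (auto intro!: eq_matI)

text \<open>Over the complex numbers an eigenvector exists. Pairing its real and imaginary parts shows that the
  eigenvalue is real, so whichever part does not vanish is an eigenvector.\<close>

lemma symmetric_real_eigenvector:
  assumes A: "sym_mat n A" and n: "n > 0"
  shows "\<exists>v\<in>carrier_vec n. \<exists>k. v \<noteq> 0\<^sub>v n \<and> A *\<^sub>v v = k \<cdot>\<^sub>v v"
proof -
  have Ac: "A \<in> carrier_mat n n" using A unfolding sym_mat_def by simp
  let ?A = "map_mat complex_of_real A"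
  have cA: "?A \<in> carrier_mat n n" using Ac by simp
  obtain k where "eigenvalue ?A k" using spectrum_non_empty[OF cA n] unfolding spectrum_def by auto
  then obtain v where v: "v \<in> carrier_vec n" "v \<noteq> 0\<^sub>v n" "?A *\<^sub>v v = k \<cdot>\<^sub>v v"
    unfolding eigenvalue_def eigenvector_def using cA by auto
  define x where "x = vec n (\<lambda>i. Re (v $ i))"
  define y where "y = vec n (\<lambda>i. Im (v $ i))"
  have xy: "x \<in> carrier_vec n" "y \<in> carrier_vec n" by (auto simp: x_def y_def)
  have ev: "(\<Sum>l<n. complex_of_real (A $$ (i, l)) * v $ l) = k * v $ i" if i: "i < n" for i
  proof -
    have "(?A *\<^sub>v v) $ i = k * v $ i" unfolding v(3) using i v(1) by simp
    then show ?thesis using mult_vec_entry[OF cA v(1) i] Ac i by simp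
  qed
  have Ax: "(A *\<^sub>v x) $ i = Re k * x $ i - Im k * y $ i" if i: "i < n" for i
  proof -
    have "Re (\<Sum>l<n. complex_of_real (A $$ (i, l)) * v $ l) = (\<Sum>l<n. A $$ (i, l) * x $ l)" by (simp add: x_def)
    then show ?thesis unfolding ev[OF i] using mult_vec_entry[OF Ac xy(1) i] i by (simp add: x_def y_def)
  qed
  have Ay: "(A *\<^sub>v y) $ i = Re k * y $ i + Im k * x $ i" if i: "i < n" for i
  proof -
    have "Im (\<Sum>l<n. complex_of_real (A $$ (i, l)) * v $ l) = (\<Sum>l<n. A $$ (i, l) * y $ l)" by (simp add: y_def)
    then show ?thesis unfolding ev[OF i] using mult_vec_entry[OF Ac xy(2) i] i by (simp add: x_def y_def)
  qed
  have "(\<Sum>i<n. y $ i * (A *\<^sub>v x) $ i) = (\<Sum>i<n. \<Sum>l<n. y $ i * (A $$ (i, l) * x $ l))"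
    using mult_vec_entry[OF Ac xy(1)] by (simp add: sum_distrib_left)
  also have "\<dots> = (\<Sum>l<n. \<Sum>i<n. y $ i * (A $$ (i, l) * x $ l))" by (rule sum.swap)
  also have "\<dots> = (\<Sum>l<n. x $ l * (A *\<^sub>v y) $ l)"
    using mult_vec_entry[OF Ac xy(2)] sym_mat_entry[OF A] by (auto simp: sum_distrib_left mult_ac intro!: sum.cong)
  finally have "(\<Sum>i<n. y $ i * (Re k * x $ i - Im k * y $ i)) = (\<Sum>i<n. x $ i * (Re k * y $ i + Im k * x $ i))"
    using Ax Ay by simp
  then have "Im k * (\<Sum>i<n. (x $ i)\<^sup>2 + (y $ i)\<^sup>2) = 0"
    by (simp add: algebra_simps sum.distrib sum_subtractf sum_distrib_left power2_eq_square)
  moreover have nz: "(\<Sum>i<n. (x $ i)\<^sup>2 + (y $ i)\<^sup>2) \<noteq> 0"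
  proof
    assume "(\<Sum>i<n. (x $ i)\<^sup>2 + (y $ i)\<^sup>2) = 0"
    then have "\<forall>i\<in>{..<n}. (x $ i)\<^sup>2 + (y $ i)\<^sup>2 = 0" by (subst (asm) sum_nonneg_eq_0_iff) auto
    then have "\<forall>i<n. v $ i = 0" by (auto simp: x_def y_def complex_eq_iff sum_power2_eq_zero_iff)
    then have "v = 0\<^sub>v n" using v(1) by (intro eq_vecI) auto
    then show False using v(2) by simp
  qed
  ultimately have k0: "Im k = 0" by simp
  have "x \<noteq> 0\<^sub>v n \<or> y \<noteq> 0\<^sub>v n" using nz by auto
  moreover have "A *\<^sub>v x = Re k \<cdot>\<^sub>v x" "A *\<^sub>v y = Re k \<cdot>\<^sub>v y"
    using Ax Ay k0 xy Ac by (auto intro!: eq_vecI)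
  ultimately show ?thesis using xy by blast
qed

text \<open>A Householder reflection moves the first basis vector to a given unit vector.\<close>

lemma householder:
  assumes v: "v \<in> carrier_vec (Suc n)" and v1: "(\<Sum>i<Suc n. (v $ i)\<^sup>2) = (1::real)"
  shows "\<exists>H\<in>carrier_mat (Suc n) (Suc n). H\<^sup>T = H \<and> H * H = 1\<^sub>m (Suc n) \<and> (\<forall>i<Suc n. H $$ (i, 0) = v $ i)"
proof (cases "v $ 0 = 1")
  case True
  have "(\<Sum>i<Suc n. (v $ i)\<^sup>2) = (v $ 0)\<^sup>2 + (\<Sum>i<n. (v $ Suc i)\<^sup>2)" by (rule sum.lessThan_Suc_shift)
  then have "(\<Sum>i<n. (v $ Suc i)\<^sup>2) = 0" using v1 True by simp
  then have "\<forall>i\<in>{..<n}. (v $ Suc i)\<^sup>2 = 0" by (subst (asm) sum_nonneg_eq_0_iff) auto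
  then have "v $ i = (if i = 0 then 1 else 0)" if "i < Suc n" for i using True that by (cases i) auto
  then show ?thesis by (intro bexI[of _ "1\<^sub>m (Suc n)"]) auto
next
  case False
  define w where "w i = v $ i - (if i = 0 then 1 else 0)" for i
  define s where "s = (\<Sum>i<Suc n. (w i)\<^sup>2)"
  have e0: "(\<Sum>i<Suc n. f i * (if i = 0 then 1 else 0)) = f 0" for f :: "nat \<Rightarrow> real"
    by (subst sum.lessThan_Suc_shift) simp
  have s: "s = 2 - 2 * v $ 0"
  proof -
    have "s = (\<Sum>i<Suc n. (v $ i)\<^sup>2) - 2 * (\<Sum>i<Suc n. v $ i * (if i = 0 then 1 else 0)) + (\<Sum>i<Suc n. 1 * (if i = 0 then 1 else 0))"
      unfolding s_def w_def sum_distrib_left sum_subtractf[symmetric] sum.distrib[symmetric]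
      by (intro sum.cong refl) (auto simp: power2_eq_square algebra_simps)
    then show ?thesis unfolding e0 v1 by simp
  qed
  have s0: "s \<noteq> 0" using False s by simp
  define H where "H = mat (Suc n) (Suc n) (\<lambda>(i, j). (if i = j then 1 else 0) - 2 * w i * w j / s)"
  have H: "H \<in> carrier_mat (Suc n) (Suc n)" unfolding H_def by simp
  show ?thesis
  proof (intro bexI[OF _ H] conjI allI impI)
    show "H\<^sup>T = H" unfolding H_def by (intro eq_matI) auto
    show "H * H = 1\<^sub>m (Suc n)"
    proof (rule eq_matI)
      fix i j assume "i < dim_row (1\<^sub>m (Suc n))" "j < dim_col (1\<^sub>m (Suc n))"
      then have ij: "i < Suc n" "j < Suc n" by auto
      have "(H * H) $$ (i, j) = (\<Sum>l<Suc n. ((if i = l then 1 else 0) - 2 * w i * w l / s) * ((if l = j then 1 else 0) - 2 * w l * w j / s))"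
        unfolding mult_entry[OF H H ij] by (intro sum.cong refl) (use ij in \<open>auto simp: H_def\<close>)
      also have "\<dots> = (\<Sum>l<Suc n. (if l = i then (if i = j then 1 else 0) - 2 * w i * w j / s else 0)
          - (if l = j then 2 * w i * w j / s else 0) + 4 * w i * w j / s\<^sup>2 * (w l)\<^sup>2)"
        by (intro sum.cong refl) (auto simp: algebra_simps power2_eq_square)
      also have "\<dots> = ((if i = j then 1 else 0) - 2 * w i * w j / s) - 2 * w i * w j / s + 4 * w i * w j / s\<^sup>2 * s"
        unfolding sum.distrib sum_subtractf s_def[symmetric] sum_distrib_left[symmetric] using ij by simp
      also have "\<dots> = (if i = j then 1 else 0)" using s0 by (simp add: power2_eq_square field_simps)
      finally show "(H * H) $$ (i, j) = 1\<^sub>m (Suc n) $$ (i, j)" using ij by simp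
    qed (use H in auto)
    fix i assume i: "i < Suc n"
    have "H $$ (i, 0) = (if i = 0 then 1 else 0) - 2 * w i * (v $ 0 - 1) / s" unfolding H_def using i by (simp add: w_def)
    also have "\<dots> = (if i = 0 then 1 else 0) + w i"
    proof -
      have "v $ 0 - 1 = - s / 2" using s by simp
      then show ?thesis using s0 by simp
    qed
    finally show "H $$ (i, 0) = v $ i" unfolding w_def by simp
  qed
qed

definition spec :: "nat \<Rightarrow> real mat \<Rightarrow> real mat \<Rightarrow> field \<Rightarrow> bool" where
  "spec n A U d \<longleftrightarrow> U \<in> carrier_mat n n \<and> U\<^sup>T * U = 1\<^sub>m n \<and> A = U * mat_diag n d * U\<^sup>T"

lemma specD:
  assumes "spec n A U d"
  shows "U \<in> carrier_mat n n" "U\<^sup>T \<in> carrier_mat n n" "U\<^sup>T * U = 1\<^sub>m n" "U * U\<^sup>T = 1\<^sub>m n"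
    "A = U * mat_diag n d * U\<^sup>T" "A \<in> carrier_mat n n"
  using assms mat_mult_left_right_inverse[of "U\<^sup>T" n U] unfolding spec_def by auto

text \<open>Deflation: a reflection that maps the first basis vector to a unit eigenvector splits off a diagonal entry.\<close>

theorem spectral_decomposition:
  "sym_mat n A \<Longrightarrow> \<exists>U d. spec n A U d"
proof (induction n arbitrary: A)
  case 0
  then have "A \<in> carrier_mat 0 0" unfolding sym_mat_def by simp
  then have "spec 0 A (1\<^sub>m 0) (\<lambda>_. 0)" unfolding spec_def by (auto intro!: eq_matI)
  then show ?case by blast
next
  case (Suc n)
  have A: "A \<in> carrier_mat (Suc n) (Suc n)" using Suc.prems unfolding sym_mat_def by simp
  have AT: "A\<^sup>T = A" using Suc.prems unfolding sym_mat_def by simp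
  obtain u k where u: "u \<in> carrier_vec (Suc n)" "u \<noteq> 0\<^sub>v (Suc n)" "A *\<^sub>v u = k \<cdot>\<^sub>v u"
    using symmetric_real_eigenvector[OF Suc.prems] by auto
  define s where "s = (\<Sum>i<Suc n. (u $ i)\<^sup>2)"
  have s0: "0 \<le> s" unfolding s_def by (intro sum_nonneg) simp
  have "s \<noteq> 0"
  proof
    assume "s = 0"
    then have "\<forall>i\<in>{..<Suc n}. (u $ i)\<^sup>2 = 0" unfolding s_def by (subst (asm) sum_nonneg_eq_0_iff) auto
    then have "u = 0\<^sub>v (Suc n)" using u(1) by (intro eq_vecI) auto
    then show False using u(2) by simp
  qed
  then have s1: "0 < s" using s0 by simp
  define v where "v = (1 / sqrt s) \<cdot>\<^sub>v u"
  have v: "v \<in> carrier_vec (Suc n)" unfolding v_def using u by simp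
  have ev: "(A *\<^sub>v v) $ i = k * v $ i" if "i < Suc n" for i
  proof -
    have "A *\<^sub>v v = (1 / sqrt s) \<cdot>\<^sub>v (A *\<^sub>v u)" unfolding v_def using A u(1) by (rule mult_mat_vec)
    then show ?thesis unfolding u(3) v_def using that u(1) by simp
  qed
  have "(\<Sum>i<Suc n. (v $ i)\<^sup>2) = (\<Sum>i<Suc n. (u $ i)\<^sup>2 / s)"
    unfolding v_def using u(1) s0 by (intro sum.cong refl) (auto simp: power_divide)
  then have v1: "(\<Sum>i<Suc n. (v $ i)\<^sup>2) = 1" using s1 by (simp add: s_def flip: sum_divide_distrib)
  obtain H where H: "H \<in> carrier_mat (Suc n) (Suc n)" "H\<^sup>T = H" "H * H = 1\<^sub>m (Suc n)" and H0: "\<And>i. i < Suc n \<Longrightarrow> H $$ (i, 0) = v $ i"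
    using householder[OF v v1] by auto
  define B where "B = H * A * H"
  have B: "B \<in> carrier_mat (Suc n) (Suc n)" unfolding B_def using H A by simp
  have BT: "B\<^sup>T = B" unfolding B_def using H A AT
    by (simp add: square_mult_closed transpose_mult[of _ "Suc n" "Suc n" _ "Suc n"] assoc_mult_mat[of _ "Suc n" "Suc n" _ "Suc n" _ "Suc n"])
  have Bsym: "B $$ (i, j) = B $$ (j, i)" if "i < Suc n" "j < Suc n" for i j
    by (rule sym_mat_entry[of "Suc n"]) (use B BT that in \<open>auto simp: sym_mat_def\<close>)
  have AH: "(A * H) $$ (i, 0) = k * H $$ (i, 0)" if i: "i < Suc n" for i
  proof -
    have "(A * H) $$ (i, 0) = (\<Sum>l<Suc n. A $$ (i, l) * v $ l)"
      using mult_entry[OF A H(1) i, of 0] H0 by simp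
    also have "\<dots> = (A *\<^sub>v v) $ i" by (rule mult_vec_entry[OF A v i, symmetric])
    finally show ?thesis using ev[OF i] H0[OF i] by simp
  qed
  have B0: "B $$ (i, 0) = (if i = 0 then k else 0)" if i: "i < Suc n" for i
  proof -
    have "B = H * (A * H)" unfolding B_def using H A by (simp add: assoc_mult_mat[of _ "Suc n" "Suc n" _ "Suc n" _ "Suc n"])
    then have "B $$ (i, 0) = (\<Sum>l<Suc n. H $$ (i, l) * (A * H) $$ (l, 0))"
      using mult_entry[OF H(1) _ i, of "A * H" "Suc n" 0] A H by simp
    also have "\<dots> = (\<Sum>l<Suc n. H $$ (i, l) * (k * H $$ (l, 0)))" using AH by (intro sum.cong refl) (simp only: lessThan_iff)
    also have "\<dots> = k * (\<Sum>l<Suc n. H $$ (i, l) * H $$ (l, 0))"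
      by (simp add: sum_distrib_left mult_ac del: sum.lessThan_Suc)
    also have "(\<Sum>l<Suc n. H $$ (i, l) * H $$ (l, 0)) = (H * H) $$ (i, 0)" using mult_entry[OF H(1) H(1) i, of 0] by simp
    finally show ?thesis unfolding H(3) using i by simp
  qed
  define A' where "A' = mat n n (\<lambda>(i, j). B $$ (Suc i, Suc j))"
  have A': "A' \<in> carrier_mat n n" unfolding A'_def by simp
  have "sym_mat n A'" by (rule sym_matI[OF A']) (use Bsym in \<open>auto simp: A'_def\<close>)
  then obtain U' d' where U': "spec n A' U' d'" using Suc.IH by blast
  note U'D = specD[OF U']
  define W where "W = four_block_mat (1\<^sub>m 1) (0\<^sub>m 1 n) (0\<^sub>m n 1) U'"
  define d where "d i = (case i of 0 \<Rightarrow> k | Suc j \<Rightarrow> d' j)" for i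
  have W: "W \<in> carrier_mat (Suc n) (Suc n)" unfolding W_def using U'D(1) by auto
  have WT: "W\<^sup>T = four_block_mat (1\<^sub>m 1) (0\<^sub>m 1 n) (0\<^sub>m n 1) U'\<^sup>T"
    unfolding W_def by (subst transpose_four_block_mat[of _ 1 1 _ n _ n]) (use U'D in auto)
  have WW: "W\<^sup>T * W = 1\<^sub>m (Suc n)"
    unfolding WT unfolding W_def
    by (subst mult_four_block_mat[of _ 1 1 _ n _ n _ _ 1 _ n]) (use U'D in auto)
  have Bb: "B = four_block_mat (mat 1 1 (\<lambda>_. k)) (0\<^sub>m 1 n) (0\<^sub>m n 1) A'"
  proof (rule eq_matI)
    fix i j assume "i < dim_row (four_block_mat (mat 1 1 (\<lambda>_. k)) (0\<^sub>m 1 n) (0\<^sub>m n 1) A')"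
      "j < dim_col (four_block_mat (mat 1 1 (\<lambda>_. k)) (0\<^sub>m 1 n) (0\<^sub>m n 1) A')"
    then have ij: "i < Suc n" "j < Suc n" using A' by auto
    then show "B $$ (i, j) = four_block_mat (mat 1 1 (\<lambda>_. k)) (0\<^sub>m 1 n) (0\<^sub>m n 1) A' $$ (i, j)"
      using B0[of i] B0[of j] Bsym[of 0 j] A' by (cases i; cases j) (auto simp: A'_def)
  qed (use B A' in auto)
  have D: "mat_diag (Suc n) d = four_block_mat (mat 1 1 (\<lambda>_. k)) (0\<^sub>m 1 n) (0\<^sub>m n 1) (mat_diag n d')"
  proof (rule eq_matI)
    fix i j assume "i < dim_row (four_block_mat (mat 1 1 (\<lambda>_. k)) (0\<^sub>m 1 n) (0\<^sub>m n 1) (mat_diag n d'))"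
      "j < dim_col (four_block_mat (mat 1 1 (\<lambda>_. k)) (0\<^sub>m 1 n) (0\<^sub>m n 1) (mat_diag n d'))"
    then have ij: "i < Suc n" "j < Suc n" by (auto simp: mat_diag_def)
    then show "mat_diag (Suc n) d $$ (i, j) = four_block_mat (mat 1 1 (\<lambda>_. k)) (0\<^sub>m 1 n) (0\<^sub>m n 1) (mat_diag n d') $$ (i, j)"
      by (cases i; cases j) (auto simp: mat_diag_def d_def)
  qed (auto simp: mat_diag_def)
  have BW: "B = W * mat_diag (Suc n) d * W\<^sup>T"
  proof -
    have "W * mat_diag (Suc n) d = four_block_mat (mat 1 1 (\<lambda>_. k)) (0\<^sub>m 1 n) (0\<^sub>m n 1) (U' * mat_diag n d')"
      unfolding W_def D by (subst mult_four_block_mat[of _ 1 1 _ n _ n _ _ 1 _ n]) (use U'D(1,2) in \<open>auto simp: left_mult_zero_mat[OF mat_diag_dim]\<close>)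
    then have "W * mat_diag (Suc n) d * W\<^sup>T = four_block_mat (mat 1 1 (\<lambda>_. k)) (0\<^sub>m 1 n) (0\<^sub>m n 1) (U' * mat_diag n d' * U'\<^sup>T)"
      unfolding WT by (simp only:) (subst mult_four_block_mat[of _ 1 1 _ n _ n _ _ 1 _ n], use U'D(1,2) in \<open>auto simp: square_mult_closed left_mult_zero_mat[OF U'D(2)] right_mult_zero_mat[of _ n n]\<close>)
    then show ?thesis unfolding Bb using U'D(5) by simp
  qed
  define U where "U = H * W"
  have U: "U \<in> carrier_mat (Suc n) (Suc n)" unfolding U_def using H W by simp
  have UT: "U\<^sup>T = W\<^sup>T * H" unfolding U_def using transpose_mult[OF H(1) W] H(2) by simp
  note as = assoc_mult_mat[of _ "Suc n" "Suc n" _ "Suc n" _ "Suc n"]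
  have WTc: "W\<^sup>T \<in> carrier_mat (Suc n) (Suc n)" using W by simp
  have "U\<^sup>T * U = W\<^sup>T * (H * H * W)" unfolding UT unfolding U_def using H(1) W WTc by (simp add: square_mult_closed as)
  also have "\<dots> = 1\<^sub>m (Suc n)" unfolding H(3) using W WW by simp
  finally have UU: "U\<^sup>T * U = 1\<^sub>m (Suc n)" .
  have "U * mat_diag (Suc n) d * U\<^sup>T = H * (W * mat_diag (Suc n) d * W\<^sup>T) * H"
    unfolding UT unfolding U_def using H(1) W WTc by (simp add: square_mult_closed as)
  also have "\<dots> = H * (H * A * H) * H" unfolding BW[symmetric] B_def ..
  also have "\<dots> = (H * H) * A * (H * H)" using H(1) A by (simp add: square_mult_closed as)
  also have "\<dots> = A" unfolding H(3) using A by simp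
  finally have "A = U * mat_diag (Suc n) d * U\<^sup>T" by simp
  then have "spec (Suc n) A U d" unfolding spec_def using U UU by simp
  then show ?case by blast
qed

lemma spec_sym: "spec n A U d \<Longrightarrow> sym_mat n A"
proof -
  assume s: "spec n A U d"
  note D = specD[OF s]
  have dT: "(mat_diag n d)\<^sup>T = mat_diag n d" unfolding mat_diag_def by (intro eq_matI) auto
  have "A\<^sup>T = U * mat_diag n d * U\<^sup>T"
    unfolding D(5) using D(1,2) dT
    by (simp add: square_mult_closed transpose_mult[of _ n n _ n] assoc_mult_mat[of _ n n _ n _ n])
  then show ?thesis using D unfolding sym_mat_def by simp
qed

definition fcalc :: "nat \<Rightarrow> real mat \<Rightarrow> field \<Rightarrow> (real \<Rightarrow> real) \<Rightarrow> real mat" where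
  "fcalc n U d f = U * mat_diag n (\<lambda>i. f (d i)) * U\<^sup>T"

lemma spec_left: assumes "spec n A U d" shows "U\<^sup>T * A = mat_diag n d * U\<^sup>T"
proof -
  note D = specD[OF assms]
  have "U\<^sup>T * A = (U\<^sup>T * U) * mat_diag n d * U\<^sup>T"
    by (subst D(5)) (use D(1,2) in \<open>simp add: square_mult_closed assoc_mult_mat[of _ n n _ n _ n]\<close>)
  then show ?thesis unfolding D(3) using D(1) by (simp add: left_mult_one_mat[of _ n n])
qed

lemma spec_right: assumes "spec n A U d" shows "A * U = U * mat_diag n d"
proof -
  note D = specD[OF assms]
  have "A * U = U * mat_diag n d * (U\<^sup>T * U)"
    by (subst D(5)) (use D(1,2) in \<open>simp add: square_mult_closed assoc_mult_mat[of _ n n _ n _ n]\<close>)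
  then show ?thesis unfolding D(3) using D(1) by (simp add: square_mult_closed right_mult_one_mat[of _ n n])
qed

lemma spec_fun: assumes "spec n A U d" shows "spec n (fcalc n U d f) U (\<lambda>i. f (d i))"
  using specD[OF assms] unfolding spec_def fcalc_def by simp

lemma spec_fun_unique:
  assumes s: "spec n A U d" and s': "spec n A W e"
  shows "fcalc n U d f = fcalc n W e f"
proof -
  note D = specD[OF s] and D' = specD[OF s']
  note as = assoc_mult_mat[of _ n n _ n _ n]
  define P where "P = U\<^sup>T * W"
  have P: "P \<in> carrier_mat n n" unfolding P_def using D D' by simp
  have "mat_diag n d * P = U\<^sup>T * A * W" unfolding P_def spec_left[OF s] using D(1,2) D'(1,2) by (simp add: square_mult_closed as)
  also have "\<dots> = P * mat_diag n e" unfolding P_def using spec_right[OF s'] D(1,2,6) D'(1,2) by (simp add: square_mult_closed as)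
  finally have eq: "mat_diag n d * P = P * mat_diag n e" .
  have ent: "d i * P $$ (i, j) = P $$ (i, j) * e j" if "i < n" "j < n" for i j
  proof -
    have "(mat_diag n d * P) $$ (i, j) = (P * mat_diag n e) $$ (i, j)" using eq by simp
    then show ?thesis using that mat_diag_mult_left[OF P, of d] mat_diag_mult_right[OF P, of e] by simp
  qed
  have "f (d i) * P $$ (i, j) = P $$ (i, j) * f (e j)" if "i < n" "j < n" for i j
    using ent[OF that] by (cases "P $$ (i, j) = 0") auto
  then have eqf: "mat_diag n (\<lambda>i. f (d i)) * P = P * mat_diag n (\<lambda>i. f (e i))"
    using mat_diag_mult_left[OF P] mat_diag_mult_right[OF P] by (intro eq_matI) auto
  have "fcalc n U d f = U * mat_diag n (\<lambda>i. f (d i)) * U\<^sup>T * (W * W\<^sup>T)" unfolding fcalc_def D'(4) using D(1,2) by (simp add: square_mult_closed right_mult_one_mat[of _ n n])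
  also have "\<dots> = U * (mat_diag n (\<lambda>i. f (d i)) * P) * W\<^sup>T" unfolding P_def using D(1,2) D'(1,2) by (simp add: square_mult_closed as)
  also have "\<dots> = (U * U\<^sup>T) * W * mat_diag n (\<lambda>i. f (e i)) * W\<^sup>T" unfolding eqf unfolding P_def using D(1,2) D'(1,2) by (simp add: square_mult_closed as)
  also have "\<dots> = fcalc n W e f" unfolding D(4) fcalc_def using D'(1,2) by (simp add: square_mult_closed left_mult_one_mat[of _ n n])
  finally show ?thesis .
qed

lemma mat_fun_eq:
  assumes s: "spec n A U d" shows "mat_fun f A = fcalc n U d f"
proof -
  have n: "dim_row A = n" using specD[OF s] by auto
  show ?thesis unfolding mat_fun_def Let_def n
  proof (rule the_equality)
    show "\<exists>U' d'. U' \<in> carrier_mat n n \<and> U'\<^sup>T * U' = 1\<^sub>m n \<and> A = U' * mat_diag n d' * U'\<^sup>T \<and> fcalc n U d f = U' * mat_diag n (\<lambda>i. f (d' i)) * U'\<^sup>T"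
      using s unfolding spec_def fcalc_def by blast
    fix B assume "\<exists>U' d'. U' \<in> carrier_mat n n \<and> U'\<^sup>T * U' = 1\<^sub>m n \<and> A = U' * mat_diag n d' * U'\<^sup>T \<and> B = U' * mat_diag n (\<lambda>i. f (d' i)) * U'\<^sup>T"
    then obtain U' d' where "spec n A U' d'" "B = fcalc n U' d' f" unfolding spec_def fcalc_def by blast
    then show "B = fcalc n U d f" using spec_fun_unique[OF s] by simp
  qed
qed

lemma spec_mat_fun: "spec n A U d \<Longrightarrow> spec n (mat_fun f A) U (\<lambda>i. f (d i))"
  using mat_fun_eq spec_fun by metis

lemma mat_fun_carrier: "sym_mat n A \<Longrightarrow> mat_fun f A \<in> carrier_mat n n"
  and mat_fun_sym: "sym_mat n A \<Longrightarrow> sym_mat n (mat_fun f A)"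
  using spectral_decomposition spec_mat_fun spec_sym specD(6) by metis+

lemma spec_cong:
  assumes "spec n A U d" "\<And>i. i < n \<Longrightarrow> d i = e i" shows "spec n A U e"
proof -
  have "mat_diag n d = mat_diag n e" unfolding mat_diag_def using assms(2) by (intro eq_matI) auto
  then show ?thesis using assms(1) unfolding spec_def by simp
qed

lemma spec_unique_mat: "spec n A U d \<Longrightarrow> spec n B U d \<Longrightarrow> A = B"
  unfolding spec_def by simp


section \<open>Frobenius inner products in a pair of eigenbases\<close>

lemma frob_entries:
  assumes "A \<in> carrier_mat r c"
  shows "frob_inner A B = (\<Sum>i<r. \<Sum>j<c. A $$ (i, j) * B $$ (i, j))"
  using assms unfolding frob_inner_def by auto

lemma frob_commute:
  assumes "A \<in> carrier_mat r c" "B \<in> carrier_mat r c" shows "frob_inner A B = frob_inner B A"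
  unfolding frob_entries[OF assms(1)] frob_entries[OF assms(2)] by (simp add: mult.commute)

lemma frob_nonneg: "0 \<le> frob_inner A A"
  unfolding frob_inner_def by (intro sum_nonneg) simp

lemma frob_add_right:
  assumes "A \<in> carrier_mat r c" "B \<in> carrier_mat r c" "C \<in> carrier_mat r c"
  shows "frob_inner A (B + C) = frob_inner A B + frob_inner A C"
  unfolding frob_entries[OF assms(1)] using assms by (simp add: distrib_left sum.distrib)

lemma frob_minus_right:
  assumes "A \<in> carrier_mat r c" "B \<in> carrier_mat r c" "C \<in> carrier_mat r c"
  shows "frob_inner A (B - C) = frob_inner A B - frob_inner A C"
  unfolding frob_entries[OF assms(1)] using assms by (simp add: right_diff_distrib sum_subtractf)

lemma frob_smult_right:
  assumes "A \<in> carrier_mat r c" "B \<in> carrier_mat r c"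
  shows "frob_inner A (k \<cdot>\<^sub>m B) = k * frob_inner A B"
  unfolding frob_entries[OF assms(1)] using assms by (simp add: sum_distrib_left mult_ac)

lemma frob_add_left:
  assumes "A \<in> carrier_mat r c" "B \<in> carrier_mat r c" "C \<in> carrier_mat r c"
  shows "frob_inner (B + C) A = frob_inner B A + frob_inner C A"
  using frob_add_right[OF assms] frob_commute[of "B + C" r c A] frob_commute[of B r c A] frob_commute[of C r c A] assms by simp

lemma frob_minus_left:
  assumes "A \<in> carrier_mat r c" "B \<in> carrier_mat r c" "C \<in> carrier_mat r c"
  shows "frob_inner (B - C) A = frob_inner B A - frob_inner C A"
  using frob_minus_right[OF assms] frob_commute[of "B - C" r c A] frob_commute[of B r c A] frob_commute[of C r c A] assms minus_carrier_mat[OF assms(3), of B] by simp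

lemma frob_smult_left:
  assumes "A \<in> carrier_mat r c" "B \<in> carrier_mat r c"
  shows "frob_inner (k \<cdot>\<^sub>m B) A = k * frob_inner B A"
  using frob_smult_right[OF assms] frob_commute[of "k \<cdot>\<^sub>m B" r c A] frob_commute[of B r c A] assms by simp

lemma mat_trace_entries: "A \<in> carrier_mat r c \<Longrightarrow> mat_trace A = (\<Sum>i<r. A $$ (i, i))"
  unfolding mat_trace_def by simp

lemma mat_trace_commute:
  assumes "A \<in> carrier_mat r c" "B \<in> carrier_mat c r"
  shows "mat_trace (A * B) = mat_trace (B * A)"
proof -
  have "mat_trace (A * B) = (\<Sum>i<r. (A * B) $$ (i, i))"
    by (rule mat_trace_entries[of _ r r]) (use assms in simp)
  also have "\<dots> = (\<Sum>i<r. \<Sum>l<c. A $$ (i, l) * B $$ (l, i))"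
    by (rule sum.cong[OF refl mult_entry[OF assms]]) auto
  also have "\<dots> = (\<Sum>l<c. \<Sum>i<r. B $$ (l, i) * A $$ (i, l))" by (subst sum.swap) (simp add: mult.commute)
  also have "\<dots> = (\<Sum>l<c. (B * A) $$ (l, l))"
    by (rule sum.cong[OF refl mult_entry[OF assms(2,1), symmetric]]) auto
  also have "\<dots> = mat_trace (B * A)"
    by (rule mat_trace_entries[of _ c c, symmetric]) (use assms in simp)
  finally show ?thesis .
qed

lemma frob_trace:
  assumes "A \<in> carrier_mat r c" "B \<in> carrier_mat r c"
  shows "frob_inner A B = mat_trace (A\<^sup>T * B)"
proof -
  have "mat_trace (A\<^sup>T * B) = (\<Sum>j<c. \<Sum>i<r. A $$ (i, j) * B $$ (i, j))"
  proof (subst mat_trace_entries[of _ c c])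
    show "A\<^sup>T * B \<in> carrier_mat c c" using assms by simp
    show "(\<Sum>i<c. (A\<^sup>T * B) $$ (i, i)) = (\<Sum>j<c. \<Sum>i<r. A $$ (i, j) * B $$ (i, j))"
    proof (rule sum.cong[OF refl])
      fix j assume "j \<in> {..<c}"
      then have j: "j < c" by simp
      have "(A\<^sup>T * B) $$ (j, j) = (\<Sum>l<r. A\<^sup>T $$ (j, l) * B $$ (l, j))"
        by (rule mult_entry) (use assms j in auto)
      then show "(A\<^sup>T * B) $$ (j, j) = (\<Sum>i<r. A $$ (i, j) * B $$ (i, j))" using assms j by simp
    qed
  qed
  then show ?thesis unfolding frob_entries[OF assms(1)] by (subst sum.swap) simp
qed

lemma frob_mult_left:
  assumes "A \<in> carrier_mat r c" "B \<in> carrier_mat r k" "C \<in> carrier_mat k c"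
  shows "frob_inner A (B * C) = frob_inner (B\<^sup>T * A) C"
proof -
  have "frob_inner (B\<^sup>T * A) C = mat_trace (A\<^sup>T * B * C)"
    using assms by (subst frob_trace[of _ k c]) (auto simp: transpose_mult[of _ k r _ c])
  also have "\<dots> = frob_inner A (B * C)"
    using assms by (subst frob_trace[of _ r c]) (auto simp: assoc_mult_mat[of _ c r _ k _ c])
  finally show ?thesis by simp
qed

lemma frob_transpose:
  assumes "A \<in> carrier_mat r c" "B \<in> carrier_mat r c"
  shows "frob_inner A\<^sup>T B\<^sup>T = frob_inner A B"
proof -
  have "frob_inner A\<^sup>T B\<^sup>T = (\<Sum>j<c. \<Sum>i<r. A $$ (i, j) * B $$ (i, j))"
    using assms by (subst frob_entries[of _ c r]) auto
  then show ?thesis unfolding frob_entries[OF assms(1)] by (subst sum.swap) simp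
qed

lemma frob_mult_right:
  assumes A: "A \<in> carrier_mat r c" and B: "B \<in> carrier_mat r k" and C: "C \<in> carrier_mat k c"
  shows "frob_inner A (B * C) = frob_inner (A * C\<^sup>T) B"
proof -
  have "frob_inner A (B * C) = frob_inner A\<^sup>T (C\<^sup>T * B\<^sup>T)"
    using frob_transpose[of A r c "B * C"] transpose_mult[OF B C] assms by simp
  also have "\<dots> = frob_inner (C * A\<^sup>T) B\<^sup>T"
    using frob_mult_left[of "A\<^sup>T" c r "C\<^sup>T" k "B\<^sup>T"] assms by simp
  also have "C * A\<^sup>T = (A * C\<^sup>T)\<^sup>T" using transpose_mult[of A r c "C\<^sup>T" k] assms by simp
  also have "frob_inner (A * C\<^sup>T)\<^sup>T B\<^sup>T = frob_inner (A * C\<^sup>T) B" using assms by (intro frob_transpose[of _ r k]) auto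
  finally show ?thesis .
qed

lemma frob_transform:
  assumes U: "U \<in> carrier_mat r r" "U * U\<^sup>T = 1\<^sub>m r" and W: "W \<in> carrier_mat c c" "W * W\<^sup>T = 1\<^sub>m c"
    and X: "X \<in> carrier_mat r c" and Y: "Y \<in> carrier_mat r c"
  shows "frob_inner (U\<^sup>T * X * W) (U\<^sup>T * Y * W) = frob_inner X Y"
proof -
  have c: "U\<^sup>T * X * W \<in> carrier_mat r c" "U\<^sup>T * Y \<in> carrier_mat r c" "U\<^sup>T * X \<in> carrier_mat r c" using U W X Y by auto
  have "frob_inner (U\<^sup>T * X * W) (U\<^sup>T * Y * W) = frob_inner (U\<^sup>T * X * W * W\<^sup>T) (U\<^sup>T * Y)"
    by (rule frob_mult_right[OF c(1,2) W(1)])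
  also have "U\<^sup>T * X * W * W\<^sup>T = U\<^sup>T * X"
    using assoc_mult_mat[OF c(3) W(1), of "W\<^sup>T" c] W(1) right_mult_one_mat[OF c(3)] unfolding W(2) by simp
  also have "frob_inner (U\<^sup>T * X) (U\<^sup>T * Y) = frob_inner (U\<^sup>T\<^sup>T * (U\<^sup>T * X)) Y"
    by (rule frob_mult_left[OF c(3) _ Y]) (use U in auto)
  also have "U\<^sup>T\<^sup>T * (U\<^sup>T * X) = X"
    using assoc_mult_mat[of U r r "U\<^sup>T" r X c] U(1) X left_mult_one_mat[OF X] unfolding U(2) by simp
  finally show ?thesis .
qed

lemma frob_CS:
  assumes "A \<in> carrier_mat r c" "B \<in> carrier_mat r c"
  shows "(frob_inner A B)\<^sup>2 \<le> frob_inner A A * frob_inner B B"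
proof -
  have e: "frob_inner X Y = (\<Sum>p\<in>{..<r} \<times> {..<c}. X $$ p * Y $$ p)" if "X \<in> carrier_mat r c" for X Y
    unfolding frob_entries[OF that] by (simp add: sum.cartesian_product split_beta)
  show ?thesis unfolding e[OF assms(1)] e[OF assms(2)]
    using Cauchy_Schwarz_ineq_sum[of "\<lambda>p. A $$ p" "\<lambda>p. B $$ p" "{..<r} \<times> {..<c}"] by (simp add: power2_eq_square)
qed

lemma fcalc_carrier: "spec n A U d \<Longrightarrow> fcalc n U d f \<in> carrier_mat n n"
  using specD(6)[OF spec_fun] .

text \<open>The squared overlaps of two orthonormal eigenbases form a doubly stochastic matrix. Traces and Frobenius
  products of functions of two symmetric matrices are sums with these weights, and so scalar
  inequalities between eigenvalues pass to matrices that do not commute.\<close>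

definition overlap :: "real mat \<Rightarrow> real mat \<Rightarrow> nat \<Rightarrow> nat \<Rightarrow> real" where
  "overlap U W i j = ((U\<^sup>T * W) $$ (i, j))\<^sup>2"

lemma overlap_nonneg: "0 \<le> overlap U W i j" unfolding overlap_def by simp

lemma overlap_row_sum:
  assumes "spec n A U d" "spec n B W e" "i < n"
  shows "(\<Sum>j<n. overlap U W i j) = 1"
proof -
  note D = specD[OF assms(1)] and D' = specD[OF assms(2)]
  define P where "P = U\<^sup>T * W"
  have P: "P \<in> carrier_mat n n" unfolding P_def using D(2) D'(1) by simp
  have "P * P\<^sup>T = U\<^sup>T * (W * W\<^sup>T) * U"
    unfolding P_def using D(1,2) D'(1,2) by (simp add: transpose_mult[of _ n n _ n] square_mult_closed assoc_mult_mat[of _ n n _ n _ n])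
  also have "\<dots> = 1\<^sub>m n" unfolding D'(4) using D(1,2,3) by simp
  finally have "(P * P\<^sup>T) $$ (i, i) = 1" using assms(3) by simp
  moreover have "(P * P\<^sup>T) $$ (i, i) = (\<Sum>j<n. P $$ (i, j) * P\<^sup>T $$ (j, i))"
    using P assms(3) by (intro mult_entry) auto
  ultimately show ?thesis unfolding overlap_def P_def[symmetric] using P assms(3) by (simp add: power2_eq_square)
qed

lemma overlap_swap:
  assumes "spec n A U d" "spec n B W e" "i < n" "j < n"
  shows "overlap W U j i = overlap U W i j"
proof -
  note D = specD[OF assms(1)] and D' = specD[OF assms(2)]
  have "(U\<^sup>T * W)\<^sup>T = W\<^sup>T * U" using D(1,2) D'(1,2) by (simp add: transpose_mult[of _ n n _ n])
  then have "(W\<^sup>T * U) $$ (j, i) = (U\<^sup>T * W)\<^sup>T $$ (j, i)" by simp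
  also have "\<dots> = (U\<^sup>T * W) $$ (i, j)" using D(2) D'(1) assms(3,4) by simp
  finally show ?thesis unfolding overlap_def by simp
qed

lemma overlap_col_sum:
  assumes "spec n A U d" "spec n B W e" "j < n"
  shows "(\<Sum>i<n. overlap U W i j) = 1"
  using overlap_row_sum[OF assms(2,1,3)] overlap_swap[OF assms(1,2) _ assms(3)] by simp

lemma transform_fcalc_left:
  assumes "spec n A U d" "spec n B W e" "i < n" "j < n"
  shows "(U\<^sup>T * fcalc n U d f * W) $$ (i, j) = f (d i) * (U\<^sup>T * W) $$ (i, j)"
proof -
  note D = specD[OF assms(1)] and D' = specD[OF assms(2)]
  have P: "U\<^sup>T * W \<in> carrier_mat n n" using D(2) D'(1) by simp
  have "U\<^sup>T * fcalc n U d f * W = mat_diag n (\<lambda>i. f (d i)) * (U\<^sup>T * W)"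
    unfolding spec_left[OF spec_fun[OF assms(1)]] using D(1,2) D'(1,2) by (simp add: assoc_mult_mat[of _ n n _ n _ n])
  then show ?thesis using mat_diag_mult_left[OF P] assms(3,4) by simp
qed

lemma transform_fcalc_right:
  assumes "spec n A U d" "spec n B W e" "i < n" "j < n"
  shows "(U\<^sup>T * fcalc n W e h * W) $$ (i, j) = (U\<^sup>T * W) $$ (i, j) * h (e j)"
proof -
  note D = specD[OF assms(1)] and D' = specD[OF assms(2)]
  have P: "U\<^sup>T * W \<in> carrier_mat n n" using D(2) D'(1) by simp
  have "U\<^sup>T * fcalc n W e h * W = U\<^sup>T * (fcalc n W e h * W)"
    using D(1,2) D'(1,2) fcalc_carrier[OF assms(2)] by (simp add: assoc_mult_mat[of _ n n _ n _ n])
  also have "\<dots> = (U\<^sup>T * W) * mat_diag n (\<lambda>i. h (e i))"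
    unfolding spec_right[OF spec_fun[OF assms(2)]] using D(1,2) D'(1,2) by (simp add: assoc_mult_mat[of _ n n _ n _ n])
  finally show ?thesis using mat_diag_mult_right[OF P] assms(3,4) by simp
qed

lemma frob_overlap:
  assumes s: "spec n A U d" "spec n B W e"
    and X: "X \<in> carrier_mat n n" "\<And>i j. i < n \<Longrightarrow> j < n \<Longrightarrow> (U\<^sup>T * X * W) $$ (i, j) = x i j * (U\<^sup>T * W) $$ (i, j)"
    and Y: "Y \<in> carrier_mat n n" "\<And>i j. i < n \<Longrightarrow> j < n \<Longrightarrow> (U\<^sup>T * Y * W) $$ (i, j) = y i j * (U\<^sup>T * W) $$ (i, j)"
  shows "frob_inner X Y = (\<Sum>i<n. \<Sum>j<n. overlap U W i j * (x i j * y i j))"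
proof -
  note D = specD[OF s(1)] and D' = specD[OF s(2)]
  have "frob_inner X Y = frob_inner (U\<^sup>T * X * W) (U\<^sup>T * Y * W)"
    by (rule frob_transform[OF D(1,4) D'(1,4) X(1) Y(1), symmetric])
  also have "\<dots> = (\<Sum>i<n. \<Sum>j<n. (U\<^sup>T * X * W) $$ (i, j) * (U\<^sup>T * Y * W) $$ (i, j))"
    by (rule frob_entries) (use D(2) D'(1) X(1) in \<open>simp add: square_mult_closed\<close>)
  also have "\<dots> = (\<Sum>i<n. \<Sum>j<n. overlap U W i j * (x i j * y i j))"
    by (intro sum.cong refl) (simp add: X(2) Y(2) overlap_def power2_eq_square mult_ac)
  finally show ?thesis .
qed

lemma transform_diff:
  assumes s: "spec n A U d" "spec n B W e" and ij: "i < n" "j < n"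
  shows "(U\<^sup>T * (fcalc n U d f - fcalc n W e h) * W) $$ (i, j) = (f (d i) - h (e j)) * (U\<^sup>T * W) $$ (i, j)"
proof -
  note D = specD[OF s(1)] and D' = specD[OF s(2)]
  have c: "fcalc n U d f \<in> carrier_mat n n" "fcalc n W e h \<in> carrier_mat n n" using fcalc_carrier s by auto
  have "U\<^sup>T * (fcalc n U d f - fcalc n W e h) * W = U\<^sup>T * fcalc n U d f * W - U\<^sup>T * fcalc n W e h * W"
    using D(2) D'(1) c by (simp add: mult_minus_distrib_mat[of _ n n _ n] minus_mult_distrib_mat[of _ n n _ _ n] square_mult_closed)
  moreover have "(X - Y) $$ (i, j) = X $$ (i, j) - Y $$ (i, j)" if "X \<in> carrier_mat n n" "Y \<in> carrier_mat n n" for X Y :: "real mat"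
    using that ij by simp
  moreover have "U\<^sup>T * fcalc n U d f * W \<in> carrier_mat n n" "U\<^sup>T * fcalc n W e h * W \<in> carrier_mat n n"
    using D(2) D'(1) c by (simp_all add: square_mult_closed)
  ultimately have "(U\<^sup>T * (fcalc n U d f - fcalc n W e h) * W) $$ (i, j)
    = (U\<^sup>T * fcalc n U d f * W) $$ (i, j) - (U\<^sup>T * fcalc n W e h * W) $$ (i, j)" by (simp only:)
  then show ?thesis unfolding transform_fcalc_left[OF s ij] transform_fcalc_right[OF s ij]
    by (simp only: left_diff_distrib mult.commute)
qed

lemma frob_fcalc_diff:
  assumes s: "spec n A U d" "spec n B W e"
  shows "frob_inner (fcalc n U d f - fcalc n W e h) (fcalc n U d f - fcalc n W e h)
    = (\<Sum>i<n. \<Sum>j<n. overlap U W i j * (f (d i) - h (e j))\<^sup>2)"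
proof -
  have c: "fcalc n U d f - fcalc n W e h \<in> carrier_mat n n" by (rule minus_carrier_mat[OF fcalc_carrier[OF s(2)]])
  show ?thesis using frob_overlap[OF s c transform_diff[OF s] c transform_diff[OF s]]
    by (simp only: power2_eq_square)
qed

lemma fcalc_id: "spec n A U d \<Longrightarrow> fcalc n U d (\<lambda>x. x) = A"
  unfolding spec_def fcalc_def by simp

lemma frob_diff_mult:
  assumes s: "spec n A U d" "spec n B W e"
  shows "frob_inner ((A - B) * fcalc n W e h) ((A - B) * fcalc n W e h)
    = (\<Sum>i<n. \<Sum>j<n. overlap U W i j * (h (e j) * (d i - e j))\<^sup>2)"
proof -
  note D = specD[OF s(1)] and D' = specD[OF s(2)]
  have c: "fcalc n W e h \<in> carrier_mat n n" using fcalc_carrier s by auto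
  have AB: "A - B \<in> carrier_mat n n" by (rule minus_carrier_mat[OF D'(6)])
  have td: "(U\<^sup>T * (A - B) * W) $$ (i, j) = (d i - e j) * (U\<^sup>T * W) $$ (i, j)" if "i < n" "j < n" for i j
    using transform_diff[OF s that, of "\<lambda>x. x" "\<lambda>x. x"] fcalc_id s by simp
  have "(U\<^sup>T * ((A - B) * fcalc n W e h) * W) $$ (i, j) = (h (e j) * (d i - e j)) * (U\<^sup>T * W) $$ (i, j)" if ij: "i < n" "j < n" for i j
  proof -
    have P: "U\<^sup>T * (A - B) * W \<in> carrier_mat n n" using D(2) D'(1) AB by simp
    have "U\<^sup>T * ((A - B) * fcalc n W e h) * W = U\<^sup>T * (A - B) * (fcalc n W e h * W)"
      using D(2) D'(1) AB c by (simp add: assoc_mult_mat[of _ n n _ n _ n] square_mult_closed)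
    also have "\<dots> = U\<^sup>T * (A - B) * W * mat_diag n (\<lambda>i. h (e i))"
      unfolding spec_right[OF spec_fun[OF s(2)]] using D(2) D'(1) AB by (simp add: assoc_mult_mat[of _ n n _ n _ n] square_mult_closed)
    finally show ?thesis using mat_diag_mult_right[OF P] ij td[OF ij] by simp
  qed
  from frob_overlap[OF s square_mult_closed[OF AB c] this square_mult_closed[OF AB c] this]
  show ?thesis by (simp only: power2_eq_square)
qed

lemma frob_diff_mult':
  assumes s: "spec n A U d" "spec n B W e"
  shows "frob_inner ((A - B) * fcalc n U d f) ((A - B) * fcalc n U d f)
    = (\<Sum>i<n. \<Sum>j<n. overlap U W i j * (f (d i) * (d i - e j))\<^sup>2)"
proof -
  note D = specD[OF s(1)] and D' = specD[OF s(2)]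
  have c: "fcalc n U d f \<in> carrier_mat n n" using fcalc_carrier s by auto
  have eq: "(A - B) * fcalc n U d f = - 1 \<cdot>\<^sub>m ((B - A) * fcalc n U d f)"
  proof -
    have "A - B = - 1 \<cdot>\<^sub>m (B - A)" using D(6) D'(6) by (intro eq_matI) auto
    then show ?thesis using mult_smult_assoc_mat[OF minus_carrier_mat[OF D(6)] c, of "- 1" B] by simp
  qed
  have BA: "(B - A) * fcalc n U d f \<in> carrier_mat n n" by (rule square_mult_closed[OF minus_carrier_mat[OF D(6)] c])
  have "frob_inner ((A - B) * fcalc n U d f) ((A - B) * fcalc n U d f) = frob_inner ((B - A) * fcalc n U d f) ((B - A) * fcalc n U d f)"
    unfolding eq using BA by (simp add: frob_smult_left[of _ n n] frob_smult_right[of _ n n])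
  also have "\<dots> = (\<Sum>j<n. \<Sum>i<n. overlap W U j i * (f (d i) * (e j - d i))\<^sup>2)" by (rule frob_diff_mult[OF s(2,1)])
  also have "\<dots> = (\<Sum>i<n. \<Sum>j<n. overlap W U j i * (f (d i) * (e j - d i))\<^sup>2)" by (rule sum.swap)
  also have "\<dots> = (\<Sum>i<n. \<Sum>j<n. overlap U W i j * (f (d i) * (d i - e j))\<^sup>2)"
    by (intro sum.cong refl) (simp add: overlap_swap[OF s] power_mult_distrib power2_commute)
  finally show ?thesis .
qed

lemma mat_trace_fcalc:
  assumes s: "spec n A U d" shows "mat_trace (fcalc n U d f) = (\<Sum>i<n. f (d i))"
proof -
  note D = specD[OF s]
  have "mat_trace (fcalc n U d f) = mat_trace (U\<^sup>T * (U * mat_diag n (\<lambda>i. f (d i))))"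
    unfolding fcalc_def using D(1,2) by (intro mat_trace_commute) (auto simp: square_mult_closed)
  also have "U\<^sup>T * (U * mat_diag n (\<lambda>i. f (d i))) = mat_diag n (\<lambda>i. f (d i))"
    using assoc_mult_mat[of "U\<^sup>T" n n U n "mat_diag n (\<lambda>i. f (d i))" n] D(1,2,3) by (simp add: left_mult_one_mat[of _ n n])
  finally show ?thesis by (simp add: mat_trace_entries[of _ n n] mat_diag_def)
qed

lemma quadratic_form_spec:
  assumes s: "spec n A U d" and x: "x \<in> carrier_vec n"
  shows "x \<bullet> (A *\<^sub>v x) = (\<Sum>i<n. d i * ((U\<^sup>T *\<^sub>v x) $ i)\<^sup>2)"
proof -
  note D = specD[OF s]
  define y where "y = U\<^sup>T *\<^sub>v x"
  have y: "y \<in> carrier_vec n" unfolding y_def using D(2) x by simp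
  have "A *\<^sub>v x = U *\<^sub>v (mat_diag n d *\<^sub>v y)"
    unfolding y_def by (subst D(5)) (use D(1,2) x in \<open>simp add: assoc_mult_mat_vec[of _ n n _ n] square_mult_closed\<close>)
  then have "x \<bullet> (A *\<^sub>v x) = y \<bullet> (mat_diag n d *\<^sub>v y)"
    using transpose_vec_mult_scalar[OF D(1) mult_mat_vec_carrier[OF mat_diag_dim y] x, of d] unfolding y_def by simp
  also have "\<dots> = (\<Sum>i<n. y $ i * (mat_diag n d *\<^sub>v y) $ i)" by (rule scalar_prod_sum[OF mult_mat_vec_carrier[OF mat_diag_dim y]])
  also have "\<dots> = (\<Sum>i<n. d i * (y $ i)\<^sup>2)"
  proof (intro sum.cong refl)
    fix i assume "i \<in> {..<n}"
    then have i: "i < n" by simp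
    have "(mat_diag n d *\<^sub>v y) $ i = (\<Sum>l<n. (if i = l then d l else 0) * y $ l)"
      using mult_vec_entry[OF mat_diag_dim y i] i by (simp add: mat_diag_def)
    also have "\<dots> = (\<Sum>l<n. if i = l then d l * y $ l else 0)" by (intro sum.cong) auto
    also have "\<dots> = d i * y $ i" using i by simp
    finally show "y $ i * (mat_diag n d *\<^sub>v y) $ i = d i * (y $ i)\<^sup>2" by (simp add: power2_eq_square)
  qed
  finally show ?thesis unfolding y_def .
qed

lemma psd_spec: "spec n A U d \<Longrightarrow> (\<And>i. i < n \<Longrightarrow> 0 \<le> d i) \<Longrightarrow> psd_mat n A"
  unfolding psd_mat_def using spec_sym by (auto simp: quadratic_form_spec intro!: sum_nonneg)

lemma frob_fcalc_psd:
  assumes s: "spec n A U d" and P: "P \<in> carrier_mat n n"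
  shows "frob_inner (fcalc n U d f) P = (\<Sum>i<n. f (d i) * (col U i \<bullet> (P *\<^sub>v col U i)))"
proof -
  note D = specD[OF s]
  have T: "U\<^sup>T * P * U \<in> carrier_mat n n" using D(1,2) P by simp
  have "frob_inner (fcalc n U d f) P = frob_inner (U\<^sup>T * fcalc n U d f * U) (U\<^sup>T * P * U)"
    by (rule frob_transform[OF D(1,4) D(1,4) fcalc_carrier[OF s] P, symmetric])
  also have "\<dots> = (\<Sum>i<n. \<Sum>j<n. (U\<^sup>T * fcalc n U d f * U) $$ (i, j) * (U\<^sup>T * P * U) $$ (i, j))"
    by (rule frob_entries) (use D(1,2) fcalc_carrier[OF s] in \<open>simp add: square_mult_closed\<close>)
  also have "\<dots> = (\<Sum>i<n. \<Sum>j<n. if i = j then f (d i) * (U\<^sup>T * P * U) $$ (i, i) else 0)"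
    by (intro sum.cong refl) (use transform_fcalc_left[OF s s] D(3) in auto)
  also have "\<dots> = (\<Sum>i<n. f (d i) * (U\<^sup>T * P * U) $$ (i, i))" by simp
  also have "\<dots> = (\<Sum>i<n. f (d i) * (col U i \<bullet> (P *\<^sub>v col U i)))"
  proof (intro sum.cong refl)
    fix i assume "i \<in> {..<n}"
    then have i: "i < n" by simp
    have "U\<^sup>T * P * U = U\<^sup>T * (P * U)" using D(1,2) P by (simp add: assoc_mult_mat[of _ n n _ n _ n])
    then have "(U\<^sup>T * P * U) $$ (i, i) = row U\<^sup>T i \<bullet> col (P * U) i" using i D(1,2) P by simp
    also have "row U\<^sup>T i = col U i" using i D(1) by simp
    also have "col (P * U) i = P *\<^sub>v col U i" using i D(1) P by (intro eq_vecI) auto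
    finally show "f (d i) * (U\<^sup>T * P * U) $$ (i, i) = f (d i) * (col U i \<bullet> (P *\<^sub>v col U i))" by simp
  qed
  finally show ?thesis .
qed

lemma psd_spec_nonneg:
  assumes s: "spec n A U d" and p: "psd_mat n A" and i: "i < n"
  shows "0 \<le> d i"
proof -
  note D = specD[OF s]
  define x where "x = col U i"
  have x: "x \<in> carrier_vec n" unfolding x_def using D(1) by auto
  have e: "(U\<^sup>T *\<^sub>v x) $ j = (if j = i then 1 else 0)" if j: "j < n" for j
  proof -
    have "(U\<^sup>T *\<^sub>v x) $ j = (U\<^sup>T * U) $$ (j, i)" unfolding x_def using D(1,2) i j by simp
    then show ?thesis unfolding D(3) using i j by simp
  qed
  have "(\<Sum>j<n. d j * ((U\<^sup>T *\<^sub>v x) $ j)\<^sup>2) = (\<Sum>j<n. if j = i then d i else 0)"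
    by (intro sum.cong refl) (auto simp: e)
  then have "x \<bullet> (A *\<^sub>v x) = d i" unfolding quadratic_form_spec[OF s x] using i by simp
  then show ?thesis using p x unfolding psd_mat_def by metis
qed

lemma frob_fcalc_psd_nonneg:
  assumes s: "spec n A U d" and P: "psd_mat n P" and f: "\<And>i. i < n \<Longrightarrow> 0 \<le> f (d i)"
  shows "0 \<le> frob_inner (fcalc n U d f) P"
proof -
  have Pc: "P \<in> carrier_mat n n" using P unfolding psd_mat_def sym_mat_def by simp
  show ?thesis unfolding frob_fcalc_psd[OF s Pc]
    using P f specD(1)[OF s] unfolding psd_mat_def by (intro sum_nonneg mult_nonneg_nonneg) auto
qed


section \<open>The Fermi--Dirac entropy and its Bregman divergence\<close>

definition sigm :: "real \<Rightarrow> real" where "sigm y = 1 / (1 + exp (- y))"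

lemma sigm_bounds: "0 < sigm y" "sigm y < 1"
  unfolding sigm_def by (auto simp: add_pos_pos)

lemma sigm_logit: "ln (sigm y / (1 - sigm y)) = y" "ln (sigm y) - ln (1 - sigm y) = y"
proof -
  have p: "1 + exp (- y) \<noteq> 0" using exp_gt_zero[of "- y"] by linarith
  have "1 - sigm y = exp (- y) / (1 + exp (- y))" unfolding sigm_def using p by (simp add: divide_simps)
  then have "sigm y / (1 - sigm y) = 1 / exp (- y)" unfolding sigm_def using p by simp
  then have "sigm y / (1 - sigm y) = exp y" by (simp add: exp_minus divide_inverse)
  then show 1: "ln (sigm y / (1 - sigm y)) = y" by simp
  show "ln (sigm y) - ln (1 - sigm y) = y" using 1 sigm_bounds[of y] by (simp add: ln_div)
qed

lemma sigm_mono: "x \<le> y \<Longrightarrow> sigm x \<le> sigm y"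
  unfolding sigm_def by (intro divide_left_mono) (auto simp: add_pos_pos)

lemma sqrt_sigm_diff_aux:
  assumes "x \<le> y"
  shows "0 \<le> sqrt (sigm y) - sqrt (sigm x)" "sqrt (sigm y) - sqrt (sigm x) \<le> sqrt (sigm y) * ((y - x) / 2)"
proof -
  show "0 \<le> sqrt (sigm y) - sqrt (sigm x)" using sigm_mono[OF assms] by simp
  have "exp (- x) = exp (- y) * exp (y - x)" by (simp flip: exp_add)
  moreover have "1 \<le> exp (y - x)" using assms by simp
  ultimately have "1 + exp (- x) \<le> (1 + exp (- y)) * exp (y - x)" by (simp add: algebra_simps)
  then have "sigm y * exp (- (y - x)) \<le> sigm x"
    unfolding sigm_def exp_minus[of "y - x"] by (simp add: field_simps add_pos_pos)
  then have "sqrt (sigm y * exp (- (y - x))) \<le> sqrt (sigm x)" by simp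
  moreover have "sqrt (exp (- (y - x))) = exp (- ((y - x) / 2))"
    by (intro real_sqrt_unique) (auto simp: power2_eq_square simp flip: exp_add)
  ultimately have "sqrt (sigm y) * exp (- ((y - x) / 2)) \<le> sqrt (sigm x)" by (simp add: real_sqrt_mult)
  moreover have "sqrt (sigm y) * (1 - (y - x) / 2) \<le> sqrt (sigm y) * exp (- ((y - x) / 2))"
    using exp_ge_add_one_self[of "- ((y - x) / 2)"] sigm_bounds(1)[of y] by (intro mult_left_mono) auto
  ultimately have "sqrt (sigm y) * (1 - (y - x) / 2) \<le> sqrt (sigm x)" by linarith
  then show "sqrt (sigm y) - sqrt (sigm x) \<le> sqrt (sigm y) * ((y - x) / 2)" unfolding right_diff_distrib by linarith
qed

text \<open>Since \<open>log sigm\<close> is increasing with slope at most 1, the square root of the sigmoid has logarithmic slope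
  at most \<open>1/2\<close>. The larger value is bounded by the sum of both, which makes the estimate symmetric.\<close>

lemma sqrt_sigm_lipschitz: "(sqrt (sigm x) - sqrt (sigm y))\<^sup>2 \<le> ((sqrt (sigm x) * (x - y))\<^sup>2 + (sqrt (sigm y) * (x - y))\<^sup>2) / 4"
proof -
  have *: "(sqrt (sigm x) - sqrt (sigm y))\<^sup>2 \<le> (sqrt (sigm y) * (x - y))\<^sup>2 / 4" if "x \<le> y" for x y
  proof -
    have "(sqrt (sigm y) - sqrt (sigm x))\<^sup>2 \<le> (sqrt (sigm y) * ((y - x) / 2))\<^sup>2"
      using sqrt_sigm_diff_aux[OF that] by (intro power_mono)
    then show ?thesis by (simp add: power_mult_distrib power_divide power2_commute[of x y] power2_commute[of "sqrt (sigm x)"])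
  qed
  show ?thesis
  proof (cases "x \<le> y")
    case True
    have "0 \<le> (sqrt (sigm x) * (x - y))\<^sup>2" by (rule zero_le_power2)
    then show ?thesis using *[OF True] unfolding add_divide_distrib by linarith
  next
    case False
    then have "(sqrt (sigm y) - sqrt (sigm x))\<^sup>2 \<le> (sqrt (sigm x) * (y - x))\<^sup>2 / 4" by (intro *) simp
    then have "(sqrt (sigm x) - sqrt (sigm y))\<^sup>2 \<le> (sqrt (sigm x) * (x - y))\<^sup>2 / 4"
      by (simp add: power_mult_distrib power2_commute[of x y] power2_commute[of "sqrt (sigm x)"])
    moreover have "0 \<le> (sqrt (sigm y) * (x - y))\<^sup>2" by (rule zero_le_power2)
    ultimately show ?thesis unfolding add_divide_distrib by linarith
  qed
qed

lemma sigm_diff_formula: "sigm d - sigm e = (1 - sigm e) * sigm d * (1 - exp (- (d - e)))"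
proof -
  have "exp (- d) = exp (- e) * exp (- (d - e))" by (simp flip: exp_add)
  then have d: "sigm d = 1 / (1 + exp (- e) * exp (- (d - e)))" unfolding sigm_def by simp
  have p: "1 + exp (- e) * exp (- (d - e)) \<noteq> 0" "1 + exp (- e) \<noteq> 0"
  proof -
    have "0 < exp (- e) * exp (- (d - e))" "0 < exp (- e)" by simp_all
    then show "1 + exp (- e) * exp (- (d - e)) \<noteq> 0" "1 + exp (- e) \<noteq> 0" by linarith+
  qed
  define E F where "E = exp (- e)" and "F = exp (- (d - e))"
  have nz: "1 + E * F \<noteq> 0" "1 + E \<noteq> 0" using p unfolding E_def F_def by auto
  have "1 / (1 + E * F) - 1 / (1 + E) = ((1 + E) - (1 + E * F)) / ((1 + E * F) * (1 + E))" using nz by (simp add: diff_frac_eq)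
  also have "\<dots> = (E / (1 + E)) * (1 / (1 + E * F)) * (1 - F)" by (simp add: algebra_simps)
  also have "E / (1 + E) = 1 - 1 / (1 + E)" using nz(2) by (simp add: diff_divide_eq_iff)
  finally show ?thesis unfolding d unfolding sigm_def[of e] E_def F_def .
qed

lemma sigm_diff_abs: "\<bar>sigm d - sigm e\<bar> \<le> \<bar>d - e\<bar>"
proof -
  have *: "sigm d - sigm e \<le> d - e" if "e \<le> d" for d e
  proof -
    have "1 - exp (- (d - e)) \<le> d - e" using exp_ge_add_one_self[of "- (d - e)"] by linarith
    moreover have "0 \<le> 1 - exp (- (d - e))" using that by simp
    moreover have "(1 - sigm e) * sigm d \<le> 1 * 1" using sigm_bounds[of e] sigm_bounds[of d] by (intro mult_mono) auto
    ultimately have "(1 - sigm e) * sigm d * (1 - exp (- (d - e))) \<le> 1 * (d - e)"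
      using sigm_bounds[of e] sigm_bounds[of d] by (intro mult_mono) auto
    then show ?thesis unfolding sigm_diff_formula by simp
  qed
  show ?thesis using *[of e d] *[of d e] sigm_mono[of e d] sigm_mono[of d e] by (cases "e \<le> d") auto
qed

lemma sigm_second_order: "sigm d - sigm e \<le> sigm e * (1 - sigm e) * (d - e) + (d - e)\<^sup>2"
proof -
  have k: "0 \<le> 1 - sigm e" "1 - sigm e \<le> 1" using sigm_bounds[of e] by auto
  have "1 - exp (- (d - e)) \<le> d - e" using exp_ge_add_one_self[of "- (d - e)"] by linarith
  then have "sigm d - sigm e \<le> (1 - sigm e) * sigm d * (d - e)"
    unfolding sigm_diff_formula using k sigm_bounds(1)[of d] by (intro mult_left_mono) auto
  also have "\<dots> = sigm e * (1 - sigm e) * (d - e) + (1 - sigm e) * ((sigm d - sigm e) * (d - e))" by (simp add: algebra_simps)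
  also have "(1 - sigm e) * ((sigm d - sigm e) * (d - e)) \<le> 1 * (d - e)\<^sup>2"
  proof (rule mult_mono)
    have "(sigm d - sigm e) * (d - e) \<le> \<bar>sigm d - sigm e\<bar> * \<bar>d - e\<bar>" by (metis abs_ge_self abs_mult)
    also have "\<dots> \<le> \<bar>d - e\<bar> * \<bar>d - e\<bar>" using sigm_diff_abs by (intro mult_right_mono) auto
    finally show "(sigm d - sigm e) * (d - e) \<le> (d - e)\<^sup>2" by (simp add: power2_eq_square flip: abs_mult)
    show "0 \<le> (sigm d - sigm e) * (d - e)"
      using sigm_mono[of e d] sigm_mono[of d e] by (cases "e \<le> d") (auto simp: mult_nonpos_nonpos)
  qed (use k in auto)
  finally show ?thesis by simp
qed

definition ent :: "real \<Rightarrow> real" where "ent x = x * ln x + (1 - x) * ln (1 - x)"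

lemma xlnx_hellinger:
  assumes "0 \<le> a" "0 < (x::real)"
  shows "2 * a - 2 * sqrt (a * x) \<le> a * ln a - a * ln x"
proof (cases "a = 0")
  case False
  then have a: "0 < a" using assms by simp
  have "ln (sqrt (x / a)) \<le> sqrt (x / a) - 1" using a assms by (intro ln_le_minus_one) auto
  moreover have "ln (sqrt (x / a)) = (ln x - ln a) / 2" using a assms by (simp add: ln_sqrt ln_div)
  ultimately have "ln x - ln a \<le> 2 * sqrt (x / a) - 2" by simp
  then have "a * (ln x - ln a) \<le> a * (2 * sqrt (x / a) - 2)" using a by (intro mult_left_mono) auto
  moreover have "a * sqrt (x / a) = sqrt (a * x)"
  proof -
    have "sqrt (a * x) = sqrt (a\<^sup>2 * (x / a))" using a by (simp add: power2_eq_square)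
    also have "\<dots> = sqrt (a\<^sup>2) * sqrt (x / a)" by (rule real_sqrt_mult)
    finally show ?thesis using a by simp
  qed
  ultimately show ?thesis by (simp add: algebra_simps)
qed simp

text \<open>From \<open>log u \<le> u - 1\<close> at \<open>u = \<surd>(x/a)\<close>, for the occupied and for the empty part.\<close>

lemma bregman_hellinger:
  assumes a: "0 \<le> a" "a \<le> 1" and x: "0 < x" "x < (1::real)"
  shows "(sqrt a - sqrt x)\<^sup>2 \<le> ent a - ent x - (ln x - ln (1 - x)) * (a - x)"
proof -
  have "ent a - ent x - (ln x - ln (1 - x)) * (a - x) = (a * ln a - a * ln x) + ((1 - a) * ln (1 - a) - (1 - a) * ln (1 - x))"
    unfolding ent_def by (simp add: algebra_simps)
  also have "\<dots> \<ge> (2 * a - 2 * sqrt (a * x)) + (2 * (1 - a) - 2 * sqrt ((1 - a) * (1 - x)))"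
    using assms by (intro add_mono xlnx_hellinger) auto
  finally have le: "(2 * a - 2 * sqrt (a * x)) + (2 * (1 - a) - 2 * sqrt ((1 - a) * (1 - x))) \<le> ent a - ent x - (ln x - ln (1 - x)) * (a - x)" .
  have sq: "(sqrt u - sqrt v)\<^sup>2 = u + v - 2 * sqrt (u * v)" if "0 \<le> u" "0 \<le> v" for u v :: real
    using that by (simp add: power2_diff real_sqrt_mult)
  have "0 \<le> (sqrt (1 - a) - sqrt (1 - x))\<^sup>2" by simp
  then have "(sqrt a - sqrt x)\<^sup>2 \<le> (sqrt a - sqrt x)\<^sup>2 + (sqrt (1 - a) - sqrt (1 - x))\<^sup>2" by simp
  also have "\<dots> = (2 * a - 2 * sqrt (a * x)) + (2 * (1 - a) - 2 * sqrt ((1 - a) * (1 - x)))"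
    using assms by (subst sq, simp, simp, subst sq) auto
  also note le
  finally show ?thesis .
qed

definition sig_mat :: "real mat \<Rightarrow> real mat" where "sig_mat Y = mat_fun sigm Y"
definition rt_mat :: "real mat \<Rightarrow> real mat" where "rt_mat Y = mat_fun (\<lambda>y. sqrt (sigm y)) Y"

lemma spec_one_minus:
  assumes s: "spec n A U d" shows "spec n (1\<^sub>m n - A) U (\<lambda>i. 1 - d i)"
proof -
  note D = specD[OF s]
  have e: "mat_diag n (\<lambda>i. 1 - d i) = 1\<^sub>m n - mat_diag n d" unfolding mat_diag_def by (intro eq_matI) auto
  have m: "1\<^sub>m n - mat_diag n d \<in> carrier_mat n n" by (intro minus_carrier_mat) simp
  have "U * (1\<^sub>m n - mat_diag n d) * U\<^sup>T = (U * 1\<^sub>m n - U * mat_diag n d) * U\<^sup>T"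
    using mult_minus_distrib_mat[OF D(1) one_carrier_mat mat_diag_dim] by simp
  also have "\<dots> = U * 1\<^sub>m n * U\<^sup>T - U * mat_diag n d * U\<^sup>T"
    by (rule minus_mult_distrib_mat[of _ n n _ _ n]) (use D(1,2) in auto)
  also have "\<dots> = 1\<^sub>m n - A" using D(1,4) D(5) by simp
  finally show ?thesis unfolding spec_def e using D by simp
qed

lemma spec_sig: "spec n Y W e \<Longrightarrow> spec n (sig_mat Y) W (\<lambda>i. sigm (e i))"
  unfolding sig_mat_def by (rule spec_mat_fun)

lemma rt_mat_eq: "spec n Y W e \<Longrightarrow> rt_mat Y = fcalc n W e (\<lambda>y. sqrt (sigm y))"
  unfolding rt_mat_def by (rule mat_fun_eq)

lemma sig_mat_eq: "spec n Y W e \<Longrightarrow> sig_mat Y = fcalc n W e sigm"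
  unfolding sig_mat_def by (rule mat_fun_eq)

lemma rt_mat_sym: "sym_mat n Y \<Longrightarrow> sym_mat n (rt_mat Y)"
  unfolding rt_mat_def by (rule mat_fun_sym)

lemma sig_mat_sym: "sym_mat n Y \<Longrightarrow> sym_mat n (sig_mat Y)"
  unfolding sig_mat_def by (rule mat_fun_sym)

lemma sqrt_sig_mat: "sym_mat n Y \<Longrightarrow> mat_fun sqrt (sig_mat Y) = rt_mat Y"
proof -
  assume "sym_mat n Y"
  then obtain W e where s: "spec n Y W e" using spectral_decomposition by blast
  show ?thesis unfolding rt_mat_eq[OF s] using mat_fun_eq[OF spec_sig[OF s], of sqrt] by (simp add: fcalc_def)
qed

lemma fcalc_mult:
  assumes s: "spec n A U d" shows "fcalc n U d f * fcalc n U d g = fcalc n U d (\<lambda>x. f x * g x)"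
proof -
  note D = specD[OF s]
  let ?F = "mat_diag n (\<lambda>i. f (d i))" and ?G = "mat_diag n (\<lambda>i. g (d i))"
  have "fcalc n U d f * fcalc n U d g = U * ?F * (U\<^sup>T * U) * ?G * U\<^sup>T"
    unfolding fcalc_def using D(1,2) by (simp add: assoc_mult_mat[of _ n n _ n _ n] square_mult_closed)
  also have "\<dots> = U * (?F * ?G) * U\<^sup>T" unfolding D(3) using D(1,2) right_mult_one_mat[of "U * ?F" n n]
    by (simp add: assoc_mult_mat[of _ n n _ n _ n] square_mult_closed)
  finally show ?thesis unfolding fcalc_def by simp
qed

lemma feasible_sym: "X \<in> feasible n \<Longrightarrow> sym_mat n X"
  unfolding feasible_def psd_mat_def by simp

lemma feasible_spec:
  assumes "X \<in> feasible n" "spec n X U a" "i < n" shows "0 \<le> a i" "a i \<le> 1"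
  using psd_spec_nonneg[OF assms(2) _ assms(3)] psd_spec_nonneg[OF spec_one_minus[OF assms(2)] _ assms(3)] assms(1)
  unfolding feasible_def by auto

lemma spec_feasible:
  assumes "spec n X U a" "\<And>i. i < n \<Longrightarrow> 0 \<le> a i" "\<And>i. i < n \<Longrightarrow> a i \<le> 1" shows "X \<in> feasible n"
  unfolding feasible_def using psd_spec[OF assms(1)] psd_spec[OF spec_one_minus[OF assms(1)]] assms by simp

lemma sig_mat_feasible: "sym_mat n Y \<Longrightarrow> sig_mat Y \<in> feasible n"
proof -
  assume "sym_mat n Y"
  then obtain W e where s: "spec n Y W e" using spectral_decomposition by blast
  show ?thesis by (rule spec_feasible[OF spec_sig[OF s]]) (use sigm_bounds in \<open>auto intro: less_imp_le\<close>)
qed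

lemma sqrt_square_feasible:
  assumes "X \<in> feasible n" shows "mat_fun sqrt X * mat_fun sqrt X = X"
proof -
  obtain U a where s: "spec n X U a" using spectral_decomposition[OF feasible_sym[OF assms]] by blast
  have "spec n (fcalc n U a (\<lambda>x. sqrt x * sqrt x)) U (\<lambda>i. sqrt (a i) * sqrt (a i))" by (rule spec_fun[OF s])
  then have "spec n (fcalc n U a (\<lambda>x. sqrt x * sqrt x)) U a"
    by (rule spec_cong) (use feasible_spec[OF assms s] in auto)
  then have "fcalc n U a (\<lambda>x. sqrt x * sqrt x) = X" using s by (rule spec_unique_mat)
  then show ?thesis unfolding mat_fun_eq[OF s] fcalc_mult[OF s] .
qed

lemma S_FD_spec:
  assumes s: "spec n X U a" shows "S_FD X = (\<Sum>i<n. ent (a i))"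
proof -
  have d: "dim_row X = n" using specD[OF s] by auto
  have "fcalc n U a (\<lambda>x. x * ln x) = mat_fun (\<lambda>x. x * ln x) X" using mat_fun_eq[OF s] by simp
  moreover have "mat_fun (\<lambda>x. x * ln x) (1\<^sub>m n - X) = fcalc n U (\<lambda>i. 1 - a i) (\<lambda>x. x * ln x)"
    by (rule mat_fun_eq[OF spec_one_minus[OF s]])
  ultimately show ?thesis unfolding S_FD_def d ent_def
    using mat_trace_fcalc[OF s, of "\<lambda>x. x * ln x"] mat_trace_fcalc[OF spec_one_minus[OF s], of "\<lambda>x. x * ln x"]
    by (simp add: sum.distrib)
qed

lemma mat_inv_unique:
  assumes A: "A \<in> carrier_mat n n" and B: "B \<in> carrier_mat n n" and AB: "A * B = 1\<^sub>m n"
  shows "mat_inv A = B"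
proof -
  have BA: "B * A = 1\<^sub>m n" by (rule mat_mult_left_right_inverse[OF A B AB])
  have "A \<in> Units (ring_mat TYPE(real) n ())"
    unfolding Units_def ring_mat_def using A B AB BA by auto
  then obtain C where C: "mat_inverse A = Some C" using mat_inverse(1)[OF A, of "()"] by (cases "mat_inverse A") auto
  note C' = mat_inverse(2)[OF A C]
  have "C = C * (A * B)" unfolding AB using C' right_mult_one_mat[of C n n] by simp
  also have "\<dots> = (C * A) * B" using C' A B assoc_mult_mat[of C n n A n B n] by metis
  also have "\<dots> = B" using C' B by simp
  finally show ?thesis unfolding mat_inv_def C by simp
qed

lemma mat_inv_spec:
  assumes s: "spec n A U d" and d: "\<And>i. i < n \<Longrightarrow> d i \<noteq> 0"
  shows "mat_inv A = fcalc n U d (\<lambda>x. 1 / x)"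
proof (rule mat_inv_unique[OF specD(6)[OF s] fcalc_carrier[OF s]])
  have "A * fcalc n U d (\<lambda>x. 1 / x) = fcalc n U d (\<lambda>x. x) * fcalc n U d (\<lambda>x. 1 / x)" using fcalc_id[OF s] by simp
  also have "\<dots> = fcalc n U d (\<lambda>x. x * (1 / x))" by (rule fcalc_mult[OF s])
  also have "\<dots> = 1\<^sub>m n"
  proof -
    have "mat_diag n (\<lambda>i. d i * (1 / d i)) = 1\<^sub>m n" unfolding mat_diag_def using d by (intro eq_matI) auto
    then show ?thesis unfolding fcalc_def using specD[OF s] by simp
  qed
  finally show "A * fcalc n U d (\<lambda>x. 1 / x) = 1\<^sub>m n" .
qed

lemma grad_S_FD_sig:
  assumes "sym_mat n Y" shows "grad_S_FD (sig_mat Y) = Y"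
proof -
  obtain W e where s: "spec n Y W e" using spectral_decomposition[OF assms] by blast
  define x where "x i = sigm (e i)" for i
  have sx: "spec n (sig_mat Y) W x" unfolding x_def by (rule spec_sig[OF s])
  have d: "dim_row (sig_mat Y) = n" using specD[OF sx] by auto
  have s1: "spec n (1\<^sub>m n - sig_mat Y) W (\<lambda>i. 1 - x i)" by (rule spec_one_minus[OF sx])
  have "mat_inv (1\<^sub>m n - sig_mat Y) = fcalc n W (\<lambda>i. 1 - x i) (\<lambda>x. 1 / x)"
    by (rule mat_inv_spec[OF s1]) (use sigm_bounds(2) in \<open>auto simp: x_def dest: less_imp_neq\<close>)
  also have "\<dots> = fcalc n W x (\<lambda>x. 1 / (1 - x))" unfolding fcalc_def ..
  finally have "sig_mat Y * mat_inv (1\<^sub>m n - sig_mat Y) = fcalc n W x (\<lambda>x. x * (1 / (1 - x)))"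
    using fcalc_mult[OF sx, of "\<lambda>x. x" "\<lambda>x. 1 / (1 - x)"] fcalc_id[OF sx] by simp
  moreover have "spec n (fcalc n W x (\<lambda>x. x * (1 / (1 - x)))) W (\<lambda>i. x i * (1 / (1 - x i)))" by (rule spec_fun[OF sx])
  ultimately have "spec n (grad_S_FD (sig_mat Y)) W (\<lambda>i. ln (x i * (1 / (1 - x i))))"
    unfolding grad_S_FD_def d using spec_mat_fun by simp
  then have "spec n (grad_S_FD (sig_mat Y)) W e"
    by (rule spec_cong) (simp add: x_def sigm_logit)
  then show ?thesis using s by (rule spec_unique_mat)
qed

text \<open>Klein's inequality in the Hellinger form: evaluated in the two eigenbases, the divergence is
  a weighted sum of scalar divergences.\<close>

lemma D_FD_hellinger:
  assumes A: "A \<in> feasible n" and Y: "sym_mat n Y"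
  shows "frob_inner (mat_fun sqrt A - rt_mat Y) (mat_fun sqrt A - rt_mat Y) \<le> D_FD A (sig_mat Y)"
proof -
  obtain U a where sa: "spec n A U a" using spectral_decomposition[OF feasible_sym[OF A]] by blast
  obtain W e where s: "spec n Y W e" using spectral_decomposition[OF Y] by blast
  let ?o = "overlap U W" and ?x = "\<lambda>j. sigm (e j)"
  have Ac: "A \<in> carrier_mat n n" "Y \<in> carrier_mat n n" "sig_mat Y \<in> carrier_mat n n"
    using specD(6) sa s spec_sig[OF s] by auto
  have row: "(\<Sum>j<n. ?o i j) = 1" if "i < n" for i by (rule overlap_row_sum[OF sa s that])
  have col: "(\<Sum>i<n. ?o i j) = 1" if "j < n" for j by (rule overlap_col_sum[OF sa s that])
  have SA: "S_FD A = (\<Sum>i<n. \<Sum>j<n. ?o i j * ent (a i))"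
    unfolding S_FD_spec[OF sa] using row by (simp flip: sum_distrib_right)
  have SX: "S_FD (sig_mat Y) = (\<Sum>i<n. \<Sum>j<n. ?o i j * ent (?x j))"
    unfolding S_FD_spec[OF spec_sig[OF s]] using col by (subst sum.swap) (simp flip: sum_distrib_right)
  have tA: "(U\<^sup>T * A * W) $$ (i, j) = a i * (U\<^sup>T * W) $$ (i, j)" if "i < n" "j < n" for i j
    using transform_fcalc_left[OF sa s that, of "\<lambda>x. x"] fcalc_id[OF sa] by simp
  have tY: "(U\<^sup>T * Y * W) $$ (i, j) = e j * (U\<^sup>T * W) $$ (i, j)" if "i < n" "j < n" for i j
    using transform_fcalc_right[OF sa s that, of "\<lambda>x. x"] fcalc_id[OF s] by simp
  have tX: "(U\<^sup>T * sig_mat Y * W) $$ (i, j) = ?x j * (U\<^sup>T * W) $$ (i, j)" if "i < n" "j < n" for i j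
    using transform_fcalc_right[OF sa s that, of sigm] sig_mat_eq[OF s] by simp
  have YA: "frob_inner Y A = (\<Sum>i<n. \<Sum>j<n. ?o i j * (e j * a i))"
    by (rule frob_overlap[OF sa s Ac(2) tY Ac(1) tA])
  have YX: "frob_inner Y (sig_mat Y) = (\<Sum>i<n. \<Sum>j<n. ?o i j * (e j * ?x j))"
    by (rule frob_overlap[OF sa s Ac(2) tY Ac(3) tX])
  have "frob_inner (mat_fun sqrt A - rt_mat Y) (mat_fun sqrt A - rt_mat Y) = (\<Sum>i<n. \<Sum>j<n. ?o i j * (sqrt (a i) - sqrt (?x j))\<^sup>2)"
    unfolding mat_fun_eq[OF sa] rt_mat_eq[OF s] by (rule frob_fcalc_diff[OF sa s])
  also have "\<dots> \<le> (\<Sum>i<n. \<Sum>j<n. ?o i j * (ent (a i) - ent (?x j) - e j * (a i - ?x j)))"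
  proof (intro sum_mono mult_left_mono overlap_nonneg)
    fix i j assume "i \<in> {..<n}"
    then show "(sqrt (a i) - sqrt (?x j))\<^sup>2 \<le> ent (a i) - ent (?x j) - e j * (a i - ?x j)"
      using bregman_hellinger[of "a i" "?x j"] feasible_spec[OF A sa] sigm_bounds[of "e j"] sigm_logit(2)[of "e j"] by simp
  qed
  also have "\<dots> = S_FD A - S_FD (sig_mat Y) - (frob_inner Y A - frob_inner Y (sig_mat Y))"
    unfolding SA SX YA YX by (simp add: algebra_simps sum.distrib sum_subtractf)
  also have "\<dots> = D_FD A (sig_mat Y)"
    unfolding D_FD_def grad_S_FD_sig[OF Y] using frob_minus_right[OF Ac(2,1,3)] by simp
  finally show ?thesis .
qed

lemma D_FD_nonneg: "A \<in> feasible n \<Longrightarrow> sym_mat n Y \<Longrightarrow> 0 \<le> D_FD A (sig_mat Y)"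
  using D_FD_hellinger frob_nonneg order_trans by blast

lemma frob_zero_imp:
  assumes "A \<in> carrier_mat r c" "frob_inner A A \<le> 0" "i < r" "j < c" shows "A $$ (i, j) = 0"
proof -
  have "(A $$ (i, j))\<^sup>2 \<le> (\<Sum>j<c. (A $$ (i, j))\<^sup>2)" using assms by (intro member_le_sum) auto
  also have "\<dots> \<le> (\<Sum>i<r. \<Sum>j<c. (A $$ (i, j))\<^sup>2)"
    using assms(3) by (intro member_le_sum[of i "{..<r}" "\<lambda>i. \<Sum>j<c. (A $$ (i, j))\<^sup>2"]) (auto intro!: sum_nonneg)
  also have "\<dots> = frob_inner A A" unfolding frob_entries[OF assms(1)] by (simp add: power2_eq_square)
  finally show ?thesis using assms(2) zero_le_power2[of "A $$ (i, j)"] by (metis antisym order_trans power2_eq_iff zero_eq_power2)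
qed

lemma D_FD_zero_imp:
  assumes A: "A \<in> feasible n" and Y: "sym_mat n Y" and D: "D_FD A (sig_mat Y) \<le> 0"
  shows "A = sig_mat Y"
proof -
  have c: "mat_fun sqrt A \<in> carrier_mat n n" "rt_mat Y \<in> carrier_mat n n"
    using mat_fun_carrier[OF feasible_sym[OF A]] mat_fun_carrier[OF Y] unfolding rt_mat_def by auto
  have le: "frob_inner (mat_fun sqrt A - rt_mat Y) (mat_fun sqrt A - rt_mat Y) \<le> 0"
    using D_FD_hellinger[OF A Y] D by simp
  have "mat_fun sqrt A = rt_mat Y"
  proof (rule eq_matI)
    fix i j assume "i < dim_row (rt_mat Y)" "j < dim_col (rt_mat Y)"
    then have ij: "i < n" "j < n" using c by auto
    show "mat_fun sqrt A $$ (i, j) = rt_mat Y $$ (i, j)"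
      using frob_zero_imp[OF minus_carrier_mat[OF c(2)] le ij] c ij by simp
  qed (use c in auto)
  then have "A = rt_mat Y * rt_mat Y" using sqrt_square_feasible[OF A] by simp
  also have "\<dots> = sig_mat Y" using sqrt_square_feasible[OF sig_mat_feasible[OF Y]] sqrt_sig_mat[OF Y] by simp
  finally show ?thesis .
qed

text \<open>The scalar estimate averaged with the overlaps; each state weights the increment by its own square root,
  so that densities appear and not operator norms.\<close>

lemma rt_mat_lipschitz:
  assumes "sym_mat n Y" "sym_mat n Y'"
  shows "frob_inner (rt_mat Y - rt_mat Y') (rt_mat Y - rt_mat Y')
    \<le> (frob_inner ((Y - Y') * rt_mat Y) ((Y - Y') * rt_mat Y) + frob_inner ((Y - Y') * rt_mat Y') ((Y - Y') * rt_mat Y')) / 4"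
proof -
  obtain U d where s: "spec n Y U d" using spectral_decomposition[OF assms(1)] by blast
  obtain W e where s': "spec n Y' W e" using spectral_decomposition[OF assms(2)] by blast
  show ?thesis unfolding rt_mat_eq[OF s] rt_mat_eq[OF s'] frob_fcalc_diff[OF s s'] frob_diff_mult[OF s s'] frob_diff_mult'[OF s s']
    unfolding sum.distrib[symmetric] sum_divide_distrib
  proof (intro sum_mono)
    fix i j
    show "overlap U W i j * (sqrt (sigm (d i)) - sqrt (sigm (e j)))\<^sup>2
      \<le> (overlap U W i j * (sqrt (sigm (d i)) * (d i - e j))\<^sup>2 + overlap U W i j * (sqrt (sigm (e j)) * (d i - e j))\<^sup>2) / 4"
      using mult_left_mono[OF sqrt_sigm_lipschitz[of "d i" "e j"] overlap_nonneg[of U W i j]] by (simp add: algebra_simps)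
  qed
qed

lemma trace_sig_step:
  assumes Y: "sym_mat n Y" and Y': "sym_mat n Y'" and P: "psd_mat n P" and t: "0 \<le> t" and eq: "Y' - Y = (- t) \<cdot>\<^sub>m P"
  shows "mat_trace (sig_mat Y') \<le> mat_trace (sig_mat Y) + t\<^sup>2 * frob_inner P P"
proof -
  obtain U d where s: "spec n Y' U d" using spectral_decomposition[OF Y'] by blast
  obtain W e where s': "spec n Y W e" using spectral_decomposition[OF Y] by blast
  let ?f = "\<lambda>x. sigm x * (1 - sigm x)" and ?o = "overlap U W"
  have Pc: "P \<in> carrier_mat n n" using P unfolding psd_mat_def sym_mat_def by simp
  have c: "Y' - Y \<in> carrier_mat n n" by (rule minus_carrier_mat[OF specD(6)[OF s']])
  have td: "(U\<^sup>T * (Y' - Y) * W) $$ (i, j) = (d i - e j) * (U\<^sup>T * W) $$ (i, j)" if "i < n" "j < n" for i j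
    using transform_diff[OF s s' that, of "\<lambda>x. x" "\<lambda>x. x"] fcalc_id s s' by simp
  have "mat_trace (sig_mat Y') = (\<Sum>i<n. \<Sum>j<n. ?o i j * sigm (d i))"
    unfolding sig_mat_eq[OF s] mat_trace_fcalc[OF s] using overlap_row_sum[OF s s'] by (simp flip: sum_distrib_right)
  moreover have "mat_trace (sig_mat Y) = (\<Sum>i<n. \<Sum>j<n. ?o i j * sigm (e j))"
    unfolding sig_mat_eq[OF s'] mat_trace_fcalc[OF s'] using overlap_col_sum[OF s s'] by (subst sum.swap) (simp flip: sum_distrib_right)
  ultimately have "mat_trace (sig_mat Y') - mat_trace (sig_mat Y) = (\<Sum>i<n. \<Sum>j<n. ?o i j * (sigm (d i) - sigm (e j)))"
    by (simp add: algebra_simps sum_subtractf)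
  also have "\<dots> \<le> (\<Sum>i<n. \<Sum>j<n. ?o i j * (?f (e j) * (d i - e j) + (d i - e j)\<^sup>2))"
    by (intro sum_mono mult_left_mono overlap_nonneg sigm_second_order)
  also have "\<dots> = (\<Sum>i<n. \<Sum>j<n. ?o i j * (?f (e j) * (d i - e j))) + (\<Sum>i<n. \<Sum>j<n. ?o i j * ((d i - e j) * (d i - e j)))"
    by (simp add: distrib_left sum.distrib power2_eq_square)
  also have "(\<Sum>i<n. \<Sum>j<n. ?o i j * (?f (e j) * (d i - e j))) = frob_inner (fcalc n W e ?f) (Y' - Y)"
    by (rule frob_overlap[OF s s' fcalc_carrier[OF s'] _ c td, symmetric])
      (use transform_fcalc_right[OF s s', of _ _ ?f] in \<open>simp add: mult_ac\<close>)
  also have "(\<Sum>i<n. \<Sum>j<n. ?o i j * ((d i - e j) * (d i - e j))) = frob_inner (Y' - Y) (Y' - Y)"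
    by (rule frob_overlap[OF s s' c td c td, symmetric])
  also have "frob_inner (fcalc n W e ?f) (Y' - Y) = - t * frob_inner (fcalc n W e ?f) P"
    unfolding eq by (rule frob_smult_right[OF fcalc_carrier[OF s'] Pc])
  also have "\<dots> \<le> 0"
  proof -
    have "0 \<le> frob_inner (fcalc n W e ?f) P"
      by (rule frob_fcalc_psd_nonneg[OF s' P]) (use sigm_bounds in \<open>auto intro: less_imp_le\<close>)
    then show ?thesis using t by simp
  qed
  also have "frob_inner (Y' - Y) (Y' - Y) = t\<^sup>2 * frob_inner P P"
    unfolding eq using Pc by (simp add: frob_smult_left[of _ n n] frob_smult_right[of _ n n] power2_eq_square)
  finally show ?thesis by simp
qed

text \<open>Monotonicity of the trace of the sigmoid, obtained by summing second-order bounds along a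
  finely subdivided segment.\<close>

lemma trace_sig_mono:
  assumes Y: "sym_mat n Y" and P: "psd_mat n P"
  shows "mat_trace (sig_mat (Y - P)) \<le> mat_trace (sig_mat Y)"
proof -
  have Pc: "P \<in> carrier_mat n n" "sym_mat n P" using P unfolding psd_mat_def sym_mat_def by auto
  have Yc: "Y \<in> carrier_mat n n" using Y unfolding sym_mat_def by simp
  define F where "F s = Y - s \<cdot>\<^sub>m P" for s
  have Fs: "sym_mat n (F s)" for s
    by (rule sym_matI) (use Yc Pc sym_mat_entry[OF Y] sym_mat_entry[OF Pc(2)] in \<open>auto simp: F_def\<close>)
  have bound: "mat_trace (sig_mat (F 1)) \<le> mat_trace (sig_mat Y) + frob_inner P P / real N" if N: "N > 0" for N :: nat
  proof -
    have "mat_trace (sig_mat (F (real k / real N))) \<le> mat_trace (sig_mat Y) + real k * ((1 / real N)\<^sup>2 * frob_inner P P)" for k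
    proof (induction k)
      case 0
      have "F 0 = Y" unfolding F_def using Yc Pc by (intro eq_matI) auto
      then show ?case by simp
    next
      case (Suc k)
      have "F (real (Suc k) / real N) - F (real k / real N) = (- (1 / real N)) \<cdot>\<^sub>m P"
        unfolding F_def using Yc Pc by (intro eq_matI) (auto simp: algebra_simps add_divide_distrib)
      from trace_sig_step[OF Fs Fs P _ this]
      have "mat_trace (sig_mat (F (real (Suc k) / real N))) \<le> mat_trace (sig_mat (F (real k / real N))) + (1 / real N)\<^sup>2 * frob_inner P P" by simp
      also have "\<dots> \<le> mat_trace (sig_mat Y) + real k * ((1 / real N)\<^sup>2 * frob_inner P P) + (1 / real N)\<^sup>2 * frob_inner P P"
        using Suc by (rule add_right_mono)
      finally show ?case by (simp only: of_nat_Suc distrib_right mult_1 add.assoc add.commute)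
    qed
    from this[of N] show ?thesis using N by (simp add: power2_eq_square)
  qed
  have F1: "F 1 = Y - P" unfolding F_def using Yc Pc by (intro eq_matI) auto
  show ?thesis
  proof (rule field_le_epsilon)
    fix \<epsilon> :: real assume e: "0 < \<epsilon>"
    obtain N :: nat where N: "frob_inner P P / \<epsilon> < real N" using reals_Archimedean2 by blast
    have "0 \<le> frob_inner P P / \<epsilon>" using e frob_nonneg by simp
    then have N0: "N > 0" using N by (cases N) auto
    have "frob_inner P P / real N \<le> \<epsilon>" using N e N0 by (simp add: field_simps)
    then show "mat_trace (sig_mat (Y - P)) \<le> mat_trace (sig_mat Y) + \<epsilon>" using bound[OF N0] unfolding F1 by linarith
  qed
qed

lemma psd_square:
  assumes "sym_mat n D" shows "psd_mat n (D * D)"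
proof -
  obtain U d where s: "spec n D U d" using spectral_decomposition[OF assms] by blast
  have "D * D = fcalc n U d (\<lambda>x. x * x)" using fcalc_mult[OF s, of "\<lambda>x. x" "\<lambda>x. x"] fcalc_id[OF s] by simp
  then show ?thesis using psd_spec[OF spec_fun[OF s, of "\<lambda>x. x * x"]] by simp
qed

text \<open>The progress of one mirror step against a positive semidefinite linear loss, in the local norm.
  Positivity removes the term that is quadratic in the increment of the square root.\<close>

lemma local_norm_step:
  assumes Y: "sym_mat n Y" and A: "A \<in> feasible n" and L: "psd_mat n L" and \<eta>: "0 < \<eta>"
  shows "frob_inner L (sig_mat Y - A) - D_FD A (sig_mat Y) / \<eta> \<le> \<eta> * frob_inner (L * rt_mat Y) (L * rt_mat Y)"
proof -
  define P where "P = rt_mat Y"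
  define Q where "Q = mat_fun sqrt A"
  define D where "D = P - Q"
  have Ps: "sym_mat n P" unfolding P_def by (rule rt_mat_sym[OF Y])
  have Qs: "sym_mat n Q" unfolding Q_def by (rule mat_fun_sym[OF feasible_sym[OF A]])
  have Ls: "sym_mat n L" using L unfolding psd_mat_def by simp
  have Pc: "P \<in> carrier_mat n n" "P\<^sup>T = P" and Qc: "Q \<in> carrier_mat n n" "Q\<^sup>T = Q" and Lc: "L \<in> carrier_mat n n" "L\<^sup>T = L"
    using Ps Qs Ls unfolding sym_mat_def by auto
  have Dc: "D \<in> carrier_mat n n" unfolding D_def by (rule minus_carrier_mat[OF Qc(1)])
  have Ds: "sym_mat n D" unfolding D_def
    by (rule sym_matI) (use Pc Qc sym_mat_entry[OF Ps] sym_mat_entry[OF Qs] in auto)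
  have Dt: "D\<^sup>T = D" using Ds unfolding sym_mat_def by simp
  have X: "sig_mat Y = P * P" unfolding P_def using sqrt_square_feasible[OF sig_mat_feasible[OF Y]] sqrt_sig_mat[OF Y] by simp
  have A': "A = Q * Q" unfolding Q_def using sqrt_square_feasible[OF A] by simp
  note as = square_mult_closed minus_carrier_mat
  have QP: "Q = P - D" unfolding D_def using Pc Qc by (intro eq_matI) auto
  have exp: "P * P - Q * Q = P * D + D * P - D * D"
  proof -
    have "Q * Q = (P - D) * P - (P - D) * D" unfolding QP by (rule mult_minus_distrib_mat[of _ n n _ n]) (use Pc Dc as in auto)
    also have "(P - D) * P = P * P - D * P" by (rule minus_mult_distrib_mat[of _ n n _ _ n]) (use Pc Dc in auto)
    also have "(P - D) * D = P * D - D * D" by (rule minus_mult_distrib_mat[of _ n n _ _ n]) (use Pc Dc in auto)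
    finally have e: "Q * Q = (P * P - D * P) - (P * D - D * D)" .
    have "X - ((X - V) - (W - Z)) = W + V - Z" if "X \<in> carrier_mat n n" "V \<in> carrier_mat n n" "W \<in> carrier_mat n n" "Z \<in> carrier_mat n n" for X V W Z :: "real mat"
      using that by (intro eq_matI) auto
    then show ?thesis unfolding e using Pc Dc as by simp
  qed
  have LP: "L * P \<in> carrier_mat n n" using Lc Pc as by simp
  have f1: "frob_inner L (D * P) = frob_inner (L * P) D" using frob_mult_right[OF Lc(1) Dc Pc(1)] Pc by simp
  have f2: "frob_inner L (P * D) = frob_inner (L * P) D"
  proof -
    have "frob_inner L (P * D) = frob_inner (P * L) D" using frob_mult_left[OF Lc(1) Pc(1) Dc] Pc by simp
    also have "P * L = (L * P)\<^sup>T" using transpose_mult[OF Lc(1) Pc(1)] Lc Pc by simp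
    also have "frob_inner (L * P)\<^sup>T D = frob_inner (L * P) D" using frob_transpose[OF LP Dc] Dt by simp
    finally show ?thesis .
  qed
  have f3: "0 \<le> frob_inner L (D * D)"
  proof -
    obtain U l where s: "spec n L U l" using spectral_decomposition[OF Ls] by blast
    have "0 \<le> frob_inner (fcalc n U l (\<lambda>x. x)) (D * D)"
      by (rule frob_fcalc_psd_nonneg[OF s psd_square[OF Ds]]) (use psd_spec_nonneg[OF s L] in simp)
    then show ?thesis unfolding fcalc_id[OF s] .
  qed
  have "frob_inner L (sig_mat Y - A) = frob_inner L (P * D + D * P) - frob_inner L (D * D)"
    unfolding X A' exp by (rule frob_minus_right[of _ n n]) (use Lc Pc Dc as in auto)
  also have "frob_inner L (P * D + D * P) = frob_inner L (P * D) + frob_inner L (D * P)"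
    by (rule frob_add_right[of _ n n]) (use Lc Pc Dc as in auto)
  finally have le: "frob_inner L (sig_mat Y - A) \<le> 2 * frob_inner (L * P) D" using f1 f2 f3 by simp
  have hel: "frob_inner D D \<le> D_FD A (sig_mat Y)"
  proof -
    have "D = (- 1) \<cdot>\<^sub>m (Q - P)" unfolding D_def using Pc Qc by (intro eq_matI) auto
    then have "frob_inner D D = frob_inner (Q - P) (Q - P)"
      using minus_carrier_mat[OF Pc(1), of Q] by (simp add: frob_smult_left[of _ n n] frob_smult_right[of _ n n])
    then show ?thesis using D_FD_hellinger[OF A Y] unfolding Q_def P_def by simp
  qed
  define u where "u = frob_inner (L * P) (L * P)"
  define w where "w = frob_inner D D"
  have uw: "0 \<le> u" "0 \<le> w" unfolding u_def w_def by (rule frob_nonneg)+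
  have "(2 * frob_inner (L * P) D)\<^sup>2 \<le> 4 * (u * w)"
    using frob_CS[OF LP Dc] unfolding u_def w_def by (simp add: power_mult_distrib)
  also have "\<dots> = 4 * ((\<eta> * u) * (w / \<eta>))" using \<eta> by simp
  also have "\<dots> \<le> (\<eta> * u + w / \<eta>)\<^sup>2" using sum_squares_bound[of "\<eta> * u" "w / \<eta>"] by (simp only: power2_sum)
  finally have "2 * frob_inner (L * P) D \<le> \<eta> * u + w / \<eta>"
    by (rule power2_le_imp_le) (use uw \<eta> in auto)
  moreover have "w / \<eta> \<le> D_FD A (sig_mat Y) / \<eta>" using hel \<eta> unfolding w_def by (intro divide_right_mono) auto
  ultimately show ?thesis using le unfolding u_def P_def by linarith
qed


section \<open>The Fermi--Dirac states as sampled dynamics\<close>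

lemma quadratic_form_entries:
  assumes A: "A \<in> carrier_mat n n" and x: "x \<in> carrier_vec n"
  shows "x \<bullet> (A *\<^sub>v x) = (\<Sum>i<n. \<Sum>j<n. x $ i * (A $$ (i, j) * x $ j))"
proof -
  have "x \<bullet> (A *\<^sub>v x) = (\<Sum>i<n. x $ i * (A *\<^sub>v x) $ i)" by (rule scalar_prod_sum[OF mult_mat_vec_carrier[OF A x]])
  also have "\<dots> = (\<Sum>i<n. \<Sum>j<n. x $ i * (A $$ (i, j) * x $ j))"
    by (intro sum.cong refl, subst mult_vec_entry[OF A x]) (auto simp: sum_distrib_left)
  finally show ?thesis .
qed

locale hartree =
  fixes n m :: nat and T :: nat and \<Psi> V C :: "real mat" and \<mu> \<beta> :: real
  assumes n0: "0 < n" and m0: "0 < m" and T0: "0 < T" and Psi: "\<Psi> \<in> carrier_mat m n" and orth: "\<Psi>\<^sup>T * \<Psi> = 1\<^sub>m n"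
    and V: "psd_mat m V" and C: "sym_mat n C" and \<beta>0: "0 < \<beta>"
    and standing: "Y \<in> feasible n \<Longrightarrow> psd_mat n (grad_E_tilde \<Psi> V Y)"
begin

lemma V_carrier: "V \<in> carrier_mat m m" and V_symm: "sym_mat m V"
  using V unfolding psd_mat_def sym_mat_def by auto

lemma C_carrier: "C \<in> carrier_mat n n" using C unfolding sym_mat_def by simp

sublocale psd_form m "\<lambda>p q. V $$ (p, q)"
proof
  show "V $$ (p, q) = V $$ (q, p)" if "p < m" "q < m" for p q using sym_mat_entry[OF V_symm that] .
  fix u :: "nat \<Rightarrow> real"
  have x: "vec m u \<in> carrier_vec m" by simp
  have "0 \<le> vec m u \<bullet> (V *\<^sub>v vec m u)" using V x unfolding psd_mat_def by blast
  also have "\<dots> = (\<Sum>p<m. u p * (\<Sum>q<m. V $$ (p, q) * u q))"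
    unfolding scalar_prod_sum[OF mult_mat_vec_carrier[OF V_carrier x]]
    by (intro sum.cong refl) (simp add: mult_vec_entry[OF V_carrier x])
  also have "\<dots> = (\<Sum>p<m. \<Sum>q<m. V $$ (p, q) * u p * u q)" by (simp add: sum_distrib_left mult_ac)
  finally show "0 \<le> (\<Sum>p<m. \<Sum>q<m. V $$ (p, q) * u p * u q)" .
qed

text \<open>The matrix \<open>\<Psi>\<^sup>T diag(f) \<Psi>\<close> of the potential \<open>f\<close>; it is the adjoint of taking densities.\<close>

definition lift :: "field \<Rightarrow> real mat" where
  "lift f = mat n n (\<lambda>(i, j). \<Sum>p<m. f p * \<Psi> $$ (p, i) * \<Psi> $$ (p, j))"

abbreviation dens :: "real mat \<Rightarrow> nat \<Rightarrow> real" where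
  "dens X \<equiv> (\<lambda>p. rho \<Psi> X $ p)"

lemma lift_carrier: "lift f \<in> carrier_mat n n" unfolding lift_def by simp

lemma lift_dim [simp]: "dim_row (lift f) = n" "dim_col (lift f) = n" unfolding lift_def by simp_all

lemma lift_sym: "sym_mat n (lift f)"
  by (rule sym_matI[OF lift_carrier]) (auto simp: lift_def mult_ac)

lemma lift_cong: "(\<And>p. p < m \<Longrightarrow> f p = g p) \<Longrightarrow> lift f = lift g"
  unfolding lift_def by (intro eq_matI) auto

lemma act_cong: "(\<And>p. p < m \<Longrightarrow> f p = g p) \<Longrightarrow> act f = act g"
  unfolding act_def by (intro ext sum.cong) auto

lemma lift_eq: "lift f = \<Psi>\<^sup>T * mat_diag m f * \<Psi>"
proof (rule eq_matI)
  have c: "\<Psi>\<^sup>T * mat_diag m f \<in> carrier_mat n m" "\<Psi>\<^sup>T \<in> carrier_mat n m" using Psi by auto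
  fix i j assume "i < dim_row (\<Psi>\<^sup>T * mat_diag m f * \<Psi>)" "j < dim_col (\<Psi>\<^sup>T * mat_diag m f * \<Psi>)"
  then have ij: "i < n" "j < n" using Psi by auto
  have "(\<Psi>\<^sup>T * mat_diag m f * \<Psi>) $$ (i, j) = (\<Sum>p<m. (\<Psi>\<^sup>T * mat_diag m f) $$ (i, p) * \<Psi> $$ (p, j))"
    by (rule mult_entry[OF c(1) Psi ij])
  also have "\<dots> = (\<Sum>p<m. f p * \<Psi> $$ (p, i) * \<Psi> $$ (p, j))"
    by (intro sum.cong refl) (use ij Psi in \<open>auto simp: mat_diag_mult_right[OF c(2)]\<close>)
  finally show "lift f $$ (i, j) = (\<Psi>\<^sup>T * mat_diag m f * \<Psi>) $$ (i, j)"
    using ij by (simp add: lift_def)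
qed (use Psi in \<open>auto simp: lift_def\<close>)

lemma quad_entry:
  assumes M: "M \<in> carrier_mat n n" and p: "p < m"
  shows "rho \<Psi> M $ p = (\<Sum>i<n. \<Sum>j<n. \<Psi> $$ (p, i) * M $$ (i, j) * \<Psi> $$ (p, j))"
proof -
  have c: "\<Psi> * M \<in> carrier_mat m n" "\<Psi>\<^sup>T \<in> carrier_mat n m" using Psi M by auto
  have "rho \<Psi> M $ p = (\<Psi> * M * \<Psi>\<^sup>T) $$ (p, p)" unfolding rho_def using Psi p by auto
  also have "\<dots> = (\<Sum>j<n. (\<Psi> * M) $$ (p, j) * \<Psi>\<^sup>T $$ (j, p))" by (rule mult_entry[OF c p p])
  also have "\<dots> = (\<Sum>j<n. \<Sum>i<n. \<Psi> $$ (p, i) * M $$ (i, j) * \<Psi> $$ (p, j))"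
    by (intro sum.cong refl) (use Psi p mult_entry[OF Psi M p] in \<open>auto simp: sum_distrib_right\<close>)
  also have "\<dots> = (\<Sum>i<n. \<Sum>j<n. \<Psi> $$ (p, i) * M $$ (i, j) * \<Psi> $$ (p, j))" by (rule sum.swap)
  finally show ?thesis .
qed

lemma frob_lift:
  assumes M: "M \<in> carrier_mat n n"
  shows "frob_inner (lift f) M = (\<Sum>p<m. f p * dens M p)"
proof -
  have "frob_inner (lift f) M = (\<Sum>i<n. \<Sum>j<n. \<Sum>p<m. f p * (\<Psi> $$ (p, i) * M $$ (i, j) * \<Psi> $$ (p, j)))"
    unfolding frob_entries[OF lift_carrier] by (simp add: lift_def sum_distrib_left sum_distrib_right mult_ac)
  also have "\<dots> = (\<Sum>i<n. \<Sum>p<m. \<Sum>j<n. f p * (\<Psi> $$ (p, i) * M $$ (i, j) * \<Psi> $$ (p, j)))"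
    by (intro sum.cong refl sum.swap)
  also have "\<dots> = (\<Sum>p<m. \<Sum>i<n. \<Sum>j<n. f p * (\<Psi> $$ (p, i) * M $$ (i, j) * \<Psi> $$ (p, j)))"
    by (rule sum.swap)
  also have "\<dots> = (\<Sum>p<m. f p * dens M p)"
    by (intro sum.cong refl) (simp add: quad_entry[OF M] sum_distrib_left)
  finally show ?thesis .
qed

lemma grad_E_lift: "grad_E_tilde \<Psi> V X = lift (act (dens X))"
proof -
  have c: "rho \<Psi> X \<in> carrier_vec m" unfolding rho_def using Psi by auto
  have "grad_E_tilde \<Psi> V X = lift (\<lambda>p. (V *\<^sub>v rho \<Psi> X) $ p)"
    unfolding grad_E_tilde_def lift_eq using Psi by auto
  also have "\<dots> = lift (act (dens X))"
    by (rule lift_cong) (simp add: mult_vec_entry[OF V_carrier c] act_def)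
  finally show ?thesis .
qed

lemma E_tilde_bil: "E_tilde \<Psi> V X = bil (dens X) (dens X) / 2"
proof -
  have c: "rho \<Psi> X \<in> carrier_vec m" unfolding rho_def using Psi by auto
  have "rho \<Psi> X \<bullet> (V *\<^sub>v rho \<Psi> X) = (\<Sum>p<m. dens X p * act (dens X) p)"
    unfolding scalar_prod_sum[OF mult_mat_vec_carrier[OF V_carrier c]]
    by (intro sum.cong refl) (simp add: mult_vec_entry[OF V_carrier c] act_def)
  then show ?thesis unfolding E_tilde_def bil_act by simp
qed

lemma lift_act_psd: "Y \<in> feasible n \<Longrightarrow> psd_mat n (lift (act (dens Y)))"
  using standing unfolding grad_E_lift .

lemma isometry_frob:
  assumes "M \<in> carrier_mat n c" shows "frob_inner (\<Psi> * M) (\<Psi> * M) = frob_inner M M"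
proof -
  have "frob_inner (\<Psi> * M) (\<Psi> * M) = frob_inner (\<Psi>\<^sup>T * (\<Psi> * M)) M"
    by (rule frob_mult_left[of _ m c]) (use Psi assms in auto)
  also have "\<Psi>\<^sup>T * (\<Psi> * M) = (\<Psi>\<^sup>T * \<Psi>) * M" using Psi assms by (intro assoc_mult_mat[symmetric]) auto
  finally show ?thesis unfolding orth using assms by simp
qed

lemma adjoint_contraction:
  assumes N: "N \<in> carrier_mat m c" shows "frob_inner (\<Psi>\<^sup>T * N) (\<Psi>\<^sup>T * N) \<le> frob_inner N N"
proof -
  define w where "w = frob_inner (\<Psi>\<^sup>T * N) (\<Psi>\<^sup>T * N)"
  have c: "\<Psi>\<^sup>T * N \<in> carrier_mat n c" using Psi N by auto
  have "w = frob_inner N (\<Psi> * (\<Psi>\<^sup>T * N))" unfolding w_def by (rule frob_mult_left[symmetric]) (use Psi N c in auto)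
  then have "w\<^sup>2 \<le> frob_inner N N * frob_inner (\<Psi> * (\<Psi>\<^sup>T * N)) (\<Psi> * (\<Psi>\<^sup>T * N))"
    using frob_CS[of N m c "\<Psi> * (\<Psi>\<^sup>T * N)"] N Psi c by auto
  also have "\<dots> = frob_inner N N * w" unfolding isometry_frob[OF c] w_def ..
  finally have le: "w * w \<le> frob_inner N N * w" by (simp add: power2_eq_square)
  have "0 \<le> w" unfolding w_def by (rule frob_nonneg)
  then have "w \<le> frob_inner N N" using le frob_nonneg[of N] by (cases "w = 0") auto
  then show ?thesis unfolding w_def .
qed

lemma frob_lift_mult:
  assumes M: "M \<in> carrier_mat n n"
  shows "frob_inner (lift f * M) (lift f * M) \<le> (\<Sum>p<m. (\<Sum>i<n. ((\<Psi> * M) $$ (p, i))\<^sup>2) * (f p)\<^sup>2)"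
proof -
  define N where "N = mat_diag m f * (\<Psi> * M)"
  have PM: "\<Psi> * M \<in> carrier_mat m n" using Psi M by simp
  have N: "N \<in> carrier_mat m n" unfolding N_def by (rule mult_carrier_mat[OF mat_diag_dim PM])
  have "lift f * M = \<Psi>\<^sup>T * N"
  proof -
    have "\<Psi>\<^sup>T * mat_diag m f * \<Psi> * M = \<Psi>\<^sup>T * mat_diag m f * (\<Psi> * M)"
      by (rule assoc_mult_mat[of _ n m _ n _ n]) (use Psi M in auto)
    also have "\<dots> = \<Psi>\<^sup>T * N" unfolding N_def by (rule assoc_mult_mat[of _ n m _ m _ n]) (use Psi PM in auto)
    finally show ?thesis unfolding lift_eq .
  qed
  then have "frob_inner (lift f * M) (lift f * M) \<le> frob_inner N N" using adjoint_contraction[OF N] by simp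
  also have "\<dots> = (\<Sum>p<m. \<Sum>i<n. (f p * (\<Psi> * M) $$ (p, i))\<^sup>2)"
    unfolding frob_entries[OF N] unfolding N_def mat_diag_mult_left[OF PM]
    by (intro sum.cong refl) (auto simp: power2_eq_square)
  also have "\<dots> = (\<Sum>p<m. (\<Sum>i<n. ((\<Psi> * M) $$ (p, i))\<^sup>2) * (f p)\<^sup>2)"
    by (simp add: power_mult_distrib sum_distrib_left mult.commute)
  finally show ?thesis .
qed

lemma dens_square:
  assumes M: "sym_mat n M" and p: "p < m"
  shows "dens (M * M) p = (\<Sum>i<n. ((\<Psi> * M) $$ (p, i))\<^sup>2)"
proof -
  have Mc: "M \<in> carrier_mat n n" using M unfolding sym_mat_def by simp
  have e: "(\<Psi> * M) $$ (p, i) = (\<Sum>k<n. \<Psi> $$ (p, k) * M $$ (k, i))" if "i < n" for i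
    by (rule mult_entry[OF Psi Mc p that])
  have "(\<Sum>i<n. ((\<Psi> * M) $$ (p, i))\<^sup>2) = (\<Sum>i<n. \<Sum>k<n. \<Sum>l<n. \<Psi> $$ (p, k) * (M $$ (k, i) * M $$ (i, l)) * \<Psi> $$ (p, l))"
    by (intro sum.cong refl) (use sym_mat_entry[OF M] in \<open>auto simp: e power2_eq_square sum_product mult_ac intro!: sum.cong\<close>)
  also have "\<dots> = (\<Sum>k<n. \<Sum>i<n. \<Sum>l<n. \<Psi> $$ (p, k) * (M $$ (k, i) * M $$ (i, l)) * \<Psi> $$ (p, l))" by (rule sum.swap)
  also have "\<dots> = (\<Sum>k<n. \<Sum>l<n. \<Sum>i<n. \<Psi> $$ (p, k) * (M $$ (k, i) * M $$ (i, l)) * \<Psi> $$ (p, l))"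
    by (intro sum.cong refl sum.swap)
  also have "\<dots> = (\<Sum>k<n. \<Sum>l<n. \<Psi> $$ (p, k) * (M * M) $$ (k, l) * \<Psi> $$ (p, l))"
    by (intro sum.cong refl) (simp add: mult_entry[OF Mc Mc] sum_distrib_left sum_distrib_right)
  also have "\<dots> = dens (M * M) p" using quad_entry[OF square_mult_closed[OF Mc Mc] p] by simp
  finally show ?thesis by simp
qed

lemma dens_linear:
  assumes "A \<in> carrier_mat n n" "B \<in> carrier_mat n n" "p < m"
  shows "dens (A + B) p = dens A p + dens B p" "dens (A - B) p = dens A p - dens B p" "dens (k \<cdot>\<^sub>m A) p = k * dens A p"
proof -
  have c: "A + B \<in> carrier_mat n n" "A - B \<in> carrier_mat n n" "k \<cdot>\<^sub>m A \<in> carrier_mat n n" using assms by auto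
  show "dens (A + B) p = dens A p + dens B p"
    unfolding quad_entry[OF c(1) assms(3)] quad_entry[OF assms(1,3)] quad_entry[OF assms(2,3)] sum.distrib[symmetric]
    by (intro sum.cong refl) (use assms in \<open>auto simp: algebra_simps\<close>)
  show "dens (A - B) p = dens A p - dens B p"
    unfolding quad_entry[OF c(2) assms(3)] quad_entry[OF assms(1,3)] quad_entry[OF assms(2,3)] sum_subtractf[symmetric]
    by (intro sum.cong refl) (use assms in \<open>auto simp: algebra_simps\<close>)
  show "dens (k \<cdot>\<^sub>m A) p = k * dens A p"
    unfolding quad_entry[OF c(3) assms(3)] quad_entry[OF assms(1,3)] sum_distrib_left
    by (intro sum.cong refl) (use assms in \<open>auto simp: algebra_simps\<close>)
qed

lemma row_norm: "p < m \<Longrightarrow> dens (1\<^sub>m n) p = (\<Sum>i<n. (\<Psi> $$ (p, i))\<^sup>2)"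
proof -
  assume p: "p < m"
  have "sym_mat n (1\<^sub>m n)" by (simp add: sym_mat_def)
  then show ?thesis using dens_square[of "1\<^sub>m n" p] p Psi by simp
qed

lemma dens_nonneg:
  assumes "psd_mat n X" "p < m" shows "0 \<le> dens X p"
proof -
  have Xc: "X \<in> carrier_mat n n" using assms(1) unfolding psd_mat_def sym_mat_def by simp
  have r: "row \<Psi> p \<in> carrier_vec n" using Psi assms(2) by auto
  have "0 \<le> row \<Psi> p \<bullet> (X *\<^sub>v row \<Psi> p)" using assms(1) r unfolding psd_mat_def by blast
  also have "\<dots> = dens X p" unfolding scalar_prod_sum[OF mult_mat_vec_carrier[OF Xc r]] quad_entry[OF Xc assms(2)]
    by (intro sum.cong refl) (use Psi assms(2) in \<open>simp add: mult_vec_entry[OF Xc r] sum_distrib_left mult_ac\<close>)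
  finally show ?thesis .
qed

lemma row_norm_c_Psi: "p < m \<Longrightarrow> dens (1\<^sub>m n) p \<le> c_Psi \<Psi>"
proof -
  assume p: "p < m"
  have "(\<Sum>i<n. \<bar>\<Psi> $$ (p, i)\<bar>\<^sup>2) \<le> c_Psi \<Psi>" unfolding c_Psi_def using Psi p by (intro Max_ge) auto
  then show ?thesis unfolding row_norm[OF p] by simp
qed

lemma dens_feasible:
  assumes "X \<in> feasible n" "p < m" shows "0 \<le> dens X p" "dens X p \<le> dens (1\<^sub>m n) p" "dens X p \<le> c_Psi \<Psi>"
proof -
  have Xc: "X \<in> carrier_mat n n" using feasible_sym[OF assms(1)] unfolding sym_mat_def by simp
  show "0 \<le> dens X p" using assms dens_nonneg unfolding feasible_def by simp
  have "0 \<le> dens (1\<^sub>m n - X) p" using assms dens_nonneg unfolding feasible_def by simp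
  then show "dens X p \<le> dens (1\<^sub>m n) p" using dens_linear(2)[OF _ Xc assms(2), of "1\<^sub>m n"] by simp
  then show "dens X p \<le> c_Psi \<Psi>" using row_norm_c_Psi[OF assms(2)] by simp
qed

lemma row_norm_le_1: "p < m \<Longrightarrow> dens (1\<^sub>m n) p \<le> 1"
proof -
  assume p: "p < m"
  define N :: "real mat" where "N = mat m 1 (\<lambda>(q, _). if q = p then 1 else 0)"
  have N: "N \<in> carrier_mat m 1" unfolding N_def by simp
  have e: "(\<Psi>\<^sup>T * N) $$ (i, 0) = \<Psi> $$ (p, i)" if "i < n" for i
  proof -
    have "(\<Psi>\<^sup>T * N) $$ (i, 0) = (\<Sum>q<m. \<Psi>\<^sup>T $$ (i, q) * N $$ (q, 0))" by (rule mult_entry) (use Psi N that in auto)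
    also have "\<dots> = (\<Sum>q<m. if q = p then \<Psi> $$ (p, i) else 0)"
      by (intro sum.cong refl) (use Psi that p in \<open>auto simp: N_def\<close>)
    finally show ?thesis using p by simp
  qed
  have c: "\<Psi>\<^sup>T * N \<in> carrier_mat n 1" using Psi N by auto
  have "frob_inner (\<Psi>\<^sup>T * N) (\<Psi>\<^sup>T * N) = (\<Sum>i<n. (\<Psi> $$ (p, i))\<^sup>2)"
    unfolding frob_entries[OF c] by (simp add: e power2_eq_square)
  moreover have "frob_inner N N = (\<Sum>q<m. if q = p then 1 else 0)"
    unfolding frob_entries[OF N] by (intro sum.cong refl) (auto simp: N_def)
  ultimately show ?thesis unfolding row_norm[OF p] using adjoint_contraction[OF N] p by simp
qed

lemma sum_dens: assumes X: "X \<in> carrier_mat n n" shows "(\<Sum>p<m. dens X p) = mat_trace X"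
proof -
  have "(\<Sum>p<m. dens X p) = mat_trace (\<Psi> * X * \<Psi>\<^sup>T)"
    unfolding rho_def using Psi X by (simp add: mat_trace_def)
  also have "\<dots> = mat_trace (\<Psi>\<^sup>T * (\<Psi> * X))" by (rule mat_trace_commute) (use Psi X in auto)
  also have "\<Psi>\<^sup>T * (\<Psi> * X) = (\<Psi>\<^sup>T * \<Psi>) * X" using Psi X by (intro assoc_mult_mat[symmetric]) auto
  finally show ?thesis unfolding orth using X by simp
qed

lemma sum_row_norm: "(\<Sum>p<m. dens (1\<^sub>m n) p) = real n"
  using sum_dens[of "1\<^sub>m n"] by (simp add: mat_trace_def)

lemma n_le_m: "n \<le> m"
proof -
  have "real n \<le> (\<Sum>p<m. 1)" unfolding sum_row_norm[symmetric] by (intro sum_mono) (simp add: row_norm_le_1)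
  then show ?thesis by simp
qed

lemma trace_feasible_le: "X \<in> feasible n \<Longrightarrow> mat_trace X \<le> real m"
proof -
  assume X: "X \<in> feasible n"
  have Xc: "X \<in> carrier_mat n n" using feasible_sym[OF X] unfolding sym_mat_def by simp
  have "mat_trace X \<le> real n" unfolding sum_dens[OF Xc, symmetric] sum_row_norm[symmetric]
    using dens_feasible[OF X] by (intro sum_mono) simp
  then show ?thesis using n_le_m by simp
qed

definition Y0 :: "real mat" where "Y0 = (- \<beta>) \<cdot>\<^sub>m (C - \<mu> \<cdot>\<^sub>m 1\<^sub>m n)"

definition dual :: "field \<Rightarrow> real mat" where "dual U = Y0 - lift (act U)"

definition amp :: "field \<Rightarrow> nat \<Rightarrow> nat \<Rightarrow> real" where
  "amp U p i = (\<Psi> * rt_mat (dual U)) $$ (p, i)"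

definition cone :: "field set" where "cone = {U. psd_mat n (lift (act U))}"

definition tau :: real where "tau = max (mat_trace (sig_mat Y0)) 1"

lemma Y0_carrier: "Y0 \<in> carrier_mat n n" unfolding Y0_def using C_carrier by (auto intro!: minus_carrier_mat)

lemma Y0_sym: "sym_mat n Y0"
  by (rule sym_matI[OF Y0_carrier]) (use sym_mat_entry[OF C] C_carrier in \<open>auto simp: Y0_def\<close>)

lemma dual_carrier: "dual U \<in> carrier_mat n n" unfolding dual_def by (rule minus_carrier_mat[OF lift_carrier])

lemma dual_sym: "sym_mat n (dual U)"
  by (rule sym_matI[OF dual_carrier])
    (use sym_mat_entry[OF Y0_sym] sym_mat_entry[OF lift_sym] Y0_carrier lift_carrier in \<open>auto simp: dual_def\<close>)

lemma rt_carrier: "rt_mat (dual U) \<in> carrier_mat n n"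
  using rt_mat_sym[OF dual_sym] unfolding sym_mat_def by simp

lemma rt_dim [simp]: "dim_row (rt_mat (dual U)) = n" "dim_col (rt_mat (dual U)) = n"
  using rt_carrier by auto

lemma rt_square: "rt_mat (dual U) * rt_mat (dual U) = sig_mat (dual U)"
  using sqrt_square_feasible[OF sig_mat_feasible[OF dual_sym]] sqrt_sig_mat[OF dual_sym] by simp

lemma amp_dens: "p < m \<Longrightarrow> (sqn n (amp U p)) = dens (sig_mat (dual U)) p"
  using dens_square[OF rt_mat_sym[OF dual_sym]] unfolding rt_square amp_def by simp

lemma lift_diff: "lift (\<lambda>p. f p - g p) = lift f - lift g"
  unfolding lift_def by (intro eq_matI) (auto simp: algebra_simps sum_subtractf)

lemma lift_comb: "lift (\<lambda>p. s * f p + t * g p) = s \<cdot>\<^sub>m lift f + t \<cdot>\<^sub>m lift g"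
  unfolding lift_def by (intro eq_matI) (auto simp: algebra_simps sum.distrib sum_distrib_left)

lemma act_comb: "act (\<lambda>p. s * f p + t * g p) = (\<lambda>p. s * act f p + t * act g p)"
  unfolding act_def by (intro ext) (simp add: algebra_simps sum.distrib sum_distrib_left)

lemma amp_diff:
  "(\<Sum>p<m. \<Sum>i<n. (amp U p i - amp U' p i)\<^sup>2)
    \<le> (\<Sum>p<m. (sqn n (amp U p) + sqn n (amp U' p)) * (act (\<lambda>q. U q - U' q) p)\<^sup>2) / 4"
proof -
  let ?R = "rt_mat (dual U)" and ?R' = "rt_mat (dual U')"
  define f where "f p = act U' p - act U p" for p
  have RR: "?R - ?R' \<in> carrier_mat n n" by (rule minus_carrier_mat[OF rt_carrier])
  have PR: "\<Psi> * ?R \<in> carrier_mat m n" "\<Psi> * ?R' \<in> carrier_mat m n" "\<Psi> * (?R - ?R') \<in> carrier_mat m n"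
    using Psi rt_carrier RR by auto
  have e: "\<Psi> * (?R - ?R') = \<Psi> * ?R - \<Psi> * ?R'" by (rule mult_minus_distrib_mat[OF Psi rt_carrier rt_carrier])
  have "(\<Sum>p<m. \<Sum>i<n. (amp U p i - amp U' p i)\<^sup>2) = frob_inner (\<Psi> * (?R - ?R')) (\<Psi> * (?R - ?R'))"
    unfolding frob_entries[OF PR(3)] unfolding e amp_def
    by (intro sum.cong refl) (use Psi in \<open>auto simp: power2_eq_square\<close>)
  also have "\<dots> = frob_inner (?R - ?R') (?R - ?R')" by (rule isometry_frob[OF RR])
  also have "\<dots> \<le> (frob_inner ((dual U - dual U') * ?R) ((dual U - dual U') * ?R)
      + frob_inner ((dual U - dual U') * ?R') ((dual U - dual U') * ?R')) / 4"
    by (rule rt_mat_lipschitz[OF dual_sym dual_sym])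
  also have "dual U - dual U' = lift f" unfolding f_def lift_diff dual_def
    using Y0_carrier lift_carrier[of "act U"] lift_carrier[of "act U'"] by (intro eq_matI) auto
  also have "(frob_inner (lift f * ?R) (lift f * ?R) + frob_inner (lift f * ?R') (lift f * ?R')) / 4
     \<le> ((\<Sum>p<m. sqn n (amp U p) * (f p)\<^sup>2) + (\<Sum>p<m. sqn n (amp U' p) * (f p)\<^sup>2)) / 4"
    unfolding amp_def by (intro divide_right_mono add_mono frob_lift_mult rt_carrier) simp
  also have "\<dots> = (\<Sum>p<m. (sqn n (amp U p) + sqn n (amp U' p)) * (act (\<lambda>q. U q - U' q) p)\<^sup>2) / 4"
    unfolding act_diff f_def sum.distrib[symmetric] distrib_right[symmetric] power2_commute[of "act U _"] ..
  finally show ?thesis .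
qed

lemma cone_add:
  assumes "U \<in> cone" "U' \<in> cone" "0 \<le> s" "0 \<le> t" shows "(\<lambda>p. s * U p + t * U' p) \<in> cone"
proof -
  have "0 \<le> x \<bullet> ((s \<cdot>\<^sub>m lift (act U) + t \<cdot>\<^sub>m lift (act U')) *\<^sub>v x)" if x: "x \<in> carrier_vec n" for x
  proof -
    have nn: "0 \<le> x \<bullet> (lift (act U) *\<^sub>v x)" "0 \<le> x \<bullet> (lift (act U') *\<^sub>v x)"
      using assms(1,2) x unfolding cone_def psd_mat_def by auto
    have "x \<bullet> ((s \<cdot>\<^sub>m lift (act U) + t \<cdot>\<^sub>m lift (act U')) *\<^sub>v x) = s * (x \<bullet> (lift (act U) *\<^sub>v x)) + t * (x \<bullet> (lift (act U') *\<^sub>v x))"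
    proof -
      let ?A = "lift (act U)" and ?B = "lift (act U')"
      have c: "s \<cdot>\<^sub>m ?A + t \<cdot>\<^sub>m ?B \<in> carrier_mat n n" using lift_carrier by simp
      show ?thesis
        unfolding quadratic_form_entries[OF c x] quadratic_form_entries[OF lift_carrier x]
          sum_distrib_left sum.distrib[symmetric]
        by (intro sum.cong refl) (auto simp: algebra_simps)
    qed
    then show ?thesis using nn assms(3,4) by simp
  qed
  then have "psd_mat n (lift (\<lambda>p. s * act U p + t * act U' p))"
    unfolding psd_mat_def lift_comb[symmetric] using lift_sym by blast
  then show ?thesis by (simp only: cone_def act_comb mem_Collect_eq)
qed

lemma rank_one_feasible:
  assumes w: "sqn n w \<le> r" and r: "0 < r"
  shows "mat n n (\<lambda>(i, j). w i * w j / r) \<in> feasible n"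
proof -
  let ?W = "mat n n (\<lambda>(i, j). w i * w j / r)"
  have c: "?W \<in> carrier_mat n n" "1\<^sub>m n - ?W \<in> carrier_mat n n" by (auto intro!: minus_carrier_mat)
  have q: "x \<bullet> (?W *\<^sub>v x) = (\<Sum>i<n. x $ i * w i)\<^sup>2 / r" if x: "x \<in> carrier_vec n" for x
    unfolding quadratic_form_entries[OF c(1) x] power2_eq_square sum_product sum_divide_distrib
    by (intro sum.cong refl) auto
  have "0 \<le> x \<bullet> ((1\<^sub>m n - ?W) *\<^sub>v x)" if x: "x \<in> carrier_vec n" for x
  proof -
    have "(\<Sum>i<n. x $ i * w i)\<^sup>2 \<le> (\<Sum>i<n. (x $ i)\<^sup>2) * sqn n w" by (rule Cauchy_Schwarz_ineq_sum)
    also have "\<dots> \<le> (\<Sum>i<n. (x $ i)\<^sup>2) * r" using w by (intro mult_left_mono sum_nonneg) auto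
    finally have "(\<Sum>i<n. x $ i * w i)\<^sup>2 / r \<le> (\<Sum>i<n. (x $ i)\<^sup>2)" using r by (simp add: field_simps)
    moreover have "x \<bullet> ((1\<^sub>m n - ?W) *\<^sub>v x) = x \<bullet> x - x \<bullet> (?W *\<^sub>v x)"
      using x scalar_prod_minus_distrib[OF x x mult_mat_vec_carrier[OF c(1) x]]
      by (simp add: minus_mult_distrib_mat_vec[OF one_carrier_mat c(1) x])
    moreover have "x \<bullet> x = (\<Sum>i<n. (x $ i)\<^sup>2)" using scalar_prod_sum[OF x] by (simp add: power2_eq_square)
    ultimately show ?thesis unfolding q[OF x] by simp
  qed
  moreover have "0 \<le> x \<bullet> (?W *\<^sub>v x)" if x: "x \<in> carrier_vec n" for x unfolding q[OF x] using r by simp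
  moreover have "sym_mat n ?W" by (rule sym_matI[OF c(1)]) (auto simp: mult.commute)
  moreover have "sym_mat n (1\<^sub>m n - ?W)" by (rule sym_matI[OF c(2)]) (auto simp: mult.commute)
  ultimately show ?thesis unfolding feasible_def psd_mat_def by blast
qed

text \<open>A sampled state has rank one. Rescaled it becomes feasible, where the gradient of the interaction is
  assumed to be positive semidefinite, and the gradient is linear.\<close>

lemma cone_sample: "(\<lambda>p. (dotp n (amp U p) z)\<^sup>2) \<in> cone"
proof -
  define w where "w k = (\<Sum>i<n. rt_mat (dual U) $$ (k, i) * z i)" for k
  define r where "r = sqn n w + 1"
  have r: "0 < r" "sqn n w \<le> r" unfolding r_def by (auto intro!: add_nonneg_pos sum_nonneg)
  let ?W = "mat n n (\<lambda>(i, j). w i * w j / r)"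
  have W: "?W \<in> feasible n" by (rule rank_one_feasible[OF r(2,1)])
  have d: "r * dens ?W p + 0 * dens ?W p = (dotp n (amp U p) z)\<^sup>2" if p: "p < m" for p
  proof -
    have "dotp n (amp U p) z = (\<Sum>i<n. \<Sum>k<n. \<Psi> $$ (p, k) * rt_mat (dual U) $$ (k, i) * z i)"
      unfolding dotp_def amp_def by (intro sum.cong refl) (simp add: mult_entry[OF Psi rt_carrier p] sum_distrib_right)
    also have "\<dots> = (\<Sum>k<n. \<Sum>i<n. \<Psi> $$ (p, k) * rt_mat (dual U) $$ (k, i) * z i)" by (rule sum.swap)
    also have "\<dots> = (\<Sum>k<n. \<Psi> $$ (p, k) * w k)" unfolding w_def by (simp add: sum_distrib_left mult_ac)
    finally have "(dotp n (amp U p) z)\<^sup>2 = (\<Sum>i<n. \<Sum>j<n. \<Psi> $$ (p, i) * (w i * w j) * \<Psi> $$ (p, j))"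
      by (simp add: power2_eq_square sum_product mult_ac)
    moreover have "r * dens ?W p = (\<Sum>i<n. \<Sum>j<n. \<Psi> $$ (p, i) * (w i * w j) * \<Psi> $$ (p, j))"
      unfolding quad_entry[OF mat_carrier p] sum_distrib_left by (intro sum.cong refl) (use r(1) in auto)
    ultimately show ?thesis by simp
  qed
  have "dens ?W \<in> cone" using lift_act_psd[OF W] unfolding cone_def by simp
  then have "(\<lambda>p. r * dens ?W p + 0 * dens ?W p) \<in> cone" using r by (intro cone_add) auto
  then show ?thesis unfolding cone_def using act_cong[of "\<lambda>p. r * dens ?W p + 0 * dens ?W p", OF d] by simp
qed

text \<open>Subtracting a positive semidefinite potential from the dual variable lowers the number of particles.\<close>

lemma cone_trace: assumes "U \<in> cone" shows "(\<Sum>p<m. sqn n (amp U p)) \<le> tau"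
proof -
  have c: "sig_mat (dual U) \<in> carrier_mat n n" using sig_mat_sym[OF dual_sym] unfolding sym_mat_def by simp
  have "(\<Sum>p<m. sqn n (amp U p)) = mat_trace (sig_mat (dual U))"
    unfolding sum_dens[OF c, symmetric] by (intro sum.cong refl) (simp add: amp_dens)
  also have "\<dots> \<le> mat_trace (sig_mat Y0)" unfolding dual_def
    by (rule trace_sig_mono[OF Y0_sym]) (use assms in \<open>simp add: cone_def\<close>)
  finally show ?thesis unfolding tau_def by simp
qed

sublocale dyn: sampled_dynamics m "\<lambda>p q. V $$ (p, q)" n T amp \<beta> tau "c_Psi \<Psi>" "mat_inf_norm V" cone
proof
  show "n > 0" "n \<le> m" "m > 0" "T > 0" "\<beta> > 0" using n0 n_le_m m0 T0 \<beta>0 by auto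
  show "(\<Sum>p<m. \<Sum>i<n. (amp U p i - amp U' p i)\<^sup>2)
    \<le> (\<Sum>p<m. (sqn n (amp U p) + sqn n (amp U' p)) * (act (\<lambda>q. U q - U' q) p)\<^sup>2) / 4" for U U'
    by (rule amp_diff)
  show "sqn n (amp U p) \<le> c_Psi \<Psi>" if "p < m" for U p
    unfolding amp_dens[OF that] by (rule dens_feasible(3)[OF sig_mat_feasible[OF dual_sym] that])
  show "absact (\<lambda>_. 1) p \<le> mat_inf_norm V" if "p < m" for p
    unfolding absact_def mat_inf_norm_def using V_carrier that by (intro Max_ge) auto
  show "1 \<le> real m * c_Psi \<Psi>"
  proof -
    have "1 \<le> real n" using n0 by simp
    also have "\<dots> \<le> (\<Sum>p<m. c_Psi \<Psi>)" unfolding sum_row_norm[symmetric] by (intro sum_mono) (simp add: row_norm_c_Psi)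
    finally show ?thesis by simp
  qed
  show "1 \<le> tau" "tau \<le> real m" unfolding tau_def
    using trace_feasible_le[OF sig_mat_feasible[OF Y0_sym]] m0 by auto
  show "(\<lambda>_. 0) \<in> cone"
  proof -
    have "0\<^sub>m n n \<in> feasible n"
    proof -
      have "mat n n (\<lambda>(i, j). 0 * 0 / 1) = (0\<^sub>m n n :: real mat)" by (intro eq_matI) auto
      then show ?thesis using rank_one_feasible[of "\<lambda>_. 0" 1] by simp
    qed
    from lift_act_psd[OF this] have "dens (0\<^sub>m n n) \<in> cone" unfolding cone_def by simp
    from cone_add[OF this this, of 0 0] show ?thesis by simp
  qed
qed (use cone_add cone_sample cone_trace in auto)

lemma ch_eq: "dyn.ch = c_h \<Psi> V" unfolding dyn.ch_def c_h_def ..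

end


section \<open>The update in both forms and its regret\<close>

lemma spec_entry:
  assumes s: "spec n A U d" and ij: "i < n" "j < n"
  shows "A $$ (i, j) = (\<Sum>k<n. d k * (U $$ (i, k) * U $$ (j, k)))"
proof -
  note D = specD[OF s]
  have c: "U * mat_diag n d \<in> carrier_mat n n" using D(1) by (simp add: square_mult_closed)
  have "A $$ (i, j) = (\<Sum>k<n. (U * mat_diag n d) $$ (i, k) * U\<^sup>T $$ (k, j))"
    by (subst D(5)) (rule mult_entry[OF c D(2) ij])
  also have "\<dots> = (\<Sum>k<n. d k * (U $$ (i, k) * U $$ (j, k)))"
    by (intro sum.cong refl) (use ij D(1) in \<open>auto simp: mat_diag_mult_right[OF D(1)]\<close>)
  finally show ?thesis .
qed

lemma spec_comb:
  assumes s: "spec n A U d" and s': "spec n B U e"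
  shows "spec n (x \<cdot>\<^sub>m A + y \<cdot>\<^sub>m B) U (\<lambda>i. x * d i + y * e i)"
proof -
  note D = specD[OF s] and D' = specD[OF s']
  let ?E = "\<lambda>i. x * d i + y * e i"
  have E: "spec n (U * mat_diag n ?E * U\<^sup>T) U ?E" using D unfolding spec_def by simp
  have "x \<cdot>\<^sub>m A + y \<cdot>\<^sub>m B = U * mat_diag n ?E * U\<^sup>T"
  proof (rule eq_matI)
    fix i j assume "i < dim_row (U * mat_diag n ?E * U\<^sup>T)" "j < dim_col (U * mat_diag n ?E * U\<^sup>T)"
    then have ij: "i < n" "j < n" using D(1) by auto
    have "(x \<cdot>\<^sub>m A + y \<cdot>\<^sub>m B) $$ (i, j) = x * A $$ (i, j) + y * B $$ (i, j)" using ij D(6) D'(6) by simp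
    then show "(x \<cdot>\<^sub>m A + y \<cdot>\<^sub>m B) $$ (i, j) = (U * mat_diag n ?E * U\<^sup>T) $$ (i, j)"
      unfolding spec_entry[OF s ij] spec_entry[OF s' ij] spec_entry[OF E ij]
      by (simp add: sum_distrib_left sum.distrib algebra_simps)
  qed (use D D' in auto)
  then show ?thesis using E by simp
qed

lemma spec_one: "spec n A U d \<Longrightarrow> spec n (1\<^sub>m n) U (\<lambda>_. 1)"
proof -
  assume s: "spec n A U d"
  have "mat_diag n (\<lambda>_. 1 :: real) = 1\<^sub>m n" unfolding mat_diag_def by (intro eq_matI) auto
  then show ?thesis using specD(1,3,4)[OF s] unfolding spec_def by simp
qed

lemma sig_mat_inverse_form:
  assumes Y: "sym_mat n Y" shows "mat_inv (1\<^sub>m n + mat_fun exp (- Y)) = sig_mat Y"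
proof -
  obtain U d where s: "spec n Y U d" using spectral_decomposition[OF Y] by blast
  note D = specD[OF s]
  have "spec n ((- 1) \<cdot>\<^sub>m Y + 0 \<cdot>\<^sub>m Y) U (\<lambda>i. (- 1) * d i + 0 * d i)" by (rule spec_comb[OF s s])
  moreover have "(- 1) \<cdot>\<^sub>m Y + 0 \<cdot>\<^sub>m Y = - Y" using D(6) by (intro eq_matI) auto
  ultimately have "spec n (- Y) U (\<lambda>i. - d i)" by simp
  then have e: "spec n (mat_fun exp (- Y)) U (\<lambda>i. exp (- d i))" by (rule spec_mat_fun)
  have "spec n (1 \<cdot>\<^sub>m 1\<^sub>m n + 1 \<cdot>\<^sub>m mat_fun exp (- Y)) U (\<lambda>i. 1 * 1 + 1 * exp (- d i))"
    by (rule spec_comb[OF spec_one[OF s] e])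
  moreover have "1 \<cdot>\<^sub>m 1\<^sub>m n + 1 \<cdot>\<^sub>m mat_fun exp (- Y) = 1\<^sub>m n + mat_fun exp (- Y)"
    using specD(6)[OF e] by (intro eq_matI) auto
  ultimately have s1: "spec n (1\<^sub>m n + mat_fun exp (- Y)) U (\<lambda>i. 1 + exp (- d i))" by simp
  have "1 + exp (- d i) \<noteq> 0" for i using exp_gt_zero[of "- d i"] by linarith
  then have "mat_inv (1\<^sub>m n + mat_fun exp (- Y)) = fcalc n U (\<lambda>i. 1 + exp (- d i)) (\<lambda>x. 1 / x)"
    by (intro mat_inv_spec[OF s1])
  also have "\<dots> = sig_mat Y" unfolding sig_mat_eq[OF s] fcalc_def sigm_def ..
  finally show ?thesis .
qed

context hartree
begin

abbreviation state :: "real \<Rightarrow> (nat \<Rightarrow> field) \<Rightarrow> nat \<Rightarrow> real mat" where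
  "state \<eta> x t \<equiv> sig_mat (dual (dyn.traj (dyn.gam \<eta>) x t))"

abbreviation free :: "real mat \<Rightarrow> real" where
  "free X \<equiv> F_free \<Psi> V C \<beta> X - \<mu> * mat_trace X"

lemma X_init_eq: "X_init C \<beta> \<mu> = sig_mat Y0"
proof -
  have n: "dim_row C = n" using C_carrier by auto
  have c: "C - \<mu> \<cdot>\<^sub>m 1\<^sub>m n \<in> carrier_mat n n" using C_carrier by (auto intro!: minus_carrier_mat)
  have "sym_mat n (C - \<mu> \<cdot>\<^sub>m 1\<^sub>m n)"
    by (rule sym_matI[OF c]) (use sym_mat_entry[OF C] C_carrier in auto)
  then obtain U d where s: "spec n (C - \<mu> \<cdot>\<^sub>m 1\<^sub>m n) U d" using spectral_decomposition by blast
  have "spec n ((- \<beta>) \<cdot>\<^sub>m (C - \<mu> \<cdot>\<^sub>m 1\<^sub>m n) + 0 \<cdot>\<^sub>m (C - \<mu> \<cdot>\<^sub>m 1\<^sub>m n)) U (\<lambda>i. (- \<beta>) * d i + 0 * d i)" by (rule spec_comb[OF s s])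
  moreover have "(- \<beta>) \<cdot>\<^sub>m (C - \<mu> \<cdot>\<^sub>m 1\<^sub>m n) + 0 \<cdot>\<^sub>m (C - \<mu> \<cdot>\<^sub>m 1\<^sub>m n) = Y0"
    unfolding Y0_def using C_carrier by (intro eq_matI) auto
  ultimately have s0: "spec n Y0 U (\<lambda>i. - \<beta> * d i)" by simp
  show ?thesis unfolding X_init_def n mat_fun_eq[OF s] sig_mat_eq[OF s0] by (simp add: fcalc_def f_FD_def sigm_def)
qed

lemma dual_zero: "dual (\<lambda>_. 0) = Y0"
  unfolding dual_def using Y0_carrier by (intro eq_matI) (auto simp: lift_def act_def)

lemma dens_sample:
  assumes p: "p < m" and z: "z \<in> carrier_vec n" and x: "\<And>i. i < n \<Longrightarrow> x i = z $ i"
  shows "dens (X_hat (sig_mat (dual U)) z) p = dyn.samp U x p"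
proof -
  let ?R = "rt_mat (dual U)"
  define w where "w i = (\<Sum>k<n. ?R $$ (i, k) * z $ k)" for i
  let ?Z = "mat n n (\<lambda>(i, j). z $ i * z $ j)"
  have Zc: "?Z \<in> carrier_mat n n" by simp
  have RZ: "?R * ?Z \<in> carrier_mat n n" by (rule square_mult_closed[OF rt_carrier Zc])
  have RZe: "(?R * ?Z) $$ (i, j) = w i * z $ j" if "i < n" "j < n" for i j
    unfolding mult_entry[OF rt_carrier Zc that] w_def sum_distrib_right
    by (intro sum.cong refl) (use that in auto)
  have X: "X_hat (sig_mat (dual U)) z = ?R * ?Z * ?R" unfolding X_hat_def sqrt_sig_mat[OF dual_sym] using z by auto
  have Xe: "(?R * ?Z * ?R) $$ (i, j) = w i * w j" if "i < n" "j < n" for i j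
    unfolding mult_entry[OF RZ rt_carrier that] w_def[of j] sum_distrib_left
    by (intro sum.cong refl) (use that sym_mat_entry[OF rt_mat_sym[OF dual_sym]] in \<open>auto simp: RZe simp del: index_mult_mat\<close>)
  have "dotp n (amp U p) x = (\<Sum>i<n. \<Sum>k<n. \<Psi> $$ (p, k) * ?R $$ (k, i) * z $ i)"
    unfolding dotp_def amp_def by (intro sum.cong refl) (simp add: mult_entry[OF Psi rt_carrier p] sum_distrib_right x)
  also have "\<dots> = (\<Sum>k<n. \<Sum>i<n. \<Psi> $$ (p, k) * ?R $$ (k, i) * z $ i)" by (rule sum.swap)
  also have "\<dots> = (\<Sum>k<n. \<Psi> $$ (p, k) * w k)" unfolding w_def by (simp add: sum_distrib_left mult_ac)
  finally have "dyn.samp U x p = (\<Sum>i<n. \<Sum>j<n. \<Psi> $$ (p, i) * (w i * w j) * \<Psi> $$ (p, j))"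
    unfolding dyn.samp_def by (simp add: power2_eq_square sum_product mult_ac)
  moreover have "dens (?R * ?Z * ?R) p = (\<Sum>i<n. \<Sum>j<n. \<Psi> $$ (p, i) * (w i * w j) * \<Psi> $$ (p, j))"
    unfolding quad_entry[OF square_mult_closed[OF RZ rt_carrier] p] by (intro sum.cong refl) (simp add: Xe del: index_mult_mat)
  ultimately show ?thesis unfolding X by simp
qed

lemma G_est_eq:
  assumes z: "z \<in> carrier_vec n" and x: "\<And>i. i < n \<Longrightarrow> x i = z $ i"
  shows "G_est \<Psi> V C (sig_mat (dual U)) z = C + lift (act (dyn.samp U x))"
  unfolding G_est_def grad_E_lift using act_cong[OF dens_sample[OF _ z x]] by simp

definition next_field :: "real \<Rightarrow> field \<Rightarrow> field \<Rightarrow> nat \<Rightarrow> real" where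
  "next_field \<gamma> U x = (\<lambda>p. (1 - \<gamma> / \<beta>) * U p + \<gamma> * dyn.samp U x p)"

lemma traj_next: "dyn.traj \<gamma> x (Suc t) = next_field \<gamma> (dyn.traj \<gamma> x t) (x t)"
  unfolding next_field_def by simp

lemma dual_dim [simp]: "dim_row (dual U) = n" "dim_col (dual U) = n"
  using dual_carrier by auto

lemma mirror_step_dual:
  assumes z: "z \<in> carrier_vec n" and x: "\<And>i. i < n \<Longrightarrow> x i = z $ i"
    and st: "mirror_step \<Psi> V C \<beta> \<mu> \<gamma> z (sig_mat (dual U)) X'"
  shows "X' = sig_mat (dual (next_field \<gamma> U x))"
proof -
  have n: "dim_row C = n" using C_carrier by auto
  have G: "G_est \<Psi> V C (sig_mat (dual U)) z = C + lift (act (dyn.samp U x))" by (rule G_est_eq[OF z]) (rule x)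
  let ?S = "dyn.samp U x"
  let ?L = "(1 - (1 / \<beta>) * \<gamma>) \<cdot>\<^sub>m dual U - \<gamma> \<cdot>\<^sub>m (C + lift (act ?S) - \<mu> \<cdot>\<^sub>m 1\<^sub>m n)"
  have "?L = dual (next_field \<gamma> U x)"
  proof (rule eq_matI)
    fix i j assume "i < dim_row (dual (next_field \<gamma> U x))" "j < dim_col (dual (next_field \<gamma> U x))"
    then have ij: "i < n" "j < n" using dual_carrier by auto
    have Ce: "(C - \<mu> \<cdot>\<^sub>m 1\<^sub>m n) $$ (i, j) = C $$ (i, j) - \<mu> * 1\<^sub>m n $$ (i, j)" using ij C_carrier by simp
    have d: "dual W $$ (i, j) = - \<beta> * (C $$ (i, j) - \<mu> * 1\<^sub>m n $$ (i, j)) - lift (act W) $$ (i, j)" for W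
      unfolding dual_def Y0_def using ij C_carrier by simp
    have l: "lift (act (next_field \<gamma> U x)) $$ (i, j) = (1 - \<gamma> / \<beta>) * lift (act U) $$ (i, j) + \<gamma> * lift (act ?S) $$ (i, j)"
      unfolding next_field_def act_comb lift_comb using ij by simp
    have "?L $$ (i, j) = (1 - (1 / \<beta>) * \<gamma>) * dual U $$ (i, j) - \<gamma> * (C $$ (i, j) + lift (act ?S) $$ (i, j) - \<mu> * 1\<^sub>m n $$ (i, j))"
      using ij C_carrier dual_carrier[of U] by (simp del: index_one_mat(1))
    then show "?L $$ (i, j) = dual (next_field \<gamma> U x) $$ (i, j)"
      unfolding d l using \<beta>0 by (simp add: field_simps)
  qed (use dual_carrier in auto)
  then show ?thesis
    using st unfolding mirror_step_def Let_def n grad_S_FD_sig[OF dual_sym] G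
    using sig_mat_inverse_form[OF dual_sym] by simp
qed

lemma feasible_carrier: "A \<in> feasible n \<Longrightarrow> A \<in> carrier_mat n n"
  using feasible_sym unfolding sym_mat_def by simp

lemma sig_carrier: "sig_mat (dual U) \<in> carrier_mat n n"
  by (rule feasible_carrier[OF sig_mat_feasible[OF dual_sym]])

lemma frob_dual:
  assumes "M \<in> carrier_mat n n"
  shows "frob_inner (dual U) M = frob_inner Y0 M - bil (dens M) U"
  unfolding dual_def frob_minus_left[OF assms Y0_carrier lift_carrier] frob_lift[OF assms] bil_act by (simp add: mult.commute)

lemma frob_lift_act: "M \<in> carrier_mat n n \<Longrightarrow> frob_inner (lift (act u)) M = bil (dens M) u"
  unfolding frob_lift bil_act by (simp add: mult.commute)

lemma frob_Y0: "M \<in> carrier_mat n n \<Longrightarrow> frob_inner (C - \<mu> \<cdot>\<^sub>m 1\<^sub>m n) M = - frob_inner Y0 M / \<beta>"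
  unfolding Y0_def using \<beta>0 C_carrier by (subst frob_smult_left[of _ n n]) (auto intro!: minus_carrier_mat)

text \<open>The identity \<open>1/\<gamma> = 1/\<eta> + 1/\<beta>\<close> turns the mirror update into the stationarity condition
  of the proximal problem.\<close>

lemma next_field_stationary:
  assumes \<eta>: "0 < \<eta>" and M: "M \<in> carrier_mat n n"
  shows "(1 / \<beta> + 1 / \<eta>) * frob_inner (dual (next_field (dyn.gam \<eta>) U x)) M
    = frob_inner Y0 M / \<beta> + frob_inner (dual U) M / \<eta> - bil (dens M) (dyn.samp U x)"
proof -
  define g where "g = dyn.gam \<eta>"
  define u l y where "u = bil (dens M) U" and "l = bil (dens M) (dyn.samp U x)" and "y = frob_inner Y0 M"
  have g: "(1 / \<beta> + 1 / \<eta>) * g = 1"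
  proof -
    have "1 / \<beta> + 1 / \<eta> = (\<eta> + \<beta>) / (\<eta> * \<beta>)" using \<eta> \<beta>0 by (simp add: field_simps)
    then show ?thesis unfolding g_def dyn.gam_def using \<eta> \<beta>0 by simp
  qed
  have b: "bil (dens M) (next_field g U x) = (1 - g / \<beta>) * u + g * l"
    unfolding next_field_def u_def l_def by (simp only: bil_add_right bil_scale_right)
  have "(1 / \<beta> + 1 / \<eta>) * (y - ((1 - g / \<beta>) * u + g * l))
    = (1 / \<beta> + 1 / \<eta>) * y - (1 / \<beta> + 1 / \<eta>) * u + ((1 / \<beta> + 1 / \<eta>) * g) * (u / \<beta> - l)"
    by (simp add: algebra_simps)
  also have "\<dots> = y / \<beta> + (y - u) / \<eta> - l" unfolding g by (simp add: algebra_simps diff_divide_distrib)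
  finally show ?thesis unfolding frob_dual[OF M] g_def[symmetric] b unfolding u_def[symmetric] l_def[symmetric] y_def[symmetric] .
qed

lemma D_dual:
  assumes "A \<in> feasible n"
  shows "D_FD A (sig_mat (dual U)) = S_FD A - S_FD (sig_mat (dual U)) - frob_inner (dual U) (A - sig_mat (dual U))"
  unfolding D_FD_def grad_S_FD_sig[OF dual_sym] ..

text \<open>The proximal objective exceeds its value at the mirror update by \<open>(1/\<beta> + 1/\<eta>) D\<close>, which is nonnegative
  and vanishes only at the mirror update.\<close>

lemma prox_step_dual:
  assumes z: "z \<in> carrier_vec n" and x: "\<And>i. i < n \<Longrightarrow> x i = z $ i"
    and st: "prox_step \<Psi> V C \<beta> \<mu> \<eta> z (sig_mat (dual U)) X'"
  shows "X' = sig_mat (dual (next_field (dyn.gam \<eta>) U x))"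
proof -
  have n: "dim_row C = n" using C_carrier by auto
  have Gx: "G_est \<Psi> V C (sig_mat (dual U)) z = C + lift (act (dyn.samp U x))" by (rule G_est_eq[OF z]) (rule x)
  define X where "X = sig_mat (dual U)"
  define W where "W = next_field (dyn.gam \<eta>) U x"
  define S where "S = dyn.samp U x"
  define P where "P = sig_mat (dual W)"
  define obj where "obj = (\<lambda>Y. energy \<Psi> V C X + frob_inner (C + lift (act S) - \<mu> \<cdot>\<^sub>m 1\<^sub>m n) (Y - X)
            + (1 / \<beta>) * S_FD Y + (1 / \<eta>) * D_FD Y X)"
  have \<eta>: "0 < \<eta>" and am: "is_arg_min obj (\<lambda>Y. Y \<in> feasible n) X'"
    using st unfolding prox_step_def n Gx obj_def X_def S_def by blast+
  have X'f: "X' \<in> feasible n" and min: "\<And>Y. Y \<in> feasible n \<Longrightarrow> obj X' \<le> obj Y"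
    using am unfolding is_arg_min_def by (auto simp: not_less)
  have Pf: "P \<in> feasible n" unfolding P_def by (rule sig_mat_feasible[OF dual_sym])
  have c: "X \<in> carrier_mat n n" "P \<in> carrier_mat n n" "X' \<in> carrier_mat n n"
    using sig_carrier feasible_carrier[OF X'f] unfolding X_def P_def by auto
  define M where "M = X' - P"
  have M: "M \<in> carrier_mat n n" unfolding M_def by (rule minus_carrier_mat[OF c(2)])
  have Cc: "C - \<mu> \<cdot>\<^sub>m 1\<^sub>m n \<in> carrier_mat n n" "C + lift (act S) - \<mu> \<cdot>\<^sub>m 1\<^sub>m n \<in> carrier_mat n n" by (auto intro!: minus_carrier_mat)
  have lin: "frob_inner K (X' - X) - frob_inner K (P - X) = frob_inner K M" if "K \<in> carrier_mat n n" for K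
    unfolding M_def using frob_minus_right[OF that] c by simp
  have G: "frob_inner (C + lift (act S) - \<mu> \<cdot>\<^sub>m 1\<^sub>m n) M = - frob_inner Y0 M / \<beta> + bil (dens M) S"
  proof -
    have "C + lift (act S) - \<mu> \<cdot>\<^sub>m 1\<^sub>m n = (C - \<mu> \<cdot>\<^sub>m 1\<^sub>m n) + lift (act S)"
      using C_carrier by (intro eq_matI) auto
    then show ?thesis using frob_add_left[OF M Cc(1) lift_carrier] frob_Y0[OF M] frob_lift_act[OF M] by simp
  qed
  have "obj X' - obj P = frob_inner (C + lift (act S) - \<mu> \<cdot>\<^sub>m 1\<^sub>m n) M + (S_FD X' - S_FD P) / \<beta>
      + (S_FD X' - S_FD P - frob_inner (dual U) M) / \<eta>"
    using lin[OF Cc(2)] lin[OF dual_carrier, of U] unfolding obj_def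
    unfolding X_def D_dual[OF X'f] D_dual[OF Pf] by (simp add: diff_divide_distrib add_divide_distrib algebra_simps)
  also have "\<dots> = (1 / \<beta> + 1 / \<eta>) * (S_FD X' - S_FD P) - (1 / \<beta> + 1 / \<eta>) * frob_inner (dual W) M"
    unfolding G unfolding W_def next_field_stationary[OF \<eta> M] S_def
    by (simp add: diff_divide_distrib add_divide_distrib algebra_simps)
  also have "\<dots> = (1 / \<beta> + 1 / \<eta>) * D_FD X' P"
    unfolding P_def D_dual[OF X'f] M_def by (simp add: algebra_simps)
  finally have "(1 / \<beta> + 1 / \<eta>) * D_FD X' P \<le> 0" using min[OF Pf] by simp
  moreover have "0 < 1 / \<beta> + 1 / \<eta>" using \<beta>0 \<eta> by (simp add: add_pos_pos)
  ultimately have "D_FD X' P \<le> 0" by (simp add: mult_le_0_iff)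
  then show ?thesis using D_FD_zero_imp[OF X'f dual_sym] unfolding P_def W_def by simp
qed

text \<open>The objective without the interaction. The initial state minimizes it, since \<open>\<beta> H\<close> is the entropy minus
  the linear functional given by \<open>Y0\<close>.\<close>

definition H :: "real mat \<Rightarrow> real" where "H A = (S_FD A - frob_inner Y0 A) / \<beta>"

lemma F_split: "A \<in> feasible n \<Longrightarrow> free A = H A + bil (dens A) (dens A) / 2"
proof -
  assume A: "A \<in> feasible n"
  note Ac = feasible_carrier[OF A]
  have c: "\<mu> \<cdot>\<^sub>m 1\<^sub>m n \<in> carrier_mat n n" by simp
  have "mat_trace (C * A) = frob_inner C A"
    using frob_trace[OF C_carrier Ac] C unfolding sym_mat_def by simp
  moreover have "\<mu> * mat_trace A = frob_inner (\<mu> \<cdot>\<^sub>m 1\<^sub>m n) A"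
    using frob_smult_left[OF Ac one_carrier_mat] frob_trace[OF one_carrier_mat Ac] Ac by simp
  ultimately have "mat_trace (C * A) - \<mu> * mat_trace A = - frob_inner Y0 A / \<beta>"
    using frob_minus_left[OF Ac C_carrier c] frob_Y0[OF Ac] by simp
  then show ?thesis unfolding F_free_def energy_def E_tilde_bil H_def by (simp add: diff_divide_distrib)
qed

lemma H_diff: "A \<in> feasible n \<Longrightarrow> H A - H (sig_mat Y0) = D_FD A (sig_mat Y0) / \<beta>"
  using frob_minus_right[OF Y0_carrier feasible_carrier feasible_carrier[OF sig_mat_feasible[OF Y0_sym]], of A]
  unfolding H_def D_FD_def grad_S_FD_sig[OF Y0_sym] by (simp add: diff_divide_distrib)

lemma H_min: "A \<in> feasible n \<Longrightarrow> H (sig_mat Y0) \<le> H A"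
  proof -
  assume A: "A \<in> feasible n"
  have "0 \<le> D_FD A (sig_mat Y0) / \<beta>" using D_FD_nonneg[OF A Y0_sym] \<beta>0 by simp
  then show ?thesis using H_diff[OF A] by linarith
qed

text \<open>One step against a comparator: the three-point identity for \<open>D\<close>, the strong convexity of the
  entropic part of the objective, and the progress in the local norm.\<close>

lemma regret_step:
  assumes A: "A \<in> feasible n" and \<eta>: "0 < \<eta>" and S: "dyn.samp U x \<in> cone"
    and c: "\<And>p. p < m \<Longrightarrow> absact (dyn.rho U) p \<le> c" and \<kappa>: "\<kappa> = \<eta> * c"
  defines "X \<equiv> sig_mat (dual U)" and "X' \<equiv> sig_mat (dual (next_field (dyn.gam \<eta>) U x))"
  shows "H X' - H A + bil (\<lambda>p. dyn.rho U p - dens A p) (dyn.samp U x)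
    \<le> (D_FD A X - D_FD A X') / \<eta> + min (bil (dyn.samp U x) (dyn.rho U)) (\<kappa> * bil (dyn.samp U x) (dyn.samp U x))"
proof -
  define W where "W = next_field (dyn.gam \<eta>) U x"
  define R where "R = dyn.samp U x"
  define L where "L = lift (act R)"
  have Ac: "A \<in> carrier_mat n n" by (rule feasible_carrier[OF A])
  have Xf: "X \<in> feasible n" "X' \<in> feasible n" unfolding X_def X'_def by (intro sig_mat_feasible dual_sym)+
  have Xc: "X \<in> carrier_mat n n" "X' \<in> carrier_mat n n" using Xf feasible_carrier by auto
  have L: "psd_mat n L" using S unfolding cone_def L_def R_def by simp
  have rho: "dens X p = dyn.rho U p" if "p < m" for p unfolding X_def dyn.rho_def using amp_dens[OF that] by simp
  define M where "M = A - X'"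
  have M: "M \<in> carrier_mat n n" unfolding M_def by (rule minus_carrier_mat[OF Xc(2)])
  have YM: "frob_inner (dual U') M = frob_inner (dual U') A - frob_inner (dual U') X'" for U'
    unfolding M_def by (rule frob_minus_right[OF dual_carrier Ac Xc(2)])
  have Y0M: "frob_inner Y0 M = frob_inner Y0 A - frob_inner Y0 X'"
    unfolding M_def by (rule frob_minus_right[OF Y0_carrier Ac Xc(2)])
  have DA: "D_FD A X = S_FD A - S_FD X - (frob_inner (dual U) A - frob_inner (dual U) X)"
    unfolding X_def D_dual[OF A] using frob_minus_right[OF dual_carrier Ac sig_carrier] by simp
  have DX: "D_FD X' X = S_FD X' - S_FD X - (frob_inner (dual U) X' - frob_inner (dual U) X)"
    using D_dual[OF Xf(2)] frob_minus_right[OF dual_carrier Xc(2) sig_carrier] unfolding X_def by simp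
  have DA': "D_FD A X' = S_FD A - S_FD X' - frob_inner (dual W) M"
    unfolding X'_def W_def D_dual[OF A] M_def ..
  have D0: "0 \<le> D_FD A X'" unfolding X'_def by (rule D_FD_nonneg[OF A dual_sym])
  have three: "D_FD A X - D_FD A X' - D_FD X' X = frob_inner (dual W) M - frob_inner (dual U) M"
    unfolding DA DX DA' YM by simp
  have stat: "frob_inner (dual W) M / \<beta> + frob_inner (dual W) M / \<eta> = frob_inner Y0 M / \<beta> + frob_inner (dual U) M / \<eta> - bil (dens M) R"
    using next_field_stationary[OF \<eta> M, of U x] unfolding W_def R_def by (simp add: algebra_simps)
  have HH: "H A - H X' = (S_FD A - S_FD X' - frob_inner Y0 M) / \<beta>"
    unfolding H_def Y0M by (simp add: diff_divide_distrib)
  have "0 \<le> D_FD A X' / \<beta>" using D0 \<beta>0 by simp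
  then have h1: "frob_inner (dual W) M / \<beta> \<le> (S_FD A - S_FD X') / \<beta>" unfolding DA' by (simp add: diff_divide_distrib)
  have "H X' - H A - bil (dens M) R = - (S_FD A - S_FD X') / \<beta> + frob_inner (dual W) M / \<beta> + (frob_inner (dual W) M - frob_inner (dual U) M) / \<eta>"
    using HH stat by (simp add: diff_divide_distrib)
  also have "\<dots> \<le> (frob_inner (dual W) M - frob_inner (dual U) M) / \<eta>" using h1 by (simp add: diff_divide_distrib)
  finally have reg: "H X' - H A - bil (dens M) R \<le> (D_FD A X - D_FD A X') / \<eta> - D_FD X' X / \<eta>"
    unfolding three[symmetric] by (simp add: diff_divide_distrib)
  have LX: "frob_inner L (X - X') = bil (dyn.rho U) R - bil (dens X') R"
  proof -
    have "frob_inner L (X - X') = frob_inner L X - frob_inner L X'" unfolding L_def by (rule frob_minus_right[OF lift_carrier Xc])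
    also have "frob_inner L X = bil (dyn.rho U) R" unfolding L_def frob_lift_act[OF Xc(1)] by (rule bil_cong) (auto simp: rho)
    finally show ?thesis unfolding L_def frob_lift_act[OF Xc(2)] .
  qed
  have dM: "bil (dens M) R = bil (dens A) R - bil (dens X') R"
    unfolding bil_diff_left[symmetric] M_def by (rule bil_cong) (auto simp: dens_linear[OF Ac Xc(2)])
  have b1: "frob_inner L (X - X') - D_FD X' X / \<eta> \<le> bil R (dyn.rho U)"
  proof -
    obtain Q q where s: "spec n X' Q q" using spectral_decomposition[OF feasible_sym[OF Xf(2)]] by blast
    have "0 \<le> frob_inner (fcalc n Q q (\<lambda>x. x)) L" by (rule frob_fcalc_psd_nonneg[OF s L]) (use feasible_spec[OF Xf(2) s] in simp)
    then have "0 \<le> frob_inner X' L" unfolding fcalc_id[OF s] .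
    then have "0 \<le> bil (dens X') R" using frob_commute[OF Xc(2) lift_carrier] frob_lift_act[OF Xc(2)] unfolding L_def by simp
    moreover have "0 \<le> D_FD X' X / \<eta>" using D_FD_nonneg[OF Xf(2) dual_sym] \<eta> unfolding X_def by simp
    ultimately show ?thesis unfolding LX bil_commute[of R] by linarith
  qed
  have b2: "frob_inner L (X - X') - D_FD X' X / \<eta> \<le> \<kappa> * bil R R"
  proof -
    have "frob_inner L (X - X') - D_FD X' X / \<eta> \<le> \<eta> * frob_inner (L * rt_mat (dual U)) (L * rt_mat (dual U))"
      unfolding X_def by (rule local_norm_step[OF dual_sym Xf(2) L \<eta>])
    also have "\<dots> \<le> \<eta> * (\<Sum>p<m. dyn.rho U p * (act R p)\<^sup>2)"
      unfolding L_def dyn.rho_def amp_def using \<eta> by (intro mult_left_mono frob_lift_mult rt_carrier) simp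
    also have "\<dots> \<le> \<eta> * (c * bil R R)"
      using \<eta> act_weighted_le[of "dyn.rho U" c R] c dyn.rho_nonneg by (intro mult_left_mono) auto
    finally show ?thesis unfolding \<kappa> by simp
  qed
  have "H X' - H A + bil (\<lambda>p. dyn.rho U p - dens A p) R
      = (H X' - H A - bil (dens M) R) + frob_inner L (X - X') + 2 * (bil (dens M) R - bil (dens A) R + bil (dens X') R)"
    unfolding bil_diff_left LX dM by simp
  also have "\<dots> = (H X' - H A - bil (dens M) R) + frob_inner L (X - X')" unfolding dM by simp
  also have "\<dots> \<le> (D_FD A X - D_FD A X') / \<eta> + (frob_inner L (X - X') - D_FD X' X / \<eta>)" using reg by simp
  also have "\<dots> \<le> (D_FD A X - D_FD A X') / \<eta> + min (bil R (dyn.rho U)) (\<kappa> * bil R R)" using b1 b2 by simp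
  finally show ?thesis unfolding R_def .
qed

text \<open>Summation of the steps. The shift from the state after the step to the state before it costs nothing
  because the initial state minimizes \<open>H\<close>, and the interaction is an exact quadratic.\<close>

theorem regret:
  assumes A: "A \<in> feasible n" and \<eta>: "0 < \<eta>"
    and good: "\<And>t. t < T \<Longrightarrow> dyn.good (dyn.gam \<eta>) c x t" and \<kappa>: "\<kappa> = \<eta> * c"
  shows "(\<Sum>t<T. free (state \<eta> x t) - free A)
    \<le> D_FD A (sig_mat Y0) / \<eta> + (\<Sum>t<T. dyn.step_excess \<kappa> (dens A) (dyn.gam \<eta>) x t)"
proof -
  define U where "U t = dyn.traj (dyn.gam \<eta>) x t" for t
  define X where "X t = sig_mat (dual (U t))" for t
  define R where "R t = dyn.samp (U t) (x t)" for t
  have Xf: "X t \<in> feasible n" for t unfolding X_def by (rule sig_mat_feasible[OF dual_sym])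
  have X0: "X 0 = sig_mat Y0" unfolding X_def U_def by (simp add: dual_zero)
  have Xr: "bil (dens (X t)) (dens (X t)) = bil (dyn.rho (U t)) (dyn.rho (U t))" for t
    unfolding X_def dyn.rho_def by (rule bil_cong) (auto simp: amp_dens)
  have step: "H (X (Suc t)) - H A + bil (\<lambda>p. dyn.rho (U t) p - dens A p) (R t)
    \<le> (D_FD A (X t) - D_FD A (X (Suc t))) / \<eta> + min (bil (R t) (dyn.rho (U t))) (\<kappa> * bil (R t) (R t))" if t: "t < T" for t
  proof -
    have "R t \<in> cone" unfolding R_def dyn.samp_def by (rule cone_sample)
    moreover have "absact (dyn.rho (U t)) p \<le> c" if "p < m" for p
      using good[OF t] that unfolding dyn.good_def U_def by simp
    moreover have "X (Suc t) = sig_mat (dual (next_field (dyn.gam \<eta>) (U t) (x t)))" unfolding X_def U_def traj_next ..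
    ultimately show ?thesis using regret_step[OF A \<eta> _ _ \<kappa>, of "U t" "x t"] unfolding R_def X_def by simp
  qed
  have gap: "free (X t) - free A
      \<le> (H (X t) - H (X (Suc t))) + (D_FD A (X t) - D_FD A (X (Suc t))) / \<eta> + dyn.step_excess \<kappa> (dens A) (dyn.gam \<eta>) x t" if t: "t < T" for t
  proof -
    let ?r = "dyn.rho (U t)" and ?s = "dens A"
    have "bil ?r ?r / 2 - bil ?s ?s / 2 = bil (\<lambda>p. ?r p - R t p) (\<lambda>p. ?r p - ?s p) - bdist ?r ?s / 2
       + bil (\<lambda>p. ?r p - ?s p) (R t)"
      unfolding bil_diff_left bil_diff_right bil_commute[of ?s ?r] bil_commute[of "R t"] by (simp add: field_simps)
    then show ?thesis unfolding F_split[OF Xf] F_split[OF A] Xr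
      unfolding dyn.step_excess_def excess_def U_def[symmetric] R_def[symmetric] using step[OF t] by linarith
  qed
  have "(\<Sum>t<T. free (X t) - free A)
     \<le> (\<Sum>t<T. (H (X t) - H (X (Suc t))) + (D_FD A (X t) - D_FD A (X (Suc t))) / \<eta> + dyn.step_excess \<kappa> (dens A) (dyn.gam \<eta>) x t)"
    by (intro sum_mono gap) simp
  also have "\<dots> = (H (X 0) - H (X T)) + (D_FD A (X 0) - D_FD A (X T)) / \<eta> + (\<Sum>t<T. dyn.step_excess \<kappa> (dens A) (dyn.gam \<eta>) x t)"
    using sum_lessThan_telescope'[of "\<lambda>t. H (X t)" T] sum_lessThan_telescope'[of "\<lambda>t. D_FD A (X t)" T]
    by (simp only: sum.distrib sum_divide_distrib[symmetric])
  also have "\<dots> \<le> D_FD A (sig_mat Y0) / \<eta> + (\<Sum>t<T. dyn.step_excess \<kappa> (dens A) (dyn.gam \<eta>) x t)"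
  proof -
    have "H (X 0) \<le> H (X T)" unfolding X0 by (rule H_min[OF Xf])
    moreover have "0 \<le> D_FD A (X T) / \<eta>" using D_FD_nonneg[OF A dual_sym] \<eta> unfolding X_def by simp
    ultimately show ?thesis unfolding X0 by (simp add: diff_divide_distrib)
  qed
  finally show ?thesis unfolding X_def U_def .
qed

end


section \<open>The number of occupied states\<close>

lemma poly_linear_factors_zero: "poly (\<Prod>y\<leftarrow>ys. [:- y, 1:]) x = 0 \<longleftrightarrow> x \<in> set ys" for x :: real
  by (induction ys) auto

lemma prod_list_map_mset:
  fixes f :: "'b \<Rightarrow> 'c :: comm_monoid_mult"
  shows "mset xs = mset ys \<Longrightarrow> prod_list (map f xs) = prod_list (map f ys)"
  by (metis mset_map prod_mset_prod_list)

lemma linear_factors_unique: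
  fixes xs ys :: "real list"
  shows "(\<Prod>x\<leftarrow>xs. [:- x, 1:]) = (\<Prod>y\<leftarrow>ys. [:- y, 1:]) \<Longrightarrow> mset xs = mset ys"
proof (induction xs arbitrary: ys)
  case Nil
  then have "ys = []" using poly_linear_factors_zero[of ys "hd ys"] by (cases ys) auto
  then show ?case by simp
next
  case (Cons x xs)
  have "poly (\<Prod>y\<leftarrow>ys. [:- y, 1:]) x = 0" unfolding Cons.prems[symmetric] by simp
  then have "x \<in> set ys" by (simp add: poly_linear_factors_zero)
  then have ys: "mset ys = mset (x # remove1 x ys)" by simp
  have "(\<Prod>y\<leftarrow>ys. [:- y, 1:]) = [:- x, 1:] * (\<Prod>y\<leftarrow>remove1 x ys. [:- y, 1:])"
    using prod_list_map_mset[OF ys, of "\<lambda>y. [:- y, 1:]"] by simp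
  then have "[:- x, 1:] * (\<Prod>x\<leftarrow>xs. [:- x, 1:]) = [:- x, 1:] * (\<Prod>y\<leftarrow>remove1 x ys. [:- y, 1:])" using Cons.prems by simp
  then have "(\<Prod>x\<leftarrow>xs. [:- x, 1:]) = (\<Prod>y\<leftarrow>remove1 x ys. [:- y, 1:])" by (subst (asm) mult_cancel_left) simp
  from Cons.IH[OF this] show ?case by (metis ys mset.simps(2))
qed

lemma sorted_eigvals_spec:
  assumes s: "spec n A U d" shows "sorted_eigvals A = sort (map d [0..<n])"
proof -
  note D = specD[OF s]
  have "similar_mat A (mat_diag n d)"
    by (rule similar_matI[of _ _ U "U\<^sup>T" n]) (use D in auto)
  then have "char_poly A = char_poly (mat_diag n d)" by (rule char_poly_similar)
  also have "\<dots> = (\<Prod>a\<leftarrow>diag_mat (mat_diag n d). [:- a, 1:])"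
    by (rule char_poly_upper_triangular[OF mat_diag_dim]) (auto simp: upper_triangular_def mat_diag_def)
  also have "diag_mat (mat_diag n d) = map d [0..<n]" unfolding diag_mat_def mat_diag_def by auto
  finally have cp: "char_poly A = (\<Prod>a\<leftarrow>map d [0..<n]. [:- a, 1:])" .
  have cps: "char_poly A = (\<Prod>x\<leftarrow>sort (map d [0..<n]). [:- x, 1:])"
    unfolding cp by (rule prod_list_map_mset) simp
  show ?thesis unfolding sorted_eigvals_def
  proof (rule the_equality)
    show "sorted (sort (map d [0..<n])) \<and> char_poly A = (\<Prod>x\<leftarrow>sort (map d [0..<n]). [:- x, 1:])" using cps by simp
    fix xs assume xs: "sorted xs \<and> char_poly A = (\<Prod>x\<leftarrow>xs. [:- x, 1:])"
    then have "mset xs = mset (map d [0..<n])" using cp by (intro linear_factors_unique) simp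
    then show "xs = sort (map d [0..<n])" using xs properties_for_sort by metis
  qed
qed

lemma sum_eigval_nth:
  assumes s: "spec n A U d" shows "(\<Sum>i<n. f (d i)) = (\<Sum>k<n. f (eigval_nth (Suc k) A))"
proof -
  let ?xs = "map d [0..<n]"
  have "(\<Sum>i<n. f (d i)) = sum_list (map f ?xs)" by (simp add: sum_list_sum_nth atLeast0LessThan)
  also have "\<dots> = sum_list (map f (sort ?xs))"
    by (metis mset_map mset_sort sum_mset_sum_list)
  also have "\<dots> = (\<Sum>k<n. f (sort ?xs ! k))" by (simp add: sum_list_sum_nth atLeast0LessThan)
  finally show ?thesis unfolding eigval_nth_def sorted_eigvals_spec[OF s] by simp
qed

lemma f_FD_antimono: "0 < \<beta> \<Longrightarrow> x \<le> y \<Longrightarrow> f_FD \<beta> y \<le> f_FD \<beta> x"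
  unfolding f_FD_def by (intro divide_left_mono) (auto simp: add_pos_pos)

text \<open>Convexity of \<open>log (1 + e\<^sup>u)\<close>, whose derivative is the sigmoid: the tangent at \<open>-b\<close> lies below the graph at \<open>t - b\<close>.\<close>

lemma softplus_convex:
  fixes t b :: real
  shows "t / (1 + exp b) \<le> ln (1 + exp (t - b)) - ln (1 + exp (- b))"
proof -
  define E where "E = exp (- b)"
  have E: "0 < E" "exp b = 1 / E" unfolding E_def by (auto simp: exp_minus field_simps)
  define w where "w = E / (1 + E)"
  have w: "0 \<le> w" "w \<le> 1" "1 - w = 1 / (1 + E)" using E unfolding w_def by (auto simp: field_simps)
  have w': "t / (1 + exp b) = w * t" using E(1) unfolding w_def E(2) by (simp add: field_simps)
  have "exp (\<Sum>i\<in>{0,1::nat}. (if i = 0 then 1 - w else w) * (if i = 0 then 0 else t))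
      \<le> (\<Sum>i\<in>{0,1::nat}. (if i = 0 then 1 - w else w) * exp (if i = 0 then 0 else t))"
    by (rule exp_convex_comb) (use w(1,2) in auto)
  then have "exp (w * t) \<le> (1 - w) + w * exp t" by simp
  also have "\<dots> = (1 + E * exp t) / (1 + E)" unfolding w(3) unfolding w_def by (simp add: add_divide_distrib)
  finally have "ln (exp (w * t)) \<le> ln ((1 + E * exp t) / (1 + E))" using E by (subst ln_le_cancel_iff) (auto intro!: divide_pos_pos add_pos_pos)
  also have "\<dots> = ln (1 + E * exp t) - ln (1 + E)" using E by (intro ln_divide_pos) (auto intro!: add_pos_pos)
  also have "E * exp t = exp (t - b)" unfolding E_def by (simp flip: exp_add)
  finally show ?thesis unfolding w' E_def by simp
qed

text \<open>Each occupation number is at most \<open>cl\<close> times the increment of an antiderivative over an interval of length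
  \<open>1/cl\<close>, so the sum telescopes.\<close>

lemma fermi_sum_bound:
  assumes \<beta>: "0 < \<beta>" and cl: "0 < cl"
  shows "(\<Sum>k<n. f_FD \<beta> (real (Suc k) / cl - \<mu>)) \<le> cl * (max \<mu> 0 + 1 / \<beta>)"
proof -
  define g where "g k = ln (1 + exp (- (\<beta> * (real k / cl - \<mu>))))" for k :: nat
  have step: "(\<beta> / cl) * f_FD \<beta> (real (Suc k) / cl - \<mu>) \<le> g k - g (Suc k)" for k
  proof -
    have "\<beta> / cl - \<beta> * (real (Suc k) / cl - \<mu>) = - (\<beta> * (real k / cl - \<mu>))" by (simp add: field_simps add_divide_distrib)
    then show ?thesis using softplus_convex[of "\<beta> / cl" "\<beta> * (real (Suc k) / cl - \<mu>)"] unfolding g_def f_FD_def by simp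
  qed
  have "(\<beta> / cl) * (\<Sum>k<n. f_FD \<beta> (real (Suc k) / cl - \<mu>)) \<le> (\<Sum>k<n. g k - g (Suc k))"
    unfolding sum_distrib_left by (intro sum_mono step)
  also have "\<dots> = g 0 - g n" by (rule sum_lessThan_telescope')
  also have "\<dots> \<le> g 0" unfolding g_def by simp
  also have "\<dots> \<le> \<beta> * max \<mu> 0 + 1"
  proof -
    have "1 + exp (\<beta> * \<mu>) \<le> exp (\<beta> * max \<mu> 0) + exp (\<beta> * max \<mu> 0)" using \<beta> by (intro add_mono) (auto intro!: mult_left_mono)
    also have "\<dots> \<le> exp 1 * exp (\<beta> * max \<mu> 0)" using exp_ge_add_one_self[of 1] by simp
    finally have "1 + exp (\<beta> * \<mu>) \<le> exp (\<beta> * max \<mu> 0 + 1)" by (simp flip: exp_add add: add.commute)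
    moreover have "0 < 1 + exp (\<beta> * \<mu>)" by (intro add_pos_pos) auto
    ultimately have "ln (1 + exp (\<beta> * \<mu>)) \<le> ln (exp (\<beta> * max \<mu> 0 + 1))" by (subst ln_le_cancel_iff) auto
    then show ?thesis unfolding g_def by simp
  qed
  finally have "(\<Sum>k<n. f_FD \<beta> (real (Suc k) / cl - \<mu>)) \<le> (\<beta> * max \<mu> 0 + 1) * (cl / \<beta>)"
    using \<beta> cl by (simp add: field_simps)
  also have "\<dots> = cl * (max \<mu> 0 + 1 / \<beta>)" using \<beta> by (simp add: field_simps)
  finally show ?thesis .
qed

context hartree
begin

lemma tau_le_n_eff:
  assumes cl: "0 < cl" and ev: "\<And>k. k \<in> {1..n} \<Longrightarrow> real k / cl \<le> eigval_nth k C"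
  shows "tau \<le> n_eff cl (max \<mu> 0) \<beta>"
proof -
  obtain U d where s: "spec n C U d" using spectral_decomposition[OF C] by blast
  have "spec n ((- \<beta>) \<cdot>\<^sub>m C + (\<beta> * \<mu>) \<cdot>\<^sub>m 1\<^sub>m n) U (\<lambda>i. (- \<beta>) * d i + (\<beta> * \<mu>) * 1)" by (rule spec_comb[OF s spec_one[OF s]])
  moreover have "(- \<beta>) \<cdot>\<^sub>m C + (\<beta> * \<mu>) \<cdot>\<^sub>m 1\<^sub>m n = Y0"
    unfolding Y0_def using C_carrier by (intro eq_matI) (auto simp: algebra_simps)
  ultimately have s0: "spec n Y0 U (\<lambda>i. (- \<beta>) * d i + (\<beta> * \<mu>) * 1)" by simp
  have "mat_trace (sig_mat Y0) = (\<Sum>i<n. f_FD \<beta> (d i - \<mu>))"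
    unfolding sig_mat_eq[OF s0] mat_trace_fcalc[OF s0] by (simp add: sigm_def f_FD_def algebra_simps)
  also have "\<dots> = (\<Sum>k<n. f_FD \<beta> (eigval_nth (Suc k) C - \<mu>))" by (rule sum_eigval_nth[OF s])
  also have "\<dots> \<le> (\<Sum>k<n. f_FD \<beta> (real (Suc k) / cl - \<mu>))"
    by (intro sum_mono f_FD_antimono[OF \<beta>0] diff_right_mono ev) simp
  also have "\<dots> \<le> cl * (max \<mu> 0 + 1 / \<beta>)" by (rule fermi_sum_bound[OF \<beta>0 cl])
  finally have "mat_trace (sig_mat Y0) \<le> cl * (max \<mu> 0 + 1 / \<beta>)" .
  moreover have "0 \<le> cl * (max \<mu> 0 + 1 / \<beta>)" using cl \<beta>0 by simp
  ultimately show ?thesis unfolding tau_def n_eff_def by simp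
qed

section \<open>Distance of the minimizer from the initial state\<close>

definition minimizer :: "real mat \<Rightarrow> bool" where
  "minimizer A \<longleftrightarrow> is_arg_min (\<lambda>Y. free Y) (\<lambda>Y. Y \<in> feasible n) A"

lemma minimizer_feasible: "minimizer A \<Longrightarrow> A \<in> feasible n"
  unfolding minimizer_def is_arg_min_def by simp

lemma minimizer_le:
  "minimizer A \<Longrightarrow> Y \<in> feasible n \<Longrightarrow> free A \<le> free Y"
  unfolding minimizer_def is_arg_min_def by (auto simp: not_less)

abbreviation rho0 :: "nat \<Rightarrow> real" where "rho0 \<equiv> dyn.rho (\<lambda>_. 0)"

lemma rho0_dens: "p < m \<Longrightarrow> dens (sig_mat Y0) p = rho0 p"
  unfolding dyn.rho_def using amp_dens[of p "\<lambda>_. 0"] by (simp add: dual_zero)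

text \<open>The minimizer trades an increase of \<open>H\<close>, which is \<open>D/\<beta>\<close>, for a decrease of the interaction energy.\<close>

lemma D_le_energy_drop:
  assumes A: "minimizer A"
  shows "D_FD A (sig_mat Y0) \<le> \<beta> / 2 * (bil rho0 rho0 - bil (dens A) (dens A))"
proof -
  have f: "sig_mat Y0 \<in> feasible n" by (rule sig_mat_feasible[OF Y0_sym])
  have "bil (dens (sig_mat Y0)) (dens (sig_mat Y0)) = bil rho0 rho0" by (rule bil_cong) (auto simp: rho0_dens)
  then have "D_FD A (sig_mat Y0) / \<beta> \<le> (bil rho0 rho0 - bil (dens A) (dens A)) / 2"
    using minimizer_le[OF A f] H_diff[OF minimizer_feasible[OF A]]
    unfolding F_split[OF f] F_split[OF minimizer_feasible[OF A]] by (simp add: diff_divide_distrib)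
  then show ?thesis using \<beta>0 by (simp add: field_simps)
qed

lemma bil_density_le:
  assumes "\<And>p. p < m \<Longrightarrow> 0 \<le> r p" "\<And>p. p < m \<Longrightarrow> absact r p \<le> c"
  shows "bil r r \<le> c * (\<Sum>p<m. r p)"
  by (rule bil_weighted_le[of r]) (use assms in \<open>auto simp: power2_eq_square\<close>)

text \<open>The distance of the densities is controlled by \<open>D\<close> through the Hellinger bound, and \<open>D\<close> by the
  difference of the interaction energies, which is linear in the distance. Hence the distance is bounded.\<close>

lemma minimizer_distance:
  assumes A: "minimizer A" and c0: "\<And>p. p < m \<Longrightarrow> absact rho0 p \<le> c" and cs: "\<And>p. p < m \<Longrightarrow> absact (dens A) p \<le> c" and c: "0 \<le> c"
  shows "bil (dens A) (dens A) \<le> c * tau" "D_FD A (sig_mat Y0) \<le> \<beta> / 2 * (c * tau)"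
    "bdist (dens A) rho0 \<le> 16 * (\<beta> * c)\<^sup>2 * (c * tau)"
proof -
  note Af = minimizer_feasible[OF A]
  define D where "D = D_FD A (sig_mat Y0)"
  have D0: "0 \<le> D" unfolding D_def by (rule D_FD_nonneg[OF Af Y0_sym])
  have Dle: "D \<le> \<beta> / 2 * (bil rho0 rho0 - bil (dens A) (dens A))" unfolding D_def by (rule D_le_energy_drop[OF A])
  have "bil rho0 rho0 \<le> c * (\<Sum>p<m. rho0 p)" by (rule bil_density_le) (use dyn.rho_nonneg c0 in auto)
  also have "\<dots> \<le> c * tau" using dyn.K_trace[OF dyn.K_zero] c unfolding dyn.rho_def by (intro mult_left_mono) auto
  finally have b0: "bil rho0 rho0 \<le> c * tau" .
  have "0 \<le> \<beta> / 2 * (bil rho0 rho0 - bil (dens A) (dens A))" using D0 Dle by simp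
  then have bb: "bil (dens A) (dens A) \<le> bil rho0 rho0" using \<beta>0 by (simp add: zero_le_mult_iff)
  then show bs: "bil (dens A) (dens A) \<le> c * tau" using b0 by simp
  have "\<beta> / 2 * (bil rho0 rho0 - bil (dens A) (dens A)) \<le> \<beta> / 2 * (c * tau)"
    using b0 bil_nonneg[of "dens A"] \<beta>0 by (intro mult_left_mono) auto
  then show "D_FD A (sig_mat Y0) \<le> \<beta> / 2 * (c * tau)" using Dle unfolding D_def by simp
  define P Q where "P = rt_mat Y0" and "Q = mat_fun sqrt A"
  have Ps: "sym_mat n P" "P * P = sig_mat Y0" unfolding P_def
    using rt_mat_sym[OF Y0_sym] rt_square[of "\<lambda>_. 0"] by (auto simp: dual_zero)
  have Qs: "sym_mat n Q" "Q * Q = A" unfolding Q_def using mat_fun_sym[OF feasible_sym[OF Af]] sqrt_square_feasible[OF Af] by auto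
  have Pc: "P \<in> carrier_mat n n" and Qc: "Q \<in> carrier_mat n n" using Ps Qs unfolding sym_mat_def by auto
  define a b where "a p i = (\<Psi> * Q) $$ (p, i)" and "b p i = (\<Psi> * P) $$ (p, i)" for p i
  have ra: "dens A p = sqn n (a p)" and rb: "rho0 p = sqn n (b p)" if "p < m" for p
    using dens_square[OF Qs(1) that] dens_square[OF Ps(1) that] rho0_dens[OF that] unfolding Ps(2) Qs(2) a_def b_def by auto
  define e k x where "e p = (\<Sum>i<n. (a p i - b p i)\<^sup>2)" and "k p = (\<Sum>i<n. (a p i + b p i)\<^sup>2)"
    and "x p = dens A p - rho0 p" for p
  have "bil x x \<le> (4 * c) * (\<Sum>p<m. e p)"
  proof (rule bil_weighted_le[of k])
    fix p assume p: "p < m"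
    show "0 \<le> k p" "0 \<le> e p" unfolding k_def e_def by (auto intro: sum_nonneg)
    have "x p = (\<Sum>i<n. (a p i + b p i) * (a p i - b p i))"
      unfolding x_def ra[OF p] rb[OF p] sum_subtractf[symmetric] by (intro sum.cong refl) (simp add: power2_eq_square algebra_simps)
    then show "(x p)\<^sup>2 \<le> k p * e p" unfolding k_def e_def using Cauchy_Schwarz_ineq_sum by metis
    have "absact k p \<le> absact (\<lambda>q. 2 * dens A q + 2 * rho0 q) p"
    proof (rule absact_mono)
      fix q assume q: "q < m"
      have "(u + v)\<^sup>2 \<le> 2 * u\<^sup>2 + 2 * v\<^sup>2" for u v :: real using sum_squares_bound[of u v] by (simp add: power2_sum)
      then have "k q \<le> (\<Sum>i<n. 2 * (a q i)\<^sup>2 + 2 * (b q i)\<^sup>2)" unfolding k_def by (intro sum_mono)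
      then show "k q \<le> 2 * dens A q + 2 * rho0 q" unfolding ra[OF q] rb[OF q] by (simp add: sum.distrib sum_distrib_left)
    qed
    also have "\<dots> = 2 * absact (dens A) p + 2 * absact rho0 p" by (simp only: absact_add absact_scale)
    finally show "absact k p \<le> 4 * c" using c0[OF p] cs[OF p] by simp
  qed
  also have "(\<Sum>p<m. e p) \<le> D"
  proof -
    have QP: "Q - P \<in> carrier_mat n n" by (rule minus_carrier_mat[OF Pc])
    have PQP: "\<Psi> * (Q - P) \<in> carrier_mat m n" using Psi QP by simp
    have eq: "\<Psi> * (Q - P) = \<Psi> * Q - \<Psi> * P" by (rule mult_minus_distrib_mat[OF Psi Qc Pc])
    have "(\<Sum>p<m. e p) = frob_inner (\<Psi> * (Q - P)) (\<Psi> * (Q - P))"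
      unfolding frob_entries[OF PQP] unfolding eq e_def a_def b_def
      by (intro sum.cong refl) (use Psi Pc Qc in \<open>auto simp: power2_eq_square\<close>)
    also have "\<dots> = frob_inner (Q - P) (Q - P)" by (rule isometry_frob[OF QP])
    also have "\<dots> \<le> D" unfolding D_def P_def Q_def by (rule D_FD_hellinger[OF Af Y0_sym])
    finally show ?thesis .
  qed
  finally have N1: "bil x x \<le> (4 * c) * D" using c by (simp add: mult_left_mono)
  define N where "N = nrm x"
  define s where "s = sqrt (c * tau)"
  have ct: "0 \<le> c * tau" using c dyn.\<tau>1 by simp
  have s: "0 \<le> s" "s\<^sup>2 = c * tau" using ct unfolding s_def by auto
  have N: "0 \<le> N" "bil x x = N\<^sup>2" unfolding N_def by (simp_all add: nrm_nonneg nrm_sq)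
  have n1: "nrm rho0 \<le> s" "nrm (dens A) \<le> s" unfolding nrm_def s_def using b0 bs by auto
  have "bil rho0 rho0 - bil (dens A) (dens A) = bil (\<lambda>p. rho0 p - dens A p) (\<lambda>p. rho0 p + dens A p)"
    unfolding bil_diff_left bil_add_right bil_commute[of "dens A" rho0] by simp
  also have "\<dots> \<le> ndist rho0 (dens A) * nrm (\<lambda>p. rho0 p + dens A p)" using bil_CS abs_le_iff by blast
  also have "\<dots> = N * nrm (\<lambda>p. rho0 p + dens A p)" unfolding N_def x_def nrm_minus_commute[of rho0] ..
  also have "\<dots> \<le> N * (2 * s)"
    using nrm_triangle[of rho0 "dens A"] n1 N by (intro mult_left_mono) auto
  finally have "\<beta> / 2 * (bil rho0 rho0 - bil (dens A) (dens A)) \<le> \<beta> / 2 * (N * (2 * s))" using \<beta>0 by (intro mult_left_mono) auto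
  then have "D \<le> \<beta> * N * s" using Dle by simp
  then have "(4 * c) * D \<le> (4 * c) * (\<beta> * N * s)" using c by (intro mult_left_mono) auto
  then have "N * N \<le> N * (4 * (\<beta> * c) * s)" using N1 unfolding N(2) by (simp add: power2_eq_square mult_ac)
  then have "N \<le> 4 * (\<beta> * c) * s" using N(1) \<beta>0 c s(1) by (cases "N = 0") auto
  then have "N\<^sup>2 \<le> (4 * (\<beta> * c) * s)\<^sup>2" using N(1) by (rule power_mono)
  also have "\<dots> = 16 * (\<beta> * c)\<^sup>2 * (c * tau)" unfolding s(2)[symmetric] by (simp add: power2_eq_square)
  finally show "bdist (dens A) rho0 \<le> 16 * (\<beta> * c)\<^sup>2 * (c * tau)"
    using N(2) unfolding x_def by simp
qed

end


section \<open>Blocks of independent Gaussian entries\<close>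


text \<open>The joint law of the entries is a product over pairs \<open>(t, i)\<close>; grouping it into blocks of constant \<open>t\<close> gives
  the product of Gaussian vectors on which the dynamics is defined.\<close>

lemma gaussian_blocks:
  assumes M: "prob_space M" and n: "0 < n" and T: "0 < T" and z: "std_gaussian_vecs M n T z"
  shows "distr M (Pi\<^sub>M {..<T} (\<lambda>_. gauss_vec n)) (\<lambda>\<omega>. \<lambda>t\<in>{..<T}. \<lambda>i\<in>{..<n}. z t \<omega> $ i) = Pi\<^sub>M {..<T} (\<lambda>_. gauss_vec n)"
    "(\<lambda>\<omega>. \<lambda>t\<in>{..<T}. \<lambda>i\<in>{..<n}. z t \<omega> $ i) \<in> M \<rightarrow>\<^sub>M Pi\<^sub>M {..<T} (\<lambda>_. gauss_vec n)"
proof -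
  interpret prob_space M by (rule M)
  define X where "X k \<omega> = z (fst k) \<omega> $ snd k" for k :: "nat \<times> nat" and \<omega>
  define B where "B t \<omega> = (\<lambda>i\<in>{..<n}. z t \<omega> $ i)" for t \<omega>
  let ?K = "\<lambda>t. {t} \<times> {..<n}"
  let ?b = "\<lambda>_ :: nat \<times> nat. borel :: real measure"
  have "(\<lambda>(t, i) \<omega>. z t \<omega> $ i) = X" unfolding X_def by (auto simp: fun_eq_iff)
  then have ind: "indep_vars ?b X ({..<T} \<times> {..<n})" and dist: "\<And>t i. t < T \<Longrightarrow> i < n \<Longrightarrow> distributed M lborel (X (t, i)) std_normal_density"
    using z unfolding std_gaussian_vecs_def X_def by auto
  have dX: "distr M borel (X k) = std_normal" if "k \<in> {..<T} \<times> {..<n}" for k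
  proof -
    have "distr M lborel (X k) = std_normal" using dist[of "fst k" "snd k"] that unfolding distributed_def by auto
    moreover have "distr M borel (X k) = distr M lborel (X k)" by (rule distr_cong) auto
    ultimately show ?thesis by simp
  qed
  have Xm: "X k \<in> borel_measurable M" if "k \<in> {..<T} \<times> {..<n}" for k
    using ind that unfolding indep_vars_def by auto
  have pm: "Pi\<^sub>M I (\<lambda>_. std_normal) = Pi\<^sub>M I (\<lambda>k. distr M borel (X k))" if "I \<subseteq> {..<T} \<times> {..<n}" for I
    by (rule PiM_cong) (use dX that in auto)
  have bK: "sets (Pi\<^sub>M I ?b) = sets (Pi\<^sub>M I (\<lambda>_. std_normal))" for I :: "(nat \<times> nat) set"
    by (rule sets_PiM_cong) auto
  define Y where "Y t f = (\<lambda>i\<in>{..<n}. f (t, i))" for t :: nat and f :: "nat \<times> nat \<Rightarrow> real"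
  have Ym: "Y t \<in> Pi\<^sub>M (?K t) ?b \<rightarrow>\<^sub>M gauss_vec n" for t
    unfolding Y_def gauss_vec_def by (rule measurable_restrict) (simp add: measurable_component_singleton)
  have YB: "Y t (\<lambda>k\<in>?K t. X k \<omega>) = B t \<omega>" for t \<omega>
    unfolding Y_def B_def X_def by (auto simp: fun_eq_iff)
  have blk: "indep_vars (\<lambda>t. Pi\<^sub>M (?K t) ?b) (\<lambda>t \<omega>. \<lambda>k\<in>?K t. X k \<omega>) {..<T}"
    by (rule indep_vars_restrict[OF ind]) (auto simp: disjoint_family_on_def)
  have "indep_vars (\<lambda>_. gauss_vec n) (\<lambda>t \<omega>. Y t (\<lambda>k\<in>?K t. X k \<omega>)) {..<T}"
    by (rule indep_vars_compose2[OF blk Ym])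
  then have indB: "indep_vars (\<lambda>_. gauss_vec n) B {..<T}" unfolding YB by simp
  have Bm: "B t \<in> M \<rightarrow>\<^sub>M gauss_vec n" if "t \<in> {..<T}" for t using indB that unfolding indep_vars_def by auto
  have dB: "distr M (gauss_vec n) (B t) = gauss_vec n" if t: "t \<in> {..<T}" for t
  proof -
    have sub: "?K t \<subseteq> {..<T} \<times> {..<n}" using t by auto
    have ne: "?K t \<noteq> {}" using n by auto
    have rm: "(\<lambda>\<omega>. \<lambda>k\<in>?K t. X k \<omega>) \<in> M \<rightarrow>\<^sub>M Pi\<^sub>M (?K t) ?b"
      by (rule measurable_restrict) (use Xm sub in auto)
    have "distr M (Pi\<^sub>M (?K t) ?b) (\<lambda>\<omega>. \<lambda>k\<in>?K t. X k \<omega>) = Pi\<^sub>M (?K t) (\<lambda>k. distr M borel (X k))"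
      using indep_vars_subset[OF ind sub] indep_vars_iff_distr_eq_PiM'[OF ne, of X ?b] Xm sub by blast
    also have "\<dots> = Pi\<^sub>M (?K t) (\<lambda>_. std_normal)" using pm[OF sub] by simp
    finally have d1: "distr M (Pi\<^sub>M (?K t) ?b) (\<lambda>\<omega>. \<lambda>k\<in>?K t. X k \<omega>) = Pi\<^sub>M (?K t) (\<lambda>_. std_normal)" .
    have "distr M (gauss_vec n) (B t) = distr (distr M (Pi\<^sub>M (?K t) ?b) (\<lambda>\<omega>. \<lambda>k\<in>?K t. X k \<omega>)) (gauss_vec n) (Y t)"
      by (subst distr_distr[OF Ym rm]) (simp add: comp_def YB)
    also have "\<dots> = distr (Pi\<^sub>M (?K t) (\<lambda>_. std_normal)) (gauss_vec n) (Y t)" unfolding d1 ..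
    also have "\<dots> = gauss_vec n" unfolding Y_def gauss_vec_def
      by (rule distr_PiM_reindex[where f = "\<lambda>i. (t, i)" and M = "\<lambda>_. std_normal"]) (auto intro: inj_onI prob_space_std_normal)
    finally show ?thesis .
  qed
  have "distr M (Pi\<^sub>M {..<T} (\<lambda>_. gauss_vec n)) (\<lambda>\<omega>. \<lambda>t\<in>{..<T}. B t \<omega>) = Pi\<^sub>M {..<T} (\<lambda>t. distr M (gauss_vec n) (B t))"
    using indB indep_vars_iff_distr_eq_PiM'[of "{..<T}" B "\<lambda>_. gauss_vec n"] Bm T by blast
  also have "\<dots> = Pi\<^sub>M {..<T} (\<lambda>_. gauss_vec n)" by (rule PiM_cong) (use dB in auto)
  finally show "distr M (Pi\<^sub>M {..<T} (\<lambda>_. gauss_vec n)) (\<lambda>\<omega>. \<lambda>t\<in>{..<T}. \<lambda>i\<in>{..<n}. z t \<omega> $ i) = Pi\<^sub>M {..<T} (\<lambda>_. gauss_vec n)"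
    unfolding B_def .
  have "(\<lambda>\<omega>. \<lambda>t\<in>{..<T}. B t \<omega>) \<in> M \<rightarrow>\<^sub>M Pi\<^sub>M {..<T} (\<lambda>_. gauss_vec n)" by (rule measurable_restrict) (rule Bm)
  then show "(\<lambda>\<omega>. \<lambda>t\<in>{..<T}. \<lambda>i\<in>{..<n}. z t \<omega> $ i) \<in> M \<rightarrow>\<^sub>M Pi\<^sub>M {..<T} (\<lambda>_. gauss_vec n)"
    unfolding B_def .
qed

section \<open>The bound along a trajectory\<close>

lemma c_Tm_bounds:
  assumes "0 < T" "0 < m" "0 < \<delta>" "\<delta> \<le> 1"
  shows "2 \<le> c_Tm T m \<delta>" "c_Tm T m \<delta> \<le> 18 * max 1 (ln (real T * real m / \<delta>))"
proof -
  have "1 * 1 \<le> real T * real m" using assms by (intro mult_mono) auto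
  then have TM: "1 \<le> real T * real m / \<delta>" using assms by (simp add: field_simps)
  then have l0: "0 \<le> ln (real T * real m / \<delta>)" by simp
  have "ln (2 * real T * real m / \<delta>) = ln (2 * (real T * real m / \<delta>))" by (simp add: mult.assoc)
  also have "\<dots> = ln 2 + ln (real T * real m / \<delta>)" using TM by (intro ln_mult_pos) auto
  finally have l: "ln (2 * real T * real m / \<delta>) = ln 2 + ln (real T * real m / \<delta>)" .
  show "2 \<le> c_Tm T m \<delta>" unfolding c_Tm_def l using l0 by simp
  have "ln 2 \<le> (1 :: real)" using ln_le_minus_one[of 2] by simp
  then show "c_Tm T m \<delta> \<le> 18 * max 1 (ln (real T * real m / \<delta>))" unfolding c_Tm_def l by simp
qed

lemma average_rescale:
  "0 < q \<Longrightarrow> (1 / (q * q)) * (q * q * F + k * (c * N) * q * B * l) = F + k * (l * B * c * N / q)" for q F k c N B l :: real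
  by (simp add: field_simps)

context hartree
begin

definition run_bounded :: "real mat \<Rightarrow> real \<Rightarrow> (nat \<Rightarrow> field) \<Rightarrow> bool" where
  "run_bounded A \<delta> x \<longleftrightarrow> (\<forall>\<eta>>0. \<forall>c\<ge>0. c \<le> dyn.ch \<longrightarrow>
     \<eta> = sqrt (2 * D_FD A (sig_mat Y0) / (tau * (c_Tm T m \<delta>)\<^sup>2 * c\<^sup>2 * real T)) \<longrightarrow>
     (\<forall>t<T. dyn.good (dyn.gam \<eta>) c x t) \<longrightarrow> (\<forall>p<m. absact (dens A) p \<le> c) \<longrightarrow>
     (\<Sum>t<T. free (state \<eta> x t) - free A)
     \<le> 25009 * (c * tau) * sqrt (real T) * (1 + sqrt (\<beta> * dyn.ch)) * max 1 (ln (real T * real m / \<delta>)))"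

text \<open>With the prescribed step size, \<open>\<eta> c = \<kappa>\<close> depends only on the data of the problem, so the uniform bound
  applies with this \<open>\<kappa>\<close>. The term \<open>D/\<eta>\<close> equals \<open>c c\<^sub>T \<surd>T \<surd>(D \<tau>/2)\<close>, and \<open>D \<le> \<beta> c \<tau>/2\<close>.\<close>

theorem trajectory_bound:
  assumes A: "minimizer A" and \<delta>: "0 < \<delta>" "\<delta> \<le> 1"
  shows "\<exists>S\<in>sets dyn.\<Omega>. 1 - \<delta> \<le> measure dyn.\<Omega> S \<and> (\<forall>x\<in>S. run_bounded A \<delta> x)"
proof -
  define D where "D = D_FD A (sig_mat Y0)"
  define cT where "cT = c_Tm T m \<delta>"
  define l where "l = max 1 (ln (real T * real m / \<delta>))"
  define b where "b = sqrt (\<beta> * dyn.ch)"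
  note Af = minimizer_feasible[OF A]
  have cT: "2 \<le> cT" "cT \<le> 18 * l" unfolding cT_def l_def using c_Tm_bounds[OF T0 m0 \<delta>] by auto
  have b0: "0 \<le> b" unfolding b_def using \<beta>0 dyn.ch_nonneg by simp
  have D0: "0 \<le> D" unfolding D_def by (rule D_FD_nonneg[OF Af Y0_sym])
  have tau1: "1 \<le> tau" by (rule dyn.\<tau>1)
  have sT: "0 < sqrt (real T)" using T0 by simp
  note run_bounded_abbr = run_bounded_def D_def[symmetric] cT_def[symmetric] l_def[symmetric] b_def[symmetric]
  show ?thesis
  proof (cases "D = 0")
    case True
    show "\<exists>S\<in>sets dyn.\<Omega>. 1 - \<delta> \<le> measure dyn.\<Omega> S \<and> (\<forall>x\<in>S. run_bounded A \<delta> x)"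
      unfolding run_bounded_abbr True using prob_space.prob_space[OF dyn.prob_space_\<Omega>] \<delta>
      by (intro bexI[of _ "space dyn.\<Omega>"]) auto
  next
    case False
    then have Dp: "0 < D" using D0 by simp
    define \<kappa> where "\<kappa> = sqrt (2 * D / tau) / (cT * sqrt (real T))"
    have \<kappa>: "0 < \<kappa>" unfolding \<kappa>_def using Dp tau1 cT sT by simp
    have rs: "0 \<le> dens A p" if "p < m" for p using dens_feasible(1)[OF Af that] .
    obtain S where S: "S \<in> sets dyn.\<Omega>" "1 - \<delta> \<le> measure dyn.\<Omega> S"
      and Sx: "\<And>x \<eta> c. x \<in> S \<Longrightarrow> 0 < \<eta> \<Longrightarrow> c = \<kappa> / \<eta> \<Longrightarrow> c \<le> dyn.ch \<Longrightarrow>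
        \<forall>t<T. dyn.good (dyn.gam \<eta>) c x t \<Longrightarrow> \<forall>p<m. absact (dens A) p \<le> c \<Longrightarrow> bil (dens A) (dens A) \<le> c * tau \<Longrightarrow>
        4 * \<kappa>\<^sup>2 * real T \<le> \<beta> * c \<Longrightarrow>
        bdist (dens A) rho0 \<le> 16 * (\<beta> * c)\<^sup>2 * (c * tau) \<Longrightarrow>
        (\<Sum>t<T. dyn.step_excess \<kappa> (dens A) (dyn.gam \<eta>) x t) \<le> 25000 * (c * tau) * sqrt (real T) * (1 + b) * l"
      using dyn.uniform_excess_bound[OF \<delta> \<kappa>, of "dens A"] rs unfolding b_def l_def by blast
    show "\<exists>S\<in>sets dyn.\<Omega>. 1 - \<delta> \<le> measure dyn.\<Omega> S \<and> (\<forall>x\<in>S. run_bounded A \<delta> x)"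
      unfolding run_bounded_abbr
    proof (intro bexI[OF _ S(1)] conjI S(2) ballI allI impI)
      fix x \<eta> c
      assume x: "x \<in> S" and \<eta>: "0 < \<eta>" and c0: "0 \<le> c" and cch: "c \<le> dyn.ch"
        and \<eta>e: "\<eta> = sqrt (2 * D / (tau * cT\<^sup>2 * c\<^sup>2 * real T))"
        and good: "\<forall>t<T. dyn.good (dyn.gam \<eta>) c x t" and cs: "\<forall>p<m. absact (dens A) p \<le> c"
      have c: "0 < c" using c0 \<eta> \<eta>e by (cases "c = 0") auto
      have ec: "\<eta> * c = \<kappa>"
      proof -
        have "2 * D / (tau * cT\<^sup>2 * c\<^sup>2 * real T) = (2 * D / tau) / ((cT * c)\<^sup>2 * real T)" by (simp add: power_mult_distrib mult.assoc)
        then have "\<eta> = sqrt (2 * D / tau) / (\<bar>cT * c\<bar> * sqrt (real T))" unfolding \<eta>e by (simp only: real_sqrt_divide real_sqrt_mult real_sqrt_abs)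
        then show ?thesis unfolding \<kappa>_def using c cT by (simp add: abs_mult)
      qed
      have g0: "absact rho0 p \<le> c" if "p < m" for p
      proof -
        have "dyn.good (dyn.gam \<eta>) c x 0" using good T0 by blast
        then show ?thesis using that unfolding dyn.good_def by simp
      qed
      note md = minimizer_distance[OF A g0 cs[rule_format] c0]
      have Dle: "D \<le> \<beta> / 2 * (c * tau)" unfolding D_def by (rule md(2)) 
      have kT: "\<kappa>\<^sup>2 * real T = 2 * D / tau / cT\<^sup>2"
        unfolding \<kappa>_def using T0 D0 tau1 by (simp add: power_divide power_mult_distrib)
      have D2: "2 * D / tau \<le> \<beta> * c" using Dle tau1 by (simp add: field_simps)
      have "4 * (\<kappa>\<^sup>2 * real T) \<le> 4 * (2 * D / tau / 4)"
        unfolding kT using cT D0 tau1 power_mono[of 2 cT 2] by (intro mult_left_mono divide_left_mono) auto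
      then have k4: "4 * \<kappa>\<^sup>2 * real T \<le> \<beta> * c" using D2 by simp
      have "(\<Sum>t<T. dyn.step_excess \<kappa> (dens A) (dyn.gam \<eta>) x t) \<le> 25000 * (c * tau) * sqrt (real T) * (1 + b) * l"
        by (rule Sx[OF x \<eta> _ cch good cs md(1) k4 md(3)]) (use ec \<eta> in \<open>auto simp: field_simps\<close>)
      moreover have "D / \<eta> \<le> 9 * (c * tau) * sqrt (real T) * b * l"
      proof -
        define s where "s = sqrt (2 * D / tau)"
        have s: "0 < s" "s\<^sup>2 = 2 * D / tau" unfolding s_def using Dp tau1 by auto
        have De: "D = s\<^sup>2 * tau / 2" unfolding s(2) using tau1 by simp
        have \<eta>s: "\<eta> = s / (cT * sqrt (real T)) / c" proof -
          have "\<eta> = \<kappa> / c" using ec c by (simp add: eq_divide_eq)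
          then show ?thesis unfolding \<kappa>_def s_def .
        qed
        have "D / \<eta> = s\<^sup>2 * tau / 2 / (s / (cT * sqrt (real T)) / c)"
          by (rule arg_cong2[where f = "(/)", OF De \<eta>s])
        also have "\<dots> = s * tau / 2 * (cT * sqrt (real T)) * c"
          using s(1) by (simp add: power2_eq_square)
        also have "\<dots> \<le> b * tau / 2 * ((18 * l) * sqrt (real T)) * c"
        proof (intro mult_mono divide_right_mono)
          have "2 * D / tau \<le> \<beta> * dyn.ch" using D2 cch \<beta>0 by (meson mult_left_mono order_trans less_imp_le)
          then show "s \<le> b" unfolding s_def b_def by simp
        qed (use tau1 cT sT c b0 s in auto)
        finally show ?thesis by (simp add: mult_ac)
      qed
      moreover have "9 * (c * tau) * sqrt (real T) * b * l \<le> 9 * (c * tau) * sqrt (real T) * (1 + b) * l"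
        using c0 tau1 sT b0 cT by (intro mult_right_mono mult_left_mono) auto
      moreover have "(\<Sum>t<T. free (state \<eta> x t) - free A) \<le> D / \<eta> + (\<Sum>t<T. dyn.step_excess \<kappa> (dens A) (dyn.gam \<eta>) x t)"
        unfolding D_def by (rule regret[OF Af \<eta> _ ec[symmetric]]) (use good in blast)
      ultimately show "(\<Sum>t<T. free (state \<eta> x t) - free A) \<le> 25009 * (c * tau) * sqrt (real T) * (1 + b) * l"
        by (simp add: mult.assoc)
    qed
  qed
qed

lemma run_is_traj:
  assumes X0: "X 0 = X_init C \<beta> \<mu>" and z: "\<And>t. t < T \<Longrightarrow> z t \<in> carrier_vec n"
    and x: "\<And>t i. t < T \<Longrightarrow> i < n \<Longrightarrow> x t i = z t $ i"
    and step: "(\<forall>t<T. prox_step \<Psi> V C \<beta> \<mu> \<eta> (z t) (X t) (X (Suc t))) \<or>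
      (\<forall>t<T. mirror_step \<Psi> V C \<beta> \<mu> (\<eta> * \<beta> / (\<eta> + \<beta>)) (z t) (X t) (X (Suc t)))"
  shows "t \<le> T \<Longrightarrow> X t = state \<eta> x t"
proof (induction t)
  case 0
  then show ?case unfolding X0 X_init_eq by (simp add: dual_zero)
next
  case (Suc t)
  then have t: "t < T" and Xt: "X t = state \<eta> x t" by auto
  show ?case using step
  proof
    assume "\<forall>t<T. prox_step \<Psi> V C \<beta> \<mu> \<eta> (z t) (X t) (X (Suc t))"
    then have st: "prox_step \<Psi> V C \<beta> \<mu> \<eta> (z t) (state \<eta> x t) (X (Suc t))" using t Xt by metis
    show ?thesis unfolding traj_next by (rule prox_step_dual[OF z[OF t] _ st]) (rule x[OF t])
  next
    assume "\<forall>t<T. mirror_step \<Psi> V C \<beta> \<mu> (\<eta> * \<beta> / (\<eta> + \<beta>)) (z t) (X t) (X (Suc t))"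
    then have st: "mirror_step \<Psi> V C \<beta> \<mu> (dyn.gam \<eta>) (z t) (state \<eta> x t) (X (Suc t))"
      using t Xt unfolding dyn.gam_def by metis
    show ?thesis unfolding traj_next by (rule mirror_step_dual[OF z[OF t] _ st]) (rule x[OF t])
  qed
qed

lemma vec_max_norm_absact:
  assumes X: "X \<in> feasible n"
  shows "vec_max_norm (abs_mat V *\<^sub>v rho \<Psi> X) \<le> c \<longleftrightarrow> (\<forall>p<m. absact (dens X) p \<le> c)"
proof -
  have Vc: "abs_mat V \<in> carrier_mat m m" unfolding abs_mat_def using V_carrier by simp
  have r: "rho \<Psi> X \<in> carrier_vec m" unfolding rho_def using Psi by auto
  have e: "\<bar>(abs_mat V *\<^sub>v rho \<Psi> X) $ p\<bar> = absact (dens X) p" if p: "p < m" for p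
  proof -
    have "(abs_mat V *\<^sub>v rho \<Psi> X) $ p = absact (dens X) p"
      unfolding mult_vec_entry[OF Vc r p] unfolding absact_def abs_mat_def using V_carrier p by (intro sum.cong refl) auto
    moreover have "0 \<le> absact (dens X) p" unfolding absact_def using dens_feasible(1)[OF X] by (intro sum_nonneg) auto
    ultimately show ?thesis by simp
  qed
  have "vec_max_norm (abs_mat V *\<^sub>v rho \<Psi> X) \<le> c \<longleftrightarrow> (\<forall>p\<in>{..<m}. \<bar>(abs_mat V *\<^sub>v rho \<Psi> X) $ p\<bar> \<le> c)"
    unfolding vec_max_norm_def using Vc m0 by (subst Max_le_iff) auto
  then show ?thesis using e by auto
qed

lemma c_h_tilde_le_iff:
  assumes A: "A \<in> feasible n" and X: "\<And>t. t < T \<Longrightarrow> X t \<in> feasible n"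
  shows "c_h_tilde \<Psi> V A T X \<le> c \<longleftrightarrow> (\<forall>p<m. absact (dens A) p \<le> c) \<and> (\<forall>t<T. \<forall>p<m. absact (dens (X t)) p \<le> c)"
proof -
  have ne: "(\<lambda>t. vec_max_norm (abs_mat V *\<^sub>v rho \<Psi> (X t))) ` {..<T} \<noteq> {}" using T0 by auto
  show ?thesis unfolding c_h_tilde_def max.bounded_iff vec_max_norm_absact[OF A]
    by (subst Max_le_iff[OF _ ne]) (use vec_max_norm_absact[OF X] in auto)
qed

lemma c_h_tilde_nonneg:
  assumes A: "A \<in> feasible n" and X: "\<And>t. t < T \<Longrightarrow> X t \<in> feasible n"
  shows "0 \<le> c_h_tilde \<Psi> V A T X" "c_h_tilde \<Psi> V A T X \<le> c_h \<Psi> V"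
proof -
  have iff: "c_h_tilde \<Psi> V A T X \<le> c \<longleftrightarrow> (\<forall>p<m. absact (dens A) p \<le> c) \<and> (\<forall>t<T. \<forall>p<m. absact (dens (X t)) p \<le> c)" for c
    by (rule c_h_tilde_le_iff[OF A]) (rule X)
  have "absact (dens A) 0 \<le> c_h_tilde \<Psi> V A T X" using iff[of "c_h_tilde \<Psi> V A T X"] m0 by auto
  moreover have "0 \<le> absact (dens A) 0" unfolding absact_def using dens_feasible(1)[OF A] by (intro sum_nonneg) auto
  ultimately show "0 \<le> c_h_tilde \<Psi> V A T X" by simp
  have "absact (dens Y) p \<le> c_h \<Psi> V" if Y: "Y \<in> feasible n" and p: "p < m" for Y p
  proof -
    have "absact (dens Y) p \<le> absact (\<lambda>_. c_Psi \<Psi>) p" by (rule absact_mono) (rule dens_feasible(3)[OF Y])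
    also have "\<dots> \<le> c_h \<Psi> V" using dyn.absact_const[OF p less_imp_le[OF dyn.cpsi_pos]] unfolding c_h_def .
    finally show ?thesis .
  qed
  then show "c_h_tilde \<Psi> V A T X \<le> c_h \<Psi> V" unfolding iff using A X by blast
qed

text \<open>A vanishing step size leaves the state at its initial value, and then the initial state is
  already optimal: either it equals the minimizer or its interaction energy vanishes.\<close>

lemma initial_optimal:
  assumes A: "minimizer A" and "D_FD A (sig_mat Y0) = 0 \<or> (\<forall>p<m. absact rho0 p \<le> 0)"
  shows "free (sig_mat Y0) \<le> free A"
  using assms(2)
proof
  assume "D_FD A (sig_mat Y0) = 0"
  then have "A = sig_mat Y0" by (intro D_FD_zero_imp[OF minimizer_feasible[OF A] Y0_sym]) simp
  then show ?thesis by simp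
next
  assume *: "\<forall>p<m. absact rho0 p \<le> 0"
  have f: "sig_mat Y0 \<in> feasible n" by (rule sig_mat_feasible[OF Y0_sym])
  have "bil (dens (sig_mat Y0)) (dens (sig_mat Y0)) = bil rho0 rho0" by (rule bil_cong) (auto simp: rho0_dens)
  also have "\<dots> \<le> 0 * (\<Sum>p<m. rho0 p)" by (rule bil_density_le) (use * dyn.rho_nonneg in auto)
  finally show ?thesis unfolding F_split[OF f] F_split[OF minimizer_feasible[OF A]]
    using H_min[OF minimizer_feasible[OF A]] bil_nonneg[of "dens A"] by simp
qed

definition algorithm_run :: "real mat \<Rightarrow> real \<Rightarrow> (nat \<Rightarrow> real vec) \<Rightarrow> real \<Rightarrow> (nat \<Rightarrow> real mat) \<Rightarrow> bool" where
  "algorithm_run A \<delta> z \<eta> X \<longleftrightarrow> X 0 = X_init C \<beta> \<mu> \<and> (\<forall>t<T. z t \<in> carrier_vec n) \<and> \<eta> = step_size \<Psi> V A T \<delta> X \<and>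
     ((\<forall>t<T. prox_step \<Psi> V C \<beta> \<mu> \<eta> (z t) (X t) (X (Suc t))) \<or>
      (\<forall>t<T. mirror_step \<Psi> V C \<beta> \<mu> (\<eta> * \<beta> / (\<eta> + \<beta>)) (z t) (X t) (X (Suc t))))"

text \<open>The bound \<open>c\<close> is taken to be \<open>c_h_tilde\<close>, for which the trajectory is good by definition.\<close>

theorem run_bound:
  assumes A: "minimizer A" and \<delta>: "0 < \<delta>" "\<delta> \<le> 1"
    and cl: "0 < cl" and ev: "\<And>k. k \<in> {1..n} \<Longrightarrow> real k / cl \<le> eigval_nth k C"
  shows "\<exists>S\<in>sets dyn.\<Omega>. 1 - \<delta> \<le> measure dyn.\<Omega> S \<and> (\<forall>x z X \<eta>. x \<in> S \<longrightarrow>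
     algorithm_run A \<delta> z \<eta> X \<longrightarrow> (\<forall>t<T. \<forall>i<n. x t i = z t $ i) \<longrightarrow>
     (1 / real T) * (\<Sum>t<T. free (X t))
        \<le> free A + 25009 * (max 1 (ln (real T * real m / \<delta>)) * (1 + sqrt (\<beta> * c_h \<Psi> V))
                  * c_h_tilde \<Psi> V A T X * n_eff cl (max \<mu> 0) \<beta> / sqrt (real T)))"
proof -
  note Af = minimizer_feasible[OF A]
  define l where "l = max 1 (ln (real T * real m / \<delta>))"
  define b where "b = sqrt (\<beta> * c_h \<Psi> V)"
  define N where "N = n_eff cl (max \<mu> 0) \<beta>"
  define F0 where "F0 = free A"
  have l1: "1 \<le> l" unfolding l_def by simp
  have b0: "0 \<le> b" unfolding b_def using \<beta>0 dyn.ch_nonneg ch_eq by simp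
  have N: "tau \<le> N" unfolding N_def by (rule tau_le_n_eff[OF cl ev])
  have tau1: "1 \<le> tau" by (rule dyn.\<tau>1)
  obtain S where S: "S \<in> sets dyn.\<Omega>" "1 - \<delta> \<le> measure dyn.\<Omega> S" and Sx: "\<And>x \<eta> c. x \<in> S \<Longrightarrow> 0 < \<eta> \<Longrightarrow> 0 \<le> c \<Longrightarrow> c \<le> dyn.ch \<Longrightarrow>
     \<eta> = sqrt (2 * D_FD A (sig_mat Y0) / (tau * (c_Tm T m \<delta>)\<^sup>2 * c\<^sup>2 * real T)) \<Longrightarrow>
     \<forall>t<T. dyn.good (dyn.gam \<eta>) c x t \<Longrightarrow> \<forall>p<m. absact (dens A) p \<le> c \<Longrightarrow>
     (\<Sum>t<T. free (state \<eta> x t)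
        - F0) \<le> 25009 * (c * tau) * sqrt (real T) * (1 + b) * l"
    using trajectory_bound[OF A \<delta>] unfolding run_bounded_def b_def l_def F0_def ch_eq by blast
  show ?thesis unfolding l_def[symmetric] b_def[symmetric] N_def[symmetric] F0_def[symmetric]
  proof (intro bexI[OF _ S(1)] conjI S(2) allI impI)
    fix x z X \<eta>
    assume x: "x \<in> S" and run: "algorithm_run A \<delta> z \<eta> X" and xz: "\<forall>t<T. \<forall>i<n. x t i = z t $ i"
    then have X0: "X 0 = X_init C \<beta> \<mu>" and z: "\<forall>t<T. z t \<in> carrier_vec n" and \<eta>: "\<eta> = step_size \<Psi> V A T \<delta> X"
      and step: "(\<forall>t<T. prox_step \<Psi> V C \<beta> \<mu> \<eta> (z t) (X t) (X (Suc t))) \<or>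
      (\<forall>t<T. mirror_step \<Psi> V C \<beta> \<mu> (\<eta> * \<beta> / (\<eta> + \<beta>)) (z t) (X t) (X (Suc t)))"
      unfolding algorithm_run_def by auto
    have Xt: "X t = state \<eta> x t" if "t < T" for t
      by (rule run_is_traj[OF X0 _ _ step]) (use z xz that in auto)
    have Xf: "X t \<in> feasible n" if "t < T" for t unfolding Xt[OF that] by (rule sig_mat_feasible[OF dual_sym])
    define c where "c = c_h_tilde \<Psi> V A T X"
    have c: "0 \<le> c" "c \<le> c_h \<Psi> V" unfolding c_def by (rule c_h_tilde_nonneg[OF Af Xf]; assumption)+
    have cA: "\<forall>p<m. absact (dens A) p \<le> c" and cX: "\<forall>t<T. \<forall>p<m. absact (dens (X t)) p \<le> c"
    proof -
      have "c_h_tilde \<Psi> V A T X \<le> c \<longleftrightarrow> (\<forall>p<m. absact (dens A) p \<le> c) \<and> (\<forall>t<T. \<forall>p<m. absact (dens (X t)) p \<le> c)"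
        by (rule c_h_tilde_le_iff[OF Af]) (rule Xf)
      then show "\<forall>p<m. absact (dens A) p \<le> c" "\<forall>t<T. \<forall>p<m. absact (dens (X t)) p \<le> c" unfolding c_def by simp_all
    qed
    have good: "\<forall>t<T. dyn.good (dyn.gam \<eta>) c x t"
    proof (intro allI impI)
      fix t assume t: "t < T"
      have "absact (dyn.rho (dyn.traj (dyn.gam \<eta>) x t)) p = absact (dens (X t)) p" for p
        unfolding absact_def Xt[OF t] dyn.rho_def by (intro sum.cong refl) (simp add: amp_dens)
      then show "dyn.good (dyn.gam \<eta>) c x t" unfolding dyn.good_def using cX t by simp
    qed
    have m: "dim_row \<Psi> = m" using Psi by auto
    have \<eta>': "\<eta> = sqrt (2 * D_FD A (sig_mat Y0) / (tau * (c_Tm T m \<delta>)\<^sup>2 * c\<^sup>2 * real T))"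
      unfolding \<eta> step_size_def c_def m X0 X_init_eq tau_def ..
    have D0: "0 \<le> D_FD A (sig_mat Y0)" by (rule D_FD_nonneg[OF Af Y0_sym])
    have \<eta>0: "0 \<le> \<eta>" unfolding \<eta>' using D0 tau1 by simp
    have "(\<Sum>t<T. free (X t) - F0) \<le> 25009 * (c * tau) * sqrt (real T) * (1 + b) * l"
    proof (cases "0 < \<eta>")
      case True
      then show ?thesis using Sx[OF x True c(1) _ \<eta>' good cA] c(2) ch_eq by (simp add: Xt)
    next
      case False
      then have e0: "\<eta> = 0" using \<eta>0 by simp
      have tr: "dyn.traj (dyn.gam \<eta>) x t = (\<lambda>_. 0)" for t unfolding e0 dyn.gam_def by (induction t) auto
      have X00: "X t = sig_mat Y0" if "t < T" for t unfolding Xt[OF that] tr dual_zero ..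
      have cT: "c_Tm T m \<delta> \<noteq> 0" using c_Tm_bounds(1)[OF T0 m0 \<delta>] by simp
      have "D_FD A (sig_mat Y0) = 0 \<or> c = 0" using \<eta>' e0 cT tau1 T0 by simp
      then have "D_FD A (sig_mat Y0) = 0 \<or> (\<forall>p<m. absact rho0 p \<le> 0)"
        using good T0 unfolding dyn.good_def tr by auto
      then have "free (X t) - F0 \<le> 0" if "t < T" for t
        using initial_optimal[OF A] unfolding X00[OF that] F0_def by simp
      then have "(\<Sum>t<T. free (X t) - F0) \<le> 0" by (intro sum_nonpos) auto
      also have "0 \<le> 25009 * (c * tau) * sqrt (real T) * (1 + b) * l" using c tau1 b0 l1 by simp
      finally show ?thesis .
    qed
    also have "\<dots> \<le> 25009 * (c * N) * sqrt (real T) * (1 + b) * l"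
      using N c b0 l1 by (intro mult_right_mono mult_left_mono) auto
    finally have sum: "(\<Sum>t<T. free (X t)) \<le> real T * F0 + 25009 * (c * N) * sqrt (real T) * (1 + b) * l"
      by (simp add: sum_subtractf)
    have "(1 / real T) * (\<Sum>t<T. free (X t))
      \<le> (1 / real T) * (real T * F0 + 25009 * (c * N) * sqrt (real T) * (1 + b) * l)"
      using sum by (intro mult_left_mono) auto
    also have "\<dots> = F0 + 25009 * (l * (1 + b) * c * N / sqrt (real T))"
    proof -
      have "0 < sqrt (real T)" "real T = sqrt (real T) * sqrt (real T)" using T0 by auto
      then show ?thesis using average_rescale[of "sqrt (real T)" F0 25009 c N "1 + b" l] by simp
    qed
    finally show "(1 / real T) * (\<Sum>t<T. free (X t))
       \<le> F0 + 25009 * (l * (1 + b) * c_h_tilde \<Psi> V A T X * N / sqrt (real T))" unfolding c_def .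
  qed
qed

end

section \<open>High-probability convergence\<close>

theorem corollary30:
  shows "\<exists>K>0. \<forall>(n::nat) (m::nat) (T::nat) (\<Psi>::real mat) (V::real mat) (C::real mat)
      (\<mu>::real) (\<beta>::real) (cl::real) (\<delta>::real) (Xs::real mat)
      (M::'a measure) (z::nat \<Rightarrow> 'a \<Rightarrow> real vec) (\<eta>::'a \<Rightarrow> real) (X::nat \<Rightarrow> 'a \<Rightarrow> real mat).
    n > 0 \<longrightarrow> m > 0 \<longrightarrow> T > 0 \<longrightarrow>
    \<Psi> \<in> carrier_mat m n \<longrightarrow> \<Psi>\<^sup>T * \<Psi> = 1\<^sub>m n \<longrightarrow>
    psd_mat m V \<longrightarrow> sym_mat n C \<longrightarrow> \<beta> \<ge> 1 \<longrightarrow>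
    (\<forall>Y \<in> feasible n. psd_mat n (grad_E_tilde \<Psi> V Y)) \<longrightarrow>
    cl > 0 \<longrightarrow> (\<forall>k\<in>{1..n}. eigval_nth k C \<ge> real k / cl) \<longrightarrow>
    0 < \<delta> \<longrightarrow> \<delta> \<le> 1 \<longrightarrow>
    is_arg_min (\<lambda>Y. F_free \<Psi> V C \<beta> Y - \<mu> * mat_trace Y) (\<lambda>Y. Y \<in> feasible n) Xs \<longrightarrow>
    prob_space M \<longrightarrow> std_gaussian_vecs M n T z \<longrightarrow>
    \<eta> \<in> borel_measurable M \<longrightarrow>
    (\<forall>\<omega>\<in>space M. \<eta> \<omega> = step_size \<Psi> V Xs T \<delta> (\<lambda>t. X t \<omega>)) \<longrightarrow>
    (\<forall>\<omega>\<in>space M. X 0 \<omega> = X_init C \<beta> \<mu>) \<longrightarrow>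
    ((\<forall>\<omega>\<in>space M. \<forall>t<T. prox_step \<Psi> V C \<beta> \<mu> (\<eta> \<omega>) (z t \<omega>) (X t \<omega>) (X (Suc t) \<omega>)) \<or>
     (\<forall>\<omega>\<in>space M. \<forall>t<T. mirror_step \<Psi> V C \<beta> \<mu> (\<eta> \<omega> * \<beta> / (\<eta> \<omega> + \<beta>)) (z t \<omega>) (X t \<omega>) (X (Suc t) \<omega>)))
    \<longrightarrow>
    (\<exists>A \<in> sets M. measure M A \<ge> 1 - \<delta> \<and>
      (\<forall>\<omega>\<in>A.
        (1 / real T) * (\<Sum>t<T. F_free \<Psi> V C \<beta> (X t \<omega>) - \<mu> * mat_trace (X t \<omega>))
        \<le> F_free \<Psi> V C \<beta> Xs - \<mu> * mat_trace Xs
           + K * (max 1 (ln (real T * real m / \<delta>)) * (1 + sqrt (\<beta> * c_h \<Psi> V))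
                  * c_h_tilde \<Psi> V Xs T (\<lambda>t. X t \<omega>) * n_eff cl (max \<mu> 0) \<beta> / sqrt (real T))))"
proof (intro exI[of _ 25009] conjI allI impI)
  show "(0 :: real) < 25009" by simp
  fix n m T :: nat and \<Psi> V C :: "real mat" and \<mu> \<beta> cl \<delta> :: real and Xs :: "real mat"
    and M :: "'a measure" and z :: "nat \<Rightarrow> 'a \<Rightarrow> real vec" and \<eta> :: "'a \<Rightarrow> real" and X :: "nat \<Rightarrow> 'a \<Rightarrow> real mat"
  assume n: "n > 0" and m: "m > 0" and T: "T > 0" and Psi: "\<Psi> \<in> carrier_mat m n" "\<Psi>\<^sup>T * \<Psi> = 1\<^sub>m n"
    and V: "psd_mat m V" and C: "sym_mat n C" and \<beta>: "\<beta> \<ge> 1"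
    and st: "\<forall>Y\<in>feasible n. psd_mat n (grad_E_tilde \<Psi> V Y)"
    and cl: "cl > 0" and ev: "\<forall>k\<in>{1..n}. eigval_nth k C \<ge> real k / cl"
    and \<delta>: "0 < \<delta>" "\<delta> \<le> 1"
    and am: "is_arg_min (\<lambda>Y. F_free \<Psi> V C \<beta> Y - \<mu> * mat_trace Y) (\<lambda>Y. Y \<in> feasible n) Xs"
    and M: "prob_space M" and z: "std_gaussian_vecs M n T z"
    and \<eta>: "\<forall>\<omega>\<in>space M. \<eta> \<omega> = step_size \<Psi> V Xs T \<delta> (\<lambda>t. X t \<omega>)"
    and X0: "\<forall>\<omega>\<in>space M. X 0 \<omega> = X_init C \<beta> \<mu>"
    and step: "(\<forall>\<omega>\<in>space M. \<forall>t<T. prox_step \<Psi> V C \<beta> \<mu> (\<eta> \<omega>) (z t \<omega>) (X t \<omega>) (X (Suc t) \<omega>)) \<or>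
     (\<forall>\<omega>\<in>space M. \<forall>t<T. mirror_step \<Psi> V C \<beta> \<mu> (\<eta> \<omega> * \<beta> / (\<eta> \<omega> + \<beta>)) (z t \<omega>) (X t \<omega>) (X (Suc t) \<omega>))"
  interpret h: hartree n m T \<Psi> V C \<mu> \<beta>
    by unfold_locales (use n m T Psi V C \<beta> st in auto)
  have min: "h.minimizer Xs" unfolding h.minimizer_def by (rule am)
  define Z where "Z \<omega> = (\<lambda>t\<in>{..<T}. \<lambda>i\<in>{..<n}. z t \<omega> $ i)" for \<omega>
  have dZ: "distr M h.dyn.\<Omega> Z = h.dyn.\<Omega>" and Zm: "Z \<in> M \<rightarrow>\<^sub>M h.dyn.\<Omega>"
    using gaussian_blocks[OF M n T z] unfolding Z_def h.dyn.\<Omega>_def by auto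
  let ?B = "\<lambda>X. 25009 * (max 1 (ln (real T * real m / \<delta>)) * (1 + sqrt (\<beta> * c_h \<Psi> V))
                  * c_h_tilde \<Psi> V Xs T X * n_eff cl (max \<mu> 0) \<beta> / sqrt (real T))"
  obtain S where S: "S \<in> sets h.dyn.\<Omega>" "1 - \<delta> \<le> measure h.dyn.\<Omega> S" and Sx: "\<And>x z X \<eta>. x \<in> S \<Longrightarrow>
     h.algorithm_run Xs \<delta> z \<eta> X \<Longrightarrow> (\<forall>t<T. \<forall>i<n. x t i = z t $ i) \<Longrightarrow>
     (1 / real T) * (\<Sum>t<T. h.free (X t)) \<le> h.free Xs + ?B X"
    using h.run_bound[OF min \<delta> cl] ev by blast
  show "\<exists>A\<in>sets M. measure M A \<ge> 1 - \<delta> \<and>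
      (\<forall>\<omega>\<in>A. (1 / real T) * (\<Sum>t<T. h.free (X t \<omega>)) \<le> h.free Xs + ?B (\<lambda>t. X t \<omega>))"
  proof (intro bexI[of _ "Z -` S \<inter> space M"] conjI ballI)
    show "Z -` S \<inter> space M \<in> sets M" using Zm S(1) by (rule measurable_sets)
    have "measure M (Z -` S \<inter> space M) = measure (distr M h.dyn.\<Omega> Z) S" by (rule measure_distr[OF Zm S(1), symmetric])
    then show "1 - \<delta> \<le> measure M (Z -` S \<inter> space M)" unfolding dZ using S(2) by simp
    fix \<omega> assume "\<omega> \<in> Z -` S \<inter> space M"
    then have w: "Z \<omega> \<in> S" "\<omega> \<in> space M" by auto
    show "(1 / real T) * (\<Sum>t<T. h.free (X t \<omega>)) \<le> h.free Xs + ?B (\<lambda>t. X t \<omega>)"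
    proof (rule Sx[OF w(1)])
      have "\<forall>t<T. z t \<omega> \<in> carrier_vec n" using z w(2) unfolding std_gaussian_vecs_def by blast
      then show "h.algorithm_run Xs \<delta> (\<lambda>t. z t \<omega>) (\<eta> \<omega>) (\<lambda>t. X t \<omega>)"
        unfolding h.algorithm_run_def using X0 \<eta> step w(2) by blast
      show "\<forall>t<T. \<forall>i<n. Z \<omega> t i = z t \<omega> $ i" unfolding Z_def by simp
    qed
  qed
qed

end
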